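(* Let $w\in(0,1)$, consider the inhomogeneous percolation measure $\tilde{\mathbb P}_w$ with density $p(z)=p_c+\varepsilon(r(z))$, $\varepsilon(r)=\alpha(r^w)$, and for $N\ge 1$ put $$I_N := \sum_{z \in S_N} P_{\infty}\big(p_c + \varepsilon(r(z))\big).$$ Let $\Psi_N$ be the number of sites in $S_N$ that belong to the infinite cluster, and $\Phi_N$ the number of sites in $S_N$ that are connected to the origin by an occupied path lying entirely in $S_N$. Then: (i) $I_N \asymp N^2\,\pi(N^w)$ and, as $N\to\infty$, $$\tilde{\mathbb E}_w(\Psi_N)\asymp I_N,\qquad \tilde{\mathbb E}_w(\Phi_N)\asymp I_N .$$ (ii) For every $\epsilon>0$ there is a constant $C_{2\epsilon}<\infty$ (independent of $N$) such that $$\tilde{\mathbb V}_w(\Psi_N)\le C_{2\epsilon}\,N^{2\epsilon}\,N^{2+2w}\,\pi^2(N^w),$$ so that $\tilde{\mathbb V}_w(\Psi_N)=o(I_N^2)$ and $$\frac{\Psi_N}{\tilde{\mathbb E}_w(\Psi_N)}\longrightarrow 1\quad\text{in } L^2 \text{ as } N\to\infty.$$ Finally, conditionally on $\{0\leadsto\infty\}$, these results hold for $\Phi_N$ as well: $\tilde{\mathbb E}_w(\Phi_N\mid 0\leadsto\infty)\asymp I_N$; for every $\epsilon>0$ there is a constant $C'_{2\epsilon}<\infty$ with $\tilde{\mathbb V}_w(\Phi_N\mid 0\leadsto\infty)\le C'_{2\epsilon}N^{2\epsilon}N^{2+2w}\pi^2(N^w)$, so that this conditional variance is $o(I_N^2)$;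 and $\Phi_N/\tilde{\mathbb E}_w(\Phi_N\mid 0\leadsto\infty)\to 1$ in $L^2$ of the conditional measure $\tilde{\mathbb P}_w(\,\cdot\mid 0\leadsto\infty)$.
   Context: Percolation model. We consider an independent (bond or site) percolation model on a planar lattice which has reflection symmetry about the vertical axis and is invariant under a rotation by some angle in $(0,\pi)$, and for which Kesten's results on critical and near-critical 2D percolation hold (in particular the Russo–Seymour–Welsh bounds: at $p=p_c$ crossing probabilities of parallelograms are bounded away from $0$ and $1$ by constants depending only on the aspect ratio, for both the model and its dual; and the near-critical relation $P_\infty(p)\asymp\mathbb P_{p_c}(0\leadsto\partial S_{L(p)})$ for $p>p_c$, where $L(p)$ is the finite-size correlation length, i.e. the smallest scale $n$ at which the long-way occupied crossing of a $3n\times n$ parallelogram has probability larger than $1-c\delta$, for a suitable fixed constant $c$ and fixed $\delta\in(0,1)$). Bond or site percolation on the square or triangular lattice are the models to keep in mind. Bonds or sites (as appropriate) are independently occupied with probability $p$ and vacant with probability $1-p$; $\mathbb P_p$ is the corresponding homogeneous measure. Geometry. $r(z)=\|z\|$ is the infinity norm of $z$ with respect to the coordinates along the $x$-axis and the axis obtained from it by the symmetry rotation. $S_N(z)$ is the set of points at distance at most $N$ from $z$ (a rhombus), $\partial S_N(z)$ the set of points at distance exactly $N$ from $z$, and $S_N=S_N(0)$. Connections. $A\leadsto B$ is the event that some site of $A$ is connected to some site of $B$ by an occupied path ($B$ may be "infinity"). $P_\infty(p)=\mathbb P_p(0\leadsto\infty)$, and $p_c\in(0,1)$ is the threshold: $P_\infty(p)>0$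 iff $p>p_c$. The critical one-arm probability is $\pi(N):=\mathbb P_{p_c}(0\leadsto\partial S_N)$ (non-integer arguments are understood as rounded to an integer). Correlation length. For $p>p_c$, let $\tau^*_{0^*,z^*}(p)$ be the probability that the dual sites $0^*$ (the dual origin) and $z^*$ are connected by a path in the dual model, and let $\tau^*_n(p)$ be the maximum of $\tau^*_{0^*,z^*}(p)$ over $z^*$ with $\|z^*\|$ within a lattice spacing of $n$. The correlation length $\xi(p)$ is defined by $\lim_{n\to\infty}[\tau^*_n(p)]^{1/n}=e^{-1/\xi(p)}$, with $\xi(1)=0$. It is continuous and monotone on $(p_c,1]$ and diverges as $p\downarrow p_c$. Let $\alpha:[0,\infty)\to(0,1-p_c]$ be the inverse function defined by $\xi(p_c+\alpha(r))=r$. Inhomogeneous model. For $w\in(0,1)$, $\tilde{\mathbb P}_w$ is the measure under which sites (or bonds) are independently occupied, with probability $p(z)=p_c+\varepsilon(r(z))$ at location $z$, where $\varepsilon(r)=\alpha(r^w)$. Equivalently $\xi(p_c+\varepsilon(r))=r^w$. $\tilde{\mathbb E}_w$ and $\tilde{\mathbb V}_w$ denote expectation and variance under $\tilde{\mathbb P}_w$. A site belongs to the infinite cluster if it is connected to infinity. Asymptotics. $f\asymp g$ means that there are constants $0<C_a\le C_b<\infty$ with $C_a g\le f\le C_b g$; here the constants do not depend on $N$. *)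

theory Defs
  imports "HOL-Probability.Probability" "HOL-Library.Landau_Symbols"
begin

section \<open>Percolation models on planar lattices\<close>

datatype percolation_mode = Site | Bond

text \<open>
  The plane is the type of complex numbers. An edge is the two-element set of its end points and
  is drawn as the straight segment between them. The angle is that of the rotation symmetry.
\<close>

record percolation_model =
  sites :: "complex set"
  edges :: "complex set set"
  angle :: real
  mode :: percolation_mode
  dual_sites :: "complex set"
  dual_origin :: complex

definition faces :: "percolation_model \<Rightarrow> complex set set" where
  "faces M = components (- (\<Union>e\<in>edges M. convex hull e))"

text \<open>
  The unit of length is the translation period along the x-axis. Invariance under translation in
  the second coordinate direction follows by conjugating with the rotation.

  In the site model the dual sites are the sites themselves (the dual graph is the matching graph,
  see \<open>dual_path\<close> below); in the bond model there is one dual site in each face.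
\<close>

locale planar_percolation =
  fixes M :: percolation_model
  assumes angle: "0 < angle M" "angle M < pi"
    and origin: "0 \<in> sites M"
    and edges: "\<And>e. e \<in> edges M \<Longrightarrow> \<exists>u\<in>sites M. \<exists>v\<in>sites M. u \<noteq> v \<and> e = {u, v}"
    and sites_locally_finite: "\<And>R. finite (sites M \<inter> cball 0 R)"
    and degrees_finite: "\<And>v. v \<in> sites M \<Longrightarrow> finite {e \<in> edges M. v \<in> e}"
    and planar: "\<And>e f. e \<in> edges M \<Longrightarrow> f \<in> edges M \<Longrightarrow> e \<noteq> f \<Longrightarrow>
                   convex hull e \<inter> convex hull f \<subseteq> e \<inter> f"
    and sites_off_edges: "\<And>v e. v \<in> sites M \<Longrightarrow> e \<in> edges M \<Longrightarrow> v \<in> convex hull e \<Longrightarrow> v \<in> e"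
    and connected_graph: "\<And>u v. u \<in> sites M \<Longrightarrow> v \<in> sites M \<Longrightarrow>
                   (u, v) \<in> {(x, y). {x, y} \<in> edges M}\<^sup>*"
    and translation: "(\<lambda>z. z + 1) ` sites M = sites M"
                     "(`) (\<lambda>z. z + 1) ` edges M = edges M"
    and reflection: "(\<lambda>z. - cnj z) ` sites M = sites M"
                    "(`) (\<lambda>z. - cnj z) ` edges M = edges M"
    and rotation: "(\<lambda>z. cis (angle M) * z) ` sites M = sites M"
                  "(`) (\<lambda>z. cis (angle M) * z) ` edges M = edges M"
    and dual_origin: "dual_origin M \<in> dual_sites M"
    and dual_sites_Site: "mode M = Site \<Longrightarrow> dual_sites M = sites M"
    and dual_sites_Bond: "mode M = Bond \<Longrightarrow> dual_sites M \<subseteq> \<Union>(faces M)"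
                         "mode M = Bond \<Longrightarrow> F \<in> faces M \<Longrightarrow> \<exists>!x. x \<in> dual_sites M \<inter> F"
    and dual_translation: "(\<lambda>z. z + 1) ` dual_sites M = dual_sites M"
                          "(\<lambda>z. z + cis (angle M)) ` dual_sites M = dual_sites M"


section \<open>Geometry\<close>

text \<open>\<open>z = coord1 M z + coord2 M z * cis (angle M)\<close>, with real coordinates.\<close>

definition coord1 :: "percolation_model \<Rightarrow> complex \<Rightarrow> real" where
  "coord1 M z = Re z - Im z * cos (angle M) / sin (angle M)"

definition coord2 :: "percolation_model \<Rightarrow> complex \<Rightarrow> real" where
  "coord2 M z = Im z / sin (angle M)"

definition rnorm :: "percolation_model \<Rightarrow> complex \<Rightarrow> real" where
  "rnorm M z = max \<bar>coord1 M z\<bar> \<bar>coord2 M z\<bar>"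

definition rball :: "percolation_model \<Rightarrow> nat \<Rightarrow> complex \<Rightarrow> complex set" where
  "rball M N z = {v \<in> sites M. rnorm M (v - z) \<le> real N}"

definition rsphere :: "percolation_model \<Rightarrow> nat \<Rightarrow> complex \<Rightarrow> complex set" where
  "rsphere M N z = {v \<in> sites M. rnorm M (v - z) = real N}"


section \<open>Configurations and connections\<close>

text \<open>
  The randomness sits on the elements: the site \<open>v\<close> is represented by \<open>{v}\<close>, a bond by its set of
  end points. A configuration \<open>\<omega>\<close> maps occupied elements to \<open>True\<close>. An element is located at
  the barycentre of its points, i.e. at the site itself or at the midpoint of the bond.
\<close>

definition elements :: "percolation_model \<Rightarrow> complex set set" where
  "elements M = (case mode M of Site \<Rightarrow> (\<lambda>v. {v}) ` sites M | Bond \<Rightarrow> edges M)"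

definition location :: "complex set \<Rightarrow> complex" where
  "location e = (\<Sum>v\<in>e. v) / of_nat (card e)"

definition perc_measure ::
    "percolation_model \<Rightarrow> (complex set \<Rightarrow> real) \<Rightarrow> (complex set \<Rightarrow> bool) measure" where
  "perc_measure M q = PiM (elements M) (\<lambda>e. measure_pmf (bernoulli_pmf (q e)))"

definition hom_measure :: "percolation_model \<Rightarrow> real \<Rightarrow> (complex set \<Rightarrow> bool) measure" where
  "hom_measure M p = perc_measure M (\<lambda>_. p)"

definition occupied_path ::
    "percolation_model \<Rightarrow> (complex set \<Rightarrow> bool) \<Rightarrow> complex list \<Rightarrow> bool" where
  "occupied_path M \<omega> vs \<longleftrightarrow>
     vs \<noteq> [] \<and> set vs \<subseteq> sites M \<and> successively (\<lambda>u v. {u, v} \<in> edges M) vs \<and>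
     (case mode M of Site \<Rightarrow> (\<forall>v\<in>set vs. \<omega> {v}) | Bond \<Rightarrow> successively (\<lambda>u v. \<omega> {u, v}) vs)"

definition connected_in ::
    "percolation_model \<Rightarrow> (complex set \<Rightarrow> bool) \<Rightarrow> complex set \<Rightarrow> complex set \<Rightarrow> complex set \<Rightarrow> bool" where
  "connected_in M \<omega> S A B \<longleftrightarrow>
     (\<exists>vs. occupied_path M \<omega> vs \<and> set vs \<subseteq> S \<and> hd vs \<in> A \<and> last vs \<in> B)"

abbreviation connected_to ::
    "percolation_model \<Rightarrow> (complex set \<Rightarrow> bool) \<Rightarrow> complex set \<Rightarrow> complex set \<Rightarrow> bool" where
  "connected_to M \<omega> A B \<equiv> connected_in M \<omega> UNIV A B"

definition connected_to_infinity ::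
    "percolation_model \<Rightarrow> (complex set \<Rightarrow> bool) \<Rightarrow> complex \<Rightarrow> bool" where
  "connected_to_infinity M \<omega> z \<longleftrightarrow> infinite {v. connected_to M \<omega> {z} {v}}"

definition P_inf :: "percolation_model \<Rightarrow> real \<Rightarrow> real" where
  "P_inf M p = \<P>(\<omega> in hom_measure M p. connected_to_infinity M \<omega> 0)"

definition p_c :: "percolation_model \<Rightarrow> real" where
  "p_c M = Inf {p \<in> {0..1}. P_inf M p > 0}"

definition one_arm :: "percolation_model \<Rightarrow> real \<Rightarrow> real" where
  "one_arm M x =
     \<P>(\<omega> in hom_measure M (p_c M). connected_to M \<omega> {0} (rsphere M (nat (round x)) 0))"


section \<open>Crossings and the dual model\<close>

text \<open>
  In the bond model a dual bond joins the dual sites in the two faces separated by a bond \<open>e\<close>, and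
  can be used when \<open>e\<close> is vacant. In the site model a dual path consists of vacant sites, successive
  ones lying on the boundary of a common face.
\<close>

definition dual_bond :: "percolation_model \<Rightarrow> complex set \<Rightarrow> complex \<Rightarrow> complex \<Rightarrow> bool" where
  "dual_bond M e x y \<longleftrightarrow> e \<in> edges M \<and>
     (\<exists>F\<in>faces M. \<exists>G\<in>faces M. F \<noteq> G \<and> x \<in> F \<and> y \<in> G \<and> convex hull e \<subseteq> frontier F \<inter> frontier G)"

definition matching_adjacent :: "percolation_model \<Rightarrow> complex \<Rightarrow> complex \<Rightarrow> bool" where
  "matching_adjacent M u v \<longleftrightarrow> u \<noteq> v \<and> (\<exists>F\<in>faces M. u \<in> frontier F \<and> v \<in> frontier F)"

definition dual_path ::
    "percolation_model \<Rightarrow> (complex set \<Rightarrow> bool) \<Rightarrow> complex list \<Rightarrow> bool" where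
  "dual_path M \<omega> xs \<longleftrightarrow>
     xs \<noteq> [] \<and> set xs \<subseteq> dual_sites M \<and>
     (case mode M of
        Site \<Rightarrow> successively (matching_adjacent M) xs \<and> (\<forall>v\<in>set xs. \<not> \<omega> {v})
      | Bond \<Rightarrow> successively (\<lambda>x y. \<exists>e. dual_bond M e x y \<and> \<not> \<omega> e) xs)"

text \<open>
  A path crosses the parallelogram with corner \<open>z\<close>, side \<open>a\<close> along the first axis and side \<open>b\<close> along
  the second, in the first direction. The first and the last vertex may lie on or beyond the two
  sides that are joined.
\<close>

definition crosses :: "percolation_model \<Rightarrow> complex \<Rightarrow> real \<Rightarrow> real \<Rightarrow> complex list \<Rightarrow> bool" where
  "crosses M z a b vs \<longleftrightarrow>
     coord1 M (hd vs - z) \<le> 0 \<and> coord1 M (last vs - z) \<ge> a \<and>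
     (\<forall>v\<in>set vs. 0 \<le> coord2 M (v - z) \<and> coord2 M (v - z) \<le> b) \<and>
     (\<forall>v\<in>set (butlast (tl vs)). 0 \<le> coord1 M (v - z) \<and> coord1 M (v - z) \<le> a)"

definition crossing_prob :: "percolation_model \<Rightarrow> real \<Rightarrow> complex \<Rightarrow> real \<Rightarrow> real \<Rightarrow> real" where
  "crossing_prob M p z a b =
     \<P>(\<omega> in hom_measure M p. \<exists>vs. occupied_path M \<omega> vs \<and> crosses M z a b vs)"

definition dual_crossing_prob :: "percolation_model \<Rightarrow> real \<Rightarrow> complex \<Rightarrow> real \<Rightarrow> real \<Rightarrow> real" where
  "dual_crossing_prob M p z a b =
     \<P>(\<omega> in hom_measure M p. \<exists>xs. dual_path M \<omega> xs \<and> crosses M z a b xs)"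


section \<open>Correlation lengths\<close>

definition tau_star :: "percolation_model \<Rightarrow> real \<Rightarrow> complex \<Rightarrow> real" where
  "tau_star M p x =
     \<P>(\<omega> in hom_measure M p. \<exists>xs. dual_path M \<omega> xs \<and> hd xs = dual_origin M \<and> last xs = x)"

definition tau_star_max :: "percolation_model \<Rightarrow> real \<Rightarrow> nat \<Rightarrow> real" where
  "tau_star_max M p n = Max (tau_star M p ` {x \<in> dual_sites M. \<bar>rnorm M x - real n\<bar> \<le> 1})"

definition is_corr_length :: "percolation_model \<Rightarrow> real \<Rightarrow> real \<Rightarrow> bool" where
  "is_corr_length M p x \<longleftrightarrow> x > 0 \<and> (\<lambda>n. root n (tau_star_max M p n)) \<longlonglongrightarrow> exp (- 1 / x)"

definition corr_length :: "percolation_model \<Rightarrow> real \<Rightarrow> real" where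
  "corr_length M p = (if p = 1 then 0 else THE x. is_corr_length M p x)"

text \<open>The inverse function of the correlation length.\<close>

definition alpha :: "percolation_model \<Rightarrow> real \<Rightarrow> real" where
  "alpha M r = (THE a. a \<in> {0<..1 - p_c M} \<and> corr_length M (p_c M + a) = r)"

text \<open>The finite-size correlation length \<open>L(p)\<close>.\<close>

definition fs_length :: "percolation_model \<Rightarrow> real \<Rightarrow> real \<Rightarrow> real \<Rightarrow> nat" where
  "fs_length M c \<delta> p = (LEAST n. n \<ge> 1 \<and> crossing_prob M p 0 (3 * real n) (real n) > 1 - c * \<delta>)"


section \<open>Standing assumptions: critical and near-critical behaviour\<close>

text \<open>
  The clause \<open>suitable_constant\<close> is the rescaling inequality that makes \<open>L(p)\<close> a meaningful scale:
  splitting a \<open>9n\<close> by \<open>3n\<close> parallelogram into disjoint \<open>9n\<close> by \<open>n\<close> strips, each of which is crossed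
  as soon as seven events of the probability of a \<open>3n\<close> by \<open>n\<close> crossing occur, shows that every \<open>0 < c \<le> 1/49\<close> is suitable.
  In \<open>rsw\<close>, scales below a bound depending on the aspect ratio are left out, because a parallelogram
  that is thin compared with the lattice period may admit no crossing path at all.
  The last two clauses are Kesten's near-critical results: \<open>P_inf\<close> is of the order of the critical
  one-arm probability at scale \<open>L(p)\<close>, and near criticality \<open>L(p)\<close> is of the order of the correlation
  length.
\<close>

locale kesten_percolation = planar_percolation M
  for M :: percolation_model +
  fixes c \<delta> :: real
  assumes p_c_bounds: "0 < p_c M" "p_c M < 1"
    and threshold: "\<And>p. 0 \<le> p \<Longrightarrow> p \<le> 1 \<Longrightarrow> P_inf M p > 0 \<longleftrightarrow> p > p_c M"
    and rsw: "\<And>k. k > 0 \<Longrightarrow> \<exists>q>0. \<exists>b0. \<forall>z. \<forall>b\<ge>b0.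
                crossing_prob M (p_c M) z (k * b) b \<in> {q..1 - q} \<and>
                dual_crossing_prob M (p_c M) z (k * b) b \<in> {q..1 - q}"
    and corr_length_exists: "\<And>p. p_c M < p \<Longrightarrow> p < 1 \<Longrightarrow> \<exists>x. is_corr_length M p x"
    and corr_length_continuous: "continuous_on {p_c M<..1} (corr_length M)"
    and corr_length_decreasing:
      "\<And>p p'. p_c M < p \<Longrightarrow> p < p' \<Longrightarrow> p' \<le> 1 \<Longrightarrow> corr_length M p' < corr_length M p"
    and corr_length_diverges: "filterlim (corr_length M) at_top (at_right (p_c M))"
    and delta: "0 < \<delta>" "\<delta> < 1"
    and c_pos: "0 < c"
    and suitable_constant: "\<And>p n d. 0 \<le> p \<Longrightarrow> p \<le> 1 \<Longrightarrow> n \<ge> 1 \<Longrightarrow> 0 < d \<Longrightarrow> d < 1 \<Longrightarrow>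
                crossing_prob M p 0 (3 * real n) (real n) > 1 - c * d \<Longrightarrow>
                crossing_prob M p 0 (9 * real n) (3 * real n) > 1 - c * d\<^sup>2"
    and fs_length_exists: "\<And>p. p_c M < p \<Longrightarrow> p \<le> 1 \<Longrightarrow>
                \<exists>n\<ge>1. crossing_prob M p 0 (3 * real n) (real n) > 1 - c * \<delta>"
    and near_critical: "\<exists>Ca Cb. 0 < Ca \<and> (\<forall>p. p_c M < p \<and> p \<le> 1 \<longrightarrow>
                Ca * one_arm M (real (fs_length M c \<delta> p)) \<le> P_inf M p \<and>
                P_inf M p \<le> Cb * one_arm M (real (fs_length M c \<delta> p)))"
    and lengths_comparable: "\<exists>Ca Cb. 0 < Ca \<and> (\<forall>\<^sub>F p in at_right (p_c M).
                Ca * corr_length M p \<le> real (fs_length M c \<delta> p) \<and>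
                real (fs_length M c \<delta> p) \<le> Cb * corr_length M p)"


section \<open>The inhomogeneous model\<close>

definition density :: "percolation_model \<Rightarrow> real \<Rightarrow> complex \<Rightarrow> real" where
  "density M w z = p_c M + alpha M (rnorm M z powr w)"

definition inhom_measure :: "percolation_model \<Rightarrow> real \<Rightarrow> (complex set \<Rightarrow> bool) measure" where
  "inhom_measure M w = perc_measure M (\<lambda>e. density M w (location e))"

definition cond_measure :: "percolation_model \<Rightarrow> real \<Rightarrow> (complex set \<Rightarrow> bool) measure" where
  "cond_measure M w = uniform_measure (inhom_measure M w)
     {\<omega> \<in> space (inhom_measure M w). connected_to_infinity M \<omega> 0}"

definition I_sum :: "percolation_model \<Rightarrow> real \<Rightarrow> nat \<Rightarrow> real" where
  "I_sum M w N = (\<Sum>z\<in>rball M N 0. P_inf M (density M w z))"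

definition Psi :: "percolation_model \<Rightarrow> nat \<Rightarrow> (complex set \<Rightarrow> bool) \<Rightarrow> real" where
  "Psi M N \<omega> = real (card {v \<in> rball M N 0. connected_to_infinity M \<omega> v})"

definition Phi :: "percolation_model \<Rightarrow> nat \<Rightarrow> (complex set \<Rightarrow> bool) \<Rightarrow> real" where
  "Phi M N \<omega> = real (card {v \<in> rball M N 0. connected_in M \<omega> (rball M N 0) {0} {v}})"


section \<open>Asymptotics\<close>

definition comparable :: "(nat \<Rightarrow> real) \<Rightarrow> (nat \<Rightarrow> real) \<Rightarrow> bool" where
  "comparable f g \<longleftrightarrow>
     (\<exists>Ca Cb. 0 < Ca \<and> Ca \<le> Cb \<and> (\<forall>N\<ge>1. Ca * g N \<le> f N \<and> f N \<le> Cb * g N))"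

definition tendsto_L2 :: "'a measure \<Rightarrow> (nat \<Rightarrow> 'a \<Rightarrow> real) \<Rightarrow> real \<Rightarrow> bool" where
  "tendsto_L2 \<mu> X l \<longleftrightarrow>
     (\<forall>N. X N \<in> borel_measurable \<mu> \<and> integrable \<mu> (\<lambda>\<omega>. (X N \<omega> - l)\<^sup>2)) \<and>
     (\<lambda>N. \<integral>\<omega>. (X N \<omega> - l)\<^sup>2 \<partial>\<mu>) \<longlonglongrightarrow> 0"

end

theory Submission
  imports Defs
begin

text \<open>
  A path joining the vertical sides of a rectangle meets every path joining its horizontal sides. Hence
  occupied long-way crossings in all cells of a grid form one connected net, which catches every path
  leaving a cell. At criticality each crossing of scale n has probability bounded below,
  so by the FKG inequality arms can be prolonged, and the one-arm probability
  satisfies arm(s) \<le> C (t / s) arm(t) for s \<le> t.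

  Above criticality the rescaling inequality, iterated from scale L(p), makes the probability that a
  crossing at scale n fails smaller than any power of L(p) / n. Nets at the scales 3^k n, with n of order
  L(p), therefore exist simultaneously with probability bounded below: reaching distance L(p) and reaching
  infinity have comparable probabilities, both of order arm(L(p)). In the inhomogeneous model the
  neighbourhood of a site z is homogeneous up to constants, with correlation length of order
  r(z)^w, so that z belongs to the infinite cluster with probability of order arm(r(z)^w), and
  the first moments follow by summation.

  At scale n = N^(w + \<epsilon>) reaching distance 2n and reaching infinity differ by a negligible probability.
  Sites farther than 7n apart are thus almost uncorrelated, and the near pairs give the variance bound through
  the regularity of the one-arm probability. A net of scale n covering the rhombus
  of radius N connects the origin, when it lies in the infinite cluster, to all sites of this cluster
  except some in a rim of width 7n, whose number has a second moment within the variance bound.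
\<close>

section \<open>Events of the product measure\<close>

text \<open>The inhomogeneous field is not translation invariant, so its probabilities come from
  comparison: the density decreases with the distance from the origin, and an increasing event that
  lives in a box is bounded by its probability under a constant density lying above or below the
  field on that box. This is why events are first taken local, and why \<open>reach\<close>, the
  passage of a distance, stands in for infinity and for the exact sphere, which an edge may jump
  over. The regularity of the arm carries the factor t / s because a long crossing passes through
  one of about t / s cells and it is not known through which. Dimension two makes this enough: the
  sum of r^(-w) over the rhombus is dominated by its outer part, and the product of two arms
  produces r^(-2), whose logarithm is absorbed by N^(2 \<epsilon>). The condition w < 1 acts twice.
  Nets around a site are taken at scales m above its distance from the origin, where the correlation
  length, of order m^w, is small against m; and N^(w + \<epsilon>) has to stay below N. At this last
  scale a crossing fails with probability O(N^(- \<epsilon> k)) for every k, which beats the number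
  of pairs of sites.\<close>

definition pr :: "percolation_model \<Rightarrow> (complex set \<Rightarrow> real) \<Rightarrow> ((complex set \<Rightarrow> bool) \<Rightarrow> bool) \<Rightarrow> real" where
  "pr M q A = measure (perc_measure M q) {\<omega> \<in> space (perc_measure M q). A \<omega>}"

text \<open>The discrete product sigma-algebra does not mention densities, so measurability is shown
  once and serves every field \<open>q\<close>.\<close>

definition event :: "percolation_model \<Rightarrow> ((complex set \<Rightarrow> bool) \<Rightarrow> bool) \<Rightarrow> bool" where
  "event M A \<longleftrightarrow> {\<omega> \<in> elements M \<rightarrow>\<^sub>E UNIV. A \<omega>} \<in> sets (PiM (elements M) (\<lambda>_. count_space UNIV))"

text \<open>Arbitrary functions are compared, not only points of the product space, so that updates
  at an element and compositions with symmetries need no side conditions.\<close>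

definition supported :: "complex set set \<Rightarrow> ((complex set \<Rightarrow> bool) \<Rightarrow> bool) \<Rightarrow> bool" where
  "supported F A \<longleftrightarrow> (\<forall>\<omega> \<omega>'. (\<forall>e\<in>F. \<omega> e = \<omega>' e) \<longrightarrow> A \<omega> = A \<omega>')"

definition cylinder :: "percolation_model \<Rightarrow> ((complex set \<Rightarrow> bool) \<Rightarrow> bool) \<Rightarrow> bool" where
  "cylinder M A \<longleftrightarrow> (\<exists>F. finite F \<and> F \<subseteq> elements M \<and> supported F A)"

definition up_event :: "((complex set \<Rightarrow> bool) \<Rightarrow> bool) \<Rightarrow> bool" where
  "up_event A \<longleftrightarrow> (\<forall>\<omega> \<omega>'. (\<forall>e. \<omega> e \<longrightarrow> \<omega>' e) \<longrightarrow> A \<omega> \<longrightarrow> A \<omega>')"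

lemma space_perc_measure [simp]: "space (perc_measure M q) = elements M \<rightarrow>\<^sub>E UNIV"
  by (simp add: perc_measure_def space_PiM)

lemma sets_perc_measure: "sets (perc_measure M q) = sets (PiM (elements M) (\<lambda>_. count_space UNIV))"
  unfolding perc_measure_def by (intro sets_PiM_cong) auto

lemma prob_space_perc_measure: "prob_space (perc_measure M q)"
  unfolding perc_measure_def by (intro prob_space_PiM measure_pmf.prob_space_axioms)

lemma event_sets: "event M A \<Longrightarrow> {\<omega> \<in> elements M \<rightarrow>\<^sub>E UNIV. A \<omega>} \<in> sets (perc_measure M q)"
  by (simp add: event_def sets_perc_measure)

lemma supportedI:
  "(\<And>\<omega> \<omega>'. (\<And>e. e \<in> F \<Longrightarrow> \<omega> e = \<omega>' e) \<Longrightarrow> A \<omega> \<Longrightarrow> A \<omega>') \<Longrightarrow> supported F A"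
  unfolding supported_def by metis

lemma supported_mono: "supported F A \<Longrightarrow> F \<subseteq> G \<Longrightarrow> supported G A"
  unfolding supported_def by blast

lemma supported_upd:
  assumes "supported (insert e F) A"
  shows "supported F (\<lambda>\<omega>. A (fun_upd \<omega> e b))"
  using assms unfolding supported_def by (simp add: fun_upd_apply)

lemma up_event_upd: "up_event A \<Longrightarrow> up_event (\<lambda>\<omega>. A (fun_upd \<omega> e b))"
  unfolding up_event_def
proof (intro allI impI)
  fix \<omega> \<omega>'
  assume "\<forall>\<omega> \<omega>'. (\<forall>e. \<omega> e \<longrightarrow> \<omega>' e) \<longrightarrow> A \<omega> \<longrightarrow> A \<omega>'" "\<forall>e. \<omega> e \<longrightarrow> \<omega>' e" "A (fun_upd \<omega> e b)"
  then show "A (fun_upd \<omega>' e b)"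
    by (elim allE[of _ "fun_upd \<omega> e b"] allE[of _ "fun_upd \<omega>' e b"]) auto
qed

lemma up_event_upd_le: "up_event A \<Longrightarrow> A (fun_upd \<omega> e False) \<Longrightarrow> A (fun_upd \<omega> e True)"
  unfolding up_event_def by (erule allE[of _ "fun_upd \<omega> e False"], erule allE[of _ "fun_upd \<omega> e True"]) simp

lemma event_True [simp]: "event M (\<lambda>\<omega>. b)"
proof -
  have "space (PiM (elements M) (\<lambda>_. count_space (UNIV::bool set))) \<in> sets (PiM (elements M) (\<lambda>_. count_space UNIV))"
    by (rule sets.top)
  then show ?thesis by (cases b) (auto simp: event_def space_PiM)
qed

lemma event_coord: "e \<in> elements M \<Longrightarrow> event M (\<lambda>\<omega>. \<omega> e)"
proof -
  assume e: "e \<in> elements M"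
  have "(\<lambda>\<omega>. \<omega> e) -` {True} \<inter> space (PiM (elements M) (\<lambda>_. count_space (UNIV::bool set))) \<in> sets (PiM (elements M) (\<lambda>_. count_space UNIV))"
    using e by (intro measurable_sets[of _ _ "count_space UNIV"]) auto
  also have "(\<lambda>\<omega>. \<omega> e) -` {True} \<inter> space (PiM (elements M) (\<lambda>_. count_space (UNIV::bool set))) = {\<omega> \<in> elements M \<rightarrow>\<^sub>E UNIV. \<omega> e}"
    by (auto simp: space_PiM)
  finally show ?thesis by (simp add: event_def)
qed

lemma event_not: "event M A \<Longrightarrow> event M (\<lambda>\<omega>. \<not> A \<omega>)"
proof -
  assume "event M A"
  then have "space (PiM (elements M) (\<lambda>_. count_space (UNIV::bool set))) - {\<omega> \<in> elements M \<rightarrow>\<^sub>E UNIV. A \<omega>}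
      \<in> sets (PiM (elements M) (\<lambda>_. count_space UNIV))"
    unfolding event_def by (rule sets.compl_sets)
  moreover have "space (PiM (elements M) (\<lambda>_. count_space (UNIV::bool set))) - {\<omega> \<in> elements M \<rightarrow>\<^sub>E UNIV. A \<omega>}
      = {\<omega> \<in> elements M \<rightarrow>\<^sub>E UNIV. \<not> A \<omega>}"
    by (auto simp: space_PiM)
  ultimately show ?thesis by (simp add: event_def)
qed

lemma event_ball:
  assumes "countable I" "\<And>i. i \<in> I \<Longrightarrow> event M (A i)"
  shows "event M (\<lambda>\<omega>. \<forall>i\<in>I. A i \<omega>)"
proof (cases "I = {}")
  case False
  have "(\<Inter>i\<in>I. {\<omega> \<in> elements M \<rightarrow>\<^sub>E UNIV. A i \<omega>}) \<in> sets (PiM (elements M) (\<lambda>_. count_space UNIV))"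
    using assms False by (intro sets.countable_INT') (auto simp: event_def)
  also have "(\<Inter>i\<in>I. {\<omega> \<in> elements M \<rightarrow>\<^sub>E UNIV. A i \<omega>}) = {\<omega> \<in> elements M \<rightarrow>\<^sub>E UNIV. \<forall>i\<in>I. A i \<omega>}"
    using False by auto
  finally show ?thesis by (simp add: event_def)
qed simp

lemma event_conj:
  assumes "event M A" "event M B"
  shows "event M (\<lambda>\<omega>. A \<omega> \<and> B \<omega>)"
proof -
  have "event M (\<lambda>\<omega>. \<forall>C\<in>{A, B}. C \<omega>)" using assms by (intro event_ball) auto
  then show ?thesis by simp
qed

lemma event_bex:
  assumes "countable I" "\<And>i. i \<in> I \<Longrightarrow> event M (A i)"
  shows "event M (\<lambda>\<omega>. \<exists>i\<in>I. A i \<omega>)"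
proof -
  have "event M (\<lambda>\<omega>. \<not> (\<forall>i\<in>I. \<not> A i \<omega>))"
    using assms by (intro event_not event_ball)
  then show ?thesis by simp
qed

lemma event_disj:
  assumes "event M A" "event M B"
  shows "event M (\<lambda>\<omega>. A \<omega> \<or> B \<omega>)"
proof -
  have "event M (\<lambda>\<omega>. \<exists>C\<in>{A, B}. C \<omega>)" using assms by (intro event_bex) auto
  then show ?thesis by simp
qed

text \<open>Splitting on the value at one element of the support writes the event as a Boolean
  combination of a coordinate event and two events with smaller support.\<close>

lemma cylinder_event:
  assumes "cylinder M A"
  shows "event M A"
proof -
  obtain F where "finite F" "F \<subseteq> elements M" "supported F A"
    using assms unfolding cylinder_def by auto
  then show ?thesis
  proof (induction F arbitrary: A)
    case empty
    then have "A = (\<lambda>\<omega>. A undefined)" unfolding supported_def by blast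
    then show ?case using event_True by metis
  next
    case (insert e F)
    have "event M (\<lambda>\<omega>. A (fun_upd \<omega> e b))" for b
      using insert.prems supported_upd[OF insert.prems(2)] by (intro insert.IH) auto
    then have "event M (\<lambda>\<omega>. \<omega> e \<and> A (fun_upd \<omega> e True) \<or> \<not> \<omega> e \<and> A (fun_upd \<omega> e False))"
      using insert.prems by (intro event_disj event_conj event_not event_coord) auto
    moreover have "(\<lambda>\<omega>. \<omega> e \<and> A (fun_upd \<omega> e True) \<or> \<not> \<omega> e \<and> A (fun_upd \<omega> e False)) = A"
    proof
      fix \<omega>
      show "(\<omega> e \<and> A (fun_upd \<omega> e True) \<or> \<not> \<omega> e \<and> A (fun_upd \<omega> e False)) = A \<omega>"
        using fun_upd_triv[of \<omega> e] by (cases "\<omega> e") auto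
    qed
    ultimately show ?case by simp
  qed
qed

lemma pr_nonneg [simp]: "0 \<le> pr M q A"
  by (simp add: pr_def)

lemma pr_le_1 [simp]: "pr M q A \<le> 1"
  unfolding pr_def by (rule prob_space.prob_le_1[OF prob_space_perc_measure])

lemma pr_True [simp]: "pr M q (\<lambda>_. True) = 1"
  using prob_space.prob_space[OF prob_space_perc_measure, of M q] by (simp add: pr_def)

lemma pr_False [simp]: "pr M q (\<lambda>_. False) = 0"
  by (simp add: pr_def)

lemma pr_mono: "event M B \<Longrightarrow> (\<And>\<omega>. A \<omega> \<Longrightarrow> B \<omega>) \<Longrightarrow> pr M q A \<le> pr M q B"
  unfolding pr_def
  using prob_space.finite_measure[OF prob_space_perc_measure]
  by (intro finite_measure.finite_measure_mono) (auto intro: event_sets)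

lemma pr_not: "event M A \<Longrightarrow> pr M q (\<lambda>\<omega>. \<not> A \<omega>) = 1 - pr M q A"
  using prob_space.prob_neg[OF prob_space_perc_measure, of M q A]
  by (simp add: pr_def event_def sets_perc_measure)

lemma pr_disj_le: "event M A \<Longrightarrow> event M B \<Longrightarrow> pr M q (\<lambda>\<omega>. A \<omega> \<or> B \<omega>) \<le> pr M q A + pr M q B"
proof -
  assume AB: "event M A" "event M B"
  interpret prob_space "perc_measure M q" by (rule prob_space_perc_measure)
  have "measure (perc_measure M q) ({\<omega> \<in> elements M \<rightarrow>\<^sub>E UNIV. A \<omega>} \<union> {\<omega> \<in> elements M \<rightarrow>\<^sub>E UNIV. B \<omega>})
      \<le> pr M q A + pr M q B"
    using AB by (simp add: pr_def measure_Un_le event_sets)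
  moreover have "{\<omega> \<in> elements M \<rightarrow>\<^sub>E UNIV. A \<omega>} \<union> {\<omega> \<in> elements M \<rightarrow>\<^sub>E UNIV. B \<omega>}
      = {\<omega> \<in> elements M \<rightarrow>\<^sub>E UNIV. A \<omega> \<or> B \<omega>}" by auto
  ultimately show ?thesis by (simp add: pr_def)
qed

lemma pr_bex_le:
  assumes "finite I" "\<And>i. i \<in> I \<Longrightarrow> event M (A i)"
  shows "pr M q (\<lambda>\<omega>. \<exists>i\<in>I. A i \<omega>) \<le> (\<Sum>i\<in>I. pr M q (A i))"
  using assms
proof (induction I)
  case (insert i I)
  have "pr M q (\<lambda>\<omega>. \<exists>i\<in>insert i I. A i \<omega>) = pr M q (\<lambda>\<omega>. A i \<omega> \<or> (\<exists>i\<in>I. A i \<omega>))" by simp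
  also have "\<dots> \<le> pr M q (A i) + pr M q (\<lambda>\<omega>. \<exists>i\<in>I. A i \<omega>)"
    using insert by (intro pr_disj_le event_bex) (auto intro: countable_finite)
  finally show ?case using insert by simp
qed simp

lemma pr_ball_ge:
  assumes "finite I" "\<And>i. i \<in> I \<Longrightarrow> event M (A i)"
  shows "1 - (\<Sum>i\<in>I. (1 - pr M q (A i))) \<le> pr M q (\<lambda>\<omega>. \<forall>i\<in>I. A i \<omega>)"
proof -
  have "pr M q (\<lambda>\<omega>. \<not> (\<forall>i\<in>I. A i \<omega>)) = pr M q (\<lambda>\<omega>. \<exists>i\<in>I. \<not> A i \<omega>)" by simp
  also have "\<dots> \<le> (\<Sum>i\<in>I. pr M q (\<lambda>\<omega>. \<not> A i \<omega>))"
    using assms by (intro pr_bex_le event_not)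
  also have "\<dots> = (\<Sum>i\<in>I. 1 - pr M q (A i))" using assms by (simp add: pr_not)
  finally show ?thesis
    using assms by (subst (asm) pr_not) (auto intro!: event_ball countable_finite)
qed

lemma pr_disjoint_bex:
  assumes "finite I" "\<And>i. i \<in> I \<Longrightarrow> event M (A i)"
    and "\<And>\<omega> i j. i \<in> I \<Longrightarrow> j \<in> I \<Longrightarrow> A i \<omega> \<Longrightarrow> A j \<omega> \<Longrightarrow> i = j"
  shows "pr M q (\<lambda>\<omega>. \<exists>i\<in>I. A i \<omega>) = (\<Sum>i\<in>I. pr M q (A i))"
proof -
  have "measure (perc_measure M q) (\<Union>i\<in>I. {\<omega> \<in> elements M \<rightarrow>\<^sub>E UNIV. A i \<omega>})
      = (\<Sum>i\<in>I. measure (perc_measure M q) {\<omega> \<in> elements M \<rightarrow>\<^sub>E UNIV. A i \<omega>})"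
    using assms prob_space.finite_measure[OF prob_space_perc_measure]
    by (intro finite_measure.finite_measure_finite_Union)
       (auto simp: event_sets disjoint_family_on_def)
  moreover have "(\<Union>i\<in>I. {\<omega> \<in> elements M \<rightarrow>\<^sub>E UNIV. A i \<omega>}) = {\<omega> \<in> elements M \<rightarrow>\<^sub>E UNIV. \<exists>i\<in>I. A i \<omega>}" by auto
  ultimately show ?thesis by (simp add: pr_def)
qed

lemma pr_lim_decreasing:
  assumes "\<And>n. event M (A n)" "\<And>n \<omega>. A (Suc n) \<omega> \<Longrightarrow> A n \<omega>"
  shows "(\<lambda>n. pr M q (A n)) \<longlonglongrightarrow> pr M q (\<lambda>\<omega>. \<forall>n. A n \<omega>)"
proof -
  have "decseq (\<lambda>n. {\<omega> \<in> elements M \<rightarrow>\<^sub>E UNIV. A n \<omega>})"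
    using assms(2) by (intro decseq_SucI) auto
  moreover have "range (\<lambda>n. {\<omega> \<in> elements M \<rightarrow>\<^sub>E UNIV. A n \<omega>}) \<subseteq> sets (perc_measure M q)"
    using assms(1) by (auto intro: event_sets)
  ultimately have "(\<lambda>n. measure (perc_measure M q) {\<omega> \<in> elements M \<rightarrow>\<^sub>E UNIV. A n \<omega>}) \<longlonglongrightarrow>
     measure (perc_measure M q) (\<Inter>n. {\<omega> \<in> elements M \<rightarrow>\<^sub>E UNIV. A n \<omega>})"
    using finite_measure.finite_Lim_measure_decseq[OF prob_space.finite_measure[OF prob_space_perc_measure]] by blast
  moreover have "(\<Inter>n. {\<omega> \<in> elements M \<rightarrow>\<^sub>E UNIV. A n \<omega>}) = {\<omega> \<in> elements M \<rightarrow>\<^sub>E UNIV. \<forall>n. A n \<omega>}" by auto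
  ultimately show ?thesis by (simp add: pr_def)
qed

text \<open>Resampling the coordinate \<open>e\<close> from its own Bernoulli law does not change
  the product measure; conditioning on the new value gives the two terms. Iterating this over a
  finite support replaces coupling and Fubini arguments in all inequalities that follow.\<close>

lemma pr_recursion:
  assumes A: "event M A" and e: "e \<in> elements M" and q: "0 \<le> q e" "q e \<le> 1"
  shows "pr M q A = q e * pr M q (\<lambda>\<omega>. A (fun_upd \<omega> e True)) + (1 - q e) * pr M q (\<lambda>\<omega>. A (fun_upd \<omega> e False))"
proof -
  let ?P = "perc_measure M q" and ?B = "measure_pmf (bernoulli_pmf (q e))"
  let ?S = "{\<omega> \<in> elements M \<rightarrow>\<^sub>E UNIV. A \<omega>}"
  interpret P: prob_space ?P by (rule prob_space_perc_measure)
  have ins: "insert e (elements M) = elements M" using e by auto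
  have S: "?S \<in> sets ?P" using A by (rule event_sets)
  \<comment> \<open>The library fact adds a coordinate; applied to an index that is already present,
    it says that overwriting it by an independent sample preserves the measure.\<close>
  have d: "distr (?B \<Otimes>\<^sub>M ?P) ?P (\<lambda>(x, X). X(e := x)) = ?P"
    using distr_pair_PiM_eq_PiM[of "elements M" "\<lambda>e. measure_pmf (bernoulli_pmf (q e))" e]
    by (simp add: perc_measure_def ins measure_pmf.prob_space_axioms)
  have meas: "(\<lambda>(x, X). X(e := x)) \<in> measurable (?B \<Otimes>\<^sub>M ?P) ?P"
    using measurable_add_dim[of e "elements M" "\<lambda>e. measure_pmf (bernoulli_pmf (q e))"]
    by (simp add: perc_measure_def ins)
  let ?T = "(\<lambda>(x, X). X(e := x)) -` ?S \<inter> space (?B \<Otimes>\<^sub>M ?P)"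
  have T: "?T \<in> sets (?B \<Otimes>\<^sub>M ?P)" using meas S by (rule measurable_sets)
  have Tb: "Pair b -` ?T = {\<omega> \<in> elements M \<rightarrow>\<^sub>E UNIV. A (fun_upd \<omega> e b)}" for b
    using e by (auto simp: space_pair_measure PiE_def extensional_def)
  have "emeasure ?P ?S = emeasure (?B \<Otimes>\<^sub>M ?P) ?T"
    by (subst d[symmetric], subst emeasure_distr[OF meas S]) simp
  also have "\<dots> = (\<integral>\<^sup>+b. emeasure ?P (Pair b -` ?T) \<partial>?B)"
    by (rule P.emeasure_pair_measure_alt[OF T])
  also have "\<dots> = (\<integral>\<^sup>+b. ennreal (pr M q (\<lambda>\<omega>. A (fun_upd \<omega> e b))) \<partial>?B)"
    unfolding Tb by (simp add: pr_def P.emeasure_eq_measure)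
  also have "\<dots> = ennreal (q e * pr M q (\<lambda>\<omega>. A (fun_upd \<omega> e True)) + (1 - q e) * pr M q (\<lambda>\<omega>. A (fun_upd \<omega> e False)))"
    using q by (subst nn_integral_bernoulli_pmf) (auto simp: ennreal_plus[symmetric] ennreal_mult[symmetric] simp del: ennreal_plus)
  finally have "ennreal (pr M q A) = ennreal (q e * pr M q (\<lambda>\<omega>. A (fun_upd \<omega> e True)) + (1 - q e) * pr M q (\<lambda>\<omega>. A (fun_upd \<omega> e False)))"
    by (simp add: pr_def P.emeasure_eq_measure)
  then show ?thesis using q by (subst (asm) ennreal_inj) auto
qed

section \<open>Correlation inequality, monotonicity, independence and symmetry for cylinder
  events\<close>

definition prob_field :: "percolation_model \<Rightarrow> (complex set \<Rightarrow> real) \<Rightarrow> bool" where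
  "prob_field M q \<longleftrightarrow> (\<forall>e\<in>elements M. 0 \<le> q e \<and> q e \<le> 1)"

lemma cylinderI: "finite F \<Longrightarrow> F \<subseteq> elements M \<Longrightarrow> supported F A \<Longrightarrow> cylinder M A"
  unfolding cylinder_def by blast

lemma event_upd:
  assumes "finite F" "insert e F \<subseteq> elements M" "supported (insert e F) A"
  shows "event M (\<lambda>\<omega>. A (fun_upd \<omega> e b))"
  using assms by (intro cylinder_event[OF cylinderI[of F]] supported_upd) auto

lemma supported_conj: "supported F A \<Longrightarrow> supported G B \<Longrightarrow> supported (F \<union> G) (\<lambda>\<omega>. A \<omega> \<and> B \<omega>)"
  unfolding supported_def
proof (intro allI impI)
  fix \<omega> \<omega>' :: "complex set \<Rightarrow> bool"
  assume *: "\<forall>\<omega> \<omega>'. (\<forall>e\<in>F. \<omega> e = \<omega>' e) \<longrightarrow> A \<omega> = A \<omega>'" "\<forall>\<omega> \<omega>'. (\<forall>e\<in>G. \<omega> e = \<omega>' e) \<longrightarrow> B \<omega> = B \<omega>'"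
    and "\<forall>e\<in>F \<union> G. \<omega> e = \<omega>' e"
  then have "A \<omega> = A \<omega>'" "B \<omega> = B \<omega>'"
    by (intro *(1)[rule_format] *(2)[rule_format]; simp)+
  then show "(A \<omega> \<and> B \<omega>) = (A \<omega>' \<and> B \<omega>')" by simp
qed

lemma cylinder_conj: "cylinder M A \<Longrightarrow> cylinder M B \<Longrightarrow> cylinder M (\<lambda>\<omega>. A \<omega> \<and> B \<omega>)"
  unfolding cylinder_def
proof (elim exE conjE)
  fix F G
  assume "finite F" "F \<subseteq> elements M" "supported F A" "finite G" "G \<subseteq> elements M" "supported G B"
  then show "\<exists>F. finite F \<and> F \<subseteq> elements M \<and> supported F (\<lambda>\<omega>. A \<omega> \<and> B \<omega>)"
    by (intro exI[of _ "F \<union> G"] conjI supported_conj) auto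
qed

lemma cylinder_const [simp]: "cylinder M (\<lambda>\<omega>. b)"
  by (rule cylinderI[of "{}"]) (auto simp: supported_def)

lemma cylinder_ball:
  "finite I \<Longrightarrow> (\<And>i. i \<in> I \<Longrightarrow> cylinder M (A i)) \<Longrightarrow> cylinder M (\<lambda>\<omega>. \<forall>i\<in>I. A i \<omega>)"
proof (induction I rule: finite_induct)
  case (insert i I)
  then show ?case using cylinder_conj[of M "A i" "\<lambda>\<omega>. \<forall>i\<in>I. A i \<omega>"] by simp
qed simp

lemma cylinder_not: "cylinder M A \<Longrightarrow> cylinder M (\<lambda>\<omega>. \<not> A \<omega>)"
  unfolding cylinder_def supported_def by simp

lemma cylinder_bex:
  assumes "finite I" "\<And>i. i \<in> I \<Longrightarrow> cylinder M (A i)"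
  shows "cylinder M (\<lambda>\<omega>. \<exists>i\<in>I. A i \<omega>)"
proof -
  have "cylinder M (\<lambda>\<omega>. \<not> (\<forall>i\<in>I. \<not> A i \<omega>))"
    using assms by (intro cylinder_not cylinder_ball)
  then show ?thesis by simp
qed

lemma up_event_conj: "up_event A \<Longrightarrow> up_event B \<Longrightarrow> up_event (\<lambda>\<omega>. A \<omega> \<and> B \<omega>)"
  unfolding up_event_def by blast

lemma up_event_ball: "(\<And>i. i \<in> I \<Longrightarrow> up_event (A i)) \<Longrightarrow> up_event (\<lambda>\<omega>. \<forall>i\<in>I. A i \<omega>)"
  unfolding up_event_def by blast

text \<open>The difference of the two sides is t (1 - t) (a1 - a0) (b1 - b0).\<close>

lemma Chebyshev_two_point:
  fixes t :: real
  assumes "0 \<le> t" "t \<le> 1" "a0 \<le> a1" "b0 \<le> b1"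
  shows "(t * a1 + (1 - t) * a0) * (t * b1 + (1 - t) * b0) \<le> t * (a1 * b1) + (1 - t) * (a0 * b0)"
proof -
  have "0 \<le> t * (1 - t) * ((a1 - a0) * (b1 - b0))" using assms by simp
  also have "\<dots> = t * (a1 * b1) + (1 - t) * (a0 * b0) - (t * a1 + (1 - t) * a0) * (t * b1 + (1 - t) * b0)"
    by (simp add: algebra_simps power2_eq_square)
  finally show ?thesis by simp
qed

text \<open>Induction over a common support: the conditional probabilities of both events increase
  with the value at \<open>e\<close>, so the two-point Chebyshev inequality applies, and the
  induction hypothesis handles each of the two conditioned pairs.\<close>

theorem Harris_FKG:
  assumes "cylinder M A" "up_event A" "cylinder M B" "up_event B" "prob_field M q"
  shows "pr M q A * pr M q B \<le> pr M q (\<lambda>\<omega>. A \<omega> \<and> B \<omega>)"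
proof -
  obtain F G where "finite F" "F \<subseteq> elements M" "supported F A" "finite G" "G \<subseteq> elements M" "supported G B"
    using assms(1,3) unfolding cylinder_def by auto
  then have FG: "finite (F \<union> G)" "F \<union> G \<subseteq> elements M" "supported (F \<union> G) A" "supported (F \<union> G) B"
    by (auto intro: supported_mono)
  have *: "pr M q A * pr M q B \<le> pr M q (\<lambda>\<omega>. A \<omega> \<and> B \<omega>)"
    if "finite F" "F \<subseteq> elements M" "supported F A" "supported F B" "up_event A" "up_event B" for F A B
    using that
  proof (induction F arbitrary: A B rule: finite_induct)
    case empty
    then have "A = (\<lambda>\<omega>. A undefined)" "B = (\<lambda>\<omega>. B undefined)" unfolding supported_def by blast+
    then obtain a b where "A = (\<lambda>_. a)" "B = (\<lambda>_. b)" by blast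
    then show ?case by (cases a; cases b) auto
  next
    case (insert e F)
    let ?A = "\<lambda>b \<omega>. A (fun_upd \<omega> e b)" and ?B = "\<lambda>b \<omega>. B (fun_upd \<omega> e b)"
    have q: "0 \<le> q e" "q e \<le> 1" using assms(5) insert.prems unfolding prob_field_def by auto
    have ev: "event M A" "event M B" "event M (?A b)" "event M (?B b)" for b
      using insert by (auto intro!: event_upd[of F] intro: cylinder_event[OF cylinderI[of "insert e F"]])
    have IH: "pr M q (?A b) * pr M q (?B b) \<le> pr M q (\<lambda>\<omega>. ?A b \<omega> \<and> ?B b \<omega>)" for b
      using insert.prems by (intro insert.IH supported_upd up_event_upd) auto
    have "pr M q A * pr M q B
       = (q e * pr M q (?A True) + (1 - q e) * pr M q (?A False)) * (q e * pr M q (?B True) + (1 - q e) * pr M q (?B False))"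
      using insert.prems q by (simp add: pr_recursion[of M A e q] pr_recursion[of M B e q] ev)
    also have "\<dots> \<le> q e * (pr M q (?A True) * pr M q (?B True)) + (1 - q e) * (pr M q (?A False) * pr M q (?B False))"
      using insert.prems q ev by (intro Chebyshev_two_point pr_mono) (auto intro: up_event_upd_le)
    also have "\<dots> \<le> q e * pr M q (\<lambda>\<omega>. ?A True \<omega> \<and> ?B True \<omega>) + (1 - q e) * pr M q (\<lambda>\<omega>. ?A False \<omega> \<and> ?B False \<omega>)"
      using IH q by (intro add_mono mult_left_mono) auto
    also have "\<dots> = pr M q (\<lambda>\<omega>. A \<omega> \<and> B \<omega>)"
      using insert.prems q by (subst (3) pr_recursion[of M _ e q]) (auto intro: event_conj ev)
    finally show ?case .
  qed
  show ?thesis using FG assms(2,4) by (rule *)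
qed

lemma FKG_ball:
  assumes "finite I" "\<And>i. i \<in> I \<Longrightarrow> cylinder M (A i)" "\<And>i. i \<in> I \<Longrightarrow> up_event (A i)" "prob_field M q"
  shows "(\<Prod>i\<in>I. pr M q (A i)) \<le> pr M q (\<lambda>\<omega>. \<forall>i\<in>I. A i \<omega>)"
  using assms(1-3)
proof (induction I rule: finite_induct)
  case (insert i I)
  have IH: "(\<Prod>i\<in>I. pr M q (A i)) \<le> pr M q (\<lambda>\<omega>. \<forall>i\<in>I. A i \<omega>)"
    by (rule insert.IH) (simp_all add: insert.prems)
  have "(\<Prod>i\<in>insert i I. pr M q (A i)) = pr M q (A i) * (\<Prod>i\<in>I. pr M q (A i))"
    using insert.hyps by simp
  also have "\<dots> \<le> pr M q (A i) * pr M q (\<lambda>\<omega>. \<forall>i\<in>I. A i \<omega>)"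
    by (intro mult_left_mono IH) simp
  also have "\<dots> \<le> pr M q (\<lambda>\<omega>. A i \<omega> \<and> (\<forall>i\<in>I. A i \<omega>))"
    by (intro Harris_FKG cylinder_ball up_event_ball insert.prems assms(4) insert.hyps) simp_all
  finally show ?case by simp
qed simp

text \<open>The densities are ordered only on the support of the event. This is what permits
  comparing the inhomogeneous field with a constant one box by box.\<close>

lemma pr_mono_field:
  assumes "finite F" "F \<subseteq> elements M" "supported F A" "up_event A"
    and "prob_field M q" "prob_field M q'" "\<And>e. e \<in> F \<Longrightarrow> q e \<le> q' e"
  shows "pr M q A \<le> pr M q' A"
  using assms(1-4,7)
proof (induction F arbitrary: A rule: finite_induct)
  case empty
  then have "A = (\<lambda>\<omega>. A undefined)" unfolding supported_def by blast
  then obtain a where "A = (\<lambda>_. a)" by blast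
  then show ?case by (cases a) auto
next
  case (insert e F)
  let ?A = "\<lambda>b \<omega>. A (fun_upd \<omega> e b)"
  have q: "0 \<le> q e" "q e \<le> 1" "0 \<le> q' e" "q' e \<le> 1" "q e \<le> q' e"
    using assms(5,6) insert.prems unfolding prob_field_def by auto
  have ev: "event M A" "event M (?A b)" for b
    using insert by (auto intro!: event_upd[of F] intro: cylinder_event[OF cylinderI[of "insert e F"]])
  have IH: "pr M q (?A b) \<le> pr M q' (?A b)" for b
    using insert.prems by (intro insert.IH supported_upd up_event_upd) auto
  have le: "pr M q' (?A False) \<le> pr M q' (?A True)"
    using insert.prems ev by (intro pr_mono) (auto intro: up_event_upd_le)
  have "pr M q A = q e * pr M q (?A True) + (1 - q e) * pr M q (?A False)"
    by (intro pr_recursion ev q) (use insert.prems in simp)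
  also have "\<dots> \<le> q e * pr M q' (?A True) + (1 - q e) * pr M q' (?A False)"
    using IH q by (intro add_mono mult_left_mono) auto
  also have "\<dots> = pr M q' (?A False) + q e * (pr M q' (?A True) - pr M q' (?A False))"
    by (simp add: algebra_simps)
  also have "\<dots> \<le> pr M q' (?A False) + q' e * (pr M q' (?A True) - pr M q' (?A False))"
    using le q by (intro add_left_mono mult_right_mono) auto
  also have "\<dots> = q' e * pr M q' (?A True) + (1 - q' e) * pr M q' (?A False)"
    by (simp add: algebra_simps)
  also have "\<dots> = pr M q' A"
    by (intro pr_recursion[symmetric] ev q) (use insert.prems in simp)
  finally show ?case .
qed

text \<open>Since \<open>B\<close> ignores the elements of \<open>F\<close>, conditioning on such an
  element leaves it alone and the recursion factors.\<close>

lemma pr_indep: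
  assumes "finite F" "F \<subseteq> elements M" "supported F A" "cylinder M B" "supported G B" "F \<inter> G = {}"
    and "prob_field M q"
  shows "pr M q (\<lambda>\<omega>. A \<omega> \<and> B \<omega>) = pr M q A * pr M q B"
  using assms(1-3,6)
proof (induction F arbitrary: A rule: finite_induct)
  case empty
  then have "A = (\<lambda>\<omega>. A undefined)" unfolding supported_def by blast
  then obtain a where "A = (\<lambda>_. a)" by blast
  then show ?case by (cases a) auto
next
  case (insert e F)
  let ?A = "\<lambda>b \<omega>. A (fun_upd \<omega> e b)"
  have q: "0 \<le> q e" "q e \<le> 1" using assms(7) insert.prems unfolding prob_field_def by auto
  have ev: "event M A" "event M (?A b)" for b
    using insert by (auto intro!: event_upd[of F] intro: cylinder_event[OF cylinderI[of "insert e F"]])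
  have IH: "pr M q (\<lambda>\<omega>. ?A b \<omega> \<and> B \<omega>) = pr M q (?A b) * pr M q B" for b
    using insert.prems by (intro insert.IH supported_upd up_event_upd) auto
  have B: "B (fun_upd \<omega> e b) = B \<omega>" for \<omega> b
  proof -
    have "\<forall>e'\<in>G. (fun_upd \<omega> e b) e' = \<omega> e'" using insert.prems(3) by auto
    then show ?thesis using assms(5) unfolding supported_def by blast
  qed
  have "pr M q (\<lambda>\<omega>. A \<omega> \<and> B \<omega>) = q e * pr M q (\<lambda>\<omega>. ?A True \<omega> \<and> B \<omega>) + (1 - q e) * pr M q (\<lambda>\<omega>. ?A False \<omega> \<and> B \<omega>)"
    using insert.prems q by (subst pr_recursion[of M _ e q]) (auto simp: B intro!: event_conj ev cylinder_event[OF assms(4)])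
  also have "\<dots> = (q e * pr M q (?A True) + (1 - q e) * pr M q (?A False)) * pr M q B"
    by (simp add: IH algebra_simps)
  also have "\<dots> = pr M q A * pr M q B"
    using insert.prems q by (simp add: pr_recursion[of M A e q] ev)
  finally show ?case .
qed

text \<open>Pulling an event back along an injective map of the elements pushes its support forward,
  so the recursion of the pulled-back event at \<open>\<Phi> e\<close> matches that of the original
  event at \<open>e\<close>.\<close>

lemma pr_automorphism:
  assumes inj: "inj_on \<Phi> (elements M)" and sub: "\<Phi> ` elements M \<subseteq> elements M"
    and "cylinder M A" and q: "prob_field M q" "\<And>e. e \<in> elements M \<Longrightarrow> q (\<Phi> e) = q e"
  shows "pr M q (\<lambda>\<omega>. A (\<omega> \<circ> \<Phi>)) = pr M q A"
proof -
  obtain F where "finite F" "F \<subseteq> elements M" "supported F A"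
    using assms(3) unfolding cylinder_def by auto
  then show ?thesis
  proof (induction F arbitrary: A rule: finite_induct)
    case empty
    then have "A = (\<lambda>\<omega>. A undefined)" unfolding supported_def by blast
    then obtain a where "A = (\<lambda>_. a)" by blast
    then show ?case by simp
  next
    case (insert e F)
    let ?A = "\<lambda>b \<omega>. A (fun_upd \<omega> e b)"
    have qe: "0 \<le> q e" "q e \<le> 1" "q (\<Phi> e) = q e" using q insert.prems unfolding prob_field_def by auto
    have e: "e \<in> elements M" "\<Phi> e \<in> elements M" using insert.prems sub by auto
    have ev: "event M A"
      using insert by (auto intro: cylinder_event[OF cylinderI[of "insert e F"]])
    have supp: "supported (\<Phi> ` insert e F) (\<lambda>\<omega>. A (\<omega> \<circ> \<Phi>))"
      using insert.prems(2) unfolding supported_def by simp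
    have ev': "event M (\<lambda>\<omega>. A (\<omega> \<circ> \<Phi>))"
      using insert.prems insert.hyps sub by (intro cylinder_event[OF cylinderI[OF _ _ supp]]) auto
    have IH: "pr M q (\<lambda>\<omega>. ?A b (\<omega> \<circ> \<Phi>)) = pr M q (?A b)" for b
      using insert.prems by (intro insert.IH supported_upd[OF insert.prems(2)]) simp
    have upd: "A (fun_upd \<omega> (\<Phi> e) b \<circ> \<Phi>) = ?A b (\<omega> \<circ> \<Phi>)" for \<omega> b
    proof -
      have "\<forall>e'\<in>insert e F. (fun_upd \<omega> (\<Phi> e) b \<circ> \<Phi>) e' = ((\<omega> \<circ> \<Phi>)(e := b)) e'"
        using inj insert.prems by (auto simp: inj_on_def)
      then show ?thesis using insert.prems(2) unfolding supported_def by blast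
    qed
    have "pr M q (\<lambda>\<omega>. A (\<omega> \<circ> \<Phi>)) = q e * pr M q (\<lambda>\<omega>. ?A True (\<omega> \<circ> \<Phi>)) + (1 - q e) * pr M q (\<lambda>\<omega>. ?A False (\<omega> \<circ> \<Phi>))"
      using e qe by (subst pr_recursion[of M _ "\<Phi> e" q]) (simp_all add: ev' upd)
    also have "\<dots> = pr M q A"
      using e qe by (simp add: IH pr_recursion[of M A e q] ev)
    finally show ?case .
  qed
qed

section \<open>Lattice symmetries and occupied paths\<close>

definition lat :: "percolation_model \<Rightarrow> real \<Rightarrow> real \<Rightarrow> complex" where
  "lat M a b = of_real a + of_real b * cis (angle M)"

definition automorphism :: "percolation_model \<Rightarrow> (complex \<Rightarrow> complex) \<Rightarrow> bool" where
  "automorphism M \<phi> \<longleftrightarrow> bij \<phi> \<and> \<phi> ` sites M = sites M \<and> (`) \<phi> ` edges M = edges M"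

abbreviation graph_path :: "percolation_model \<Rightarrow> complex list \<Rightarrow> bool" where
  "graph_path M vs \<equiv> occupied_path M (\<lambda>_. True) vs"

text \<open>In contrast to \<open>rball\<close> a region of the whole plane with a real radius;
  sites are intersected in where finiteness matters.\<close>

definition rbox :: "percolation_model \<Rightarrow> complex \<Rightarrow> real \<Rightarrow> complex set" where
  "rbox M x s = {v. rnorm M (v - x) \<le> s}"

lemma coord_linear:
  "coord1 M (x + y) = coord1 M x + coord1 M y" "coord2 M (x + y) = coord2 M x + coord2 M y"
  "coord1 M (x - y) = coord1 M x - coord1 M y" "coord2 M (x - y) = coord2 M x - coord2 M y"
  "coord1 M (- x) = - coord1 M x" "coord2 M (- x) = - coord2 M x"
  "coord1 M 0 = 0" "coord2 M 0 = 0"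
  "coord1 M (r *\<^sub>R x) = r * coord1 M x" "coord2 M (r *\<^sub>R x) = r * coord2 M x"
  by (auto simp: coord1_def coord2_def algebra_simps add_divide_distrib diff_divide_distrib)

lemma rnorm_nonneg [simp]: "0 \<le> rnorm M x"
  by (simp add: rnorm_def)

lemma rnorm_triangle: "rnorm M (x + y) \<le> rnorm M x + rnorm M y"
  unfolding rnorm_def coord_linear by linarith

lemma rnorm_0 [simp]: "rnorm M 0 = 0"
  by (simp add: rnorm_def coord_linear)

lemma rnorm_minus [simp]: "rnorm M (- x) = rnorm M x"
  by (simp add: rnorm_def coord_linear)

lemma rnorm_commute: "rnorm M (x - y) = rnorm M (y - x)"
  using rnorm_minus[of M "x - y"] by simp

lemma rnorm_triangle_sub: "rnorm M (x - z) \<le> rnorm M (x - y) + rnorm M (y - z)"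
  using rnorm_triangle[of M "x - y" "y - z"] by simp

lemma rnorm_le_iff: "rnorm M x \<le> s \<longleftrightarrow> \<bar>coord1 M x\<bar> \<le> s \<and> \<bar>coord2 M x\<bar> \<le> s"
  by (auto simp: rnorm_def)

lemma coord_le_rnorm: "\<bar>coord1 M x\<bar> \<le> rnorm M x" "\<bar>coord2 M x\<bar> \<le> rnorm M x"
  by (auto simp: rnorm_def)

lemma automorphism_comp: "automorphism M \<phi> \<Longrightarrow> automorphism M \<psi> \<Longrightarrow> automorphism M (\<phi> \<circ> \<psi>)"
proof -
  assume *: "automorphism M \<phi>" "automorphism M \<psi>"
  have "(`) (\<phi> \<circ> \<psi>) ` edges M = (`) \<phi> ` ((`) \<psi> ` edges M)" "(\<phi> \<circ> \<psi>) ` sites M = \<phi> ` (\<psi> ` sites M)"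
    by (simp_all add: image_image image_comp)
  then show ?thesis using * unfolding automorphism_def by (metis bij_comp)
qed

lemma automorphism_inv:
  assumes "automorphism M \<phi>" shows "automorphism M (inv \<phi>)"
proof -
  have b: "bij \<phi>" and s: "\<phi> ` sites M = sites M" and e: "(`) \<phi> ` edges M = edges M"
    using assms by (auto simp: automorphism_def)
  have i: "inv \<phi> ` (\<phi> ` A) = A" for A using b by (simp add: bij_is_inj image_image)
  have "inv \<phi> ` sites M = sites M" using i[of "sites M"] s by simp
  moreover have "(`) (inv \<phi>) ` ((`) \<phi> ` edges M) = edges M" by (simp add: image_image[of "(`) (inv \<phi>)"] i)
  ultimately show ?thesis using b e by (simp add: automorphism_def bij_imp_bij_inv)
qed

lemma automorphism_site_iff: "automorphism M \<phi> \<Longrightarrow> \<phi> x \<in> sites M \<longleftrightarrow> x \<in> sites M"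
  unfolding automorphism_def by (metis bij_is_inj inj_image_mem_iff)

lemma automorphism_edge_iff:
  assumes "automorphism M \<phi>" shows "\<phi> ` e \<in> edges M \<longleftrightarrow> e \<in> edges M"
proof -
  have "inj ((`) \<phi>)" using assms by (intro injI) (simp add: automorphism_def bij_is_inj inj_image_eq_iff)
  then show ?thesis using assms unfolding automorphism_def by (metis inj_image_mem_iff)
qed

lemma automorphism_elements:
  assumes "automorphism M \<phi>"
  shows "inj_on ((`) \<phi>) (elements M)" "(`) \<phi> ` elements M \<subseteq> elements M"
proof -
  show "inj_on ((`) \<phi>) (elements M)"
    using assms by (intro inj_onI) (simp add: automorphism_def bij_is_inj inj_image_eq_iff)
  show "(`) \<phi> ` elements M \<subseteq> elements M"
  proof (cases "mode M")
    case Site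
    then show ?thesis using automorphism_site_iff[OF assms] by (auto simp: elements_def)
  next
    case Bond
    then show ?thesis using automorphism_edge_iff[OF assms] by (auto simp: elements_def)
  qed
qed

lemma occupied_path_map:
  assumes "automorphism M \<phi>"
  shows "occupied_path M \<omega> (map \<phi> vs) \<longleftrightarrow> occupied_path M (\<omega> \<circ> (`) \<phi>) vs"
proof -
  have "{\<phi> u, \<phi> v} \<in> edges M \<longleftrightarrow> {u, v} \<in> edges M" for u v
    using automorphism_edge_iff[OF assms, of "{u, v}"] by simp
  moreover have "\<phi> ` set vs \<subseteq> sites M \<longleftrightarrow> set vs \<subseteq> sites M"
    using automorphism_site_iff[OF assms] by auto
  ultimately show ?thesis
    by (simp add: occupied_path_def successively_map split: percolation_mode.split)
qed

lemma graph_path_map: "automorphism M \<phi> \<Longrightarrow> graph_path M (map \<phi> vs) \<longleftrightarrow> graph_path M vs"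
  using occupied_path_map[of M \<phi> "\<lambda>_. True"] by (simp add: comp_def)

lemma successively_all: "(\<And>u v. P u v) \<Longrightarrow> successively P vs"
  by (induction P vs rule: successively.induct) auto

lemma occupied_imp_graph_path: "occupied_path M \<omega> vs \<Longrightarrow> graph_path M vs"
  by (auto simp: occupied_path_def successively_all split: percolation_mode.splits)

lemma occupied_path_mono: "occupied_path M \<omega> vs \<Longrightarrow> (\<And>e. \<omega> e \<Longrightarrow> \<omega>' e) \<Longrightarrow> occupied_path M \<omega>' vs"
  by (auto simp: occupied_path_def split: percolation_mode.splits intro: successively_mono)

lemma successively_conj: "successively P vs \<Longrightarrow> successively Q vs \<Longrightarrow> successively (\<lambda>u v. P u v \<and> Q u v) vs"
  by (induction P vs rule: successively.induct) auto

lemma occupied_path_rev: "occupied_path M \<omega> vs \<Longrightarrow> occupied_path M \<omega> (rev vs)"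
  by (auto simp: occupied_path_def insert_commute split: percolation_mode.splits)

lemma occupied_path_append:
  assumes "occupied_path M \<omega> vs" "occupied_path M \<omega> ws" "last vs = hd ws"
  shows "occupied_path M \<omega> (vs @ tl ws)" "set (vs @ tl ws) = set vs \<union> set ws"
    "hd (vs @ tl ws) = hd vs" "last (vs @ tl ws) = last ws"
proof -
  have ne: "vs \<noteq> []" "ws \<noteq> []" using assms by (auto simp: occupied_path_def)
  obtain w ws' where ws: "ws = w # ws'" using ne by (cases ws) auto
  obtain vs' v where vs: "vs = vs' @ [v]" using ne by (cases vs rule: rev_cases) auto
  have [simp]: "v = w" using assms(3) ws vs by simp
  show "occupied_path M \<omega> (vs @ tl ws)"
    using assms(1,2) unfolding occupied_path_def ws vs
    by (cases "ws'") (auto simp: successively_append_iff split: percolation_mode.splits)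
  show "set (vs @ tl ws) = set vs \<union> set ws" "hd (vs @ tl ws) = hd vs" "last (vs @ tl ws) = last ws"
    unfolding ws vs by (cases vs'; auto)+
qed

lemma successively_drop: "successively P vs \<Longrightarrow> successively P (drop n vs)"
  using successively_append_iff[of P "take n vs" "drop n vs"] by simp

lemma successively_take: "successively P vs \<Longrightarrow> successively P (take n vs)"
  using successively_append_iff[of P "take n vs" "drop n vs"] by simp

lemma occupied_path_drop: "occupied_path M \<omega> vs \<Longrightarrow> n < length vs \<Longrightarrow> occupied_path M \<omega> (drop n vs)"
  by (auto simp: occupied_path_def successively_drop dest: in_set_dropD split: percolation_mode.splits)

lemma occupied_path_take: "occupied_path M \<omega> vs \<Longrightarrow> 0 < n \<Longrightarrow> occupied_path M \<omega> (take n vs)"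
  by (auto simp: occupied_path_def successively_take dest: in_set_takeD split: percolation_mode.splits)

abbreviation con :: "percolation_model \<Rightarrow> (complex set \<Rightarrow> bool) \<Rightarrow> complex set \<Rightarrow> complex \<Rightarrow> complex \<Rightarrow> bool" where
  "con M \<omega> S x y \<equiv> connected_in M \<omega> S {x} {y}"

lemma con_iff: "con M \<omega> S x y \<longleftrightarrow> (\<exists>vs. occupied_path M \<omega> vs \<and> set vs \<subseteq> S \<and> hd vs = x \<and> last vs = y)"
  by (simp add: connected_in_def)

lemma con_trans: "con M \<omega> S x y \<Longrightarrow> con M \<omega> S y z \<Longrightarrow> con M \<omega> S x z"
proof -
  assume "con M \<omega> S x y" "con M \<omega> S y z"
  then obtain vs ws where "occupied_path M \<omega> vs" "set vs \<subseteq> S" "hd vs = x" "last vs = y"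
    "occupied_path M \<omega> ws" "set ws \<subseteq> S" "hd ws = y" "last ws = z" unfolding con_iff by auto
  with occupied_path_append[of M \<omega> vs ws] show ?thesis
    unfolding con_iff by (intro exI[of _ "vs @ tl ws"]) simp
qed

lemma con_sym: "con M \<omega> S x y \<Longrightarrow> con M \<omega> S y x"
proof -
  assume "con M \<omega> S x y"
  then obtain vs where "occupied_path M \<omega> vs" "set vs \<subseteq> S" "hd vs = x" "last vs = y" unfolding con_iff by auto
  with occupied_path_rev[of M \<omega> vs] show ?thesis
    unfolding con_iff by (intro exI[of _ "rev vs"]) (simp add: hd_rev last_rev)
qed

lemma con_mono: "con M \<omega> S x y \<Longrightarrow> S \<subseteq> T \<Longrightarrow> con M \<omega> T x y"
  unfolding con_iff by blast

lemma con_hd: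
  assumes "occupied_path M \<omega> vs" "set vs \<subseteq> S" "v \<in> set vs"
  shows "con M \<omega> S (hd vs) v"
proof -
  obtain n where n: "n < length vs" "vs ! n = v" using assms(3) by (auto simp: in_set_conv_nth)
  have ne: "vs \<noteq> []" using n by auto
  have "occupied_path M \<omega> (take (Suc n) vs)" using assms by (intro occupied_path_take) auto
  moreover have "set (take (Suc n) vs) \<subseteq> S" "hd (take (Suc n) vs) = hd vs"
    "last (take (Suc n) vs) = v"
    using assms(2) n ne by (auto simp: take_Suc_conv_app_nth hd_append hd_conv_nth dest: in_set_takeD)
  ultimately show ?thesis unfolding con_iff by blast
qed

lemma con_path:
  assumes "occupied_path M \<omega> vs" "set vs \<subseteq> S" "u \<in> set vs" "v \<in> set vs"
  shows "con M \<omega> S u v"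
  using con_trans[OF con_sym[OF con_hd[OF assms(1-3)]] con_hd[OF assms(1,2,4)]] .

section \<open>Lattice coordinates, symmetries and finite-range bounds\<close>

context planar_percolation
begin

lemma sin_angle: "sin (angle M) > 0"
  using angle by (intro sin_gt_zero) auto

lemma coord_lat [simp]: "coord1 M (lat M a b) = a" "coord2 M (lat M a b) = b"
  using sin_angle by (auto simp: coord1_def coord2_def lat_def)

lemma lat_coord: "lat M (coord1 M z) (coord2 M z) = z"
  using sin_angle by (auto simp: coord1_def coord2_def lat_def complex_eq_iff)

lemma coord_inject: "coord1 M x = coord1 M y \<Longrightarrow> coord2 M x = coord2 M y \<Longrightarrow> x = y"
  by (metis lat_coord)

lemma norm_le_rnorm: "norm z \<le> 2 * rnorm M z"
proof -
  have "norm z \<le> \<bar>coord1 M z\<bar> + \<bar>coord2 M z\<bar>"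
    using norm_triangle_ineq[of "of_real (coord1 M z)" "of_real (coord2 M z) * cis (angle M)"]
    unfolding lat_def[symmetric] lat_coord by (simp add: norm_mult)
  then show ?thesis unfolding rnorm_def by linarith
qed

lemma finite_sites_rbox: "finite (sites M \<inter> rbox M x s)"
proof (rule finite_subset[OF _ sites_locally_finite[of "2 * (s + rnorm M x)"]])
  show "sites M \<inter> rbox M x s \<subseteq> sites M \<inter> cball 0 (2 * (s + rnorm M x))"
  proof
    fix v assume "v \<in> sites M \<inter> rbox M x s"
    then show "v \<in> sites M \<inter> cball 0 (2 * (s + rnorm M x))"
      using rnorm_triangle[of M "v - x" x] norm_le_rnorm[of v] by (simp add: rbox_def)
  qed
qed

lemma automorphism_translation: "automorphism M (\<lambda>z. z + lat M (of_int i) (of_int j))"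
proof -
  have bij_add: "bij (\<lambda>z. z + a)" for a :: complex
    by (rule o_bij[of "\<lambda>z. z - a"]) auto
  have 1: "automorphism M (\<lambda>z. z + 1)"
    using translation bij_add by (simp add: automorphism_def)
  have r: "automorphism M (\<lambda>z. cis (angle M) * z)"
    using rotation by (auto simp: automorphism_def intro!: o_bij[of "\<lambda>z. cis (- angle M) * z"] simp: fun_eq_iff mult.assoc[symmetric] cis_mult)
  have ri: "inv (\<lambda>z. cis (angle M) * z) = (\<lambda>z. cis (- angle M) * z)"
    by (rule inv_equality) (auto simp: mult.assoc[symmetric] cis_mult)
  have 2: "automorphism M (\<lambda>z. z + cis (angle M))"
    using automorphism_comp[OF r automorphism_comp[OF 1 automorphism_inv[OF r]]]
    unfolding ri by (simp add: comp_def algebra_simps mult.assoc[symmetric] cis_mult)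
  have int_pow: "automorphism M (\<lambda>z. z + of_int k * a)" if a: "automorphism M (\<lambda>z. z + a)" for k :: int and a :: complex
  proof (induction k rule: int_induct[where k = 0])
    case base
    then show ?case using bij_id by (simp add: automorphism_def id_def)
  next
    case (step1 k)
    show ?case using automorphism_comp[OF a step1(2)] by (simp add: comp_def algebra_simps)
  next
    case (step2 k)
    have "inv (\<lambda>z. z + a) = (\<lambda>z. z - a)" by (rule inv_equality) auto
    then have "automorphism M (\<lambda>z. z - a)" using automorphism_inv[OF a] by simp
    from automorphism_comp[OF this step2(2)] show ?case by (simp add: comp_def algebra_simps)
  qed
  show ?thesis
    using automorphism_comp[OF int_pow[OF 2, of j] int_pow[OF 1, of i]] by (simp add: comp_def lat_def add.assoc)
qed

text \<open>Reflection followed by the rotation. It sends the coordinates (a, b) to (-b, -a) and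
  therefore turns horizontal crossings into reversed vertical ones.\<close>

definition swap :: "complex \<Rightarrow> complex" where
  "swap z = cis (angle M) * (- cnj z)"

lemma automorphism_swap: "automorphism M swap"
proof -
  have r: "automorphism M (\<lambda>z. cis (angle M) * z)"
    using rotation by (auto simp: automorphism_def intro!: o_bij[of "\<lambda>z. cis (- angle M) * z"] simp: fun_eq_iff mult.assoc[symmetric] cis_mult)
  have "automorphism M (\<lambda>z. - cnj z)"
    using reflection by (auto simp: automorphism_def intro!: o_bij[of "\<lambda>z. - cnj z"])
  from automorphism_comp[OF r this] show ?thesis by (simp add: comp_def swap_def[abs_def])
qed

lemma coord_swap [simp]: "coord1 M (swap z) = - coord2 M z" "coord2 M (swap z) = - coord1 M z"
proof -
  define s c x y where "s = sin (angle M)" "c = cos (angle M)" "x = Re z" "y = Im z"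
  have s: "s > 0" "s * s + c * c = 1" using sin_angle sin_cos_squared_add[of "angle M"] by (auto simp: s_c_x_y_def power2_eq_square)
  have e: "coord1 M (swap z) = (- c * x - s * y) - (c * y - s * x) * c / s" "coord2 M (swap z) = (c * y - s * x) / s"
    by (auto simp: coord1_def coord2_def swap_def s_c_x_y_def algebra_simps)
  have "((- c * x - s * y) - (c * y - s * x) * c / s) * s = - ((s * s + c * c) * y)"
    using s(1) by (simp add: field_simps)
  then show "coord1 M (swap z) = - coord2 M z"
    using s unfolding e by (simp add: coord2_def s_c_x_y_def field_simps)
  show "coord2 M (swap z) = - coord1 M z"
    using s unfolding e by (simp add: coord1_def s_c_x_y_def field_simps)
qed

lemma lat_in_sites: "lat M (of_int i) (of_int j) \<in> sites M"
  using automorphism_site_iff[OF automorphism_translation[of i j], of 0] origin by simp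

definition cell_base :: "complex \<Rightarrow> complex" where
  "cell_base z = lat M (of_int \<lfloor>coord1 M z\<rfloor>) (of_int \<lfloor>coord2 M z\<rfloor>)"

lemma rnorm_cell_base: "rnorm M (z - cell_base z) \<le> 1"
  by (simp add: rnorm_le_iff coord_linear cell_base_def) linarith

lemma automorphism_minus_cell_base: "automorphism M (\<lambda>z. z - cell_base x)"
proof -
  have "(\<lambda>z. z - cell_base x) = (\<lambda>z. z + lat M (of_int (-\<lfloor>coord1 M x\<rfloor>)) (of_int (-\<lfloor>coord2 M x\<rfloor>)))"
    by (auto simp: cell_base_def lat_def)
  then show ?thesis using automorphism_translation by metis
qed

lemma edge_sites: "{u, v} \<in> edges M \<Longrightarrow> u \<in> sites M \<and> v \<in> sites M \<and> u \<noteq> v"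
  using edges[of "{u, v}"] by (auto simp: doubleton_eq_iff)

text \<open>By translation every edge has a copy with an end point in the unit cell at the origin,
  and only finitely many edges touch that cell.\<close>

lemma edge_range_exists: "\<exists>R\<ge>1. \<forall>u v. {u, v} \<in> edges M \<longrightarrow> rnorm M (u - v) \<le> R"
proof -
  define C where "C = sites M \<inter> rbox M 0 1"
  define E where "E = (\<Union>v\<in>C. {e \<in> edges M. v \<in> e})"
  have "finite C" unfolding C_def by (rule finite_sites_rbox)
  then have "finite E" unfolding E_def using degrees_finite by (auto simp: C_def)
  moreover have "finite e" if "e \<in> E" for e using that edges by (auto simp: E_def)
  ultimately have fin: "finite ((\<lambda>(u, v). rnorm M (u - v)) ` (\<Union>e\<in>E. e \<times> e))" by blast
  define R where "R = Max (insert 1 ((\<lambda>(u, v). rnorm M (u - v)) ` (\<Union>e\<in>E. e \<times> e)))"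
  have "rnorm M (u - v) \<le> R" if "{u, v} \<in> edges M" for u v
  proof -
    have "(\<lambda>z. z - cell_base u) ` {u, v} \<in> edges M"
      using that automorphism_edge_iff[OF automorphism_minus_cell_base] by blast
    then have *: "{u - cell_base u, v - cell_base u} \<in> edges M" by simp
    have "u - cell_base u \<in> C" using edge_sites[OF *] rnorm_cell_base[of u] by (auto simp: C_def rbox_def)
    then have "{u - cell_base u, v - cell_base u} \<in> E" using * by (auto simp: E_def)
    then have "rnorm M ((u - cell_base u) - (v - cell_base u)) \<in> (\<lambda>(u, v). rnorm M (u - v)) ` (\<Union>e\<in>E. e \<times> e)"
      by (intro image_eqI[of _ _ "(u - cell_base u, v - cell_base u)"]) auto
    then show ?thesis unfolding R_def using fin by (intro Max_ge) auto
  qed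
  moreover have "1 \<le> R" unfolding R_def using fin by (intro Max_ge) auto
  ultimately show ?thesis by blast
qed

text \<open>The length of the longest step of a path, hence the amount by which a path overshoots
  when it leaves a region.\<close>

definition R :: real where
  "R = (SOME R. R \<ge> 1 \<and> (\<forall>u v. {u, v} \<in> edges M \<longrightarrow> rnorm M (u - v) \<le> R))"

lemma R: "1 \<le> R" "{u, v} \<in> edges M \<Longrightarrow> rnorm M (u - v) \<le> R"
  using someI_ex[OF edge_range_exists] unfolding R_def by auto

text \<open>Uniformity in x and y: after translating x into the unit cell at the origin only
  finitely many pairs remain, and the longest of the chosen paths gives the bound.\<close>

lemma graph_path_exists: "\<exists>K. \<forall>x\<in>sites M. \<forall>y\<in>sites M. rnorm M (x - y) \<le> D \<longrightarrow>
   (\<exists>vs. graph_path M vs \<and> hd vs = x \<and> last vs = y \<and> length vs \<le> K)"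
proof -
  have ex: "\<exists>vs. graph_path M vs \<and> hd vs = x \<and> last vs = y" if "x \<in> sites M" "y \<in> sites M" for x y
    using connected_graph[OF that]
  proof (induction rule: rtrancl_induct)
    case base
    show ?case using that by (intro exI[of _ "[x]"]) (auto simp: occupied_path_def split: percolation_mode.split)
  next
    case (step y z)
    then obtain vs where vs: "graph_path M vs" "hd vs = x" "last vs = y" by auto
    have "graph_path M [y, z]"
      using edge_sites step(2) by (auto simp: occupied_path_def split: percolation_mode.split)
    from occupied_path_append[OF vs(1) this] vs show ?case by auto
  qed
  define p where "p x y = (SOME vs. graph_path M vs \<and> hd vs = x \<and> last vs = y)" for x y
  have p: "graph_path M (p x y) \<and> hd (p x y) = x \<and> last (p x y) = y" if "x \<in> sites M" "y \<in> sites M" for x y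
    using someI_ex[OF ex[OF that]] unfolding p_def .
  define B where "B = sites M \<inter> rbox M 0 (\<bar>D\<bar> + 1)"
  have fin: "finite ((\<lambda>(x, y). length (p x y)) ` (B \<times> B))" unfolding B_def using finite_sites_rbox by blast
  define K where "K = Max ((\<lambda>(x, y). length (p x y)) ` (B \<times> B))"
  show ?thesis
  proof (intro exI[of _ K] ballI impI)
    fix x y assume xy: "x \<in> sites M" "y \<in> sites M" "rnorm M (x - y) \<le> D"
    let ?b = "cell_base x"
    have s: "x - ?b \<in> sites M" "y - ?b \<in> sites M"
      using xy automorphism_site_iff[OF automorphism_minus_cell_base] by auto
    have "rnorm M (y - ?b) \<le> D + 1"
      using rnorm_triangle_sub[of M y ?b x] rnorm_cell_base[of x] xy(3) rnorm_commute[of M x y] by simp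
    then have "x - ?b \<in> B" "y - ?b \<in> B" using s rnorm_cell_base[of x] by (auto simp: B_def rbox_def)
    then have len: "length (p (x - ?b) (y - ?b)) \<le> K" unfolding K_def using fin by (intro Max_ge) auto
    have a: "automorphism M (inv (\<lambda>z. z - ?b))" by (rule automorphism_inv[OF automorphism_minus_cell_base])
    have i: "inv (\<lambda>z. z - ?b) = (\<lambda>z. z + ?b)" by (rule inv_equality) auto
    have ne: "p (x - ?b) (y - ?b) \<noteq> []" using p[OF s] by (auto simp: occupied_path_def)
    show "\<exists>vs. graph_path M vs \<and> hd vs = x \<and> last vs = y \<and> length vs \<le> K"
      using p[OF s] len a ne unfolding i
      by (intro exI[of _ "map (\<lambda>z. z + ?b) (p (x - ?b) (y - ?b))"]) (auto simp: graph_path_map hd_map last_map)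
  qed
qed

text \<open>Both modes are treated at once by regarding a site as a degenerate bond with equal end
  points.\<close>

lemma element_form:
  assumes "e \<in> elements M"
  obtains u v where "e = {u, v}" "u \<in> sites M" "v \<in> sites M" "location e = (u + v) / 2" "rnorm M (u - v) \<le> R"
proof (cases "mode M")
  case Site
  then obtain v where "e = {v}" "v \<in> sites M" using assms by (auto simp: elements_def)
  then show ?thesis using that[of v v] R(1) by (auto simp: location_def)
next
  case Bond
  then have "e \<in> edges M" using assms by (simp add: elements_def)
  then obtain u v where "u \<in> sites M" "v \<in> sites M" "u \<noteq> v" "e = {u, v}" using edges by blast
  then show ?thesis using that[of u v] R(2)[of u v] \<open>e \<in> edges M\<close> by (simp add: location_def)
qed

lemma element_sites: "e \<in> elements M \<Longrightarrow> e \<subseteq> sites M" "e \<in> elements M \<Longrightarrow> e \<noteq> {}"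
  by (auto elim: element_form)

lemma rnorm_scaleR: "rnorm M (r *\<^sub>R x) = \<bar>r\<bar> * rnorm M x"
  by (simp add: rnorm_def coord_linear abs_mult max_def mult_left_mono mult_le_cancel_left)

lemma location_rbox:
  assumes "e \<in> elements M" "e \<subseteq> rbox M x s"
  shows "rnorm M (location e - x) \<le> s"
proof -
  obtain u v where e: "e = {u, v}" "location e = (u + v) / 2" using assms(1) by (rule element_form)
  have "location e - x = (1/2) *\<^sub>R (u - x) + (1/2) *\<^sub>R (v - x)"
    unfolding e(2) by (simp add: scaleR_conv_of_real field_simps)
  then have "rnorm M (location e - x) \<le> (1/2) * rnorm M (u - x) + (1/2) * rnorm M (v - x)"
    using rnorm_triangle[of M "(1/2) *\<^sub>R (u - x)" "(1/2) *\<^sub>R (v - x)"] by (simp add: rnorm_scaleR)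
  then show ?thesis using assms(2) unfolding e(1) rbox_def by simp
qed

definition elems :: "complex set \<Rightarrow> complex set set" where
  "elems S = {e \<in> elements M. e \<subseteq> S}"

lemma finite_elems:
  assumes "finite (sites M \<inter> S)" shows "finite (elems S)"
proof -
  have "elems S \<subseteq> Pow (sites M \<inter> S)" using element_sites by (auto simp: elems_def)
  moreover have "finite (Pow (sites M \<inter> S))" using assms by (rule finite_Pow_iff[THEN iffD2])
  ultimately show ?thesis by (rule finite_subset)
qed

lemma elems_subset: "elems S \<subseteq> elements M"
  by (auto simp: elems_def)

lemma elems_mono: "S \<subseteq> T \<Longrightarrow> elems S \<subseteq> elems T"
  by (auto simp: elems_def)

lemma occupied_path_local:
  assumes "occupied_path M \<omega> vs" "set vs \<subseteq> S" "\<And>e. e \<in> elems S \<Longrightarrow> \<omega> e = \<omega>' e"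
  shows "occupied_path M \<omega>' vs"
proof (cases "mode M")
  case Site
  then have "\<omega> {v} = \<omega>' {v}" if "v \<in> set vs" for v
    using that assms by (intro assms(3)) (auto simp: elems_def elements_def occupied_path_def)
  then show ?thesis using assms(1) Site by (auto simp: occupied_path_def)
next
  case Bond
  have "successively (\<lambda>u v. {u, v} \<in> edges M \<and> \<omega> {u, v}) vs"
    using assms(1) Bond by (auto simp: occupied_path_def successively_conj)
  then have "successively (\<lambda>u v. \<omega>' {u, v}) vs"
  proof (rule successively_mono)
    fix u v assume "u \<in> set vs" "v \<in> set vs" "{u, v} \<in> edges M \<and> \<omega> {u, v}"
    then show "\<omega>' {u, v}"
      using assms(2,3) Bond by (subst assms(3)[symmetric]) (auto simp: elems_def elements_def)
  qed
  then show ?thesis using assms(1) Bond by (simp add: occupied_path_def)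
qed

text \<open>The common form of nearly all increasing events below: a deterministic condition on an
  occupied path inside a region. Locality, monotonicity and the effect of symmetries are then proved
  once.\<close>

definition path_event :: "complex set \<Rightarrow> (complex list \<Rightarrow> bool) \<Rightarrow> (complex set \<Rightarrow> bool) \<Rightarrow> bool" where
  "path_event S P \<omega> \<longleftrightarrow> (\<exists>vs. occupied_path M \<omega> vs \<and> set vs \<subseteq> S \<and> P vs)"

lemma supported_path_event: "supported (elems S) (path_event S P)"
proof (rule supportedI)
  fix \<omega> \<omega>' assume eq: "\<And>e. e \<in> elems S \<Longrightarrow> \<omega> e = \<omega>' e" and "path_event S P \<omega>"
  then obtain vs where "occupied_path M \<omega> vs" "set vs \<subseteq> S" "P vs" by (auto simp: path_event_def)
  then show "path_event S P \<omega>'"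
    using occupied_path_local[of \<omega> vs S \<omega>'] eq by (auto simp: path_event_def)
qed

lemma up_event_path_event: "up_event (path_event S P)"
  unfolding path_event_def up_event_def
proof (intro allI impI, elim exE conjE)
  fix \<omega> \<omega>' vs assume "\<forall>e. \<omega> e \<longrightarrow> \<omega>' e" "occupied_path M \<omega> vs" "set vs \<subseteq> S" "P vs"
  then show "\<exists>vs. occupied_path M \<omega>' vs \<and> set vs \<subseteq> S \<and> P vs"
    using occupied_path_mono[of M \<omega> vs \<omega>'] by blast
qed

lemma cylinder_path_event: "finite (sites M \<inter> S) \<Longrightarrow> cylinder M (path_event S P)"
  by (intro cylinderI[OF finite_elems elems_subset supported_path_event])

text \<open>K is the number of sites in a fixed box around the origin; a side of length s meets at
  most s + 2 unit intervals with integer end points.\<close>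

lemma card_sites_rectangle:
  "\<exists>K\<ge>1. \<forall>a b s t. 0 \<le> s \<longrightarrow> 0 \<le> t \<longrightarrow>
     finite {v \<in> sites M. a \<le> coord1 M v \<and> coord1 M v \<le> a + s \<and> b \<le> coord2 M v \<and> coord2 M v \<le> b + t} \<and>
     real (card {v \<in> sites M. a \<le> coord1 M v \<and> coord1 M v \<le> a + s \<and> b \<le> coord2 M v \<and> coord2 M v \<le> b + t})
       \<le> K * (s + 2) * (t + 2)"
proof -
  define C where "C = sites M \<inter> rbox M 0 1"
  have C: "finite C" unfolding C_def by (rule finite_sites_rbox)
  show ?thesis
  proof (intro exI[of _ "real (card C)"] conjI allI impI)
    have "0 \<in> C" using origin by (simp add: C_def rbox_def)
    then have "card C \<noteq> 0" using C by auto
    then show "1 \<le> real (card C)" by simp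
    fix a b s t :: real assume st: "0 \<le> s" "0 \<le> t"
    let ?S = "{v \<in> sites M. a \<le> coord1 M v \<and> coord1 M v \<le> a + s \<and> b \<le> coord2 M v \<and> coord2 M v \<le> b + t}"
    let ?I = "{\<lfloor>a\<rfloor>..\<lfloor>a + s\<rfloor>} \<times> {\<lfloor>b\<rfloor>..\<lfloor>b + t\<rfloor>}"
    have sub: "?S \<subseteq> (\<lambda>((i, j), c). lat M (of_int i) (of_int j) + c) ` (?I \<times> C)"
    proof
      fix v assume v: "v \<in> ?S"
      have "v - cell_base v \<in> C"
        using v rnorm_cell_base[of v] automorphism_site_iff[OF automorphism_minus_cell_base, of v v] by (auto simp: C_def rbox_def)
      moreover have "(\<lfloor>coord1 M v\<rfloor>, \<lfloor>coord2 M v\<rfloor>) \<in> ?I" using v by (auto intro: floor_mono)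
      moreover have "v = (\<lambda>((i, j), c). lat M (of_int i) (of_int j) + c) ((\<lfloor>coord1 M v\<rfloor>, \<lfloor>coord2 M v\<rfloor>), v - cell_base v)"
        by (simp add: cell_base_def)
      ultimately show "v \<in> (\<lambda>((i, j), c). lat M (of_int i) (of_int j) + c) ` (?I \<times> C)" by blast
    qed
    have fin: "finite (?I \<times> C)" using C by auto
    then show "finite ?S" using sub by (rule finite_surj)
    have "card ?S \<le> card (?I \<times> C)" using surj_card_le[OF fin sub] .
    then have "real (card ?S) \<le> real (card (?I \<times> C))" by (rule of_nat_mono)
    also have "\<dots> = real (card ?I) * real (card C)" by (simp only: card_cartesian_product of_nat_mult)
    also have "real (card ?I) = of_int (\<lfloor>a + s\<rfloor> - \<lfloor>a\<rfloor> + 1) * of_int (\<lfloor>b + t\<rfloor> - \<lfloor>b\<rfloor> + 1)"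
      using st by (simp add: card_cartesian_product floor_mono)
    also have "\<dots> \<le> (s + 2) * (t + 2)"
    proof (intro mult_mono)
      show "of_int (\<lfloor>a + s\<rfloor> - \<lfloor>a\<rfloor> + 1) \<le> s + 2" "of_int (\<lfloor>b + t\<rfloor> - \<lfloor>b\<rfloor> + 1) \<le> t + 2" by linarith+
      have "\<lfloor>b\<rfloor> \<le> \<lfloor>b + t\<rfloor>" using st by (intro floor_mono) simp
      then show "(0::real) \<le> of_int (\<lfloor>b + t\<rfloor> - \<lfloor>b\<rfloor> + 1)" by linarith
    qed (use st in simp)
    finally show "real (card ?S) \<le> real (card C) * (s + 2) * (t + 2)"
      by (simp add: mult_ac mult_right_mono)
  qed
qed

end

section \<open>Crossing paths meet\<close>

text \<open>The Fashoda theorem needs paths ending on the sides of a box. Both paths are prolonged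
  straight to the sides of a large square, \<open>f\<close> horizontally and \<open>g\<close>
  vertically. An intersection of the prolonged paths has both coordinates within the bounds of the
  original rectangle, and there a prolongation contains at most the end point it starts
  from.\<close>

lemma crossing_paths_intersect:
  fixes f g :: "real \<Rightarrow> real^2"
  assumes "path f" "path g"
    and f: "\<And>z. z \<in> path_image f \<Longrightarrow> y1 \<le> z $ 2 \<and> z $ 2 \<le> y2" "pathstart f $ 1 \<le> x1" "x2 \<le> pathfinish f $ 1"
    and g: "\<And>z. z \<in> path_image g \<Longrightarrow> x1 \<le> z $ 1 \<and> z $ 1 \<le> x2" "pathstart g $ 2 \<le> y1" "y2 \<le> pathfinish g $ 2"
  shows "\<exists>z. z \<in> path_image f \<and> z \<in> path_image g"
proof -
  define s t u v where "s = pathstart f" "t = pathfinish f" "u = pathstart g" "v = pathfinish g"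
  have ends: "s \<in> path_image f" "t \<in> path_image f" "u \<in> path_image g" "v \<in> path_image g"
    by (auto simp: s_t_u_v_def)
  have "bounded (path_image f \<union> path_image g)" using assms(1,2) by (simp add: bounded_path_image)
  then obtain B where B: "\<And>z. z \<in> path_image f \<union> path_image g \<Longrightarrow> norm z \<le> B" unfolding bounded_iff by auto
  have comp: "\<bar>z $ i\<bar> \<le> B" if "z \<in> path_image f \<union> path_image g" for z i
    using B[OF that] component_le_norm_cart[of z i] by linarith
  let ?a = "vector [- B, - B] :: real^2" and ?b = "vector [B, B] :: real^2"
  let ?f = "linepath (vector [- B, s $ 2]) s +++ f +++ linepath t (vector [B, t $ 2])"
  let ?g = "linepath (vector [u $ 1, - B]) u +++ g +++ linepath v (vector [v $ 1, B])"
  have pf: "path_image ?f = closed_segment (vector [- B, s $ 2]) s \<union> path_image f \<union> closed_segment t (vector [B, t $ 2])"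
    by (subst path_image_join; simp add: s_t_u_v_def path_image_join Un_assoc)
  have pg: "path_image ?g = closed_segment (vector [u $ 1, - B]) u \<union> path_image g \<union> closed_segment v (vector [v $ 1, B])"
    by (subst path_image_join; simp add: s_t_u_v_def path_image_join Un_assoc)
  have rbox: "cbox ?a ?b = {z. \<bar>z $ 1\<bar> \<le> B \<and> \<bar>z $ 2\<bar> \<le> B}"
    by (auto simp: mem_box_cart forall_2)
  have bnd: "\<bar>z $ 1\<bar> \<le> B" "\<bar>z $ 2\<bar> \<le> B" if "z \<in> {s, t, u, v}" for z
    using that ends comp by blast+
  have "0 \<le> B" using order_trans[OF norm_ge_zero B[of s]] ends by simp
  then have corners: "vector [- B, s $ 2] \<in> cbox ?a ?b" "vector [B, t $ 2] \<in> cbox ?a ?b"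
    "vector [u $ 1, - B] \<in> cbox ?a ?b" "vector [v $ 1, B] \<in> cbox ?a ?b" "s \<in> cbox ?a ?b" "t \<in> cbox ?a ?b" "u \<in> cbox ?a ?b" "v \<in> cbox ?a ?b"
    unfolding rbox using bnd by auto
  have "path_image f \<subseteq> cbox ?a ?b" "path_image g \<subseteq> cbox ?a ?b" unfolding rbox using comp by auto
  then have sub: "path_image ?f \<subseteq> cbox ?a ?b" "path_image ?g \<subseteq> cbox ?a ?b"
    unfolding pf pg using corners by (simp_all add: closed_segment_subset)
  have paths: "path ?f" "path ?g" using assms(1,2) by (auto simp: s_t_u_v_def)
  have ends': "pathstart ?f $ 1 = ?a $ 1" "pathfinish ?f $ 1 = ?b $ 1" "pathstart ?g $ 2 = ?a $ 2" "pathfinish ?g $ 2 = ?b $ 2"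
    by (simp_all only: pathstart_join pathfinish_join pathstart_linepath pathfinish_linepath vector_2)
  obtain z where z: "z \<in> path_image ?f" "z \<in> path_image ?g"
    by (rule fashoda[OF paths sub ends'])
  have segf: "z $ 2 = w $ 2 \<and> (c = - B \<longrightarrow> z $ 1 \<le> w $ 1) \<and> (c = B \<longrightarrow> w $ 1 \<le> z $ 1)"
    if "z \<in> closed_segment (vector [c, w $ 2]) w" "\<bar>w $ 1\<bar> \<le> B" for w :: "real^2" and c
  proof -
    have "\<exists>r. 0 \<le> r \<and> r \<le> 1 \<and> z = (1 - r) *\<^sub>R vector [c, w $ 2] + r *\<^sub>R w" using that(1) by (simp only: in_segment)
    then obtain r where r: "0 \<le> r" "r \<le> 1" "z = (1 - r) *\<^sub>R vector [c, w $ 2] + r *\<^sub>R w" by (elim exE conjE)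
    have "z $ 1 = (1 - r) * c + r * w $ 1" "z $ 2 = (1 - r) * w $ 2 + r * w $ 2" by (simp_all add: r(3))
    then have "z $ 1 - w $ 1 = (1 - r) * (c - w $ 1)" "z $ 2 = w $ 2" by (simp_all add: algebra_simps)
    moreover have "(1 - r) * (- B - w $ 1) \<le> 0" "0 \<le> (1 - r) * (B - w $ 1)" using r that(2) by (auto intro!: mult_nonneg_nonpos)
    ultimately show ?thesis by auto
  qed
  have segg: "z $ 1 = w $ 1 \<and> (c = - B \<longrightarrow> z $ 2 \<le> w $ 2) \<and> (c = B \<longrightarrow> w $ 2 \<le> z $ 2)"
    if "z \<in> closed_segment (vector [w $ 1, c]) w" "\<bar>w $ 2\<bar> \<le> B" for w :: "real^2" and c
  proof -
    have "\<exists>r. 0 \<le> r \<and> r \<le> 1 \<and> z = (1 - r) *\<^sub>R vector [w $ 1, c] + r *\<^sub>R w" using that(1) by (simp only: in_segment)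
    then obtain r where r: "0 \<le> r" "r \<le> 1" "z = (1 - r) *\<^sub>R vector [w $ 1, c] + r *\<^sub>R w" by (elim exE conjE)
    have "z $ 2 = (1 - r) * c + r * w $ 2" "z $ 1 = (1 - r) * w $ 1 + r * w $ 1" by (simp_all add: r(3))
    then have "z $ 2 - w $ 2 = (1 - r) * (c - w $ 2)" "z $ 1 = w $ 1" by (simp_all add: algebra_simps)
    moreover have "(1 - r) * (- B - w $ 2) \<le> 0" "0 \<le> (1 - r) * (B - w $ 2)" using r that(2) by (auto intro!: mult_nonneg_nonpos)
    ultimately show ?thesis by auto
  qed
  have zf: "z \<in> path_image f \<or> (z $ 2 = s $ 2 \<and> z $ 1 \<le> s $ 1) \<or> (z $ 2 = t $ 2 \<and> t $ 1 \<le> z $ 1)"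
    using z(1) segf[of "- B" s] segf[of B t] bnd unfolding pf by (auto simp: closed_segment_commute)
  have zg: "z \<in> path_image g \<or> (z $ 1 = u $ 1 \<and> z $ 2 \<le> u $ 2) \<or> (z $ 1 = v $ 1 \<and> v $ 2 \<le> z $ 2)"
    using z(2) segg[of u "- B"] segg[of v B] bnd unfolding pg by (auto simp: closed_segment_commute)
  \<comment> \<open>Prolonging \<open>g\<close> keeps the first coordinate of its end points, so the
    prolonged \<open>g\<close> stays in the vertical strip; likewise the prolonged \<open>f\<close>
    stays in the horizontal one.\<close>
  have zx: "x1 \<le> z $ 1" "z $ 1 \<le> x2" using zg g(1)[of z] g(1)[of u] g(1)[of v] ends by auto
  have zy: "y1 \<le> z $ 2" "z $ 2 \<le> y2" using zf f(1)[of z] f(1)[of s] f(1)[of t] ends by auto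
  have "z \<in> path_image f"
  proof -
    have "z = s" if "z $ 2 = s $ 2 \<and> z $ 1 \<le> s $ 1" using that zx f(2) by (simp add: vec_eq_iff forall_2 s_t_u_v_def)
    moreover have "z = t" if "z $ 2 = t $ 2 \<and> t $ 1 \<le> z $ 1" using that zx f(3) by (simp add: vec_eq_iff forall_2 s_t_u_v_def)
    ultimately show ?thesis using zf ends by blast
  qed
  moreover have "z \<in> path_image g"
  proof -
    have "z = u" if "z $ 1 = u $ 1 \<and> z $ 2 \<le> u $ 2" using that zy g(2) by (simp add: vec_eq_iff forall_2 s_t_u_v_def)
    moreover have "z = v" if "z $ 1 = v $ 1 \<and> v $ 2 \<le> z $ 2" using that zy g(3) by (simp add: vec_eq_iff forall_2 s_t_u_v_def)
    ultimately show ?thesis using zg ends by blast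
  qed
  ultimately show ?thesis by blast
qed

fun polyline :: "complex list \<Rightarrow> real \<Rightarrow> complex" where
  "polyline [] = linepath 0 0"
| "polyline [v] = linepath v v"
| "polyline (u # v # vs) = linepath u v +++ polyline (v # vs)"

lemma pathstart_polyline: "vs \<noteq> [] \<Longrightarrow> pathstart (polyline vs) = hd vs"
  by (induction vs rule: polyline.induct) auto

lemma pathfinish_polyline: "vs \<noteq> [] \<Longrightarrow> pathfinish (polyline vs) = last vs"
  by (induction vs rule: polyline.induct) auto

lemma path_polyline: "path (polyline vs)"
proof (induction vs rule: polyline.induct)
  case (3 u v vs)
  then show ?case by (simp add: pathstart_polyline)
qed (simp_all add: path_def)

lemma path_image_polyline_Cons:
  "path_image (polyline (u # v # vs)) = closed_segment u v \<union> path_image (polyline (v # vs))"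
  by (simp add: path_image_join pathstart_polyline)

lemma path_image_polyline_single: "path_image (polyline [v]) = {v}"
  by (auto simp: path_image_def image_constant_conv)

lemma path_image_polyline_convex: "vs \<noteq> [] \<Longrightarrow> set vs \<subseteq> C \<Longrightarrow> convex C \<Longrightarrow> path_image (polyline vs) \<subseteq> C"
proof (induction vs rule: polyline.induct)
  case (3 u v vs)
  have "closed_segment u v \<subseteq> C" using 3 by (intro closed_segment_subset) simp_all
  moreover have "path_image (polyline (v # vs)) \<subseteq> C" using 3 by (intro "3.IH") simp_all
  ultimately show ?case unfolding path_image_polyline_Cons by (rule Un_least)
next
  case (2 v)
  then show ?case unfolding path_image_polyline_single by simp
qed simp

lemma path_image_polyline:
  "vs \<noteq> [] \<Longrightarrow> successively (\<lambda>u v. {u, v} \<in> E) vs \<Longrightarrow> z \<in> path_image (polyline vs) \<Longrightarrow>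
    z \<in> set vs \<or> (\<exists>u\<in>set vs. \<exists>v\<in>set vs. {u, v} \<in> E \<and> z \<in> convex hull {u, v})"
proof (induction vs rule: polyline.induct)
  case (3 u v vs)
  from 3(4) consider "z \<in> closed_segment u v" | "z \<in> path_image (polyline (v # vs))"
    unfolding path_image_polyline_Cons by (elim UnE)
  then show ?case
  proof cases
    case 1
    then have "z \<in> convex hull {u, v}" by (simp only: segment_convex_hull)
    moreover have "{u, v} \<in> E" using 3(3) by simp
    ultimately show ?thesis by (intro disjI2 bexI[of _ u] bexI[of _ v]) simp_all
  next
    case 2
    have "successively (\<lambda>u v. {u, v} \<in> E) (v # vs)" using 3(3) by simp
    from "3.IH"[OF _ this 2] have "z \<in> set (v # vs) \<or> (\<exists>u\<in>set (v # vs). \<exists>w\<in>set (v # vs). {u, w} \<in> E \<and> z \<in> convex hull {u, w})"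
      by simp
    then show ?thesis by (elim disjE bexE conjE) (auto simp only: set_simps insert_iff)+
  qed
next
  case (2 v)
  then show ?case unfolding path_image_polyline_single by simp
qed simp

definition coord_vec :: "percolation_model \<Rightarrow> complex \<Rightarrow> real^2" where
  "coord_vec M z = vector [coord1 M z, coord2 M z]"

lemma coord_vec_nth [simp]: "coord_vec M z $ 1 = coord1 M z" "coord_vec M z $ 2 = coord2 M z"
  by (simp_all add: coord_vec_def)

lemma continuous_coord: "continuous_on S (coord1 M)" "continuous_on S (coord2 M)"
  unfolding coord1_def[abs_def] coord2_def[abs_def] divide_inverse by (intro continuous_intros; simp)+

lemma continuous_coord_vec: "continuous_on S (coord_vec M)"
proof -
  have "coord_vec M = (\<lambda>z. \<chi> i. if i = 1 then coord1 M z else coord2 M z)"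
    by (auto simp: fun_eq_iff vec_eq_iff forall_2)
  moreover have "continuous_on S (\<lambda>z. if i = 1 then coord1 M z else coord2 M z)" for i :: 2
    by (cases "i = 1") (simp_all add: continuous_coord)
  ultimately show ?thesis by (simp only:, intro continuous_on_vec_lambda)
qed

context planar_percolation
begin

lemma coord_vec_inject: "coord_vec M x = coord_vec M y \<Longrightarrow> x = y"
  by (metis coord_inject coord_vec_nth)

lemma plane_paths_intersect:
  assumes "path f" "path g"
    and f: "\<And>z. z \<in> path_image f \<Longrightarrow> y1 \<le> coord2 M z \<and> coord2 M z \<le> y2" "coord1 M (pathstart f) \<le> x1" "x2 \<le> coord1 M (pathfinish f)"
    and g: "\<And>z. z \<in> path_image g \<Longrightarrow> x1 \<le> coord1 M z \<and> coord1 M z \<le> x2" "coord2 M (pathstart g) \<le> y1" "y2 \<le> coord2 M (pathfinish g)"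
  shows "\<exists>z. z \<in> path_image f \<and> z \<in> path_image g"
proof -
  have "path (coord_vec M \<circ> f)" "path (coord_vec M \<circ> g)"
    using assms(1,2) continuous_coord_vec by (auto intro: path_continuous_image)
  then have "\<exists>z. z \<in> path_image (coord_vec M \<circ> f) \<and> z \<in> path_image (coord_vec M \<circ> g)"
    by (rule crossing_paths_intersect[of _ _ y1 y2 x1 x2])
      (use f g in \<open>auto simp: path_image_compose pathstart_compose pathfinish_compose\<close>)
  then show ?thesis by (auto simp: path_image_compose dest!: coord_vec_inject)
qed

text \<open>Planarity: two different edges meet only in common end points, and a site on an edge is
  one of its end points. So a meeting of drawings is a meeting of vertex sets.\<close>

lemma polylines_share_site:
  assumes "graph_path M vs" "graph_path M ws" "z \<in> path_image (polyline vs)" "z \<in> path_image (polyline ws)"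
  shows "set vs \<inter> set ws \<noteq> {}"
proof -
  have vs: "vs \<noteq> []" "set vs \<subseteq> sites M" "successively (\<lambda>u v. {u, v} \<in> edges M) vs" using assms(1) by (auto simp: occupied_path_def)
  have ws: "ws \<noteq> []" "set ws \<subseteq> sites M" "successively (\<lambda>u v. {u, v} \<in> edges M) ws" using assms(2) by (auto simp: occupied_path_def)
  from path_image_polyline[OF vs(1,3) assms(3)] path_image_polyline[OF ws(1,3) assms(4)]
  show ?thesis
  proof (elim disjE bexE conjE)
    fix u v assume "z \<in> set vs" "u \<in> set ws" "v \<in> set ws" "{u, v} \<in> edges M" "z \<in> convex hull {u, v}"
    with sites_off_edges[of z "{u, v}"] vs show ?thesis by blast
  next
    fix u v assume "z \<in> set ws" "u \<in> set vs" "v \<in> set vs" "{u, v} \<in> edges M" "z \<in> convex hull {u, v}"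
    with sites_off_edges[of z "{u, v}"] ws show ?thesis by blast
  next
    fix u v u' v'
    assume *: "u \<in> set vs" "v \<in> set vs" "{u, v} \<in> edges M" "z \<in> convex hull {u, v}"
      "u' \<in> set ws" "v' \<in> set ws" "{u', v'} \<in> edges M" "z \<in> convex hull {u', v'}"
    show ?thesis
    proof (cases "{u, v} = {u', v'}")
      case True
      then show ?thesis using * by (auto simp: doubleton_eq_iff)
    next
      case False
      then show ?thesis using planar[OF *(3,7)] * by blast
    qed
  qed auto
qed

lemma convex_strips: "convex {z. a \<le> coord1 M z \<and> coord1 M z \<le> b}" "convex {z. a \<le> coord2 M z \<and> coord2 M z \<le> b}"
proof -
  have l: "linear (coord1 M)" "linear (coord2 M)" by (auto intro!: linearI simp: coord_linear)
  have "convex (coord1 M -` {a..b})" "convex (coord2 M -` {a..b})" using l by (auto intro: convex_linear_vimage)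
  then show "convex {z. a \<le> coord1 M z \<and> coord1 M z \<le> b}" "convex {z. a \<le> coord2 M z \<and> coord2 M z \<le> b}"
    by (simp_all add: vimage_def)
qed

lemma polyline_in_strip1:
  assumes "vs \<noteq> []" "\<And>v. v \<in> set vs \<Longrightarrow> a \<le> coord1 M v \<and> coord1 M v \<le> b" "z \<in> path_image (polyline vs)"
  shows "a \<le> coord1 M z \<and> coord1 M z \<le> b"
  using path_image_polyline_convex[OF assms(1) _ convex_strips(1)[of a b]] assms(2,3) by blast

lemma polyline_in_strip2:
  assumes "vs \<noteq> []" "\<And>v. v \<in> set vs \<Longrightarrow> a \<le> coord2 M v \<and> coord2 M v \<le> b" "z \<in> path_image (polyline vs)"
  shows "a \<le> coord2 M z \<and> coord2 M z \<le> b"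
  using path_image_polyline_convex[OF assms(1) _ convex_strips(2)[of a b]] assms(2,3) by blast

text \<open>Only the second coordinate is confined and the ends may lie beyond the two sides; the
  crossing argument asks for no more.\<close>

definition h_spans :: "complex list \<Rightarrow> real \<Rightarrow> real \<Rightarrow> real \<Rightarrow> real \<Rightarrow> bool" where
  "h_spans vs x1 x2 y1 y2 \<longleftrightarrow> graph_path M vs \<and> coord1 M (hd vs) \<le> x1 \<and> x2 \<le> coord1 M (last vs) \<and>
     (\<forall>v\<in>set vs. y1 \<le> coord2 M v \<and> coord2 M v \<le> y2)"

definition v_spans :: "complex list \<Rightarrow> real \<Rightarrow> real \<Rightarrow> real \<Rightarrow> real \<Rightarrow> bool" where
  "v_spans vs x1 x2 y1 y2 \<longleftrightarrow> graph_path M vs \<and> coord2 M (hd vs) \<le> y1 \<and> y2 \<le> coord2 M (last vs) \<and>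
     (\<forall>v\<in>set vs. x1 \<le> coord1 M v \<and> coord1 M v \<le> x2)"

lemma h_path_meets_v_span:
  assumes "path h" "v_spans ws x1 x2 y1 y2"
    and "\<And>z. z \<in> path_image h \<Longrightarrow> y1 \<le> coord2 M z \<and> coord2 M z \<le> y2" "coord1 M (pathstart h) \<le> x1" "x2 \<le> coord1 M (pathfinish h)"
  shows "\<exists>z. z \<in> path_image h \<and> z \<in> path_image (polyline ws)"
proof (rule plane_paths_intersect[OF assms(1) path_polyline assms(3-5)])
  have ne: "ws \<noteq> []" using assms(2) by (auto simp: v_spans_def occupied_path_def)
  show "x1 \<le> coord1 M z \<and> coord1 M z \<le> x2" if "z \<in> path_image (polyline ws)" for z
    using polyline_in_strip1[OF ne _ that] assms(2) by (auto simp: v_spans_def)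
  show "coord2 M (pathstart (polyline ws)) \<le> y1" "y2 \<le> coord2 M (pathfinish (polyline ws))"
    using assms(2) ne by (auto simp: v_spans_def pathstart_polyline pathfinish_polyline)
qed

lemma v_path_meets_h_span:
  assumes "path h" "h_spans ws x1 x2 y1 y2"
    and "\<And>z. z \<in> path_image h \<Longrightarrow> x1 \<le> coord1 M z \<and> coord1 M z \<le> x2" "coord2 M (pathstart h) \<le> y1" "y2 \<le> coord2 M (pathfinish h)"
  shows "\<exists>z. z \<in> path_image h \<and> z \<in> path_image (polyline ws)"
proof -
  have ne: "ws \<noteq> []" using assms(2) by (auto simp: h_spans_def occupied_path_def)
  have "\<exists>z. z \<in> path_image (polyline ws) \<and> z \<in> path_image h"
  proof (rule plane_paths_intersect[OF path_polyline assms(1) _ _ _ assms(3-5)])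
    show "y1 \<le> coord2 M z \<and> coord2 M z \<le> y2" if "z \<in> path_image (polyline ws)" for z
      using polyline_in_strip2[OF ne _ that] assms(2) by (auto simp: h_spans_def)
    show "coord1 M (pathstart (polyline ws)) \<le> x1" "x2 \<le> coord1 M (pathfinish (polyline ws))"
      using assms(2) ne by (auto simp: h_spans_def pathstart_polyline pathfinish_polyline)
  qed
  then show ?thesis by blast
qed

lemma h_span_meets_v_span:
  assumes "h_spans vs x1 x2 y1 y2" "v_spans ws x1 x2 y1 y2"
  shows "set vs \<inter> set ws \<noteq> {}"
proof -
  have ne: "vs \<noteq> []" using assms(1) by (auto simp: h_spans_def occupied_path_def)
  have "\<exists>z. z \<in> path_image (polyline vs) \<and> z \<in> path_image (polyline ws)"
  proof (rule h_path_meets_v_span[OF path_polyline assms(2)])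
    show "y1 \<le> coord2 M z \<and> coord2 M z \<le> y2" if "z \<in> path_image (polyline vs)" for z
      using polyline_in_strip2[OF ne _ that] assms(1) by (auto simp: h_spans_def)
    show "coord1 M (pathstart (polyline vs)) \<le> x1" "x2 \<le> coord1 M (pathfinish (polyline vs))"
      using assms(1) ne by (auto simp: h_spans_def pathstart_polyline pathfinish_polyline)
  qed
  then show ?thesis using polylines_share_site assms by (auto simp: h_spans_def v_spans_def)
qed

text \<open>The drawing of \<open>vs\<close> is stopped at its first exit from the open outer
  rectangle. The stopped curve traverses one of the four strips between the inner and the outer
  rectangle in the short direction without leaving the strip lengthwise, so it meets the crossing of
  that strip.\<close>

lemma path_leaving_rectangle:
  assumes vs: "graph_path M vs"
    and ord: "X1 \<le> x1" "x1 \<le> x2" "x2 \<le> X2" "Y1 \<le> y1" "y1 \<le> y2" "y2 \<le> Y2"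
    and start: "x1 \<le> coord1 M (hd vs)" "coord1 M (hd vs) \<le> x2" "y1 \<le> coord2 M (hd vs)" "coord2 M (hd vs) \<le> y2"
    and finish: "coord1 M (last vs) \<le> X1 \<or> X2 \<le> coord1 M (last vs) \<or> coord2 M (last vs) \<le> Y1 \<or> Y2 \<le> coord2 M (last vs)"
    and left: "v_spans wl X1 x1 Y1 Y2" and right: "v_spans wr x2 X2 Y1 Y2"
    and bottom: "h_spans wb X1 X2 Y1 y1" and top: "h_spans wt X1 X2 y2 Y2"
  shows "\<exists>ws\<in>{wl, wr, wb, wt}. set vs \<inter> set ws \<noteq> {}"
proof -
  have ne: "vs \<noteq> []" using vs by (auto simp: occupied_path_def)
  define Q where "Q = {z. X1 < coord1 M z} \<inter> {z. coord1 M z < X2} \<inter> {z. Y1 < coord2 M z} \<inter> {z. coord2 M z < Y2}"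
  define Q' where "Q' = {z. X1 \<le> coord1 M z} \<inter> {z. coord1 M z \<le> X2} \<inter> {z. Y1 \<le> coord2 M z} \<inter> {z. coord2 M z \<le> Y2}"
  have "open Q" unfolding Q_def by (intro open_Int open_Collect_less continuous_coord continuous_on_const)
  have "closed Q'" unfolding Q'_def by (intro closed_Int closed_Collect_le continuous_coord continuous_on_const)
  have "Q \<subseteq> Q'" by (auto simp: Q_def Q'_def)
  have "\<exists>h. path h \<and> pathstart h = hd vs \<and> path_image h \<subseteq> path_image (polyline vs) \<and> path_image h \<subseteq> Q' \<and> pathfinish h \<notin> Q"
  proof (cases "hd vs \<in> Q")
    case True
    have fin: "pathfinish (polyline vs) \<notin> Q" using finish ne by (auto simp: Q_def pathfinish_polyline)
    have st: "pathstart (polyline vs) \<in> closure Q"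
      using True ne closure_subset[of Q] by (auto simp: pathstart_polyline)
    obtain h where h: "path h" "pathstart h = pathstart (polyline vs)" "path_image h \<subseteq> path_image (polyline vs)"
      "path_image h - {pathfinish h} \<subseteq> interior Q" "pathfinish h \<in> frontier Q"
      by (rule exists_path_subpath_to_frontier[OF path_polyline st fin])
    have "pathfinish h \<notin> Q" "pathfinish h \<in> closure Q" using h(5) \<open>open Q\<close> by (auto simp: frontier_def interior_open)
    moreover have "closure Q \<subseteq> Q'" using \<open>closed Q'\<close> \<open>Q \<subseteq> Q'\<close> by (rule closure_minimal[rotated])
    moreover have "interior Q \<subseteq> Q'" using \<open>Q \<subseteq> Q'\<close> interior_subset by blast
    ultimately show ?thesis using h ne by (intro exI[of _ h]) (auto simp: pathstart_polyline)
  next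
    \<comment> \<open>The start may already lie on the boundary of the outer rectangle, since inner
      and outer sides are allowed to coincide; then the constant path takes the part of the stopped
      curve.\<close>
    case False
    have "hd vs \<in> path_image (polyline vs)" using pathstart_in_path_image[of "polyline vs"] ne by (simp add: pathstart_polyline)
    moreover have "hd vs \<in> Q'" using start ord by (auto simp: Q'_def)
    ultimately show ?thesis using False by (intro exI[of _ "linepath (hd vs) (hd vs)"]) auto
  qed
  then obtain h where h: "path h" "pathstart h = hd vs" "path_image h \<subseteq> path_image (polyline vs)" "path_image h \<subseteq> Q'" "pathfinish h \<notin> Q"
    by blast
  have hQ: "X1 \<le> coord1 M z" "coord1 M z \<le> X2" "Y1 \<le> coord2 M z" "coord2 M z \<le> Y2" if "z \<in> path_image h" for z
    using h(4) that by (auto simp: Q'_def)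
  have rev: "path (reversepath h)" "pathstart (reversepath h) = pathfinish h" "pathfinish (reversepath h) = hd vs"
    using h by auto
  have "\<exists>ws\<in>{wl, wr, wb, wt}. graph_path M ws \<and> (\<exists>z. z \<in> path_image h \<and> z \<in> path_image (polyline ws))"
  proof -
    consider "coord1 M (pathfinish h) \<le> X1" | "X2 \<le> coord1 M (pathfinish h)" | "coord2 M (pathfinish h) \<le> Y1" | "Y2 \<le> coord2 M (pathfinish h)"
      using h(5) by (force simp: Q_def)
    then show ?thesis
    proof cases
      case 1
      have "\<exists>z. z \<in> path_image (reversepath h) \<and> z \<in> path_image (polyline wl)"
        by (rule h_path_meets_v_span[OF rev(1) left]) (use 1 rev start hQ in auto)
      then show ?thesis using left by (auto simp: v_spans_def)
    next
      case 2
      have "\<exists>z. z \<in> path_image h \<and> z \<in> path_image (polyline wr)"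
        by (rule h_path_meets_v_span[OF h(1) right]) (use 2 h start hQ in auto)
      then show ?thesis using right by (auto simp: v_spans_def)
    next
      case 3
      have "\<exists>z. z \<in> path_image (reversepath h) \<and> z \<in> path_image (polyline wb)"
        by (rule v_path_meets_h_span[OF rev(1) bottom]) (use 3 rev start hQ in auto)
      then show ?thesis using bottom by (auto simp: h_spans_def)
    next
      case 4
      have "\<exists>z. z \<in> path_image h \<and> z \<in> path_image (polyline wt)"
        by (rule v_path_meets_h_span[OF h(1) top]) (use 4 h start hQ in auto)
      then show ?thesis using top by (auto simp: h_spans_def)
    qed
  qed
  then obtain ws z where "ws \<in> {wl, wr, wb, wt}" "graph_path M ws" "z \<in> path_image h" "z \<in> path_image (polyline ws)" by blast
  then show ?thesis using polylines_share_site[OF vs, of ws z] h(3) by blast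
qed

end

section \<open>Nets of crossings\<close>

lemma first_hit:
  assumes "occupied_path M \<omega> vs" "Q (last vs)"
  obtains ws where "occupied_path M \<omega> ws" "hd ws = hd vs" "Q (last ws)" "\<And>v. v \<in> set (butlast ws) \<Longrightarrow> \<not> Q v" "set ws \<subseteq> set vs"
proof -
  have ne: "vs \<noteq> []" using assms by (auto simp: occupied_path_def)
  define k where "k = (LEAST k. k < length vs \<and> Q (vs ! k))"
  have "length vs - 1 < length vs \<and> Q (vs ! (length vs - 1))" using ne assms(2) by (simp add: last_conv_nth)
  then have k: "k < length vs" "Q (vs ! k)" unfolding k_def by (metis (mono_tags, lifting) LeastI)+
  have below: "\<not> Q (vs ! l)" if "l < k" for l
    using not_less_Least[of l "\<lambda>k. k < length vs \<and> Q (vs ! k)"] that k(1) unfolding k_def[symmetric] by simp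
  let ?ws = "take (Suc k) vs"
  have ws: "?ws = take k vs @ [vs ! k]" using k(1) by (rule take_Suc_conv_app_nth)
  show thesis
  proof (rule that[of ?ws])
    show "occupied_path M \<omega> ?ws" using assms(1) by (rule occupied_path_take) simp
    show "hd ?ws = hd vs" by simp
    show "Q (last ?ws)" using k(2) unfolding ws by simp
    show "\<not> Q v" if "v \<in> set (butlast ?ws)" for v
      using that below k(1) unfolding ws by (auto simp: in_set_conv_nth)
    show "set ?ws \<subseteq> set vs" by (rule set_take_subset)
  qed
qed

lemma int_mult_le: "(i::int) \<le> j \<Longrightarrow> 0 \<le> (r::real) \<Longrightarrow> of_int i * r \<le> of_int j * r"
  by (intro mult_right_mono) simp_all

context planar_percolation
begin

text \<open>Stopping at the first vertex at distance d overshoots by at most one edge. This makes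
  reaching a distance a local event.\<close>

lemma path_truncate:
  assumes "occupied_path M \<omega> vs" "d \<le> rnorm M (last vs - hd vs)" "0 \<le> d"
  obtains ws where "occupied_path M \<omega> ws" "hd ws = hd vs" "d \<le> rnorm M (last ws - hd vs)" "set ws \<subseteq> rbox M (hd vs) (d + R)"
proof -
  obtain ws where ws: "occupied_path M \<omega> ws" "hd ws = hd vs" "d \<le> rnorm M (last ws - hd vs)"
    "\<And>v. v \<in> set (butlast ws) \<Longrightarrow> \<not> d \<le> rnorm M (v - hd vs)"
    by (rule first_hit[OF assms(1), of "\<lambda>v. d \<le> rnorm M (v - hd vs)"]) (use assms(2) in auto)
  have ne: "ws \<noteq> []" using ws(1) by (auto simp: occupied_path_def)
  have last: "rnorm M (last ws - hd vs) \<le> d + R"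
  proof (cases "butlast ws = []")
    case True
    then have "last ws = hd vs" using ne ws(2) by (metis append_Nil append_butlast_last_id list.sel(1))
    then show ?thesis using assms(3) R(1) by simp
  next
    case False
    let ?u = "last (butlast ws)"
    have "ws = butlast ws @ [last ws]" using ne by simp
    then have "{?u, last ws} \<in> edges M"
      using ws(1) False successively_append_iff[of "\<lambda>u v. {u, v} \<in> edges M" "butlast ws" "[last ws]"]
      by (simp add: occupied_path_def)
    then have "rnorm M (last ws - ?u) \<le> R" using R(2) rnorm_commute by metis
    moreover have "rnorm M (?u - hd vs) < d" using ws(4)[of ?u] False by simp
    ultimately show ?thesis using rnorm_triangle_sub[of M "last ws" "hd vs" ?u] by linarith
  qed
  have "set ws \<subseteq> rbox M (hd vs) (d + R)"
  proof
    fix v assume "v \<in> set ws"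
    then have "v \<in> set (butlast ws) \<or> v = last ws"
      using ne by (metis append_butlast_last_id in_set_conv_decomp rotate1.simps(2) set_ConsD set_rotate1)
    then show "v \<in> rbox M (hd vs) (d + R)" using last ws(4)[of v] R(1) by (auto simp: rbox_def)
  qed
  with ws that show thesis by blast
qed

text \<open>
  Cell (i, j) of scale n has the corner (i n, j n) and side n. Its horizontal crossing traverses the rectangle of
  width 3n and height n with the same corner and may overshoot it by at most one edge at both ends, hence
  the margin in the region. It meets the vertical crossings of the cells (i, j), (i + 1, j) and (i + 2, j).
\<close>

definition cell_region :: "nat \<Rightarrow> int \<Rightarrow> int \<Rightarrow> int \<Rightarrow> int \<Rightarrow> complex set" where
  "cell_region n i0 i1 j0 j1 = {v. of_int (i0 - 1) * real n \<le> coord1 M v \<and> coord1 M v \<le> of_int (i1 + 4) * real n \<and>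
     of_int (j0 - 1) * real n \<le> coord2 M v \<and> coord2 M v \<le> of_int (j1 + 4) * real n}"

definition H_path :: "nat \<Rightarrow> int \<Rightarrow> int \<Rightarrow> complex list \<Rightarrow> bool" where
  "H_path n i j vs \<longleftrightarrow> h_spans vs (of_int i * real n) (of_int (i + 3) * real n) (of_int j * real n) (of_int (j + 1) * real n)"

definition V_path :: "nat \<Rightarrow> int \<Rightarrow> int \<Rightarrow> complex list \<Rightarrow> bool" where
  "V_path n i j vs \<longleftrightarrow> v_spans vs (of_int i * real n) (of_int (i + 1) * real n) (of_int j * real n) (of_int (j + 3) * real n)"

definition HX :: "nat \<Rightarrow> int \<Rightarrow> int \<Rightarrow> (complex set \<Rightarrow> bool) \<Rightarrow> bool" where
  "HX n i j = path_event (cell_region n i i j j) (H_path n i j)"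

definition VX :: "nat \<Rightarrow> int \<Rightarrow> int \<Rightarrow> (complex set \<Rightarrow> bool) \<Rightarrow> bool" where
  "VX n i j = path_event (cell_region n i i j j) (V_path n i j)"

definition grid :: "nat \<Rightarrow> int \<Rightarrow> int \<Rightarrow> int \<Rightarrow> int \<Rightarrow> (complex set \<Rightarrow> bool) \<Rightarrow> bool" where
  "grid n i0 i1 j0 j1 \<omega> \<longleftrightarrow> (\<forall>(a, b)\<in>{i0..i1} \<times> {j0..j1}. HX n a b \<omega> \<and> VX n a b \<omega>)"

text \<open>The paths hp and vp are arbitrary when the crossing does not exist.\<close>

definition hp :: "(complex set \<Rightarrow> bool) \<Rightarrow> nat \<Rightarrow> int \<Rightarrow> int \<Rightarrow> complex list" where
  "hp \<omega> n i j = (SOME vs. occupied_path M \<omega> vs \<and> set vs \<subseteq> cell_region n i i j j \<and> H_path n i j vs)"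

definition vp :: "(complex set \<Rightarrow> bool) \<Rightarrow> nat \<Rightarrow> int \<Rightarrow> int \<Rightarrow> complex list" where
  "vp \<omega> n i j = (SOME vs. occupied_path M \<omega> vs \<and> set vs \<subseteq> cell_region n i i j j \<and> V_path n i j vs)"

definition cell_net :: "(complex set \<Rightarrow> bool) \<Rightarrow> nat \<Rightarrow> int \<Rightarrow> int \<Rightarrow> complex set" where
  "cell_net \<omega> n i j = set (hp \<omega> n i j) \<union> set (vp \<omega> n i j)"

lemma hp:
  assumes "HX n i j \<omega>"
  shows "occupied_path M \<omega> (hp \<omega> n i j)" "set (hp \<omega> n i j) \<subseteq> cell_region n i i j j" "H_path n i j (hp \<omega> n i j)"
  using someI_ex[OF assms[unfolded HX_def path_event_def]] unfolding hp_def by blast+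

lemma vp:
  assumes "VX n i j \<omega>"
  shows "occupied_path M \<omega> (vp \<omega> n i j)" "set (vp \<omega> n i j) \<subseteq> cell_region n i i j j" "V_path n i j (vp \<omega> n i j)"
  using someI_ex[OF assms[unfolded VX_def path_event_def]] unfolding vp_def by blast+

lemma cell_region_mono:
  "i0' \<le> i0 \<Longrightarrow> i1 \<le> i1' \<Longrightarrow> j0' \<le> j0 \<Longrightarrow> j1 \<le> j1' \<Longrightarrow> cell_region n i0 i1 j0 j1 \<subseteq> cell_region n i0' i1' j0' j1'"
  unfolding cell_region_def
  using int_mult_le[of "i0' - 1" "i0 - 1" "real n"] int_mult_le[of "i1 + 4" "i1' + 4" "real n"]
    int_mult_le[of "j0' - 1" "j0 - 1" "real n"] int_mult_le[of "j1 + 4" "j1' + 4" "real n"]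
  by auto

lemma cell_region_rbox:
  assumes "of_int i * real n \<le> coord1 M x" "coord1 M x \<le> of_int (i + 1) * real n"
    "of_int j * real n \<le> coord2 M x" "coord2 M x \<le> of_int (j + 1) * real n" "0 \<le> K"
  shows "cell_region n (i - K) (i + K) (j - K) (j + K) \<subseteq> rbox M x ((of_int K + 4) * real n)"
proof
  fix v assume v: "v \<in> cell_region n (i - K) (i + K) (j - K) (j + K)"
  have "0 \<le> of_int K * real n" using assms(5) by simp
  then show "v \<in> rbox M x ((of_int K + 4) * real n)"
    using v assms unfolding cell_region_def rbox_def rnorm_le_iff coord_linear mem_Collect_eq abs_le_iff
    by (simp add: algebra_simps)
qed

lemma finite_cell_region: "finite (sites M \<inter> cell_region n i0 i1 j0 j1)"
proof -
  obtain K where "\<forall>a b s t. 0 \<le> s \<longrightarrow> 0 \<le> t \<longrightarrow>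
     finite {v \<in> sites M. a \<le> coord1 M v \<and> coord1 M v \<le> a + s \<and> b \<le> coord2 M v \<and> coord2 M v \<le> b + t}"
    using card_sites_rectangle by auto
  note K = this[rule_format, of "\<bar>of_int (i1 + 4) * real n - of_int (i0 - 1) * real n\<bar>" "\<bar>of_int (j1 + 4) * real n - of_int (j0 - 1) * real n\<bar>"
     "of_int (i0 - 1) * real n" "of_int (j0 - 1) * real n"]
  show ?thesis by (rule finite_subset[OF _ K]) (auto simp: cell_region_def)
qed

lemma HX_VX_event:
  "cylinder M (HX n i j)" "cylinder M (VX n i j)" "up_event (HX n i j)" "up_event (VX n i j)"
  "supported (elems (cell_region n i i j j)) (HX n i j)" "supported (elems (cell_region n i i j j)) (VX n i j)"
  unfolding HX_def VX_def
  by (intro cylinder_path_event finite_cell_region up_event_path_event supported_path_event)+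

lemma grid_event: "cylinder M (grid n i0 i1 j0 j1)" "up_event (grid n i0 i1 j0 j1)"
proof -
  have eq: "grid n i0 i1 j0 j1 = (\<lambda>\<omega>. \<forall>p\<in>{i0..i1} \<times> {j0..j1}. HX n (fst p) (snd p) \<omega> \<and> VX n (fst p) (snd p) \<omega>)"
    by (auto simp: grid_def fun_eq_iff)
  show "cylinder M (grid n i0 i1 j0 j1)" unfolding eq
    by (intro cylinder_ball cylinder_conj HX_VX_event) auto
  show "up_event (grid n i0 i1 j0 j1)" unfolding eq
    by (intro up_event_ball up_event_conj HX_VX_event)
qed

lemma gridD: "grid n i0 i1 j0 j1 \<omega> \<Longrightarrow> a \<in> {i0..i1} \<Longrightarrow> b \<in> {j0..j1} \<Longrightarrow> HX n a b \<omega> \<and> VX n a b \<omega>"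
  by (auto simp: grid_def)

lemma grid_mono: "grid n i0 i1 j0 j1 \<omega> \<Longrightarrow> i0 \<le> i0' \<Longrightarrow> i1' \<le> i1 \<Longrightarrow> j0 \<le> j0' \<Longrightarrow> j1' \<le> j1 \<Longrightarrow> grid n i0' i1' j0' j1' \<omega>"
  by (auto simp: grid_def)

lemma H_meets_V:
  assumes "H_path n a b vs" "V_path m k l ws"
    and "of_int a * real n \<le> of_int k * real m" "of_int (k + 1) * real m \<le> of_int (a + 3) * real n"
    and "of_int l * real m \<le> of_int b * real n" "of_int (b + 1) * real n \<le> of_int (l + 3) * real m"
  shows "set vs \<inter> set ws \<noteq> {}"
  by (rule h_span_meets_v_span[of _ "of_int k * real m" "of_int (k + 1) * real m" "of_int b * real n" "of_int (b + 1) * real n"])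
    (use assms in \<open>auto simp: H_path_def V_path_def h_spans_def v_spans_def simp del: of_int_add\<close>)

lemma H_meets_V_same:
  assumes "H_path n a b vs" "V_path n k l ws" "a \<le> k" "k \<le> a + 2" "l \<le> b" "b \<le> l + 2"
  shows "set vs \<inter> set ws \<noteq> {}"
  by (rule H_meets_V[OF assms(1,2)]; intro int_mult_le) (use assms in auto)

lemma cell_net_connected:
  assumes "HX n i j \<omega>" "VX n i j \<omega>" "x \<in> cell_net \<omega> n i j" "y \<in> cell_net \<omega> n i j"
  shows "con M \<omega> (cell_region n i i j j) x y"
proof -
  obtain z where z: "z \<in> set (hp \<omega> n i j)" "z \<in> set (vp \<omega> n i j)"
    using H_meets_V_same[OF hp(3)[OF assms(1)] vp(3)[OF assms(2)]] by auto
  have "con M \<omega> (cell_region n i i j j) z u" if "u \<in> cell_net \<omega> n i j" for u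
    using that z con_path[OF hp(1,2)[OF assms(1)]] con_path[OF vp(1,2)[OF assms(2)]] by (auto simp: cell_net_def)
  from con_trans[OF con_sym[OF this[OF assms(3)]] this[OF assms(4)]] show ?thesis .
qed

lemma hp_ne: "HX n i j \<omega> \<Longrightarrow> hp \<omega> n i j \<noteq> []"
  using hp(1) by (auto simp: occupied_path_def)

lemma cell_net_up: "HX n i (j + 1) \<omega> \<Longrightarrow> VX n i j \<omega> \<Longrightarrow> cell_net \<omega> n i j \<inter> cell_net \<omega> n i (j + 1) \<noteq> {}"
  unfolding cell_net_def
  using H_meets_V_same[of n i "j + 1" "hp \<omega> n i (j + 1)" i j "vp \<omega> n i j"] hp(3) vp(3) by fastforce

lemma cell_net_right: "HX n i j \<omega> \<Longrightarrow> VX n (i + 1) j \<omega> \<Longrightarrow> cell_net \<omega> n i j \<inter> cell_net \<omega> n (i + 1) j \<noteq> {}"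
  using H_meets_V_same[of n i j "hp \<omega> n i j" "i + 1" j "vp \<omega> n (i + 1) j"] hp(3) vp(3) unfolding cell_net_def by fastforce

text \<open>Everything is joined to one vertex of the corner cell: the nets of the first column by
  induction upwards, then those of each row by induction to the right.\<close>

lemma grid_connected:
  assumes g: "grid n i0 i1 j0 j1 \<omega>"
    and a: "a \<in> {i0..i1}" "b \<in> {j0..j1}" "x \<in> cell_net \<omega> n a b"
    and a': "a' \<in> {i0..i1}" "b' \<in> {j0..j1}" "y \<in> cell_net \<omega> n a' b'"
  shows "con M \<omega> (cell_region n i0 i1 j0 j1) x y"
proof -
  let ?S = "cell_region n i0 i1 j0 j1"
  have cell: "con M \<omega> ?S u v" if "c \<in> {i0..i1}" "d \<in> {j0..j1}" "u \<in> cell_net \<omega> n c d" "v \<in> cell_net \<omega> n c d" for c d u v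
    by (rule con_mono[OF cell_net_connected[OF _ _ that(3,4)] cell_region_mono]) (use gridD[OF g that(1,2)] that(1,2) in auto)
  obtain z where z: "z \<in> cell_net \<omega> n i0 j0"
    using hp_ne[of n i0 j0 \<omega>] gridD[OF g, of i0 j0] a unfolding cell_net_def by (cases "hp \<omega> n i0 j0") auto
  have row: "\<forall>u\<in>cell_net \<omega> n i0 (j0 + int k). con M \<omega> ?S z u" if "j0 + int k \<le> j1" for k
    using that
  proof (induction k)
    case 0
    then show ?case using cell[of i0 j0 z] z a by auto
  next
    case (Suc k)
    obtain t where t: "t \<in> cell_net \<omega> n i0 (j0 + int k)" "t \<in> cell_net \<omega> n i0 (j0 + int k + 1)"
      using cell_net_up[of n i0 "j0 + int k" \<omega>] gridD[OF g, of i0 "j0 + int k"] gridD[OF g, of i0 "j0 + int k + 1"] Suc.prems a by auto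
    have eq: "j0 + int (Suc k) = j0 + int k + 1" by simp
    show ?case
    proof
      fix u assume u: "u \<in> cell_net \<omega> n i0 (j0 + int (Suc k))"
      have "con M \<omega> ?S z t" using Suc t(1) by auto
      moreover have "con M \<omega> ?S t u" using cell[of i0 "j0 + int k + 1" t u] t(2) u Suc.prems a unfolding eq by auto
      ultimately show "con M \<omega> ?S z u" by (rule con_trans)
    qed
  qed
  have all: "\<forall>u\<in>cell_net \<omega> n (i0 + int k) d. con M \<omega> ?S z u" if "i0 + int k \<le> i1" and d: "d \<in> {j0..j1}" for k d
    using that(1)
  proof (induction k)
    case 0
    have "j0 + int (nat (d - j0)) = d" using d by auto
    then show ?case using row[of "nat (d - j0)"] d by auto
  next
    case (Suc k)
    obtain t where t: "t \<in> cell_net \<omega> n (i0 + int k) d" "t \<in> cell_net \<omega> n (i0 + int k + 1) d"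
      using cell_net_right[of n "i0 + int k" d \<omega>] gridD[OF g, of "i0 + int k" d] gridD[OF g, of "i0 + int k + 1" d] Suc.prems a d by auto
    have eq: "i0 + int (Suc k) = i0 + int k + 1" by simp
    show ?case
    proof
      fix u assume u: "u \<in> cell_net \<omega> n (i0 + int (Suc k)) d"
      have "con M \<omega> ?S z t" using Suc t(1) by auto
      moreover have "con M \<omega> ?S t u" using cell[of "i0 + int k + 1" d t u] t(2) u Suc.prems a d unfolding eq by auto
      ultimately show "con M \<omega> ?S z u" by (rule con_trans)
    qed
  qed
  have "con M \<omega> ?S z u" if "c \<in> {i0..i1}" "d \<in> {j0..j1}" "u \<in> cell_net \<omega> n c d" for c d u
  proof -
    have "i0 + int (nat (c - i0)) = c" using that(1) by auto
    then show ?thesis using all[of "nat (c - i0)" d] that by auto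
  qed
  from con_trans[OF con_sym[OF this[OF a]] this[OF a']] show ?thesis .
qed

definition cell_of :: "nat \<Rightarrow> complex \<Rightarrow> int \<times> int" where
  "cell_of n x = (\<lfloor>coord1 M x / real n\<rfloor>, \<lfloor>coord2 M x / real n\<rfloor>)"

lemma cell_of_bounds:
  assumes "n \<ge> 1" "cell_of n x = (i, j)"
  shows "of_int i * real n \<le> coord1 M x" "coord1 M x \<le> of_int (i + 1) * real n"
    "of_int j * real n \<le> coord2 M x" "coord2 M x \<le> of_int (j + 1) * real n"
proof -
  have "of_int i \<le> coord1 M x / real n" "coord1 M x / real n \<le> of_int (i + 1)"
    "of_int j \<le> coord2 M x / real n" "coord2 M x / real n \<le> of_int (j + 1)"
    using assms(2) unfolding cell_of_def by (simp_all, linarith+)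
  then show "of_int i * real n \<le> coord1 M x" "coord1 M x \<le> of_int (i + 1) * real n"
    "of_int j * real n \<le> coord2 M x" "coord2 M x \<le> of_int (j + 1) * real n"
    using assms(1) by (simp_all add: pos_le_divide_eq pos_divide_le_eq)
qed

text \<open>A displacement of 2n in one coordinate, starting in cell (i, j), leaves the 3 by 3 block
  of cells around it, and four crossings of length 3n border the central cell inside that
  block.\<close>

lemma path_leaving_cell:
  assumes n: "n \<ge> 1" and vs: "graph_path M vs"
    and x: "of_int i * real n \<le> coord1 M (hd vs)" "coord1 M (hd vs) \<le> of_int (i + 1) * real n"
      "of_int j * real n \<le> coord2 M (hd vs)" "coord2 M (hd vs) \<le> of_int (j + 1) * real n"
    and far: "2 * real n \<le> rnorm M (last vs - hd vs)"
    and g: "grid n (i - 1) (i + 1) (j - 1) (j + 1) \<omega>"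
  shows "\<exists>a\<in>{i-1..i+1}. \<exists>b\<in>{j-1..j+1}. set vs \<inter> cell_net \<omega> n a b \<noteq> {}"
proof -
  note H = gridD[OF g, THEN conjunct1, THEN hp(3), unfolded H_path_def]
  note V = gridD[OF g, THEN conjunct2, THEN vp(3), unfolded V_path_def]
  let ?l = "vp \<omega> n (i - 1) (j - 1)" and ?r = "vp \<omega> n (i + 1) (j - 1)"
  let ?b = "hp \<omega> n (i - 1) (j - 1)" and ?t = "hp \<omega> n (i - 1) (j + 1)"
  have "\<exists>ws\<in>{?l, ?r, ?b, ?t}. set vs \<inter> set ws \<noteq> {}"
  proof (rule path_leaving_rectangle[OF vs, of "of_int (i - 1) * real n" "of_int i * real n" "of_int (i + 1) * real n" "of_int (i + 2) * real n"
       "of_int (j - 1) * real n" "of_int j * real n" "of_int (j + 1) * real n" "of_int (j + 2) * real n"])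
    show "coord1 M (last vs) \<le> of_int (i - 1) * real n \<or> of_int (i + 2) * real n \<le> coord1 M (last vs) \<or>
      coord2 M (last vs) \<le> of_int (j - 1) * real n \<or> of_int (j + 2) * real n \<le> coord2 M (last vs)"
      using far x unfolding rnorm_def coord_linear by (auto simp: le_max_iff_disj abs_real_def algebra_simps split: if_splits)
    show "v_spans ?l (of_int (i - 1) * real n) (of_int i * real n) (of_int (j - 1) * real n) (of_int (j + 2) * real n)"
      using V[of "i - 1" "j - 1"] by (simp add: algebra_simps)
    show "v_spans ?r (of_int (i + 1) * real n) (of_int (i + 2) * real n) (of_int (j - 1) * real n) (of_int (j + 2) * real n)"
      using V[of "i + 1" "j - 1"] by (simp add: algebra_simps)
    show "h_spans ?b (of_int (i - 1) * real n) (of_int (i + 2) * real n) (of_int (j - 1) * real n) (of_int j * real n)"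
      using H[of "i - 1" "j - 1"] by (simp add: algebra_simps)
    show "h_spans ?t (of_int (i - 1) * real n) (of_int (i + 2) * real n) (of_int (j + 1) * real n) (of_int (j + 2) * real n)"
      using H[of "i - 1" "j + 1"] by (simp add: algebra_simps)
  qed (use x in \<open>auto intro!: mult_right_mono\<close>)
  then show ?thesis
  proof (elim bexE insertE emptyE)
    fix ws assume "set vs \<inter> set ws \<noteq> {}" "ws = ?l"
    then show ?thesis by (intro bexI[of _ "i - 1"] bexI[of _ "j - 1"]) (auto simp: cell_net_def)
  next
    fix ws assume "set vs \<inter> set ws \<noteq> {}" "ws = ?r"
    then show ?thesis by (intro bexI[of _ "i + 1"] bexI[of _ "j - 1"]) (auto simp: cell_net_def)
  next
    fix ws assume "set vs \<inter> set ws \<noteq> {}" "ws = ?b"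
    then show ?thesis by (intro bexI[of _ "i - 1"] bexI[of _ "j - 1"]) (auto simp: cell_net_def)
  next
    fix ws assume "set vs \<inter> set ws \<noteq> {}" "ws = ?t"
    then show ?thesis by (intro bexI[of _ "i - 1"] bexI[of _ "j + 1"]) (auto simp: cell_net_def)
  qed
qed

text \<open>Passing the distance d instead of hitting a sphere: the event is antitone in d, makes
  sense for real d and is insensitive to edges that jump over the exact distance.\<close>

definition reach :: "complex \<Rightarrow> real \<Rightarrow> (complex set \<Rightarrow> bool) \<Rightarrow> bool" where
  "reach x d \<omega> \<longleftrightarrow> (\<exists>vs. occupied_path M \<omega> vs \<and> hd vs = x \<and> d \<le> rnorm M (last vs - x))"

lemma reach_path_event:
  assumes "0 \<le> d"
  shows "reach x d = path_event (rbox M x (d + R)) (\<lambda>vs. hd vs = x \<and> d \<le> rnorm M (last vs - x))"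
proof
  fix \<omega>
  show "reach x d \<omega> = path_event (rbox M x (d + R)) (\<lambda>vs. hd vs = x \<and> d \<le> rnorm M (last vs - x)) \<omega>"
    unfolding reach_def path_event_def
  proof (intro iffI; elim exE conjE)
    fix vs assume vs: "occupied_path M \<omega> vs" "hd vs = x" "d \<le> rnorm M (last vs - x)"
    from path_truncate[OF vs(1) vs(3)[folded vs(2)] assms]
    show "\<exists>vs. occupied_path M \<omega> vs \<and> set vs \<subseteq> rbox M x (d + R) \<and> hd vs = x \<and> d \<le> rnorm M (last vs - x)"
      using vs(2) by metis
  qed blast
qed

lemma reach_event:
  assumes "0 \<le> d"
  shows "cylinder M (reach x d)" "up_event (reach x d)" "supported (elems (rbox M x (d + R))) (reach x d)"
  unfolding reach_path_event[OF assms]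
  by (intro cylinder_path_event finite_sites_rbox up_event_path_event supported_path_event)+

lemma reach_antimono: "reach x d \<omega> \<Longrightarrow> d' \<le> d \<Longrightarrow> reach x d' \<omega>"
  unfolding reach_def by (elim exE conjE) (rule exI, auto)

lemma reach_con: "con M \<omega> S x y \<Longrightarrow> d \<le> rnorm M (y - x) \<Longrightarrow> reach x d \<omega>"
  unfolding con_iff reach_def by blast

text \<open>One layer of cells around that of x catches a path leaving it. The second layer is
  needed for linking with scale 3n, since the rows of the coarse cell start up to two fine rows
  below x.\<close>

definition net :: "nat \<Rightarrow> complex \<Rightarrow> (complex set \<Rightarrow> bool) \<Rightarrow> bool" where
  "net n x = (case cell_of n x of (i, j) \<Rightarrow> grid n (i - 2) (i + 2) (j - 2) (j + 2))"

lemma net_event: "cylinder M (net n x)" "up_event (net n x)"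
  by (auto simp: net_def grid_event split: prod.split)

lemma reach_meets_grid:
  assumes n: "n \<ge> 1" and r: "reach x (2 * real n) \<omega>" and c: "cell_of n x = (i, j)"
    and g: "grid n (i - 1) (i + 1) (j - 1) (j + 1) \<omega>"
  shows "\<exists>a\<in>{i-1..i+1}. \<exists>b\<in>{j-1..j+1}. \<exists>y\<in>cell_net \<omega> n a b. con M \<omega> (rbox M x (2 * real n + R)) x y"
proof -
  obtain vs where vs: "occupied_path M \<omega> vs" "set vs \<subseteq> rbox M x (2 * real n + R)" "hd vs = x" "2 * real n \<le> rnorm M (last vs - x)"
    using r reach_path_event[of "2 * real n" x] by (auto simp: path_event_def)
  note b = cell_of_bounds[OF n c]
  obtain a b y where "a \<in> {i-1..i+1}" "b \<in> {j-1..j+1}" "y \<in> set vs" "y \<in> cell_net \<omega> n a b"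
    using path_leaving_cell[OF n occupied_imp_graph_path[OF vs(1)], of i j \<omega>] b vs g by blast
  then show ?thesis using con_hd[OF vs(1,2), of y] vs(3) by blast
qed

lemma cell_of_triple:
  assumes "n \<ge> 1" "cell_of n x = (i, j)" "cell_of (3 * n) x = (i', j')"
  shows "3 * i' \<le> i" "i \<le> 3 * i' + 2" "3 * j' \<le> j" "j \<le> 3 * j' + 2"
proof -
  have *: "3 * \<lfloor>y / real (3 * n)\<rfloor> \<le> \<lfloor>y / real n\<rfloor>" "\<lfloor>y / real n\<rfloor> \<le> 3 * \<lfloor>y / real (3 * n)\<rfloor> + 2" for y :: real
  proof -
    have e: "y / real n = 3 * (y / real (3 * n))" using assms(1) by simp
    show "3 * \<lfloor>y / real (3 * n)\<rfloor> \<le> \<lfloor>y / real n\<rfloor>" "\<lfloor>y / real n\<rfloor> \<le> 3 * \<lfloor>y / real (3 * n)\<rfloor> + 2"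
      unfolding e by linarith+
  qed
  show "3 * i' \<le> i" "i \<le> 3 * i' + 2" "3 * j' \<le> j" "j \<le> 3 * j' + 2"
    using assms(2,3) *[of "coord1 M x"] *[of "coord2 M x"] by (auto simp: cell_of_def)
qed

text \<open>The horizontal crossing of the coarse cell lives in a strip of height 3n, which is
  exactly the height of a fine vertical crossing starting in row 3 j'; so these two meet.\<close>

lemma net_links_scales:
  assumes n: "n \<ge> 1" and "net n x \<omega>" "net (3 * n) x \<omega>" and c: "cell_of n x = (i, j)" "cell_of (3 * n) x = (i', j')"
    and a: "a \<in> {i-2..i+2}" "b \<in> {j-2..j+2}" "y \<in> cell_net \<omega> n a b"
    and a': "a' \<in> {i'-2..i'+2}" "b' \<in> {j'-2..j'+2}" "z \<in> cell_net \<omega> (3 * n) a' b'"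
  shows "con M \<omega> UNIV y z"
proof -
  have g: "grid n (i - 2) (i + 2) (j - 2) (j + 2) \<omega>" "grid (3 * n) (i' - 2) (i' + 2) (j' - 2) (j' + 2) \<omega>"
    using assms(2,3) c by (auto simp: net_def)
  note t = cell_of_triple[OF n c]
  have "HX (3 * n) i' j' \<omega>" "VX n i (3 * j') \<omega>" using gridD[OF g(1), of i "3 * j'"] gridD[OF g(2), of i' j'] t by auto
  then have "set (hp \<omega> (3 * n) i' j') \<inter> set (vp \<omega> n i (3 * j')) \<noteq> {}"
  proof (intro H_meets_V[OF hp(3) vp(3)])
    show "of_int i' * real (3 * n) \<le> of_int i * real n" using int_mult_le[OF t(1), of "real n"] by simp
    show "of_int (i + 1) * real n \<le> of_int (i' + 3) * real (3 * n)"
      using int_mult_le[of "i + 1" "3 * (i' + 3)" "real n"] t(2) by (simp add: algebra_simps)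
    show "of_int (3 * j') * real n \<le> of_int j' * real (3 * n)" "of_int (j' + 1) * real (3 * n) \<le> of_int (3 * j' + 3) * real n"
      by (simp_all add: algebra_simps)
  qed
  then obtain u where u: "u \<in> cell_net \<omega> n i (3 * j')" "u \<in> cell_net \<omega> (3 * n) i' j'" by (auto simp: cell_net_def)
  have "con M \<omega> (cell_region n (i - 2) (i + 2) (j - 2) (j + 2)) y u"
    by (rule grid_connected[OF g(1) a _ _ u(1)]) (use t in auto)
  moreover have "con M \<omega> (cell_region (3 * n) (i' - 2) (i' + 2) (j' - 2) (j' + 2)) u z"
    by (rule grid_connected[OF g(2) _ _ u(2) a']) auto
  ultimately show ?thesis using con_trans con_mono subset_UNIV by meson
qed

text \<open>By induction on k, x is joined to every vertex of its net at scale 3^k n. At the last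
  scale the right end of the central horizontal crossing is at least two cell widths away from
  x.\<close>

lemma reach_through_nets:
  assumes n: "n \<ge> 1" and r: "reach x (2 * real n) \<omega>" and nets: "\<And>k. k \<le> m \<Longrightarrow> net (3 ^ k * n) x \<omega>"
  shows "reach x (2 * real (3 ^ m * n)) \<omega>"
proof -
  have nk: "3 ^ k * n \<ge> 1" for k using n by simp
  have *: "\<forall>i j. cell_of (3 ^ k * n) x = (i, j) \<longrightarrow> (\<forall>a\<in>{i-2..i+2}. \<forall>b\<in>{j-2..j+2}. \<forall>y\<in>cell_net \<omega> (3 ^ k * n) a b. con M \<omega> UNIV x y)"
    if "k \<le> m" for k
    using that
  proof (induction k)
    case 0
    obtain i j where c: "cell_of n x = (i, j)" by fastforce
    have g: "grid n (i - 2) (i + 2) (j - 2) (j + 2) \<omega>" using nets[of 0] c by (simp add: net_def)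
    obtain a b y where y: "a \<in> {i-1..i+1}" "b \<in> {j-1..j+1}" "y \<in> cell_net \<omega> n a b" "con M \<omega> (rbox M x (2 * real n + R)) x y"
      using reach_meets_grid[OF n r c grid_mono[OF g]] by auto
    have "con M \<omega> UNIV x z" if "a' \<in> {i-2..i+2}" "b' \<in> {j-2..j+2}" "z \<in> cell_net \<omega> n a' b'" for a' b' z
    proof (rule con_trans[OF con_mono[OF y(4)] con_mono[OF grid_connected[OF g _ _ y(3) that]]])
    qed (use y in auto)
    then show ?case using c by simp
  next
    case (Suc k)
    obtain i j where c: "cell_of (3 ^ k * n) x = (i, j)" by fastforce
    have net1: "net (3 ^ k * n) x \<omega>" using nets[of k] Suc.prems by simp
    have net2: "net (3 * (3 ^ k * n)) x \<omega>" using nets[of "Suc k"] Suc.prems by (simp add: mult.assoc)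
    have g: "grid (3 ^ k * n) (i - 2) (i + 2) (j - 2) (j + 2) \<omega>" using net1 c by (simp add: net_def)
    have "hp \<omega> (3 ^ k * n) i j \<noteq> []" using gridD[OF g, of i j] hp_ne by auto
    then obtain y where y: "y \<in> cell_net \<omega> (3 ^ k * n) i j" by (cases "hp \<omega> (3 ^ k * n) i j") (auto simp: cell_net_def)
    have "i \<in> {i-2..i+2}" "j \<in> {j-2..j+2}" by auto
    moreover have "k \<le> m" using Suc.prems by simp
    ultimately have xy: "con M \<omega> UNIV x y" using Suc.IH[rule_format, OF _ c _ _ y] by simp
    have "con M \<omega> UNIV x z" if "cell_of (3 * (3 ^ k * n)) x = (i', j')" "a' \<in> {i'-2..i'+2}" "b' \<in> {j'-2..j'+2}"
      "z \<in> cell_net \<omega> (3 * (3 ^ k * n)) a' b'" for i' j' a' b' z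
      by (rule con_trans[OF xy net_links_scales[OF nk net1 net2 c that(1) _ _ y that(2-4)]]) auto
    then show ?case by (simp add: mult.assoc)
  qed
  obtain i j where c: "cell_of (3 ^ m * n) x = (i, j)" by fastforce
  have "net (3 ^ m * n) x \<omega>" by (rule nets) simp
  then have g: "grid (3 ^ m * n) (i - 2) (i + 2) (j - 2) (j + 2) \<omega>" using c by (simp add: net_def)
  have X: "HX (3 ^ m * n) i j \<omega>" using gridD[OF g, of i j] by simp
  let ?y = "last (hp \<omega> (3 ^ m * n) i j)"
  have "?y \<in> cell_net \<omega> (3 ^ m * n) i j" using hp_ne[OF X] by (simp add: cell_net_def)
  moreover have "i \<in> {i-2..i+2}" "j \<in> {j-2..j+2}" by auto
  ultimately have xy: "con M \<omega> UNIV x ?y" using *[of m] c by blast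
  have "of_int (i + 3) * real (3 ^ m * n) \<le> coord1 M ?y" using hp(3)[OF X] by (simp add: H_path_def h_spans_def)
  moreover have "coord1 M x \<le> of_int (i + 1) * real (3 ^ m * n)" using cell_of_bounds[OF nk c] by simp
  ultimately have "2 * real (3 ^ m * n) \<le> coord1 M (?y - x)" unfolding coord_linear by (simp add: algebra_simps)
  also have "\<dots> \<le> rnorm M (?y - x)" using coord_le_rnorm(1)[of M "?y - x"] by linarith
  finally show ?thesis using reach_con[OF xy] by simp
qed

text \<open>A single row of fine cells, running from the left to the right side of the coarse
  rectangle, is connected. The row is raised by one because the region of a fine cell extends one
  cell below it; up to four further cells above its base and the rounding fit because of 6 n \<le>
  m.\<close>

lemma grid_crosses_larger_cell:
  assumes n: "n \<ge> 1" and nm: "6 * n \<le> m"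
    and k0: "k0 = \<lfloor>of_int a * real m / real n\<rfloor>" and k1: "k1 = \<lceil>of_int (a + 3) * real m / real n\<rceil>" and l: "l = \<lceil>of_int b * real m / real n\<rceil> + 1"
    and g: "grid n k0 k1 l l \<omega>"
  shows "HX m a b \<omega>"
proof -
  have n0: "0 < real n" using n by simp
  have "of_int k0 \<le> of_int a * real m / real n" "of_int a * real m / real n \<le> of_int k0 + 1"
    "of_int (a + 3) * real m / real n \<le> of_int k1" "of_int k1 \<le> of_int (a + 3) * real m / real n + 1"
    "of_int b * real m / real n \<le> of_int (l - 1)" "of_int (l - 1) \<le> of_int b * real m / real n + 1"
    unfolding k0 k1 l by linarith+
  then have b: "of_int k0 * real n \<le> of_int a * real m" "of_int a * real m \<le> of_int k0 * real n + real n"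
    "of_int (a + 3) * real m \<le> of_int k1 * real n" "of_int k1 * real n \<le> of_int (a + 3) * real m + real n"
    "of_int b * real m \<le> of_int (l - 1) * real n" "of_int (l - 1) * real n \<le> of_int b * real m + real n"
    using n0 by (simp_all add: field_simps)
  have nm': "6 * real n \<le> real m" using nm by (metis of_nat_le_iff of_nat_mult of_nat_numeral)
  have "of_int a * real m \<le> of_int (a + 3) * real m" by (rule int_mult_le) simp_all
  then have kk: "k0 \<le> k1" using b n0 by (metis mult_le_cancel_right_pos of_int_le_iff order_trans)
  have X: "HX n k0 l \<omega>" "HX n k1 l \<omega>" using gridD[OF g] kk by auto
  let ?u = "hd (hp \<omega> n k0 l)" and ?v = "last (hp \<omega> n k1 l)"
  have "con M \<omega> (cell_region n k0 k1 l l) ?u ?v"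
    by (rule grid_connected[OF g, of k0 l _ k1 l]) (use kk hp_ne[OF X(1)] hp_ne[OF X(2)] in \<open>auto simp: cell_net_def\<close>)
  then obtain vs where vs: "occupied_path M \<omega> vs" "set vs \<subseteq> cell_region n k0 k1 l l" "hd vs = ?u" "last vs = ?v"
    by (auto simp: con_iff)
  have ends: "coord1 M ?u \<le> of_int k0 * real n" "of_int (k1 + 3) * real n \<le> coord1 M ?v"
    using hp(3)[OF X(1)] hp(3)[OF X(2)] by (auto simp: H_path_def h_spans_def simp del: of_int_add)
  have reg: "of_int (a - 1) * real m \<le> coord1 M v" "coord1 M v \<le> of_int (a + 4) * real m"
    "of_int b * real m \<le> coord2 M v" "coord2 M v \<le> of_int (b + 1) * real m" if "v \<in> set vs" for v
  proof -
    have v: "of_int (k0 - 1) * real n \<le> coord1 M v" "coord1 M v \<le> of_int (k1 + 4) * real n"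
      "of_int (l - 1) * real n \<le> coord2 M v" "coord2 M v \<le> of_int (l + 4) * real n"
      using vs(2) that by (auto simp: cell_region_def simp del: of_int_add of_int_diff)
    show "of_int (a - 1) * real m \<le> coord1 M v" "coord1 M v \<le> of_int (a + 4) * real m"
      "of_int b * real m \<le> coord2 M v" "coord2 M v \<le> of_int (b + 1) * real m"
      using v b nm' by (simp_all add: algebra_simps)
  qed
  have "H_path m a b vs"
    unfolding H_path_def h_spans_def using occupied_imp_graph_path[OF vs(1)] vs(3,4) ends b reg n0
    by (auto simp: algebra_simps)
  moreover have "set vs \<subseteq> cell_region m a a b b"
  proof
    fix v assume v: "v \<in> set vs"
    have "of_int (b - 1) * real m \<le> of_int b * real m" "of_int (b + 1) * real m \<le> of_int (b + 4) * real m"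
      by (intro int_mult_le; simp)+
    then show "v \<in> cell_region m a a b b" using reg[OF v] unfolding cell_region_def by (auto simp del: of_int_add of_int_diff)
  qed
  ultimately show ?thesis unfolding HX_def path_event_def using vs(1) by blast
qed

text \<open>In \<open>crosses\<close> the first and the last vertex may lie outside the
  parallelogram, but each is one edge away from an inner vertex, and R \<le> n puts it within the
  margin of the region. An inner vertex exists because one edge cannot span 3n.\<close>

lemma crosses_imp_H_path:
  assumes n: "R \<le> real n" and vs: "occupied_path M \<omega> vs" "crosses M (lat M (of_int i * real n) (of_int j * real n)) (3 * real n) (real n) vs"
  shows "HX n i j \<omega>"
proof -
  let ?z = "lat M (of_int i * real n) (of_int j * real n)"
  have n0: "1 \<le> real n" using n R(1) by linarith
  have ne: "vs \<noteq> []" using vs by (auto simp: occupied_path_def)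
  have c: "coord1 M (hd vs - ?z) \<le> 0" "3 * real n \<le> coord1 M (last vs - ?z)"
    "\<And>v. v \<in> set vs \<Longrightarrow> 0 \<le> coord2 M (v - ?z) \<and> coord2 M (v - ?z) \<le> real n"
    "\<And>v. v \<in> set (butlast (tl vs)) \<Longrightarrow> 0 \<le> coord1 M (v - ?z) \<and> coord1 M (v - ?z) \<le> 3 * real n"
    using vs(2) by (auto simp: crosses_def)
  have edge: "\<bar>coord1 M (u - ?z) - coord1 M (v - ?z)\<bar> \<le> real n" if "{u, v} \<in> edges M" for u v
    using R(2)[OF that] coord_le_rnorm(1)[of M "u - v"] n by (simp add: coord_linear)
  obtain u ws where ws: "vs = u # ws" using ne by (cases vs) auto
  have "ws \<noteq> []" using c(1,2) n0 unfolding ws by auto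
  then obtain ys w where ys: "vs = u # ys @ [w]" unfolding ws by (cases ws rule: rev_cases) auto
  have succ: "successively (\<lambda>u v. {u, v} \<in> edges M) (u # ys @ [w])" using vs(1) unfolding ys by (simp add: occupied_path_def)
  have "ys \<noteq> []"
  proof
    assume "ys = []"
    then have "{u, w} \<in> edges M" using succ by simp
    from edge[OF this] show False using c(1,2) n0 ys \<open>ys = []\<close> by auto
  qed
  have mid: "butlast (tl vs) = ys" using ys by simp
  have hd_in: "- real n \<le> coord1 M (u - ?z)"
  proof -
    have "{u, hd ys} \<in> edges M" using succ \<open>ys \<noteq> []\<close> by (cases ys) auto
    from edge[OF this] show ?thesis using c(4)[of "hd ys"] \<open>ys \<noteq> []\<close> unfolding mid by auto
  qed
  have last_in: "coord1 M (w - ?z) \<le> 4 * real n"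
  proof -
    have "successively (\<lambda>u v. {u, v} \<in> edges M) ((u # ys) @ [w])" using succ by simp
    then have "{last ys, w} \<in> edges M" using \<open>ys \<noteq> []\<close> unfolding successively_append_iff by simp
    from edge[OF this] show ?thesis using c(4)[of "last ys"] \<open>ys \<noteq> []\<close> unfolding mid by auto
  qed
  have all: "- real n \<le> coord1 M (v - ?z) \<and> coord1 M (v - ?z) \<le> 4 * real n" if "v \<in> set vs" for v
  proof -
    have "v = u \<or> v \<in> set ys \<or> v = w" using that ys by auto
    then show ?thesis using hd_in last_in c(1,2) c(4)[of v] n0 unfolding mid by (auto simp: ys)
  qed
  have "H_path n i j vs"
    using c(1-3) occupied_imp_graph_path[OF vs(1)] unfolding H_path_def h_spans_def coord_linear
    by (auto simp: algebra_simps)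
  moreover have "set vs \<subseteq> cell_region n i i j j"
    using all c(3) unfolding cell_region_def coord_linear by (force simp: algebra_simps)
  ultimately show ?thesis unfolding HX_def path_event_def using vs(1) by blast
qed

end

section \<open>Crossing probabilities\<close>

lemma power_le_fact_exp:
  fixes x :: real assumes "0 \<le> x" shows "x ^ n \<le> fact n * exp x"
proof -
  have "(\<Sum>i\<in>{n}. x ^ i /\<^sub>R fact i) \<le> exp x"
    unfolding exp_def using assms summable_exp_generic[of x] by (intro sum_le_suminf) auto
  then show ?thesis by (simp add: field_simps)
qed

text \<open>With d = exp(-l) the left side is exp(-2^i l), which is below every power of 2^i. The
  power 2k is used because 3^i \<le> (2^i)^2.\<close>

lemma double_exponential_decay:
  fixes d :: real assumes "0 < d" "d < 1"
  shows "\<exists>C\<ge>0. \<forall>i. d ^ (2 ^ i) \<le> C * (1 / 3 ^ i) ^ k"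
proof -
  define l where "l = - ln d"
  have l: "l > 0" "d = exp (- l)" using assms by (auto simp: l_def)
  have "d ^ (2 ^ i) \<le> (fact (2 * k) / l ^ (2 * k)) * (1 / 3 ^ i) ^ k" for i
  proof -
    have "(2 ^ i * l) ^ (2 * k) \<le> fact (2 * k) * exp (2 ^ i * l)" using l by (intro power_le_fact_exp) simp
    moreover have "d ^ (2 ^ i) = exp (- (2 ^ i * l))" unfolding l(2) by (simp add: exp_of_nat_mult[symmetric])
    ultimately have "(2 ^ i * l) ^ (2 * k) * d ^ (2 ^ i) \<le> fact (2 * k) * exp (2 ^ i * l) * exp (- (2 ^ i * l))"
      by (simp only: mult_right_mono exp_ge_zero)
    then have "(2 ^ i * l) ^ (2 * k) * d ^ (2 ^ i) \<le> fact (2 * k)" by (simp only: mult.assoc exp_minus_inverse mult_1_right)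
    moreover have "((3::real) ^ i) ^ k \<le> (2 ^ i) ^ (2 * k)"
    proof -
      have "(3::real) ^ i \<le> 4 ^ i" by (rule power_mono) auto
      also have "\<dots> = (2 ^ i) ^ 2" by (simp add: power_mult[symmetric] power_even_eq[symmetric] power2_eq_square power_mult_distrib[symmetric])
      finally show ?thesis by (simp add: power_mult power_mono)
    qed
    ultimately have "((3::real) ^ i) ^ k * l ^ (2 * k) * d ^ (2 ^ i) \<le> fact (2 * k)"
      using assms l by (smt (verit) mult_right_mono power_mult_distrib zero_le_power)
    then show ?thesis using l by (simp add: field_simps power_divide)
  qed
  moreover have "0 \<le> fact (2 * k) / l ^ (2 * k)" using l by simp
  ultimately show ?thesis by blast
qed

lemma pr_conj_fails:
  assumes "event M A" "event M B"
  shows "1 - pr M q (\<lambda>\<omega>. A \<omega> \<and> B \<omega>) \<le> (1 - pr M q A) + (1 - pr M q B)"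
proof -
  have "pr M q (\<lambda>\<omega>. \<not> (A \<omega> \<and> B \<omega>)) \<le> pr M q (\<lambda>\<omega>. \<not> A \<omega>) + pr M q (\<lambda>\<omega>. \<not> B \<omega>)"
    using pr_disj_le[OF event_not[OF assms(1)] event_not[OF assms(2)], of q] by simp
  then show ?thesis
    using pr_not[OF assms(1), of q] pr_not[OF assms(2), of q] pr_not[OF event_conj[OF assms], of q] by linarith
qed

context planar_percolation
begin

text \<open>The alternative with \<open>rev\<close> serves symmetries that reverse a crossing. The
  premise on S may use the path property because \<open>swap\<close> does not map regions of cells
  into regions of cells, only the vertices of crossings.\<close>

lemma pr_path_event_automorphism:
  assumes \<phi>: "automorphism M \<phi>" and p: "0 \<le> p" "p \<le> 1"
    and fin: "finite (sites M \<inter> S)" "finite (sites M \<inter> S')"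
    and S: "\<And>vs v. P vs \<Longrightarrow> v \<in> set vs \<Longrightarrow> v \<in> S \<Longrightarrow> \<phi> v \<in> S'"
    and P: "\<And>vs. graph_path M vs \<Longrightarrow> P vs \<Longrightarrow> P' (map \<phi> vs) \<or> P' (rev (map \<phi> vs))"
  shows "pr M (\<lambda>_. p) (path_event S P) \<le> pr M (\<lambda>_. p) (path_event S' P')"
proof -
  have q: "prob_field M (\<lambda>_. p)" using p by (simp add: prob_field_def)
  have "pr M (\<lambda>_. p) (path_event S P) = pr M (\<lambda>_. p) (\<lambda>\<omega>. path_event S P (\<omega> \<circ> (`) \<phi>))"
    by (rule pr_automorphism[symmetric, OF automorphism_elements[OF \<phi>] cylinder_path_event[OF fin(1)] q]) simp
  also have "\<dots> \<le> pr M (\<lambda>_. p) (path_event S' P')"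
  proof (rule pr_mono[OF cylinder_event[OF cylinder_path_event[OF fin(2)]]])
    fix \<omega> assume "path_event S P (\<omega> \<circ> (`) \<phi>)"
    then obtain vs where vs: "occupied_path M (\<omega> \<circ> (`) \<phi>) vs" "set vs \<subseteq> S" "P vs" by (auto simp: path_event_def)
    then have occ: "occupied_path M \<omega> (map \<phi> vs)" by (simp add: occupied_path_map[OF \<phi>])
    have sub: "set (map \<phi> vs) \<subseteq> S'" using vs(2) S[OF vs(3)] by auto
    from P[OF occupied_imp_graph_path[OF vs(1)] vs(3)] show "path_event S' P' \<omega>"
    proof
      assume "P' (map \<phi> vs)"
      then show ?thesis using occ sub unfolding path_event_def by blast
    next
      assume "P' (rev (map \<phi> vs))"
      moreover have "set (rev (map \<phi> vs)) \<subseteq> S'" using sub by simp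
      ultimately show ?thesis using occupied_path_rev[OF occ] unfolding path_event_def by blast
    qed
  qed
  finally show ?thesis .
qed

lemma HX_translate:
  assumes "0 \<le> p" "p \<le> 1"
  shows "pr M (\<lambda>_. p) (HX n i j) \<le> pr M (\<lambda>_. p) (HX n i' j')"
  unfolding HX_def
proof (rule pr_path_event_automorphism[OF automorphism_translation[of "(i' - i) * int n" "(j' - j) * int n"] assms finite_cell_region finite_cell_region])
  let ?\<phi> = "\<lambda>z. z + lat M (of_int ((i' - i) * int n)) (of_int ((j' - j) * int n))"
  show "?\<phi> v \<in> cell_region n i' i' j' j'" if "v \<in> cell_region n i i j j" for v
    using that unfolding cell_region_def by (simp add: coord_linear algebra_simps)
  show "H_path n i' j' (map ?\<phi> vs) \<or> H_path n i' j' (rev (map ?\<phi> vs))" if "graph_path M vs" "H_path n i j vs" for vs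
  proof (rule disjI1)
    have "vs \<noteq> []" using that(1) by (auto simp: occupied_path_def)
    then show "H_path n i' j' (map ?\<phi> vs)"
      using that graph_path_map[OF automorphism_translation[of "(i' - i) * int n" "(j' - j) * int n"], of vs]
      unfolding H_path_def h_spans_def by (simp add: hd_map last_map coord_linear algebra_simps)
  qed
qed

text \<open>The indices are those of the preimage under \<open>swap\<close>, which negates and
  exchanges the coordinate ranges [i, i + 1] and [j, j + 3].\<close>

lemma VX_from_HX:
  assumes "0 \<le> p" "p \<le> 1"
  shows "pr M (\<lambda>_. p) (HX n (- (j + 3)) (- (i + 1))) \<le> pr M (\<lambda>_. p) (VX n i j)"
  unfolding HX_def VX_def
proof (rule pr_path_event_automorphism[OF automorphism_swap assms finite_cell_region finite_cell_region])
  show "swap v \<in> cell_region n i i j j" if "H_path n (- (j + 3)) (- (i + 1)) vs" "v \<in> set vs"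
    "v \<in> cell_region n (- (j + 3)) (- (j + 3)) (- (i + 1)) (- (i + 1))" for vs v
    using that unfolding cell_region_def H_path_def h_spans_def by (auto simp: algebra_simps)
  show "V_path n i j (map swap vs) \<or> V_path n i j (rev (map swap vs))" if "graph_path M vs" "H_path n (- (j + 3)) (- (i + 1)) vs" for vs
  proof (rule disjI2)
    have "vs \<noteq> []" using that(1) by (auto simp: occupied_path_def)
    moreover have "graph_path M (rev (map swap vs))" using that(1) graph_path_map[OF automorphism_swap, of vs] by (intro occupied_path_rev) simp
    ultimately show "V_path n i j (rev (map swap vs))"
      using that unfolding H_path_def h_spans_def V_path_def v_spans_def
      by (auto simp: hd_rev last_rev hd_map last_map algebra_simps)
  qed
qed

lemma crossing_prob_le_HX:
  assumes "R \<le> real n"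
  shows "crossing_prob M p (lat M (of_int i * real n) (of_int j * real n)) (3 * real n) (real n) \<le> pr M (\<lambda>_. p) (HX n i j)"
proof -
  have "pr M (\<lambda>_. p) (\<lambda>\<omega>. \<exists>vs. occupied_path M \<omega> vs \<and> crosses M (lat M (of_int i * real n) (of_int j * real n)) (3 * real n) (real n) vs)
      \<le> pr M (\<lambda>_. p) (HX n i j)"
    using crosses_imp_H_path[OF assms] by (intro pr_mono cylinder_event HX_VX_event) blast
  then show ?thesis by (simp add: crossing_prob_def pr_def hom_measure_def)
qed

end

section \<open>Crossing estimates at and above criticality\<close>

context kesten_percolation
begin

text \<open>Constant and inhomogeneous densities alike are at least critical, so the critical lower
  bounds hold for all of them.\<close>

definition field :: "(complex set \<Rightarrow> real) \<Rightarrow> bool" where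
  "field q \<longleftrightarrow> (\<forall>e\<in>elements M. p_c M \<le> q e \<and> q e \<le> 1)"

lemma field_prob_field: "field q \<Longrightarrow> prob_field M q"
  using p_c_bounds by (force simp: field_def prob_field_def)

lemma field_const: "p_c M \<le> p \<Longrightarrow> p \<le> 1 \<Longrightarrow> field (\<lambda>_. p)"
  by (simp add: field_def)

lemma field_const_le:
  assumes "field q" "cylinder M A" "up_event A" shows "pr M (\<lambda>_. p_c M) A \<le> pr M q A"
proof -
  obtain F where F: "finite F" "F \<subseteq> elements M" "supported F A" using assms(2) by (auto simp: cylinder_def)
  have "field (\<lambda>_. p_c M)" using p_c_bounds by (intro field_const) auto
  then show ?thesis
    using assms(1) F(2) by (intro pr_mono_field[OF F assms(3)] field_prob_field) (auto simp: field_def)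
qed

lemma pr_mono_p:
  assumes "p_c M \<le> p" "p \<le> p'" "p' \<le> 1" "cylinder M A" "up_event A"
  shows "pr M (\<lambda>_. p) A \<le> pr M (\<lambda>_. p') A"
proof -
  obtain F where F: "finite F" "F \<subseteq> elements M" "supported F A" using assms(4) by (auto simp: cylinder_def)
  show ?thesis
    using assms by (intro pr_mono_field[OF F assms(5)] field_prob_field field_const) auto
qed

text \<open>The RSW bound at aspect ratio 3, for vertical crossings through \<open>swap\<close>,
  passes from the critical density to every field by monotonicity.\<close>

lemma critical_crossings:
  "\<exists>q0 m0. 0 < q0 \<and> q0 \<le> 1 \<and> 1 \<le> m0 \<and> R \<le> real m0 \<and>
     (\<forall>q n i j. field q \<longrightarrow> m0 \<le> n \<longrightarrow> q0 \<le> pr M q (HX n i j) \<and> q0 \<le> pr M q (VX n i j))"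
proof -
  obtain q0 b0 where q0: "q0 > 0" and rsw3: "\<And>z b. b \<ge> b0 \<Longrightarrow> crossing_prob M (p_c M) z (3 * b) b \<in> {q0..1 - q0}"
    using rsw[of 3] by auto
  define m0 where "m0 = max 1 (max (nat \<lceil>b0\<rceil>) (nat \<lceil>R\<rceil>))"
  have m0: "1 \<le> m0" "b0 \<le> real m0" "R \<le> real m0" unfolding m0_def by linarith+
  have H: "q0 \<le> pr M (\<lambda>_. p_c M) (HX n i j)" if "m0 \<le> n" for n i j
  proof -
    have "real m0 \<le> real n" using that by simp
    then have "R \<le> real n" "b0 \<le> real n" using m0 by linarith+
    then show ?thesis
      using crossing_prob_le_HX[of n "p_c M" i j] rsw3[of "real n" "lat M (of_int i * real n) (of_int j * real n)"] by simp
  qed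
  have V: "q0 \<le> pr M (\<lambda>_. p_c M) (VX n i j)" if "m0 \<le> n" for n i j
    using H[OF that] VX_from_HX[of "p_c M"] p_c_bounds order_trans by (metis less_imp_le)
  have "q0 \<le> 1" using H[of m0 0 0] pr_le_1 order_trans by blast
  then show ?thesis
    using q0 m0 H V field_const_le[OF _ HX_VX_event(1,3)] field_const_le[OF _ HX_VX_event(2,4)] order_trans by meson
qed

lemma crossing_prob_iterate:
  assumes "0 \<le> p" "p \<le> 1" "n \<ge> 1" "0 < d" "d < 1" "crossing_prob M p 0 (3 * real n) (real n) > 1 - c * d"
  shows "crossing_prob M p 0 (3 * real (3 ^ i * n)) (real (3 ^ i * n)) > 1 - c * d ^ (2 ^ i)"
proof (induction i)
  case 0
  then show ?case using assms by simp
next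
  case (Suc i)
  have "crossing_prob M p 0 (9 * real (3 ^ i * n)) (3 * real (3 ^ i * n)) > 1 - c * (d ^ (2 ^ i))\<^sup>2"
    using assms Suc by (intro suitable_constant) (auto simp: power_less_one_iff)
  then show ?case by (simp add: power_mult[symmetric] mult_ac)
qed

text \<open>If c > 1, then d = 1 / sqrt c satisfies d < 1 and c d > 1, so the premise of the
  rescaling inequality holds trivially at scale 1 even at criticality. Iterating it would drive
  critical crossing probabilities to 1, against RSW.\<close>

lemma c_le_1: "c \<le> 1"
proof (rule ccontr)
  assume "\<not> c \<le> 1"
  then have c1: "c > 1" by simp
  define d where "d = 1 / sqrt c"
  have d: "0 < d" "d < 1" "c * d > 1"
  proof -
    show "0 < d" using c1 by (simp add: d_def)
    show "d < 1" using c1 by (simp add: d_def)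
    have "c * d = sqrt c" using c1 by (simp add: d_def real_div_sqrt)
    then show "c * d > 1" using c1 by simp
  qed
  obtain q0 b0 where q0: "q0 > 0" and rsw3: "\<And>z b. b \<ge> b0 \<Longrightarrow> crossing_prob M (p_c M) z (3 * b) b \<in> {q0..1 - q0}"
    using rsw[of 3] by auto
  have "crossing_prob M (p_c M) 0 (3 * real 1) (real 1) \<ge> 0" by (simp add: crossing_prob_def)
  then have base: "crossing_prob M (p_c M) 0 (3 * real 1) (real 1) > 1 - c * d" using d by linarith
  have it: "crossing_prob M (p_c M) 0 (3 * real (3 ^ i * 1)) (real (3 ^ i * 1)) > 1 - c * d ^ (2 ^ i)" for i
    using p_c_bounds d base by (intro crossing_prob_iterate) auto
  obtain C where C: "\<And>i. d ^ (2 ^ i) \<le> C * (1 / 3 ^ i) ^ 1" using double_exponential_decay[OF d(1,2), of 1] by auto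
  have "(\<lambda>i. c * (C * (1 / 3) ^ i)) \<longlonglongrightarrow> c * (C * 0)" by (intro tendsto_intros LIMSEQ_realpow_zero) auto
  then have "\<forall>\<^sub>F i in sequentially. c * (C * (1 / 3) ^ i) < q0" using q0 by (simp add: order_tendstoD)
  moreover obtain N where N: "b0 < 3 ^ N" using real_arch_pow[of 3 b0] by auto
  have "\<forall>\<^sub>F i in sequentially. b0 \<le> 3 ^ i"
  proof (rule eventually_sequentiallyI[of N])
    fix i assume "N \<le> i"
    then have "(3::real) ^ N \<le> 3 ^ i" by (intro power_increasing) auto
    then show "b0 \<le> 3 ^ i" using N by linarith
  qed
  ultimately have "\<forall>\<^sub>F i in sequentially. c * (C * (1 / 3) ^ i) < q0 \<and> b0 \<le> 3 ^ i" by (rule eventually_conj)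
  then obtain i where i: "c * (C * (1 / 3) ^ i) < q0" "b0 \<le> 3 ^ i" by (auto simp: eventually_sequentially)
  have "c * d ^ (2 ^ i) \<le> c * (C * (1 / 3) ^ i)" using mult_left_mono[OF C[of i], of c] c1 by (simp add: power_divide)
  then have "crossing_prob M (p_c M) 0 (3 * 3 ^ i) (3 ^ i) > 1 - q0" using it[of i] i(1) by simp
  then show False using rsw3[OF i(2), of 0] by simp
qed

abbreviation L :: "real \<Rightarrow> nat" where "L p \<equiv> fs_length M c \<delta> p"

lemma fs_length:
  assumes "p_c M < p" "p \<le> 1"
  shows "1 \<le> L p" "crossing_prob M p 0 (3 * real (L p)) (real (L p)) > 1 - c * \<delta>"
  using LeastI_ex[OF fs_length_exists[OF assms, unfolded Bex_def]] unfolding fs_length_def by auto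

lemma supercritical_crossing:
  assumes p: "p_c M < p" "p \<le> 1" and n: "R \<le> real (3 ^ i * L p)"
  shows "1 - \<delta> ^ (2 ^ i) \<le> pr M (\<lambda>_. p) (HX (3 ^ i * L p) a b)" "1 - \<delta> ^ (2 ^ i) \<le> pr M (\<lambda>_. p) (VX (3 ^ i * L p) a b)"
proof -
  have p01: "0 \<le> p" "p \<le> 1" using p p_c_bounds by auto
  have "1 - c * \<delta> ^ (2 ^ i) < crossing_prob M p 0 (3 * real (3 ^ i * L p)) (real (3 ^ i * L p))"
    using crossing_prob_iterate[OF p01 fs_length(1)[OF p] delta fs_length(2)[OF p]] .
  moreover have "c * \<delta> ^ (2 ^ i) \<le> \<delta> ^ (2 ^ i)" using c_le_1 delta by (simp add: mult_left_le_one_le c_pos less_imp_le)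
  moreover have "lat M (of_int 0 * real (3 ^ i * L p)) (of_int 0 * real (3 ^ i * L p)) = 0" by (simp add: lat_def)
  ultimately have "1 - \<delta> ^ (2 ^ i) \<le> pr M (\<lambda>_. p) (HX (3 ^ i * L p) 0 0)"
    using crossing_prob_le_HX[OF n, of p 0 0] by simp
  then show "1 - \<delta> ^ (2 ^ i) \<le> pr M (\<lambda>_. p) (HX (3 ^ i * L p) a b)" for a b
    using HX_translate[OF p01] order_trans by blast
  then show "1 - \<delta> ^ (2 ^ i) \<le> pr M (\<lambda>_. p) (VX (3 ^ i * L p) a b)"
    using VX_from_HX[OF p01] order_trans by blast
qed

lemma grid_fails_le:
  assumes "\<And>a b. a \<in> {i0..i1} \<Longrightarrow> b \<in> {j0..j1} \<Longrightarrow> 1 - pr M q (HX n a b) \<le> \<eta> \<and> 1 - pr M q (VX n a b) \<le> \<eta>"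
  shows "1 - pr M q (grid n i0 i1 j0 j1) \<le> 2 * real (card ({i0..i1} \<times> {j0..j1})) * \<eta>"
proof -
  let ?A = "\<lambda>p \<omega>. HX n (fst p) (snd p) \<omega> \<and> VX n (fst p) (snd p) \<omega>"
  have ev: "event M (?A p)" for p by (intro cylinder_event cylinder_conj HX_VX_event)
  have eq: "grid n i0 i1 j0 j1 = (\<lambda>\<omega>. \<forall>p\<in>{i0..i1} \<times> {j0..j1}. ?A p \<omega>)" by (auto simp: grid_def fun_eq_iff)
  have "1 - pr M q (?A p) \<le> 2 * \<eta>" if "p \<in> {i0..i1} \<times> {j0..j1}" for p
  proof -
    have "1 - pr M q (?A p) \<le> (1 - pr M q (HX n (fst p) (snd p))) + (1 - pr M q (VX n (fst p) (snd p)))"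
      by (intro pr_conj_fails cylinder_event HX_VX_event)
    then show ?thesis using assms[of "fst p" "snd p"] that by auto
  qed
  then have "(\<Sum>p\<in>{i0..i1} \<times> {j0..j1}. (1 - pr M q (?A p))) \<le> (\<Sum>p\<in>{i0..i1} \<times> {j0..j1}. 2 * \<eta>)" by (rule sum_mono)
  also have "\<dots> = 2 * real (card ({i0..i1} \<times> {j0..j1})) * \<eta>" by simp
  finally show ?thesis using pr_ball_ge[of "{i0..i1} \<times> {j0..j1}" M ?A q] ev unfolding eq by simp
qed

text \<open>For crossings that are merely bounded below the union bound is void; FKG supplies the
  product instead.\<close>

lemma grid_ge_power:
  assumes "field q" "0 \<le> q0" "\<And>a b. a \<in> {i0..i1} \<Longrightarrow> b \<in> {j0..j1} \<Longrightarrow> q0 \<le> pr M q (HX n a b) \<and> q0 \<le> pr M q (VX n a b)"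
  shows "(q0\<^sup>2) ^ card ({i0..i1} \<times> {j0..j1}) \<le> pr M q (grid n i0 i1 j0 j1)"
proof -
  let ?A = "\<lambda>p \<omega>. HX n (fst p) (snd p) \<omega> \<and> VX n (fst p) (snd p) \<omega>"
  have eq: "grid n i0 i1 j0 j1 = (\<lambda>\<omega>. \<forall>p\<in>{i0..i1} \<times> {j0..j1}. ?A p \<omega>)" by (auto simp: grid_def fun_eq_iff)
  have "q0\<^sup>2 \<le> pr M q (?A p)" if "p \<in> {i0..i1} \<times> {j0..j1}" for p
  proof -
    have "q0 * q0 \<le> pr M q (HX n (fst p) (snd p)) * pr M q (VX n (fst p) (snd p))"
      using assms(2) assms(3)[of "fst p" "snd p"] that by (intro mult_mono) auto
    also have "\<dots> \<le> pr M q (?A p)" by (intro Harris_FKG HX_VX_event field_prob_field assms(1))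
    finally show ?thesis by (simp add: power2_eq_square)
  qed
  then have "(\<Prod>p\<in>{i0..i1} \<times> {j0..j1}. q0\<^sup>2) \<le> (\<Prod>p\<in>{i0..i1} \<times> {j0..j1}. pr M q (?A p))"
    by (intro prod_mono) auto
  also have "\<dots> \<le> pr M q (grid n i0 i1 j0 j1)"
    unfolding eq by (intro FKG_ball cylinder_conj up_event_conj HX_VX_event field_prob_field assms(1)) auto
  finally show ?thesis by simp
qed

text \<open>The iterated rescaling inequality only speaks about the scales 3^i L(p). A general m is
  served by the largest such n with 9 n \<le> m, through a row of cells of scale n. For m up to 27 R
  L(p) the right side is at least 1.\<close>

lemma crossing_decay_L:
  "\<exists>C\<ge>0. \<forall>p m a b. p_c M < p \<longrightarrow> p \<le> 1 \<longrightarrow> 1 \<le> m \<longrightarrow> 1 - pr M (\<lambda>_. p) (HX m a b) \<le> C * (real (L p) / real m) ^ k"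
proof -
  obtain C0 where C0: "0 \<le> C0" "\<And>i. \<delta> ^ (2 ^ i) \<le> C0 * (1 / 3 ^ i) ^ k"
    using double_exponential_decay[OF delta, of k] by auto
  define C where "C = (27 * R) ^ k + 2 * 84 * C0 * 27 ^ k"
  have R0: "1 \<le> 27 * R" using R(1) by simp
  have C_nonneg: "0 \<le> C" using C0(1) R0 by (simp add: C_def)
  have "1 - pr M (\<lambda>_. p) (HX m a b) \<le> C * (real (L p) / real m) ^ k" if p: "p_c M < p" "p \<le> 1" and m: "1 \<le> m" for p m a b
  proof -
    let ?L = "real (L p)"
    have L1: "1 \<le> ?L" using fs_length(1)[OF p] by simp
    have trivial: ?thesis if "real m \<le> 27 * R * ?L"
    proof -
      have "1 \<le> 27 * R * (?L / real m)" using that m by (simp add: field_simps)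
      then have "1 \<le> (27 * R * (?L / real m)) ^ k" by (rule one_le_power)
      also have "\<dots> = (27 * R) ^ k * (?L / real m) ^ k" by (rule power_mult_distrib)
      also have "\<dots> \<le> C * (?L / real m) ^ k" using C0(1) by (intro mult_right_mono) (auto simp: C_def)
      finally show ?thesis by (smt (verit) pr_nonneg)
    qed
    show ?thesis
    proof (cases "real m \<le> 27 * R * ?L")
      case False
      then have big: "27 * R * ?L < real m" by simp
      have "27 * 1 * 1 \<le> 27 * R * ?L" using R(1) L1 by (intro mult_mono) auto
      define Q where "Q = (\<lambda>i. 9 * (3 ^ i * L p) \<le> m)"
      have Q0: "Q 0"
      proof -
        have "9 * ?L \<le> 27 * R * ?L" using R(1) L1 by (intro mult_right_mono) auto
        then have "9 * ?L \<le> real m" using big by linarith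
        then show ?thesis unfolding Q_def by (metis mult.left_neutral of_nat_le_iff of_nat_mult of_nat_numeral power_0)
      qed
      have bound: "i \<le> m" if "Q i" for i
      proof -
        have "i < 3 ^ i" by (rule less_exp[THEN less_le_trans]) (auto intro: power_mono)
        also have "\<dots> \<le> 9 * (3 ^ i * L p)" using fs_length(1)[OF p] by simp
        finally show ?thesis using that unfolding Q_def by simp
      qed
      define i where "i = (GREATEST i. Q i)"
      have Qi: "Q i" unfolding i_def by (rule GreatestI_nat[of Q 0 m]) (use Q0 bound in auto)
      have nQ: "\<not> Q (Suc i)" using Greatest_le_nat[of Q "Suc i" m] bound unfolding i_def[symmetric] by auto
      define n where "n = 3 ^ i * L p"
      have n: "9 * n \<le> m" "m < 27 * n" "1 \<le> n" using Qi nQ fs_length(1)[OF p] unfolding Q_def n_def by auto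
      then have nr: "9 * real n \<le> real m" "real m < 27 * real n" "0 < real n" by linarith+
      have Rn: "R \<le> real n"
      proof -
        have "27 * R * 1 \<le> 27 * R * ?L" using R(1) L1 by (intro mult_left_mono) auto
        then show ?thesis using big nr(2) by linarith
      qed
      define k0 k1 l where "k0 = \<lfloor>of_int a * real m / real n\<rfloor>" "k1 = \<lceil>of_int (a + 3) * real m / real n\<rceil>" "l = \<lceil>of_int b * real m / real n\<rceil> + 1"
      have "1 - pr M (\<lambda>_. p) (HX m a b) \<le> 1 - pr M (\<lambda>_. p) (grid n k0 k1 l l)"
        using n grid_crosses_larger_cell[of n m k0 a k1 l b] k0_k1_l_def
        by (intro diff_left_mono pr_mono cylinder_event HX_VX_event) auto
      also have "\<dots> \<le> 2 * real (card ({k0..k1} \<times> {l..l})) * \<delta> ^ (2 ^ i)"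
      proof (rule grid_fails_le)
        fix a b
        show "1 - pr M (\<lambda>_. p) (HX n a b) \<le> \<delta> ^ (2 ^ i) \<and> 1 - pr M (\<lambda>_. p) (VX n a b) \<le> \<delta> ^ (2 ^ i)"
          using supercritical_crossing[OF p Rn[unfolded n_def], of a b] unfolding n_def by linarith
      qed
      also have "\<dots> \<le> 2 * 84 * \<delta> ^ (2 ^ i)"
      proof -
        \<comment> \<open>Since m < 27 n, the row extends over fewer than 3 * 27 + 2 index steps,
          hence at most 84 cells.\<close>
        have "of_int k1 - of_int k0 \<le> of_int (a + 3) * real m / real n + 1 - (of_int a * real m / real n - 1)"
          unfolding k0_k1_l_def by linarith
        also have "\<dots> = 3 * (real m / real n) + 2" by (simp add: algebra_simps add_divide_distrib)
        also have "\<dots> < 83" using nr by (simp add: field_simps)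
        finally have "real (card ({k0..k1} \<times> {l..l})) \<le> 84" by (simp add: card_cartesian_product)
        then show ?thesis using delta by (intro mult_right_mono) auto
      qed
      also have "\<dots> \<le> 2 * 84 * (C0 * (1 / 3 ^ i) ^ k)" using C0(2)[of i] by simp
      also have "\<dots> \<le> 2 * 84 * (C0 * (27 * (?L / real m)) ^ k)"
      proof -
        have "1 / 3 ^ i \<le> 27 * (?L / real m)" using nr m unfolding n_def by (simp add: field_simps)
        then show ?thesis using C0(1) by (intro mult_left_mono power_mono) auto
      qed
      also have "\<dots> = (2 * 84 * C0 * 27 ^ k) * (?L / real m) ^ k" by (simp only: power_mult_distrib mult.assoc)
      also have "\<dots> \<le> C * (?L / real m) ^ k" using R0 by (intro mult_right_mono) (auto simp: C_def)
      finally show ?thesis .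
    qed (rule trivial)
  qed
  then show ?thesis using C_nonneg by blast
qed

text \<open>Existence by the intermediate value theorem between p = 1, where the correlation length
  is 0, and some p near the threshold where it exceeds r; uniqueness by strict monotonicity.\<close>

lemma alpha:
  assumes "0 \<le> r"
  shows "0 < alpha M r" "p_c M + alpha M r \<le> 1" "corr_length M (p_c M + alpha M r) = r"
proof -
  have one: "corr_length M 1 = 0" by (simp add: corr_length_def)
  have ex: "\<exists>p. p_c M < p \<and> p \<le> 1 \<and> corr_length M p = r"
  proof -
    have "\<forall>\<^sub>F p in at_right (p_c M). r \<le> corr_length M p" using corr_length_diverges by (simp add: filterlim_at_top)
    moreover have "\<forall>\<^sub>F p in at_right (p_c M). p_c M < p \<and> p < 1"
      using p_c_bounds eventually_at_right[of "p_c M" 1] by auto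
    ultimately have "\<forall>\<^sub>F p in at_right (p_c M). r \<le> corr_length M p \<and> p_c M < p \<and> p < 1" by (rule eventually_conj)
    then obtain p where p: "r \<le> corr_length M p" "p_c M < p" "p < 1"
      using eventually_happens'[OF trivial_limit_at_right_real] by blast
    have "continuous_on {p..1} (corr_length M)" by (rule continuous_on_subset[OF corr_length_continuous]) (use p in auto)
    then obtain x where "p \<le> x" "x \<le> 1" "corr_length M x = r"
      using IVT2'[of "corr_length M" 1 r p] p one assms by auto
    then show ?thesis using p by (intro exI[of _ x]) auto
  qed
  have inj: "p = p'" if "p_c M < p" "p \<le> 1" "p_c M < p'" "p' \<le> 1" "corr_length M p = corr_length M p'" for p p'
    using corr_length_decreasing[of p p'] corr_length_decreasing[of p' p] that by (cases p p' rule: linorder_cases) auto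
  have "\<exists>!a. a \<in> {0<..1 - p_c M} \<and> corr_length M (p_c M + a) = r"
  proof -
    obtain p where "p_c M < p" "p \<le> 1" "corr_length M p = r" using ex by blast
    note p = this
    show ?thesis
    proof (rule ex1I[of _ "p - p_c M"])
      fix a assume "a \<in> {0<..1 - p_c M} \<and> corr_length M (p_c M + a) = r"
      then show "a = p - p_c M" using inj[of "p_c M + a" p] p by auto
    qed (use p in auto)
  qed
  from theI'[OF this] have "alpha M r \<in> {0<..1 - p_c M} \<and> corr_length M (p_c M + alpha M r) = r" unfolding alpha_def .
  then show "0 < alpha M r" "p_c M + alpha M r \<le> 1" "corr_length M (p_c M + alpha M r) = r" by auto
qed

text \<open>The density with correlation length r. Near-critical estimates are stated in terms of r,
  in which densities decrease.\<close>

definition pp :: "real \<Rightarrow> real" where "pp r = p_c M + alpha M r"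

lemma pp: "0 \<le> r \<Longrightarrow> p_c M < pp r" "0 \<le> r \<Longrightarrow> pp r \<le> 1" "0 \<le> r \<Longrightarrow> corr_length M (pp r) = r"
  using alpha by (auto simp: pp_def)

lemma pp_antimono: "0 \<le> r \<Longrightarrow> r \<le> r' \<Longrightarrow> pp r' \<le> pp r"
  using corr_length_decreasing[of "pp r" "pp r'"] pp[of r] pp[of r'] by (cases "pp r' \<le> pp r") auto

text \<open>Comparability of the two lengths is available near the threshold only, which means for r
  beyond some \<open>r0\<close>.\<close>

lemma fs_length_pp: "\<exists>Ca Cb r0. 0 < Ca \<and> 0 < Cb \<and> 1 \<le> r0 \<and> (\<forall>r\<ge>r0. Ca * r \<le> real (L (pp r)) \<and> real (L (pp r)) \<le> Cb * r)"
proof -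
  obtain Ca Cb where Ca: "0 < Ca" and ev: "\<forall>\<^sub>F p in at_right (p_c M). Ca * corr_length M p \<le> real (L p) \<and> real (L p) \<le> Cb * corr_length M p"
    using lengths_comparable by blast
  obtain b where b: "p_c M < b" "\<And>p. p_c M < p \<Longrightarrow> p < b \<Longrightarrow> Ca * corr_length M p \<le> real (L p) \<and> real (L p) \<le> Cb * corr_length M p"
    using ev unfolding eventually_at_right_field by blast
  define p0 where "p0 = min 1 b"
  have p0: "p_c M < p0" "p0 \<le> 1" "p0 \<le> b" using b p_c_bounds by (auto simp: p0_def)
  define r0 where "r0 = max 1 (corr_length M p0 + 1)"
  have "Ca * r \<le> real (L (pp r)) \<and> real (L (pp r)) \<le> Cb * r" if "r \<ge> r0" for r
  proof -
    have r: "0 \<le> r" "corr_length M p0 < r" using that by (auto simp: r0_def)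
    have "pp r < p0"
    proof (rule ccontr)
      assume "\<not> pp r < p0"
      then have "corr_length M (pp r) \<le> corr_length M p0"
        using corr_length_decreasing[of p0 "pp r"] p0 pp(2)[OF r(1)] by (cases "pp r = p0") auto
      then show False using pp(3)[OF r(1)] r(2) by simp
    qed
    then show ?thesis using b(2)[of "pp r"] p0(3) pp[OF r(1)] by auto
  qed
  note * = this
  have "0 < Cb"
  proof -
    have r0: "r0 \<ge> 1" by (simp add: r0_def)
    then have "0 < Ca * r0" using Ca by simp
    also have "\<dots> \<le> Cb * r0" using *[of r0] by simp
    finally show ?thesis using r0 by (simp add: zero_less_mult_iff)
  qed
  moreover have "1 \<le> r0" by (simp add: r0_def)
  ultimately show ?thesis using Ca * by blast
qed

text \<open>For r \<ge> r0 the length L is at most a multiple of r. For smaller r the density is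
  lowered to \<open>pp r0\<close>, whose L is a constant.\<close>

lemma crossing_decay:
  "\<exists>C\<ge>0. \<forall>r p m a b. 1 \<le> r \<longrightarrow> pp r \<le> p \<longrightarrow> p \<le> 1 \<longrightarrow> 1 \<le> m \<longrightarrow>
     1 - pr M (\<lambda>_. p) (HX m a b) \<le> C * (r / real m) ^ k \<and> 1 - pr M (\<lambda>_. p) (VX m a b) \<le> C * (r / real m) ^ k"
proof -
  obtain C where C: "0 \<le> C" "\<And>p m a b. p_c M < p \<Longrightarrow> p \<le> 1 \<Longrightarrow> 1 \<le> m \<Longrightarrow> 1 - pr M (\<lambda>_. p) (HX m a b) \<le> C * (real (L p) / real m) ^ k"
    using crossing_decay_L[of k] by blast
  obtain Cb r0 where Cb: "0 < Cb" "1 \<le> r0" "\<And>r. r \<ge> r0 \<Longrightarrow> real (L (pp r)) \<le> Cb * r" using fs_length_pp by blast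
  define D where "D = max Cb (real (L (pp r0)))"
  have H: "1 - pr M (\<lambda>_. p) (HX m a b) \<le> C * D ^ k * (r / real m) ^ k" if r: "1 \<le> r" "pp r \<le> p" "p \<le> 1" "1 \<le> m" for r p m a b
  proof -
    define r' where "r' = max r r0"
    have r': "0 \<le> r'" "pp r' \<le> p" "real (L (pp r')) \<le> D * r"
    proof -
      show "0 \<le> r'" using r by (simp add: r'_def)
      show "pp r' \<le> p" using pp_antimono[of r r'] r by (simp add: r'_def)
      show "real (L (pp r')) \<le> D * r"
      proof (cases "r0 \<le> r")
        case True
        then have "real (L (pp r')) \<le> Cb * r" using Cb(3)[of r] by (simp add: r'_def max_absorb1)
        also have "\<dots> \<le> D * r" using r by (intro mult_right_mono) (auto simp: D_def)
        finally show ?thesis .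
      next
        case False
        then have "real (L (pp r')) \<le> D * 1" by (simp add: r'_def D_def)
        also have "\<dots> \<le> D * r" using r Cb(1) by (intro mult_left_mono) (auto simp: D_def)
        finally show ?thesis .
      qed
    qed
    have "1 - pr M (\<lambda>_. p) (HX m a b) \<le> 1 - pr M (\<lambda>_. pp r') (HX m a b)"
      using r' r pp[OF r'(1)] by (intro diff_left_mono pr_mono_p HX_VX_event) auto
    also have "\<dots> \<le> C * (real (L (pp r')) / real m) ^ k" using pp[OF r'(1)] r by (intro C) auto
    also have "\<dots> \<le> C * (D * r / real m) ^ k" using r' C(1) r by (intro mult_left_mono power_mono divide_right_mono) auto
    also have "\<dots> = C * D ^ k * (r / real m) ^ k" by (simp add: power_mult_distrib power_divide)
    finally show ?thesis .
  qed
  have V: "1 - pr M (\<lambda>_. p) (VX m a b) \<le> C * D ^ k * (r / real m) ^ k" if r: "1 \<le> r" "pp r \<le> p" "p \<le> 1" "1 \<le> m" for r p m a b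
  proof -
    have "0 \<le> p" using r pp(1)[of r] p_c_bounds by simp
    then show ?thesis using H[OF r, of "- (b + 3)" "- (a + 1)"] VX_from_HX[of p m b a] r(3) by linarith
  qed
  have "0 \<le> C * D ^ k" using C(1) Cb(1) by (simp add: D_def)
  then show ?thesis using H V by blast
qed

end

context planar_percolation
begin

section \<open>Reaching a distance and reaching infinity\<close>

lemma con_sites: "con M \<omega> S x y \<Longrightarrow> x \<in> sites M \<and> y \<in> sites M"
  unfolding con_iff occupied_path_def by (auto simp: subset_iff)

text \<open>By local finiteness a cluster is infinite exactly when it is unbounded; percolation thus
  becomes a decreasing limit of cylinder events.\<close>

lemma connected_to_infinity_iff: "connected_to_infinity M \<omega> x \<longleftrightarrow> (\<forall>n::nat. reach x (real n) \<omega>)"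
proof
  assume inf: "connected_to_infinity M \<omega> x"
  show "\<forall>n::nat. reach x (real n) \<omega>"
  proof
    fix n :: nat
    show "reach x (real n) \<omega>"
    proof (rule ccontr)
      assume *: "\<not> reach x (real n) \<omega>"
      have "{v. con M \<omega> UNIV x v} \<subseteq> sites M \<inter> rbox M x (real n)"
      proof
        fix v assume v: "v \<in> {v. con M \<omega> UNIV x v}"
        then have "\<not> real n \<le> rnorm M (v - x)" using reach_con[of \<omega> UNIV x v "real n"] * by blast
        then show "v \<in> sites M \<inter> rbox M x (real n)" using v con_sites[of \<omega> UNIV x v] by (auto simp: rbox_def)
      qed
      then show False using inf finite_sites_rbox finite_subset unfolding connected_to_infinity_def by blast
    qed
  qed
next
  assume r: "\<forall>n::nat. reach x (real n) \<omega>"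
  show "connected_to_infinity M \<omega> x"
    unfolding connected_to_infinity_def
  proof
    assume fin: "finite {v. con M \<omega> UNIV x v}"
    define B where "B = Max (insert 0 ((\<lambda>v. rnorm M (v - x)) ` {v. con M \<omega> UNIV x v}))"
    obtain n :: nat where n: "B < real n" using reals_Archimedean2 by blast
    obtain vs where vs: "occupied_path M \<omega> vs" "hd vs = x" "real n \<le> rnorm M (last vs - x)" using r by (auto simp: reach_def)
    have "con M \<omega> UNIV x (last vs)" using vs by (auto simp: con_iff)
    then have "rnorm M (last vs - x) \<le> B" unfolding B_def using fin by (intro Max_ge) auto
    then show False using vs(3) n by linarith
  qed
qed

lemma event_infinite: "event M (\<lambda>\<omega>. connected_to_infinity M \<omega> x)"
proof -
  have "event M (\<lambda>\<omega>. \<forall>n\<in>(UNIV::nat set). reach x (real n) \<omega>)"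
    by (intro event_ball cylinder_event reach_event) auto
  then show ?thesis by (simp add: connected_to_infinity_iff)
qed

lemma pr_reach_lim: "(\<lambda>n. pr M q (reach x (real n))) \<longlonglongrightarrow> pr M q (\<lambda>\<omega>. connected_to_infinity M \<omega> x)"
  unfolding connected_to_infinity_iff
proof (rule pr_lim_decreasing)
  show "event M (reach x (real n))" for n by (intro cylinder_event reach_event) simp
  show "reach x (real n) \<omega>" if "reach x (real (Suc n)) \<omega>" for n \<omega> using that by (rule reach_antimono) simp
qed

lemma pr_infinite_le_reach: "0 \<le> d \<Longrightarrow> pr M q (\<lambda>\<omega>. connected_to_infinity M \<omega> x) \<le> pr M q (reach x d)"
proof (rule pr_mono)
  fix \<omega> assume "connected_to_infinity M \<omega> x"
  then show "reach x d \<omega>" unfolding connected_to_infinity_iff using reach_antimono real_nat_ceiling_ge by blast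
qed (intro cylinder_event reach_event)

lemma pr_reach_antimono: "0 \<le> d' \<Longrightarrow> d' \<le> d \<Longrightarrow> pr M q (reach x d) \<le> pr M q (reach x d')"
  by (intro pr_mono cylinder_event reach_event) (auto elim: reach_antimono)

lemma reach_translate:
  assumes p: "0 \<le> p" "p \<le> 1" and d: "0 \<le> d"
  shows "pr M (\<lambda>_. p) (reach (lat M (of_int i) (of_int j)) d) = pr M (\<lambda>_. p) (reach 0 d)"
proof -
  have le: "pr M (\<lambda>_. p) (reach x d) \<le> pr M (\<lambda>_. p) (reach (x + lat M (of_int k) (of_int l)) d)" for x k l
    unfolding reach_path_event[OF d]
  proof (rule pr_path_event_automorphism[OF automorphism_translation[of k l] p finite_sites_rbox finite_sites_rbox])
    show "v + lat M (of_int k) (of_int l) \<in> rbox M (x + lat M (of_int k) (of_int l)) (d + R)" if "v \<in> rbox M x (d + R)" for v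
      using that by (simp add: rbox_def)
    fix vs assume "graph_path M vs" "hd vs = x \<and> d \<le> rnorm M (last vs - x)"
    moreover from this(1) have "vs \<noteq> []" by (auto simp: occupied_path_def)
    ultimately have "hd (map (\<lambda>z. z + lat M (of_int k) (of_int l)) vs) = x + lat M (of_int k) (of_int l)
       \<and> d \<le> rnorm M (last (map (\<lambda>z. z + lat M (of_int k) (of_int l)) vs) - (x + lat M (of_int k) (of_int l)))"
      by (simp add: hd_map last_map)
    then show "hd (map (\<lambda>z. z + lat M (of_int k) (of_int l)) vs) = x + lat M (of_int k) (of_int l)
       \<and> d \<le> rnorm M (last (map (\<lambda>z. z + lat M (of_int k) (of_int l)) vs) - (x + lat M (of_int k) (of_int l))) \<or>
       hd (rev (map (\<lambda>z. z + lat M (of_int k) (of_int l)) vs)) = x + lat M (of_int k) (of_int l)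
       \<and> d \<le> rnorm M (last (rev (map (\<lambda>z. z + lat M (of_int k) (of_int l)) vs)) - (x + lat M (of_int k) (of_int l)))" by blast
  qed
  have "lat M (of_int i) (of_int j) + lat M (of_int (- i)) (of_int (- j)) = 0" by (simp add: lat_def)
  then show ?thesis using le[of 0 i j] le[of "lat M (of_int i) (of_int j)" "- i" "- j"] by simp
qed

lemma occupied_if_elements_open:
  assumes "graph_path M vs" "\<And>e. e \<in> elements M \<Longrightarrow> e \<subseteq> set vs \<Longrightarrow> \<omega> e"
  shows "occupied_path M \<omega> vs"
proof (rule occupied_path_local[OF assms(1), of "set vs"])
  show "(\<lambda>_. True) e = \<omega> e" if "e \<in> elems (set vs)" for e using that assms(2) by (simp add: elems_def)
qed simp

lemma card_elems_path:
  assumes "length vs \<le> K" shows "card (elems (set vs)) \<le> K\<^sup>2"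
proof -
  have "elems (set vs) \<subseteq> (\<lambda>(a, b). {a, b}) ` (set vs \<times> set vs)"
  proof
    fix e assume "e \<in> elems (set vs)"
    then have "e \<in> elements M" "e \<subseteq> set vs" by (auto simp: elems_def)
    then show "e \<in> (\<lambda>(a, b). {a, b}) ` (set vs \<times> set vs)" by (auto elim!: element_form)
  qed
  then have "card (elems (set vs)) \<le> card (set vs \<times> set vs)" by (intro surj_card_le) auto
  also have "\<dots> \<le> K * K" using assms card_length[of vs] by (simp add: card_cartesian_product mult_mono)
  finally show ?thesis by (simp add: power2_eq_square)
qed

end

section \<open>Finite-energy comparison of nearby sites\<close>

context kesten_percolation
begin

lemma pr_coord: "field q \<Longrightarrow> e \<in> elements M \<Longrightarrow> p_c M \<le> pr M q (\<lambda>\<omega>. \<omega> e)"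
  using pr_recursion[OF event_coord[of e M], of e q] p_c_bounds by (force simp: field_def)

lemma pr_open_elements:
  assumes "field q" "finite I" "I \<subseteq> elements M" "card I \<le> k"
  shows "p_c M ^ k \<le> pr M q (\<lambda>\<omega>. \<forall>e\<in>I. \<omega> e)"
proof -
  have "p_c M ^ k \<le> p_c M ^ card I" using assms(4) p_c_bounds by (intro power_decreasing) auto
  also have "\<dots> = (\<Prod>e\<in>I. p_c M)" by simp
  also have "\<dots> \<le> (\<Prod>e\<in>I. pr M q (\<lambda>\<omega>. \<omega> e))"
    using p_c_bounds pr_coord[OF assms(1)] assms(3) by (intro prod_mono) auto
  also have "\<dots> \<le> pr M q (\<lambda>\<omega>. \<forall>e\<in>I. \<omega> e)"
  proof (rule FKG_ball[OF assms(2) _ _ field_prob_field[OF assms(1)]])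
    show "cylinder M (\<lambda>\<omega>. \<omega> e)" if "e \<in> I" for e
      using that assms(3) by (intro cylinderI[of "{e}"]) (auto simp: supported_def)
  qed (simp add: up_event_def)
  finally show ?thesis .
qed

lemma path_event_fixed: "cylinder M (\<lambda>\<omega>. occupied_path M \<omega> vs)" "up_event (\<lambda>\<omega>. occupied_path M \<omega> vs)"
proof -
  have eq: "(\<lambda>\<omega>. occupied_path M \<omega> vs) = path_event (set vs) (\<lambda>ws. ws = vs)" by (auto simp: path_event_def fun_eq_iff)
  show "cylinder M (\<lambda>\<omega>. occupied_path M \<omega> vs)" "up_event (\<lambda>\<omega>. occupied_path M \<omega> vs)"
    unfolding eq by (intro cylinder_path_event up_event_path_event; simp)+
qed

lemma pr_path_open:
  assumes "field q" "graph_path M vs" "length vs \<le> K"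
  shows "p_c M ^ K\<^sup>2 \<le> pr M q (\<lambda>\<omega>. occupied_path M \<omega> vs)"
proof -
  have "p_c M ^ K\<^sup>2 \<le> pr M q (\<lambda>\<omega>. \<forall>e\<in>elems (set vs). \<omega> e)"
    by (rule pr_open_elements[OF assms(1) _ elems_subset card_elems_path[OF assms(3)]]) (simp add: finite_elems)
  also have "\<dots> \<le> pr M q (\<lambda>\<omega>. occupied_path M \<omega> vs)"
    using occupied_if_elements_open[OF assms(2)] by (intro pr_mono cylinder_event path_event_fixed) (auto simp: elems_def)
  finally show ?thesis .
qed

text \<open>Opening a path of bounded length from x to y costs a fixed factor by FKG; the distance
  drops by one because the base point moves by at most one.\<close>

lemma reach_nearby_exists:
  "\<exists>\<kappa>>0. \<kappa> \<le> 1 \<and> (\<forall>x\<in>sites M. \<forall>y\<in>sites M. \<forall>d q. rnorm M (x - y) \<le> 1 \<longrightarrow> 0 \<le> d \<longrightarrow> field q \<longrightarrow>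
     \<kappa> * pr M q (reach y (d + 1)) \<le> pr M q (reach x d))"
proof -
  obtain K where K: "\<And>x y. x \<in> sites M \<Longrightarrow> y \<in> sites M \<Longrightarrow> rnorm M (x - y) \<le> 1 \<Longrightarrow>
      \<exists>vs. graph_path M vs \<and> hd vs = x \<and> last vs = y \<and> length vs \<le> K"
    using graph_path_exists[of 1] by blast
  show ?thesis
  proof (intro exI[of _ "p_c M ^ K\<^sup>2"] conjI ballI allI impI)
    show "0 < p_c M ^ K\<^sup>2" "p_c M ^ K\<^sup>2 \<le> 1" using p_c_bounds by (auto intro: power_le_one)
    fix x y q and d :: real assume xy: "x \<in> sites M" "y \<in> sites M" "rnorm M (x - y) \<le> 1" "0 \<le> d" and q: "field q"
    obtain vs where vs: "graph_path M vs" "hd vs = x" "last vs = y" "length vs \<le> K" using K[OF xy(1-3)] by blast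
    have "p_c M ^ K\<^sup>2 * pr M q (reach y (d + 1)) \<le> pr M q (\<lambda>\<omega>. occupied_path M \<omega> vs) * pr M q (reach y (d + 1))"
      using pr_path_open[OF q vs(1,4)] by (intro mult_right_mono) auto
    also have "\<dots> \<le> pr M q (\<lambda>\<omega>. occupied_path M \<omega> vs \<and> reach y (d + 1) \<omega>)"
      using xy(4) by (intro Harris_FKG path_event_fixed reach_event field_prob_field q) auto
    also have "\<dots> \<le> pr M q (reach x d)"
    proof (rule pr_mono)
      fix \<omega> assume *: "occupied_path M \<omega> vs \<and> reach y (d + 1) \<omega>"
      then obtain ws where ws: "occupied_path M \<omega> ws" "hd ws = y" "d + 1 \<le> rnorm M (last ws - y)" by (auto simp: reach_def)
      have "con M \<omega> UNIV x y" "con M \<omega> UNIV y (last ws)" using * vs ws by (auto simp: con_iff)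
      then have "con M \<omega> UNIV x (last ws)" by (rule con_trans)
      moreover have "d \<le> rnorm M (last ws - x)" using rnorm_triangle_sub[of M "last ws" y x] ws(3) xy(3) by linarith
      ultimately show "reach x d \<omega>" by (rule reach_con)
    qed (use xy(4) in \<open>intro cylinder_event reach_event\<close>)
    finally show "p_c M ^ K\<^sup>2 * pr M q (reach y (d + 1)) \<le> pr M q (reach x d)" .
  qed
qed

definition \<kappa> :: real where
  "\<kappa> = (SOME \<kappa>. 0 < \<kappa> \<and> \<kappa> \<le> 1 \<and> (\<forall>x\<in>sites M. \<forall>y\<in>sites M. \<forall>d q. rnorm M (x - y) \<le> 1 \<longrightarrow> 0 \<le> d \<longrightarrow> field q \<longrightarrow>
     \<kappa> * pr M q (reach y (d + 1)) \<le> pr M q (reach x d)))"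

lemma \<kappa>: "0 < \<kappa>" "\<kappa> \<le> 1"
  "x \<in> sites M \<Longrightarrow> y \<in> sites M \<Longrightarrow> rnorm M (x - y) \<le> 1 \<Longrightarrow> 0 \<le> d \<Longrightarrow> field q \<Longrightarrow>
     \<kappa> * pr M q (reach y (d + 1)) \<le> pr M q (reach x d)"
  using someI_ex[OF reach_nearby_exists] unfolding \<kappa>_def by blast+

lemma field_p: "p_c M \<le> p \<Longrightarrow> p \<le> 1 \<Longrightarrow> field (\<lambda>_. p) \<and> 0 \<le> p"
  using p_c_bounds by (simp add: field_const)

text \<open>A site need not be a translate of the origin, but it is within distance 1 of the
  translate \<open>cell_base x\<close>.\<close>

lemma reach_site_vs_origin:
  assumes "x \<in> sites M" "p_c M \<le> p" "p \<le> 1" "0 \<le> d"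
  shows "\<kappa> * pr M (\<lambda>_. p) (reach 0 (d + 1)) \<le> pr M (\<lambda>_. p) (reach x d)"
    "\<kappa> * pr M (\<lambda>_. p) (reach x (d + 1)) \<le> pr M (\<lambda>_. p) (reach 0 d)"
proof -
  have u: "cell_base x \<in> sites M" "rnorm M (x - cell_base x) \<le> 1" "rnorm M (cell_base x - x) \<le> 1"
    using rnorm_cell_base[of x] rnorm_commute[of M x] by (auto simp: cell_base_def lat_in_sites)
  have e: "pr M (\<lambda>_. p) (reach (cell_base x) d') = pr M (\<lambda>_. p) (reach 0 d')" if "0 \<le> d'" for d'
    unfolding cell_base_def using that field_p[OF assms(2,3)] assms(3) by (intro reach_translate) auto
  show "\<kappa> * pr M (\<lambda>_. p) (reach 0 (d + 1)) \<le> pr M (\<lambda>_. p) (reach x d)"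
    using \<kappa>(3)[OF assms(1) u(1,2) assms(4), of "\<lambda>_. p"] e[of "d + 1"] field_p[OF assms(2,3)] assms(4) by simp
  show "\<kappa> * pr M (\<lambda>_. p) (reach x (d + 1)) \<le> pr M (\<lambda>_. p) (reach 0 d)"
    using \<kappa>(3)[OF u(1) assms(1) u(3) assms(4), of "\<lambda>_. p"] e[of d] field_p[OF assms(2,3)] assms(4) by simp
qed

lemma P_inf_pr: "P_inf M p = pr M (\<lambda>_. p) (\<lambda>\<omega>. connected_to_infinity M \<omega> 0)"
  by (simp add: P_inf_def pr_def hom_measure_def)

lemma infinite_site_vs_origin:
  assumes "x \<in> sites M" "p_c M \<le> p" "p \<le> 1"
  shows "\<kappa> * P_inf M p \<le> pr M (\<lambda>_. p) (\<lambda>\<omega>. connected_to_infinity M \<omega> x)"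
    "\<kappa> * pr M (\<lambda>_. p) (\<lambda>\<omega>. connected_to_infinity M \<omega> x) \<le> P_inf M p"
proof -
  have *: "\<kappa> * pr M (\<lambda>_. p) (\<lambda>\<omega>. connected_to_infinity M \<omega> y) \<le> pr M (\<lambda>_. p) (\<lambda>\<omega>. connected_to_infinity M \<omega> z)"
    if "\<And>n::nat. \<kappa> * pr M (\<lambda>_. p) (reach y (real n + 1)) \<le> pr M (\<lambda>_. p) (reach z (real n))" for y z
  proof (rule LIMSEQ_le)
    show "(\<lambda>n. \<kappa> * pr M (\<lambda>_. p) (reach y (real (Suc n)))) \<longlonglongrightarrow> \<kappa> * pr M (\<lambda>_. p) (\<lambda>\<omega>. connected_to_infinity M \<omega> y)"
      by (intro tendsto_mult tendsto_const LIMSEQ_Suc[OF pr_reach_lim])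
    show "(\<lambda>n. pr M (\<lambda>_. p) (reach z (real n))) \<longlonglongrightarrow> pr M (\<lambda>_. p) (\<lambda>\<omega>. connected_to_infinity M \<omega> z)"
      by (rule pr_reach_lim)
    show "\<exists>N. \<forall>n\<ge>N. \<kappa> * pr M (\<lambda>_. p) (reach y (real (Suc n))) \<le> pr M (\<lambda>_. p) (reach z (real n))"
      using that by (simp add: add.commute)
  qed
  show "\<kappa> * P_inf M p \<le> pr M (\<lambda>_. p) (\<lambda>\<omega>. connected_to_infinity M \<omega> x)"
    unfolding P_inf_pr by (rule *[OF reach_site_vs_origin(1)[OF assms]]) simp
  show "\<kappa> * pr M (\<lambda>_. p) (\<lambda>\<omega>. connected_to_infinity M \<omega> x) \<le> P_inf M p"
    unfolding P_inf_pr by (rule *[OF reach_site_vs_origin(2)[OF assms]]) simp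
qed

text \<open>Chosen once, together with \<open>q0\<close>: from this scale on every crossing has
  probability at least \<open>q0\<close> under every field.\<close>

definition m0 :: nat where
  "m0 = (SOME m0. \<exists>q0. 0 < q0 \<and> q0 \<le> 1 \<and> 1 \<le> m0 \<and> R \<le> real m0 \<and>
     (\<forall>q n i j. field q \<longrightarrow> m0 \<le> n \<longrightarrow> q0 \<le> pr M q (HX n i j) \<and> q0 \<le> pr M q (VX n i j)))"

definition q0 :: real where
  "q0 = (SOME q0. 0 < q0 \<and> q0 \<le> 1 \<and> 1 \<le> m0 \<and> R \<le> real m0 \<and>
     (\<forall>q n i j. field q \<longrightarrow> m0 \<le> n \<longrightarrow> q0 \<le> pr M q (HX n i j) \<and> q0 \<le> pr M q (VX n i j)))"

lemma q0_props: "0 < q0 \<and> q0 \<le> 1 \<and> 1 \<le> m0 \<and> R \<le> real m0 \<and>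
     (\<forall>q n i j. field q \<longrightarrow> m0 \<le> n \<longrightarrow> q0 \<le> pr M q (HX n i j) \<and> q0 \<le> pr M q (VX n i j))"
proof -
  have "\<exists>m0 q0. 0 < q0 \<and> q0 \<le> 1 \<and> 1 \<le> m0 \<and> R \<le> real m0 \<and>
     (\<forall>q n i j. field q \<longrightarrow> m0 \<le> n \<longrightarrow> q0 \<le> pr M q (HX n i j) \<and> q0 \<le> pr M q (VX n i j))"
    using critical_crossings by blast
  from someI_ex[OF this] have "\<exists>q0. 0 < q0 \<and> q0 \<le> 1 \<and> 1 \<le> m0 \<and> R \<le> real m0 \<and>
     (\<forall>q n i j. field q \<longrightarrow> m0 \<le> n \<longrightarrow> q0 \<le> pr M q (HX n i j) \<and> q0 \<le> pr M q (VX n i j))"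
    unfolding m0_def .
  from someI_ex[OF this] show ?thesis unfolding q0_def .
qed

lemma m0: "1 \<le> m0" "R \<le> real m0" and q0: "0 < q0" "q0 \<le> 1"
  and crossing_ge_q0: "field q \<Longrightarrow> m0 \<le> n \<Longrightarrow> q0 \<le> pr M q (HX n i j) \<and> q0 \<le> pr M q (VX n i j)"
  using q0_props by blast+

text \<open>The exponent counts two crossings in each of 25 cells.\<close>

lemma pr_net_ge: "field q \<Longrightarrow> m0 \<le> n \<Longrightarrow> q0 ^ 50 \<le> pr M q (net n x)"
  using grid_ge_power[of q q0 "fst (cell_of n x) - 2" "fst (cell_of n x) + 2" "snd (cell_of n x) - 2" "snd (cell_of n x) + 2" n]
    crossing_ge_q0[of q n] q0
  by (auto simp: net_def case_prod_beta card_cartesian_product power_mult[symmetric])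

section \<open>Regularity of the critical one-arm probability\<close>

definition arm :: "real \<Rightarrow> real" where "arm s = pr M (\<lambda>_. p_c M) (reach 0 s)"

lemma arm_le_1: "arm s \<le> 1" "0 \<le> arm s"
  by (auto simp: arm_def)

lemma arm_antimono: "0 \<le> s \<Longrightarrow> s \<le> t \<Longrightarrow> arm t \<le> arm s"
  unfolding arm_def by (rule pr_reach_antimono)

lemma field_pc: "field (\<lambda>_. p_c M)"
  using p_c_bounds by (intro field_const) auto

lemma lat_path_open: "\<exists>\<kappa>>0. \<forall>q. field q \<longrightarrow> \<kappa> \<le> pr M q (\<lambda>\<omega>. con M \<omega> UNIV 0 (lat M (real n) 0))"
proof -
  have "lat M (of_int (int n)) (of_int 0) \<in> sites M" by (rule lat_in_sites)
  then have s: "lat M (real n) 0 \<in> sites M" by simp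
  obtain K where "\<And>x y. x \<in> sites M \<Longrightarrow> y \<in> sites M \<Longrightarrow> rnorm M (x - y) \<le> real n \<Longrightarrow>
      \<exists>vs. graph_path M vs \<and> hd vs = x \<and> last vs = y \<and> length vs \<le> K"
    using graph_path_exists[of "real n"] by blast
  from this[OF origin s] obtain vs where vs: "graph_path M vs" "hd vs = 0" "last vs = lat M (real n) 0" "length vs \<le> K"
    by (auto simp: rnorm_le_iff coord_linear)
  have ev: "event M (\<lambda>\<omega>. con M \<omega> UNIV 0 (lat M (real n) 0))"
  proof -
    have "event M (\<lambda>\<omega>. \<exists>N\<in>(UNIV::nat set). path_event (rbox M 0 (real N)) (\<lambda>vs. hd vs = 0 \<and> last vs = lat M (real n) 0) \<omega>)"
      by (intro event_bex cylinder_event cylinder_path_event finite_sites_rbox) auto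
    moreover have "(\<exists>N\<in>(UNIV::nat set). path_event (rbox M 0 (real N)) (\<lambda>vs. hd vs = 0 \<and> last vs = lat M (real n) 0) \<omega>) = con M \<omega> UNIV 0 (lat M (real n) 0)" for \<omega>
    proof
      assume "con M \<omega> UNIV 0 (lat M (real n) 0)"
      then obtain vs where vs: "occupied_path M \<omega> vs" "hd vs = 0" "last vs = lat M (real n) 0" by (auto simp: con_iff)
      obtain N :: nat where "Max (rnorm M ` insert 0 (set vs)) \<le> real N" using real_arch_simple by blast
      then have "set vs \<subseteq> rbox M 0 (real N)" by (auto simp: rbox_def)
      then show "\<exists>N\<in>(UNIV::nat set). path_event (rbox M 0 (real N)) (\<lambda>vs. hd vs = 0 \<and> last vs = lat M (real n) 0) \<omega>"
        using vs unfolding path_event_def by blast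
    qed (auto simp: path_event_def con_iff)
    ultimately show ?thesis by simp
  qed
  have "p_c M ^ K\<^sup>2 \<le> pr M q (\<lambda>\<omega>. con M \<omega> UNIV 0 (lat M (real n) 0))" if "field q" for q
  proof -
    have "p_c M ^ K\<^sup>2 \<le> pr M q (\<lambda>\<omega>. occupied_path M \<omega> vs)" by (rule pr_path_open[OF that vs(1,4)])
    also have "\<dots> \<le> pr M q (\<lambda>\<omega>. con M \<omega> UNIV 0 (lat M (real n) 0))"
      using vs by (intro pr_mono ev) (auto simp: con_iff)
    finally show ?thesis .
  qed
  moreover have "0 < p_c M ^ K\<^sup>2" using p_c_bounds by simp
  ultimately show ?thesis by blast
qed

lemma arm_pos: "0 < arm s"
proof -
  obtain n :: nat where n: "max s 0 \<le> real n" using real_arch_simple by blast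
  obtain k where k: "0 < k" "k \<le> pr M (\<lambda>_. p_c M) (\<lambda>\<omega>. con M \<omega> UNIV 0 (lat M (real n) 0))"
    using lat_path_open[of n] field_pc by blast
  have "k \<le> arm (real n)"
  proof -
    have "pr M (\<lambda>_. p_c M) (\<lambda>\<omega>. con M \<omega> UNIV 0 (lat M (real n) 0)) \<le> arm (real n)"
      unfolding arm_def
    proof (rule pr_mono)
      have "real n \<le> rnorm M (lat M (real n) 0 - 0)" using coord_le_rnorm(1)[of M "lat M (real n) 0"] by simp
      then show "reach 0 (real n) \<omega>" if "con M \<omega> UNIV 0 (lat M (real n) 0)" for \<omega> using reach_con[OF that] by blast
    qed (intro cylinder_event reach_event; simp)
    then show ?thesis using k by linarith
  qed
  also have "\<dots> \<le> arm (max s 0)" using n by (intro arm_antimono) auto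
  also have "\<dots> \<le> arm s"
    unfolding arm_def
  proof (cases "0 \<le> s")
    case False
    then have eq: "reach 0 s \<omega> = reach 0 0 \<omega>" for \<omega>
      unfolding reach_def using rnorm_nonneg[of M] by (smt (verit))
    then have "reach 0 s = reach 0 0" by blast
    then show "pr M (\<lambda>_. p_c M) (reach 0 (max s 0)) \<le> pr M (\<lambda>_. p_c M) (reach 0 s)" using False by simp
  qed (simp add: max_absorb1)
  finally show ?thesis using k(1) by linarith
qed

definition cell :: "nat \<Rightarrow> int \<Rightarrow> int \<Rightarrow> complex set" where
  "cell n i j = {v. of_int i * real n \<le> coord1 M v \<and> coord1 M v \<le> of_int (i + 1) * real n \<and>
     of_int j * real n \<le> coord2 M v \<and> coord2 M v \<le> of_int (j + 1) * real n}"

text \<open>The starting point is free within the cell. The radius of the box adds the size of the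
  cell, the distance and one overshooting edge.\<close>

definition cell_reach :: "nat \<Rightarrow> int \<Rightarrow> int \<Rightarrow> nat \<Rightarrow> (complex set \<Rightarrow> bool) \<Rightarrow> bool" where
  "cell_reach n i j T = path_event (rbox M (lat M (of_int (i * int n)) (of_int (j * int n))) (real n + real T + R))
     (\<lambda>vs. hd vs \<in> cell n i j \<and> real T \<le> rnorm M (last vs - hd vs))"

lemma cell_reach_event: "cylinder M (cell_reach n i j T)" "up_event (cell_reach n i j T)"
  unfolding cell_reach_def by (intro cylinder_path_event finite_sites_rbox up_event_path_event)+

lemma cell_reach_translate: "pr M (\<lambda>_. p_c M) (cell_reach n i j T) \<le> pr M (\<lambda>_. p_c M) (cell_reach n 0 0 T)"
proof -
  let ?\<phi> = "\<lambda>z. z + lat M (of_int (- i * int n)) (of_int (- j * int n))"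
  have eq: "lat M (of_int (i * int n)) (of_int (j * int n)) + lat M (of_int (- i * int n)) (of_int (- j * int n)) = 0"
    by (simp add: lat_def)
  show ?thesis
    unfolding cell_reach_def
  proof (rule pr_path_event_automorphism[OF automorphism_translation[of "- i * int n" "- j * int n"] _ _ finite_sites_rbox finite_sites_rbox])
    show "?\<phi> v \<in> rbox M (lat M (of_int (0 * int n)) (of_int (0 * int n))) (real n + real T + R)"
      if "v \<in> rbox M (lat M (of_int (i * int n)) (of_int (j * int n))) (real n + real T + R)" for v
    proof -
      have "?\<phi> v - lat M (of_int (0 * int n)) (of_int (0 * int n)) = v - lat M (of_int (i * int n)) (of_int (j * int n))"
        by (simp add: lat_def)
      then show ?thesis using that unfolding rbox_def mem_Collect_eq by (simp only:)
    qed
    show "(hd (map ?\<phi> vs) \<in> cell n 0 0 \<and> real T \<le> rnorm M (last (map ?\<phi> vs) - hd (map ?\<phi> vs))) \<or>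
       (hd (rev (map ?\<phi> vs)) \<in> cell n 0 0 \<and> real T \<le> rnorm M (last (rev (map ?\<phi> vs)) - hd (rev (map ?\<phi> vs))))"
      if "graph_path M vs" "hd vs \<in> cell n i j \<and> real T \<le> rnorm M (last vs - hd vs)" for vs
    proof (rule disjI1)
      have "vs \<noteq> []" using that(1) by (auto simp: occupied_path_def)
      then show "hd (map ?\<phi> vs) \<in> cell n 0 0 \<and> real T \<le> rnorm M (last (map ?\<phi> vs) - hd (map ?\<phi> vs))"
        using that(2) by (simp add: hd_map last_map cell_def coord_linear algebra_simps)
    qed
  qed (use p_c_bounds in auto)
qed

lemma HX_imp_cell_reach:
  assumes n: "1 \<le> n" "R \<le> real n" and K: "1 \<le> K" and X: "HX (K * n) 0 0 \<omega>"
  shows "\<exists>j\<in>{0..int K}. cell_reach n (int K) j (K * n) \<omega>"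
proof -
  let ?T = "real (K * n)"
  have "1 * real n \<le> real K * real n" using K by (intro mult_right_mono) auto
  then have T: "real n \<le> ?T" by simp
  have n1: "1 \<le> real n" using n by simp
  obtain vs where vs: "occupied_path M \<omega> vs" and H: "H_path (K * n) 0 0 vs" using X by (auto simp: HX_def path_event_def)
  have h: "coord1 M (hd vs) \<le> 0" "3 * ?T \<le> coord1 M (last vs)" "\<And>v. v \<in> set vs \<Longrightarrow> 0 \<le> coord2 M v \<and> coord2 M v \<le> ?T"
    using H by (auto simp: H_path_def h_spans_def)
  have lastT: "?T \<le> coord1 M (last vs)" using h(2) T n1 by linarith
  obtain ws where ws: "occupied_path M \<omega> ws" "hd ws = hd vs" "?T \<le> coord1 M (last ws)"
    "\<And>v. v \<in> set (butlast ws) \<Longrightarrow> \<not> ?T \<le> coord1 M v" "set ws \<subseteq> set vs"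
    by (rule first_hit[OF vs, of "\<lambda>v. ?T \<le> coord1 M v"]) (use lastT in auto)
  let ?v = "last ws"
  have ne: "ws \<noteq> []" using ws(1) by (auto simp: occupied_path_def)
  have v_in: "?v \<in> set vs" using ws(5) ne by auto
  have "butlast ws \<noteq> []"
  proof
    assume "butlast ws = []"
    then have "?v = hd ws" using ne by (metis append_Nil append_butlast_last_id list.sel(1))
    then have "?T \<le> coord1 M (hd vs)" using ws(2,3) by (simp only:)
    then show False using h(1) T n1 by linarith
  qed
  let ?u = "last (butlast ws)"
  have "ws = butlast ws @ [?v]" using ne by simp
  then have "{?u, ?v} \<in> edges M"
    using ws(1) \<open>butlast ws \<noteq> []\<close> successively_append_iff[of "\<lambda>u v. {u, v} \<in> edges M" "butlast ws" "[?v]"]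
    by (simp add: occupied_path_def)
  then have "\<bar>coord1 M (?u - ?v)\<bar> \<le> real n" using R(2) coord_le_rnorm(1)[of M "?u - ?v"] n(2) by fastforce
  moreover have "coord1 M ?u < ?T" using ws(4)[of ?u] \<open>butlast ws \<noteq> []\<close> by simp
  ultimately have v1: "coord1 M ?v \<le> ?T + real n" unfolding coord_linear by linarith
  define j where "j = \<lfloor>coord2 M ?v / real n\<rfloor>"
  have n0: "0 < real n" using n by simp
  have v2: "0 \<le> coord2 M ?v / real n" "coord2 M ?v / real n \<le> real K"
    using h(3)[OF v_in] n0 by (simp_all add: field_simps)
  \<comment> \<open>The value j = K occurs only for a vertex on the top side of the rectangle; it is
    the reason for K + 1 cells.\<close>
  have j: "j \<in> {0..int K}" using v2 unfolding j_def by (auto simp: floor_le_iff le_floor_iff)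
  have jb: "of_int j \<le> coord2 M ?v / real n" "coord2 M ?v / real n \<le> of_int (j + 1)" unfolding j_def by linarith+
  have cell_v: "?v \<in> cell n (int K) j"
    using ws(3) v1 jb n0 unfolding cell_def by (simp add: field_simps)
  have "con M \<omega> UNIV ?v (last vs)"
    by (rule con_path[OF vs _ v_in]) (use vs in \<open>auto simp: occupied_path_def\<close>)
  then obtain us where us: "occupied_path M \<omega> us" "hd us = ?v" "last us = last vs" by (auto simp: con_iff)
  have "?T \<le> coord1 M (last us - ?v)" using us(3) h(2) v1 T by (simp add: coord_linear)
  also have "\<dots> \<le> rnorm M (last us - hd us)" using coord_le_rnorm(1)[of M "last us - ?v"] us(2) by simp
  finally obtain us' where us': "occupied_path M \<omega> us'" "hd us' = ?v" "?T \<le> rnorm M (last us' - ?v)" "set us' \<subseteq> rbox M ?v (?T + R)"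
    using path_truncate[OF us(1), of ?T] us(2) by auto
  have "rnorm M (?v - lat M (of_int (int K * int n)) (of_int (j * int n))) \<le> real n"
    using cell_v unfolding rnorm_le_iff coord_linear cell_def by (simp add: algebra_simps)
  then have "set us' \<subseteq> rbox M (lat M (of_int (int K * int n)) (of_int (j * int n))) (real n + ?T + R)"
  proof (intro subsetI)
    fix w assume a: "w \<in> set us'" "rnorm M (?v - lat M (of_int (int K * int n)) (of_int (j * int n))) \<le> real n"
    then have "rnorm M (w - ?v) \<le> ?T + R" using us'(4) by (auto simp: rbox_def)
    then show "w \<in> rbox M (lat M (of_int (int K * int n)) (of_int (j * int n))) (real n + ?T + R)"
      unfolding rbox_def using a(2) rnorm_triangle_sub[of M w "lat M (of_int (int K * int n)) (of_int (j * int n))" ?v] by simp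
  qed
  then have "cell_reach n (int K) j (K * n) \<omega>" unfolding cell_reach_def path_event_def
    using us' cell_v by (intro exI[of _ us']) simp
  then show ?thesis using j by blast
qed

text \<open>
  The horizontal crossing of a rectangle of scale K n passes through one of K + 1 cells of scale n in its middle,
  and from there it reaches distance K n. A net around this cell joins it to the arm of length 2n.
\<close>

lemma arm_extension:
  assumes n: "m0 \<le> n" and K: "2 \<le> K"
  shows "arm (2 * real n) * (q0 ^ 51 / (2 * real K)) \<le> arm (real ((K - 1) * n))"
proof -
  let ?q = "\<lambda>_::complex set. p_c M"
  have n1: "1 \<le> n" "R \<le> real n" using n m0 by (auto intro: order_trans of_nat_mono)
  have "q0 \<le> pr M ?q (HX (K * n) 0 0)"
  proof -
    have "m0 \<le> K * n" using n K by (metis One_nat_def Suc_1 Suc_leD le_trans mult_le_mono1 nat_mult_1)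
    then show ?thesis using crossing_ge_q0[OF field_pc] by blast
  qed
  also have "\<dots> \<le> pr M ?q (\<lambda>\<omega>. \<exists>j\<in>{0..int K}. cell_reach n (int K) j (K * n) \<omega>)"
    using HX_imp_cell_reach[OF n1, of K] K by (intro pr_mono cylinder_event cylinder_bex cell_reach_event) auto
  also have "\<dots> \<le> (\<Sum>j\<in>{0..int K}. pr M ?q (cell_reach n (int K) j (K * n)))"
    by (intro pr_bex_le cylinder_event cell_reach_event) auto
  also have "\<dots> \<le> (\<Sum>j\<in>{0..int K}. pr M ?q (cell_reach n 0 0 (K * n)))"
    by (intro sum_mono cell_reach_translate)
  also have "\<dots> = (real K + 1) * pr M ?q (cell_reach n 0 0 (K * n))" by simp
  also have "\<dots> \<le> (2 * real K) * pr M ?q (cell_reach n 0 0 (K * n))" using K by (intro mult_right_mono) auto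
  finally have cr: "q0 / (2 * real K) \<le> pr M ?q (cell_reach n 0 0 (K * n))" using K by (simp add: field_simps)
  \<comment> \<open>Fifty factors pay for the net and one for the large crossing; 2 K bounds the
    number K + 1 of cells.\<close>
  have "arm (2 * real n) * (q0 ^ 51 / (2 * real K)) = arm (2 * real n) * (q0 ^ 50 * (q0 / (2 * real K)))"
    using power_Suc2[of q0 50] by simp
  also have "\<dots> \<le> pr M ?q (reach 0 (2 * real n)) * (pr M ?q (net n 0) * pr M ?q (cell_reach n 0 0 (K * n)))"
    unfolding arm_def using pr_net_ge[OF field_pc n] cr q0 by (intro mult_left_mono mult_mono) auto
  also have "\<dots> \<le> pr M ?q (reach 0 (2 * real n)) * pr M ?q (\<lambda>\<omega>. net n 0 \<omega> \<and> cell_reach n 0 0 (K * n) \<omega>)"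
    by (intro mult_left_mono Harris_FKG net_event cell_reach_event field_prob_field[OF field_pc]) auto
  also have "\<dots> \<le> pr M ?q (\<lambda>\<omega>. reach 0 (2 * real n) \<omega> \<and> (net n 0 \<omega> \<and> cell_reach n 0 0 (K * n) \<omega>))"
    by (intro Harris_FKG cylinder_conj up_event_conj reach_event net_event cell_reach_event field_prob_field[OF field_pc]) auto
  also have "\<dots> \<le> arm (real ((K - 1) * n))"
    unfolding arm_def
  proof (rule pr_mono)
    fix \<omega> assume *: "reach 0 (2 * real n) \<omega> \<and> (net n 0 \<omega> \<and> cell_reach n 0 0 (K * n) \<omega>)"
    have c: "cell_of n 0 = (0, 0)" by (simp add: cell_of_def coord_linear)
    have g: "grid n (0 - 2) (0 + 2) (0 - 2) (0 + 2) \<omega>" using * c by (simp add: net_def)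
    have g1: "grid n (0 - 1) (0 + 1) (0 - 1) (0 + 1) \<omega>" by (rule grid_mono[OF g]) auto
    obtain a b y where y: "a \<in> {0-1..0+1}" "b \<in> {0-1..0+1}" "y \<in> cell_net \<omega> n a b" "con M \<omega> (rbox M 0 (2 * real n + R)) 0 y"
      using reach_meets_grid[OF n1(1) conjunct1[OF *] c g1] by blast
    obtain vs where vs: "occupied_path M \<omega> vs" "hd vs \<in> cell n 0 0" "real (K * n) \<le> rnorm M (last vs - hd vs)"
      using * by (auto simp: cell_reach_def path_event_def)
    have hd_cell: "of_int 0 * real n \<le> coord1 M (hd vs)" "coord1 M (hd vs) \<le> of_int (0 + 1) * real n"
      "of_int 0 * real n \<le> coord2 M (hd vs)" "coord2 M (hd vs) \<le> of_int (0 + 1) * real n"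
      using vs(2) by (auto simp: cell_def)
    have "2 * real n \<le> real K * real n" using K by (intro mult_right_mono) auto
    then have "2 * real n \<le> real (K * n)" by simp
    then have "2 * real n \<le> rnorm M (last vs - hd vs)" using vs(3) by linarith
    from path_leaving_cell[OF n1(1) occupied_imp_graph_path[OF vs(1)] hd_cell this g1]
    obtain a' b' z where z: "a' \<in> {0-1..0+1}" "b' \<in> {0-1..0+1}" "z \<in> set vs" "z \<in> cell_net \<omega> n a' b'" by blast
    have "con M \<omega> UNIV 0 y" using y(4) by (rule con_mono) simp
    moreover have "con M \<omega> UNIV y z"
      by (rule con_mono[OF grid_connected[OF g _ _ y(3) _ _ z(4)]]) (use y z in auto)
    moreover have "con M \<omega> UNIV z (last vs)" by (rule con_path[OF vs(1) _ z(3)]) (use vs(1) in \<open>auto simp: occupied_path_def\<close>)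
    ultimately have "con M \<omega> UNIV 0 (last vs)" using con_trans by blast
    moreover have "real ((K - 1) * n) \<le> rnorm M (last vs - 0)"
    proof -
      have "rnorm M (hd vs) \<le> real n" using hd_cell by (simp add: rnorm_le_iff)
      moreover have "rnorm M (last vs - hd vs) \<le> rnorm M (last vs) + rnorm M (hd vs)" using rnorm_triangle[of M "last vs" "- hd vs"] by simp
      moreover have "real ((K - 1) * n) = real (K * n) - real n" using K by (simp add: of_nat_diff algebra_simps)
      ultimately show ?thesis using vs(3) by simp
    qed
    ultimately show "reach 0 (real ((K - 1) * n)) \<omega>" by (rule reach_con)
  qed (intro cylinder_event reach_event; simp)
  finally show ?thesis .
qed

text \<open>Extension from n about s / 2 with K about t / n: the number of cells that the long
  crossing may pass through is the factor t / s.\<close>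

lemma arm_regular: "\<exists>C\<ge>1. \<forall>s t. 1 \<le> s \<longrightarrow> s \<le> t \<longrightarrow> arm s \<le> C * (t / s) * arm t"
proof -
  \<comment> \<open>From S on, n = \<lfloor>s / 2\<rfloor> is at least \<open>m0\<close> and at
    least s / 4.\<close>
  define S where "S = real (max (2 * m0 + 2) 4)"
  have S: "4 \<le> S" "2 * real m0 + 2 \<le> S" by (auto simp: S_def)
  define A where "A = 20 / q0 ^ 51"
  have A: "0 \<le> A" using q0 by (simp add: A_def)
  have big: "arm s \<le> A * (t / s) * arm t" if st: "S \<le> s" "s \<le> t" for s t
  proof -
    define n where "n = nat \<lfloor>s / 2\<rfloor>"
    have n: "2 * real n \<le> s" "s / 4 \<le> real n" "m0 \<le> n"
    proof -
      have "0 \<le> \<lfloor>s / 2\<rfloor>" using st S by simp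
      then have rn: "real n = of_int \<lfloor>s / 2\<rfloor>" by (simp add: n_def)
      show "2 * real n \<le> s" unfolding rn by linarith
      show "s / 4 \<le> real n" unfolding rn using st S by linarith
      have "real m0 \<le> real n" unfolding rn using st S by linarith
      then show "m0 \<le> n" by simp
    qed
    define K where "K = nat \<lceil>t / real n\<rceil> + 2"
    have n0: "0 < real n" using n(3) m0(1) by simp
    have tn: "0 \<le> t / real n" using st S n0 by simp
    have rK: "real K = of_int \<lceil>t / real n\<rceil> + 2" using tn by (simp add: K_def)
    have K2: "2 \<le> K" by (simp add: K_def)
    have "t / real n \<le> real (K - 1)" using rK K2 by (simp add: of_nat_diff) linarith
    then have t_le: "t \<le> real ((K - 1) * n)" using n0 by (simp add: field_simps)
    have "t / real n \<le> 4 * (t / s)"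
    proof -
      have "t * s \<le> t * (4 * real n)" using n(2) st S by (intro mult_left_mono) auto
      then show ?thesis using n0 st S by (simp add: field_simps)
    qed
    moreover have "1 \<le> t / s" using st S by simp
    moreover have "of_int \<lceil>t / real n\<rceil> \<le> t / real n + 1" by linarith
    ultimately have K_le: "2 * real K \<le> 20 * (t / s)" unfolding rK by argo
    have "arm s \<le> arm (2 * real n)" using n by (intro arm_antimono) auto
    also have "\<dots> \<le> (2 * real K / q0 ^ 51) * arm (real ((K - 1) * n))"
      using arm_extension[OF n(3) K2] q0(1) K2 by (simp add: field_simps)
    also have "\<dots> \<le> (20 * (t / s) / q0 ^ 51) * arm t"
    proof (rule mult_mono)
      show "2 * real K / q0 ^ 51 \<le> 20 * (t / s) / q0 ^ 51" using K_le q0(1) by (intro divide_right_mono) auto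
      show "arm (real ((K - 1) * n)) \<le> arm t" by (intro arm_antimono t_le) (use st S in linarith)
    qed (use q0(1) st S arm_le_1 in auto)
    also have "\<dots> = A * (t / s) * arm t" by (simp add: A_def)
    finally show ?thesis .
  qed
  \<comment> \<open>For s < S the left side is bounded by 1, and \<open>arm S\<close> in the
    denominator makes up for it.\<close>
  define C where "C = max 1 (max A (max 1 A * S / arm S))"
  have "arm s \<le> C * (t / s) * arm t" if st: "1 \<le> s" "s \<le> t" for s t
  proof (cases "S \<le> s")
    case True
    have "A * (t / s) * arm t \<le> C * (t / s) * arm t"
      using st arm_le_1(2)[of t] by (intro mult_right_mono) (auto simp: C_def)
    then show ?thesis using big[OF True st(2)] by linarith
  next
    case False
    have pos: "0 < arm S" "0 < arm t" by (rule arm_pos)+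
    have "arm S \<le> max 1 A * S * (t / s) * arm t"
    proof (cases "S \<le> t")
      case True
      have "arm S \<le> A * (t / S) * arm t" using big[of S t] True by simp
      also have "\<dots> \<le> max 1 A * (S * (t / s)) * arm t"
      proof (intro mult_right_mono mult_mono)
        have "t / S \<le> t * 1" using st S by (simp add: field_simps mult_left_mono)
        also have "\<dots> \<le> S * (t / s)" using st S False by (simp add: field_simps mult_left_mono)
        finally show "t / S \<le> S * (t / s)" .
      qed (use pos st S A in auto)
      finally show ?thesis by (simp add: mult.assoc)
    next
      case False
      have "arm S \<le> 1 * 1 * 1 * arm t" using False st by (simp add: arm_antimono)
      also have "\<dots> \<le> max 1 A * S * (t / s) * arm t" using pos st S by (intro mult_right_mono mult_mono) auto
      finally show ?thesis .
    qed
    then have "1 \<le> (max 1 A * S * (t / s) * arm t) / arm S" using pos by (simp only: le_divide_eq_1_pos)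
    then have "1 \<le> (max 1 A * S / arm S) * (t / s) * arm t" by (simp add: mult_ac)
    also have "\<dots> \<le> C * (t / s) * arm t" using st pos by (intro mult_right_mono) (auto simp: C_def)
    finally show ?thesis using arm_le_1(1)[of s] by linarith
  qed
  moreover have "1 \<le> C" by (simp add: C_def)
  ultimately show ?thesis by blast
qed

section \<open>The one-arm probability of the exact sphere\<close>

text \<open>Both coordinates are rounded down and clamped to [-n, n]; a coordinate of modulus at
  least n then becomes n or -n, which puts the resulting lattice point on the sphere.\<close>

lemma nearby_sphere_site:
  assumes "real n \<le> rnorm M v" "rnorm M v \<le> real n + R" "v \<in> sites M"
  shows "\<exists>y\<in>rsphere M n 0. rnorm M (v - y) \<le> R + 1"
proof -
  define f where "f x = max (- int n) (min (int n) \<lfloor>x\<rfloor>)" for x :: real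
  have f_le: "\<bar>real_of_int (f x)\<bar> \<le> real n" for x unfolding f_def by (auto simp: abs_le_iff max_def min_def)
  have f_dist: "\<bar>x - real_of_int (f x)\<bar> \<le> R + 1" if "\<bar>x\<bar> \<le> real n + R" for x
    using that R(1) unfolding f_def max_def min_def abs_le_iff by (auto split: if_splits; linarith)
  have f_eq: "\<bar>real_of_int (f x)\<bar> = real n" if "real n \<le> \<bar>x\<bar>" for x
  proof (cases "real n \<le> x")
    case True
    then have "int n \<le> \<lfloor>x\<rfloor>" by (simp add: le_floor_iff)
    then show ?thesis by (auto simp: f_def)
  next
    case False
    then have "x \<le> - real n" using that by linarith
    then have "\<lfloor>x\<rfloor> \<le> - int n" by linarith
    then show ?thesis by (auto simp: f_def)
  qed
  let ?y = "lat M (of_int (f (coord1 M v))) (of_int (f (coord2 M v)))"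
  have c: "\<bar>coord1 M v\<bar> \<le> real n + R" "\<bar>coord2 M v\<bar> \<le> real n + R" using assms(2) by (auto simp: rnorm_def)
  have "rnorm M ?y = real n"
  proof -
    have "real n \<le> \<bar>coord1 M v\<bar> \<or> real n \<le> \<bar>coord2 M v\<bar>" using assms(1) by (auto simp: rnorm_def le_max_iff_disj)
    then show ?thesis using f_eq f_le[of "coord1 M v"] f_le[of "coord2 M v"] unfolding rnorm_def coord_lat by (auto simp: max_def)
  qed
  moreover have "rnorm M (v - ?y) \<le> R + 1" using f_dist[OF c(1)] f_dist[OF c(2)] by (simp add: rnorm_le_iff coord_linear)
  ultimately show ?thesis using lat_in_sites by (intro bexI[of _ ?y]) (auto simp: rsphere_def)
qed

definition sphere_arm :: "nat \<Rightarrow> real" where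
  "sphere_arm n = pr M (\<lambda>_. p_c M) (\<lambda>\<omega>. connected_to M \<omega> {0} (rsphere M n 0))"

lemma one_arm_eq: "one_arm M x = sphere_arm (nat (round x))"
  by (simp add: one_arm_def sphere_arm_def pr_def hom_measure_def)

lemma event_sphere: "event M (\<lambda>\<omega>. connected_to M \<omega> {0} (rsphere M n 0))"
proof -
  have "event M (\<lambda>\<omega>. \<exists>N\<in>(UNIV::nat set). path_event (rbox M 0 (real N)) (\<lambda>vs. hd vs = 0 \<and> last vs \<in> rsphere M n 0) \<omega>)"
    by (intro event_bex cylinder_event cylinder_path_event finite_sites_rbox) auto
  moreover have "(\<exists>N\<in>(UNIV::nat set). path_event (rbox M 0 (real N)) (\<lambda>vs. hd vs = 0 \<and> last vs \<in> rsphere M n 0) \<omega>)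
      = connected_to M \<omega> {0} (rsphere M n 0)" for \<omega>
  proof
    assume "connected_to M \<omega> {0} (rsphere M n 0)"
    then obtain vs where vs: "occupied_path M \<omega> vs" "hd vs = 0" "last vs \<in> rsphere M n 0" by (auto simp: connected_in_def)
    obtain N :: nat where "Max (rnorm M ` insert 0 (set vs)) \<le> real N" using real_arch_simple by blast
    then have "set vs \<subseteq> rbox M 0 (real N)" by (auto simp: rbox_def)
    then show "\<exists>N\<in>(UNIV::nat set). path_event (rbox M 0 (real N)) (\<lambda>vs. hd vs = 0 \<and> last vs \<in> rsphere M n 0) \<omega>"
      using vs unfolding path_event_def by blast
  qed (auto simp: path_event_def connected_in_def)
  ultimately show ?thesis by simp
qed

lemma sphere_arm_le: "sphere_arm n \<le> arm (real n)"
  unfolding sphere_arm_def arm_def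
proof (rule pr_mono)
  fix \<omega> assume "connected_to M \<omega> {0} (rsphere M n 0)"
  then obtain vs where "occupied_path M \<omega> vs" "hd vs = 0" "last vs \<in> rsphere M n 0" by (auto simp: connected_in_def)
  then show "reach 0 (real n) \<omega>" unfolding reach_def by (intro exI[of _ vs]) (auto simp: rsphere_def)
qed (intro cylinder_event reach_event; simp)

text \<open>The cluster of the origin is explored up to a fixed graph distance from the sphere. The rest of the
  connection uses a path of bounded length all of whose elements are still unexplored.\<close>

lemma sphere_arm_ge: "\<exists>k>0. \<forall>n. k * arm (real n) \<le> sphere_arm n"
proof -
  let ?q = "\<lambda>_::complex set. p_c M"
  obtain K where K: "\<And>x y. x \<in> sites M \<Longrightarrow> y \<in> sites M \<Longrightarrow> rnorm M (x - y) \<le> R + 1 \<Longrightarrow>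
      \<exists>vs. graph_path M vs \<and> hd vs = x \<and> last vs = y \<and> length vs \<le> K"
    using graph_path_exists[of "R + 1"] by blast
  \<comment> \<open>The connecting path consists of a boundary vertex of the explored part and a
    tail of at most K vertices.\<close>
  define \<kappa>1 where "\<kappa>1 = p_c M ^ (Suc K)\<^sup>2"
  have \<kappa>1: "0 < \<kappa>1" using p_c_bounds by (simp add: \<kappa>1_def)
  have main: "\<kappa>1 * arm (real n) \<le> sphere_arm n" if n: "real K * R < real n" for n
  proof -
    define W where "W = {v \<in> sites M. \<exists>vs. graph_path M vs \<and> hd vs = v \<and> last vs \<in> rsphere M n 0 \<and> length vs \<le> K}"
    define S where "S = {v. rnorm M v < real n} - W"
    have S_fin: "finite (sites M \<inter> S)"
      by (rule finite_subset[OF _ finite_sites_rbox[of 0 "real n"]]) (auto simp: S_def rbox_def)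
    \<comment> \<open>A walk with K vertices covers at most distance K R, which is less than n, so
      exploration from the origin is not void.\<close>
    have zero_W: "0 \<notin> W"
    proof
      assume "0 \<in> W"
      then obtain vs where vs: "graph_path M vs" "hd vs = 0" "last vs \<in> rsphere M n 0" "length vs \<le> K" by (auto simp: W_def)
      have walk: "rnorm M (last us - hd us) \<le> real (length us - 1) * R" if "successively (\<lambda>u v. {u, v} \<in> edges M) us" "us \<noteq> []" for us
        using that
      proof (induction "\<lambda>u v. {u, v} \<in> edges M" us rule: successively.induct)
        case (3 u v us)
        have "rnorm M (last (v # us) - v) \<le> real (length (v # us) - 1) * R" using 3 by simp
        moreover have "rnorm M (v - u) \<le> R" using 3(2) R(2)[of v u] by (simp add: insert_commute)
        ultimately show ?case using rnorm_triangle_sub[of M "last (v # us)" u v] by (simp add: algebra_simps)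
      qed auto
      have "rnorm M (last vs - hd vs) \<le> real (length vs - 1) * R" using vs(1) by (intro walk) (auto simp: occupied_path_def)
      also have "\<dots> \<le> real K * R" using vs(4) R(1) by (intro mult_right_mono) auto
      finally show False using vs(2,3) n by (simp add: rsphere_def)
    qed
    define V where "V = {v \<in> sites M \<inter> S. \<exists>u\<in>W. {v, u} \<in> edges M}"
    have V_fin: "finite V" using S_fin by (rule rev_finite_subset) (auto simp: V_def)
    define tail where "tail v = (SOME us. graph_path M us \<and> {v, hd us} \<in> edges M \<and> set us \<subseteq> W \<and> last us \<in> rsphere M n 0 \<and> length us \<le> K)" for v
    have tail: "graph_path M (tail v)" "{v, hd (tail v)} \<in> edges M" "set (tail v) \<subseteq> W" "last (tail v) \<in> rsphere M n 0" "length (tail v) \<le> K"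
      if v: "v \<in> V" for v
    proof -
      obtain u where u: "u \<in> W" "{v, u} \<in> edges M" using v by (auto simp: V_def)
      then obtain vs where vs: "graph_path M vs" "hd vs = u" "last vs \<in> rsphere M n 0" "length vs \<le> K" by (auto simp: W_def)
      have "set vs \<subseteq> W"
      proof
        fix z assume z: "z \<in> set vs"
        then obtain k where k: "k < length vs" "vs ! k = z" by (auto simp: in_set_conv_nth)
        have "graph_path M (drop k vs)" "hd (drop k vs) = z" "last (drop k vs) \<in> rsphere M n 0" "length (drop k vs) \<le> K"
          using occupied_path_drop[OF vs(1) k(1)] k vs by (auto simp: hd_drop_conv_nth)
        moreover have "z \<in> sites M" using z vs(1) by (auto simp: occupied_path_def)
        ultimately show "z \<in> W" unfolding W_def by blast
      qed
      then have "\<exists>us. graph_path M us \<and> {v, hd us} \<in> edges M \<and> set us \<subseteq> W \<and> last us \<in> rsphere M n 0 \<and> length us \<le> K"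
        using vs u by (intro exI[of _ vs]) auto
      from someI_ex[OF this] show "graph_path M (tail v)" "{v, hd (tail v)} \<in> edges M" "set (tail v) \<subseteq> W" "last (tail v) \<in> rsphere M n 0" "length (tail v) \<le> K"
        unfolding tail_def by blast+
    qed
    \<comment> \<open>Exactly those elements of the prolonged tail that touch \<open>W\<close>. As S
      avoids \<open>W\<close>, they are not visible to paths in S, so their states are independent
      of the exploration.\<close>
    define I where "I v = {e \<in> elems (set (v # tail v)). e \<inter> W \<noteq> {}}" for v
    have I: "finite (I v)" "I v \<subseteq> elements M" "I v \<inter> elems S = {}" for v
    proof -
      have "finite (elems (set (v # tail v)))" by (rule finite_elems) simp
      then show "finite (I v)" unfolding I_def by simp
      show "I v \<subseteq> elements M" by (auto simp: I_def elems_def)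
      show "I v \<inter> elems S = {}" by (auto simp: I_def elems_def S_def)
    qed
    have I_card: "card (I v) \<le> (Suc K)\<^sup>2" if "v \<in> V" for v
    proof -
      have "card (I v) \<le> card (elems (set (v # tail v)))"
        by (rule card_mono) (auto simp: I_def intro: finite_elems)
      also have "\<dots> \<le> (Suc K)\<^sup>2" using tail(5)[OF that] by (intro card_elems_path) simp
      finally show ?thesis .
    qed
    define A where "A v = path_event S (\<lambda>vs. hd vs = 0 \<and> last vs = v)" for v
    \<comment> \<open>An enumeration of the boundary vertices: selecting the first one that is
      reached makes the events disjoint, so that independence can be used for each vertex
      separately.\<close>
    obtain f :: "complex \<Rightarrow> nat" where f: "inj_on f V" using finite_imp_inj_to_nat_seg[OF V_fin] by auto
    define E where "E v \<omega> \<longleftrightarrow> A v \<omega> \<and> (\<forall>v'\<in>V. f v' < f v \<longrightarrow> \<not> A v' \<omega>)" for v \<omega>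
    define B where "B v \<omega> \<longleftrightarrow> (\<forall>e\<in>I v. \<omega> e)" for v and \<omega> :: "complex set \<Rightarrow> bool"
    have A_supp: "supported (elems S) (A v)" for v unfolding A_def by (rule supported_path_event)
    have E_supp: "supported (elems S) (E v)" for v
    proof (rule supportedI)
      fix \<omega> \<omega>' assume "\<And>e. e \<in> elems S \<Longrightarrow> \<omega> e = \<omega>' e" and E: "E v \<omega>"
      then have "A v' \<omega> = A v' \<omega>'" for v' using A_supp[of v'] unfolding supported_def by blast
      then show "E v \<omega>'" using E unfolding E_def by simp
    qed
    have E_cyl: "cylinder M (E v)" for v by (rule cylinderI[OF finite_elems[OF S_fin] elems_subset E_supp])
    have B_supp: "supported (I v) (B v)" for v unfolding B_def supported_def by simp
    have B_cyl: "cylinder M (B v)" for v by (rule cylinderI[OF I(1,2) B_supp])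
    have EB: "pr M ?q (\<lambda>\<omega>. E v \<omega> \<and> B v \<omega>) = pr M ?q (E v) * pr M ?q (B v)" for v
      by (rule pr_indep[OF finite_elems[OF S_fin] elems_subset E_supp B_cyl B_supp _ field_prob_field[OF field_pc]])
        (use I(3) in blast)
    have disj: "v = v'" if "v \<in> V" "v' \<in> V" "E v \<omega>" "E v' \<omega>" for v v' \<omega>
    proof -
      have "\<not> f v < f v'" "\<not> f v' < f v" using that unfolding E_def by blast+
      then have "f v = f v'" by simp
      then show ?thesis using f that by (auto dest: inj_onD)
    qed
    have "arm (real n) \<le> pr M ?q (\<lambda>\<omega>. \<exists>v\<in>V. E v \<omega>)"
      unfolding arm_def
    proof (rule pr_mono)
      fix \<omega> assume "reach 0 (real n) \<omega>"
      then obtain vs where vs: "occupied_path M \<omega> vs" "hd vs = 0" "real n \<le> rnorm M (last vs)" by (auto simp: reach_def)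
      obtain ws where ws: "occupied_path M \<omega> ws" "hd ws = hd vs" "real n \<le> rnorm M (last ws) \<or> last ws \<in> W"
        "\<And>v. v \<in> set (butlast ws) \<Longrightarrow> \<not> (real n \<le> rnorm M v \<or> v \<in> W)"
        by (rule first_hit[OF vs(1), of "\<lambda>v. real n \<le> rnorm M v \<or> v \<in> W"]) (use vs in auto)
      have ne: "ws \<noteq> []" using ws(1) by (auto simp: occupied_path_def)
      have "butlast ws \<noteq> []"
      proof
        assume "butlast ws = []"
        then have "last ws = 0" using ne ws(2) vs(2) by (metis append_Nil append_butlast_last_id list.sel(1))
        moreover have "0 < real n" using n R(1) by (smt (verit) mult_nonneg_nonneg of_nat_0_le_iff)
        ultimately show False using ws(3) zero_W by simp
      qed
      let ?v = "last (butlast ws)" and ?u = "last ws"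
      have split: "ws = butlast ws @ [?u]" using ne by simp
      then have edge: "{?v, ?u} \<in> edges M"
        using ws(1) \<open>butlast ws \<noteq> []\<close> successively_append_iff[of "\<lambda>u v. {u, v} \<in> edges M" "butlast ws" "[?u]"]
        by (simp add: occupied_path_def)
      have in_S: "set (butlast ws) \<subseteq> S" using ws(4) by (fastforce simp: S_def not_le)
      \<comment> \<open>A vertex outside the rhombus, entered by one step from inside, is within R +
        1 of a site of the sphere and belongs to \<open>W\<close> by the choice of K.\<close>
      have "?u \<in> W"
      proof (cases "?u \<in> W")
        case False
        then have far: "real n \<le> rnorm M ?u" using ws(3) by simp
        have "rnorm M ?v < real n" using ws(4)[of ?v] \<open>butlast ws \<noteq> []\<close> by simp
        then have "rnorm M ?u \<le> real n + R" using R(2)[OF edge] rnorm_triangle_sub[of M ?u 0 ?v] rnorm_commute[of M ?u ?v] by simp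
        then obtain y where y: "y \<in> rsphere M n 0" "rnorm M (?u - y) \<le> R + 1"
          using nearby_sphere_site[OF far] edge_sites[OF edge] by auto
        then show ?thesis using K[of ?u y] edge_sites[OF edge] by (auto simp: W_def rsphere_def)
      qed simp
      then have "?v \<in> V" using edge edge_sites[OF edge] in_S \<open>butlast ws \<noteq> []\<close> by (auto simp: V_def)
      moreover have "A ?v \<omega>"
      proof -
        have len: "length ws - 1 > 0" using \<open>butlast ws \<noteq> []\<close> by (cases ws) auto
        have "occupied_path M \<omega> (butlast ws)" unfolding butlast_conv_take by (rule occupied_path_take[OF ws(1) len])
        moreover have "hd (butlast ws) = 0" using split \<open>butlast ws \<noteq> []\<close> ws(2) vs(2) by (metis hd_append2)
        ultimately show ?thesis unfolding A_def path_event_def using in_S by blast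
      qed
      ultimately have "\<exists>v. v \<in> V \<and> A v \<omega>" by blast
      then obtain v where v: "v \<in> V \<and> A v \<omega>" "\<And>y. y \<in> V \<and> A y \<omega> \<Longrightarrow> f v \<le> f y" 
        using ex_has_least_nat[of "\<lambda>v. v \<in> V \<and> A v \<omega>" _ f] by blast
      then have "E v \<omega>" unfolding E_def by (metis leD)
      then show "\<exists>v\<in>V. E v \<omega>" using v by blast
    qed (intro cylinder_event cylinder_bex V_fin E_cyl)
    also have "\<dots> = (\<Sum>v\<in>V. pr M ?q (E v))" using disj by (intro pr_disjoint_bex V_fin cylinder_event E_cyl)
    finally have "\<kappa>1 * arm (real n) \<le> (\<Sum>v\<in>V. pr M ?q (E v) * \<kappa>1)"
      using \<kappa>1 by (subst sum_distrib_right[symmetric]) (simp add: mult.commute)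
    also have "\<dots> \<le> (\<Sum>v\<in>V. pr M ?q (\<lambda>\<omega>. E v \<omega> \<and> B v \<omega>))"
    proof (intro sum_mono)
      fix v assume "v \<in> V"
      then have "\<kappa>1 \<le> pr M ?q (B v)" unfolding \<kappa>1_def B_def[abs_def] by (intro pr_open_elements field_pc I I_card)
      then show "pr M ?q (E v) * \<kappa>1 \<le> pr M ?q (\<lambda>\<omega>. E v \<omega> \<and> B v \<omega>)" unfolding EB by (intro mult_left_mono) auto
    qed
    also have "\<dots> = pr M ?q (\<lambda>\<omega>. \<exists>v\<in>V. E v \<omega> \<and> B v \<omega>)"
      by (rule pr_disjoint_bex[symmetric, OF V_fin]) (auto intro!: cylinder_event cylinder_conj E_cyl B_cyl dest: disj)
    also have "\<dots> \<le> sphere_arm n"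
      unfolding sphere_arm_def
    proof (rule pr_mono[OF event_sphere])
      fix \<omega> assume "\<exists>v\<in>V. E v \<omega> \<and> B v \<omega>"
      then obtain v where v: "v \<in> V" "A v \<omega>" "B v \<omega>" by (auto simp: E_def)
      obtain vs where vs: "occupied_path M \<omega> vs" "hd vs = 0" "last vs = v" using v(2) by (auto simp: A_def path_event_def)
      note t = tail[OF v(1)]
      have ne: "vs \<noteq> []" "tail v \<noteq> []" using vs(1) t(1) by (auto simp: occupied_path_def)
      have open_el: "\<omega> e" if "e \<in> elements M" "e \<subseteq> set (v # tail v)" "e \<inter> W \<noteq> {}" for e
        using v(3) that by (auto simp: B_def I_def elems_def)
      have "occupied_path M \<omega> (vs @ tail v)"
      proof (cases "mode M")
        case Site
        have "\<omega> {z}" if "z \<in> set (tail v)" for z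
        proof (rule open_el)
          have "z \<in> sites M" using that t(1) by (auto simp: occupied_path_def)
          then show "{z} \<in> elements M" using Site by (simp add: elements_def)
        qed (use that t(3) in auto)
        then show ?thesis using vs t(1,2) Site unfolding occupied_path_def successively_append_iff by auto
      next
        case Bond
        have w: "\<omega> {a, b}" if "{a, b} \<in> edges M" "a \<in> set (v # tail v)" "b \<in> set (tail v)" for a b
          by (rule open_el) (use that t(3) Bond in \<open>auto simp: elements_def\<close>)
        have "successively (\<lambda>a b. {a, b} \<in> edges M) (tail v)" using t(1) by (simp add: occupied_path_def)
        then have "successively (\<lambda>a b. \<omega> {a, b}) (tail v)" by (rule successively_mono) (auto intro: w)
        moreover have "\<omega> {v, hd (tail v)}" using w[OF t(2)] ne by simp
        ultimately show ?thesis using vs t(1,2) Bond unfolding occupied_path_def successively_append_iff by auto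
      qed
      then show "connected_to M \<omega> {0} (rsphere M n 0)"
        unfolding connected_in_def using ne vs(2) t(4) by (intro exI[of _ "vs @ tail v"]) auto
    qed
    finally show ?thesis .
  qed
  \<comment> \<open>The finitely many radii not covered by \<open>main\<close> are settled by
    positivity.\<close>
  define N where "N = nat \<lceil>real K * R\<rceil>"
  have "\<exists>k>0. \<forall>n\<le>N. k \<le> sphere_arm n"
  proof -
    have pos: "0 < sphere_arm n" for n
    proof -
      obtain k where k: "0 < k" "k \<le> pr M ?q (\<lambda>\<omega>. con M \<omega> UNIV 0 (lat M (real n) 0))" using lat_path_open[of n] field_pc by blast
      have "lat M (real n) 0 \<in> rsphere M n 0"
        using lat_in_sites[of "int n" 0] by (auto simp: rsphere_def rnorm_def)
      then have "pr M ?q (\<lambda>\<omega>. con M \<omega> UNIV 0 (lat M (real n) 0)) \<le> sphere_arm n"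
        unfolding sphere_arm_def by (intro pr_mono event_sphere) (auto simp: connected_in_def)
      then show ?thesis using k by linarith
    qed
    show ?thesis
      by (rule exI[of _ "Min (sphere_arm ` {..N})"]) (auto simp: pos)
  qed
  then obtain k where k: "0 < k" "\<And>n. n \<le> N \<Longrightarrow> k \<le> sphere_arm n" by blast
  have "min \<kappa>1 k * arm (real n) \<le> sphere_arm n" for n
  proof (cases "n \<le> N")
    case True
    have "min \<kappa>1 k * arm (real n) \<le> k * 1" using k(1) arm_le_1[of "real n"] \<kappa>1 by (intro mult_mono) auto
    then show ?thesis using k(2)[OF True] by simp
  next
    case False
    then have "\<lceil>real K * R\<rceil> < int n" unfolding N_def by linarith
    then have "real K * R < real n" by linarith
    from main[OF this] show ?thesis
      using mult_right_mono[of "min \<kappa>1 k" \<kappa>1 "arm (real n)"] arm_le_1(2)[of "real n"] by linarith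
  qed
  moreover have "0 < min \<kappa>1 k" using \<kappa>1 k by simp
  ultimately show ?thesis by blast
qed

section \<open>Nets at growing scales\<close>

lemma geometric_tail_le:
  fixes b :: real assumes "0 \<le> b" "b < 1"
  shows "(\<Sum>k\<in>{k0..m}. b ^ k) \<le> b ^ k0 / (1 - b)"
  using assms by (simp add: sum_gp divide_right_mono)

text \<open>Beyond some k0 the union bound leaves probability at least 1/2 for all nets together;
  the first k0 nets have a uniform positive probability by FKG, and FKG joins the two
  groups.\<close>

lemma nets_occur:
  fixes A b :: real
  assumes "0 \<le> A" "0 \<le> b" "b < 1"
  shows "\<exists>c>0. \<forall>q n x. field q \<longrightarrow> m0 \<le> n \<longrightarrow> (\<forall>k. 1 - pr M q (net (3 ^ k * n) x) \<le> A * b ^ k) \<longrightarrow>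
     (\<forall>m. c \<le> pr M q (\<lambda>\<omega>. \<forall>k\<in>{..m}. net (3 ^ k * n) x \<omega>))"
proof -
  have "(\<lambda>k. A * (b ^ k / (1 - b))) \<longlonglongrightarrow> A * (0 / (1 - b))"
    using assms by (intro tendsto_intros LIMSEQ_realpow_zero) auto
  moreover have "A * (0 / (1 - b)) < 1 / 2" by simp
  ultimately have "\<forall>\<^sub>F k in sequentially. A * (b ^ k / (1 - b)) < 1 / 2" by (rule order_tendstoD(2))
  then obtain k0 where k0: "A * (b ^ k0 / (1 - b)) < 1 / 2" by (auto simp: eventually_sequentially)
  define c where "c = (q0 ^ 50) ^ k0 * (1 / 2)"
  have "0 < c" using q0 by (simp add: c_def)
  moreover have "c \<le> pr M q (\<lambda>\<omega>. \<forall>k\<in>{..m}. net (3 ^ k * n) x \<omega>)"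
    if q: "field q" and n: "m0 \<le> n" and f: "\<And>k. 1 - pr M q (net (3 ^ k * n) x) \<le> A * b ^ k" for q n x m
  proof -
    have nk: "m0 \<le> 3 ^ k * n" for k using n by (metis le_trans mult_le_mono1 nat_mult_1 one_le_numeral one_le_power)
    have ev: "cylinder M (net (3 ^ k * n) x)" "up_event (net (3 ^ k * n) x)" for k by (rule net_event)+
    have "(q0 ^ 50) ^ k0 = (\<Prod>k\<in>{..<k0}. q0 ^ 50)" by simp
    also have "\<dots> \<le> (\<Prod>k\<in>{..<k0}. pr M q (net (3 ^ k * n) x))"
      using q0 pr_net_ge[OF q nk] by (intro prod_mono) auto
    also have "\<dots> \<le> pr M q (\<lambda>\<omega>. \<forall>k\<in>{..<k0}. net (3 ^ k * n) x \<omega>)"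
      by (intro FKG_ball ev field_prob_field q) auto
    finally have 1: "(q0 ^ 50) ^ k0 \<le> pr M q (\<lambda>\<omega>. \<forall>k\<in>{..<k0}. net (3 ^ k * n) x \<omega>)" .
    have "(\<Sum>k\<in>{k0..m}. 1 - pr M q (net (3 ^ k * n) x)) \<le> (\<Sum>k\<in>{k0..m}. A * b ^ k)" by (intro sum_mono f)
    also have "\<dots> \<le> A * (b ^ k0 / (1 - b))"
      using mult_left_mono[OF geometric_tail_le[OF assms(2,3), of k0 m] assms(1)] by (simp add: sum_distrib_left)
    finally have "(\<Sum>k\<in>{k0..m}. 1 - pr M q (net (3 ^ k * n) x)) \<le> A * (b ^ k0 / (1 - b))" .
    moreover have "1 - (\<Sum>k\<in>{k0..m}. 1 - pr M q (net (3 ^ k * n) x)) \<le> pr M q (\<lambda>\<omega>. \<forall>k\<in>{k0..m}. net (3 ^ k * n) x \<omega>)"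
      by (intro pr_ball_ge cylinder_event ev) simp
    ultimately have 2: "1 / 2 \<le> pr M q (\<lambda>\<omega>. \<forall>k\<in>{k0..m}. net (3 ^ k * n) x \<omega>)" using k0 by linarith
    have "c \<le> pr M q (\<lambda>\<omega>. \<forall>k\<in>{..<k0}. net (3 ^ k * n) x \<omega>) * pr M q (\<lambda>\<omega>. \<forall>k\<in>{k0..m}. net (3 ^ k * n) x \<omega>)"
      unfolding c_def using 1 2 q0 by (intro mult_mono) auto
    also have "\<dots> \<le> pr M q (\<lambda>\<omega>. (\<forall>k\<in>{..<k0}. net (3 ^ k * n) x \<omega>) \<and> (\<forall>k\<in>{k0..m}. net (3 ^ k * n) x \<omega>))"
      by (intro Harris_FKG cylinder_ball up_event_ball ev field_prob_field q) auto
    also have "\<dots> \<le> pr M q (\<lambda>\<omega>. \<forall>k\<in>{..m}. net (3 ^ k * n) x \<omega>)"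
    proof (rule pr_mono)
      fix \<omega> assume *: "(\<forall>k\<in>{..<k0}. net (3 ^ k * n) x \<omega>) \<and> (\<forall>k\<in>{k0..m}. net (3 ^ k * n) x \<omega>)"
      show "\<forall>k\<in>{..m}. net (3 ^ k * n) x \<omega>"
      proof
        fix k assume "k \<in> {..m}"
        then show "net (3 ^ k * n) x \<omega>" using * by (cases "k < k0") auto
      qed
    qed (intro cylinder_event cylinder_ball ev; simp)
    finally show ?thesis .
  qed
  ultimately show ?thesis by blast
qed

lemma scale_exceeds: "1 \<le> n \<Longrightarrow> \<exists>m. real N \<le> 2 * real (3 ^ m * n)"
proof -
  assume n: "1 \<le> n"
  have "N < 3 ^ N" by (rule less_exp[THEN less_le_trans]) (auto intro: power_mono)
  also have "\<dots> \<le> 3 ^ N * n" using n by simp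
  finally have "real N \<le> real (3 ^ N * n)" by (intro of_nat_mono) simp
  then show ?thesis by (intro exI[of _ N]) linarith
qed

text \<open>Nets carry a reached distance 2n on to any larger distance; FKG charges a constant
  factor that does not grow with the number of scales.\<close>

lemma infinite_ge_reach:
  assumes q: "field q" and n: "1 \<le> n" and c: "0 \<le> b" "\<And>m. b \<le> pr M q (\<lambda>\<omega>. \<forall>k\<in>{..m}. net (3 ^ k * n) x \<omega>)"
  shows "b * pr M q (reach x (2 * real n)) \<le> pr M q (\<lambda>\<omega>. connected_to_infinity M \<omega> x)"
proof (rule LIMSEQ_le_const[OF pr_reach_lim], rule exI[of _ 0], intro allI impI)
  fix N :: nat
  obtain m where m: "real N \<le> 2 * real (3 ^ m * n)" using scale_exceeds[OF n] by blast
  have "b * pr M q (reach x (2 * real n)) \<le> pr M q (\<lambda>\<omega>. \<forall>k\<in>{..m}. net (3 ^ k * n) x \<omega>) * pr M q (reach x (2 * real n))"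
    using c(2)[of m] by (intro mult_right_mono) auto
  also have "\<dots> \<le> pr M q (\<lambda>\<omega>. (\<forall>k\<in>{..m}. net (3 ^ k * n) x \<omega>) \<and> reach x (2 * real n) \<omega>)"
    by (intro Harris_FKG cylinder_ball up_event_ball net_event reach_event field_prob_field q) auto
  also have "\<dots> \<le> pr M q (reach x (real N))"
  proof (rule pr_mono)
    fix \<omega> assume *: "(\<forall>k\<in>{..m}. net (3 ^ k * n) x \<omega>) \<and> reach x (2 * real n) \<omega>"
    have "reach x (2 * real (3 ^ m * n)) \<omega>" by (rule reach_through_nets[OF n]) (use * in auto)
    then show "reach x (real N) \<omega>" using m by (rule reach_antimono)
  qed (intro cylinder_event reach_event; simp)
  finally show "b * pr M q (reach x (2 * real n)) \<le> pr M q (reach x (real N))" .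
qed

text \<open>Here the union bound replaces FKG: the error is additive and the factor in front stays
  1, as needed for covariances, where leading terms must cancel.\<close>

lemma reach_le_infinite_plus:
  assumes n: "1 \<le> n" and s: "\<And>m. (\<Sum>k\<in>{..m}. 1 - pr M q (net (3 ^ k * n) x)) \<le> s"
  shows "pr M q (reach x (2 * real n)) \<le> pr M q (\<lambda>\<omega>. connected_to_infinity M \<omega> x) + s"
proof -
  have "pr M q (reach x (2 * real n)) - s \<le> pr M q (reach x (real N))" for N
  proof -
    obtain m where m: "real N \<le> 2 * real (3 ^ m * n)" using scale_exceeds[OF n] by blast
    let ?G = "\<lambda>\<omega>. \<forall>k\<in>{..m}. net (3 ^ k * n) x \<omega>"
    have ev: "event M ?G" by (intro cylinder_event cylinder_ball net_event) auto
    have "1 - (\<Sum>k\<in>{..m}. 1 - pr M q (net (3 ^ k * n) x)) \<le> pr M q ?G"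
      by (intro pr_ball_ge cylinder_event net_event) simp
    then have "1 - s \<le> pr M q ?G" using s[of m] by linarith
    moreover have "pr M q (reach x (2 * real n)) \<le> pr M q (\<lambda>\<omega>. reach x (real N) \<omega> \<or> \<not> ?G \<omega>)"
    proof (rule pr_mono)
      fix \<omega> assume r: "reach x (2 * real n) \<omega>"
      show "reach x (real N) \<omega> \<or> \<not> ?G \<omega>"
      proof (cases "?G \<omega>")
        case True
        have "reach x (2 * real (3 ^ m * n)) \<omega>" by (rule reach_through_nets[OF n r]) (use True in auto)
        then show ?thesis using m reach_antimono by blast
      qed simp
    qed (intro event_disj event_not ev cylinder_event reach_event; simp)
    moreover have "\<dots> \<le> pr M q (reach x (real N)) + pr M q (\<lambda>\<omega>. \<not> ?G \<omega>)"
      by (intro pr_disj_le event_not ev cylinder_event reach_event) simp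
    ultimately show ?thesis using pr_not[OF ev, of q] by linarith
  qed
  then have "pr M q (reach x (2 * real n)) - s \<le> pr M q (\<lambda>\<omega>. connected_to_infinity M \<omega> x)"
    by (intro LIMSEQ_le_const[OF pr_reach_lim]) auto
  then show ?thesis by simp
qed

definition decay_const :: "nat \<Rightarrow> real" where
  "decay_const k = (SOME C. 0 \<le> C \<and> (\<forall>r p m a b. 1 \<le> r \<longrightarrow> pp r \<le> p \<longrightarrow> p \<le> 1 \<longrightarrow> 1 \<le> m \<longrightarrow>
     1 - pr M (\<lambda>_. p) (HX m a b) \<le> C * (r / real m) ^ k \<and> 1 - pr M (\<lambda>_. p) (VX m a b) \<le> C * (r / real m) ^ k))"

lemma decay_const:
  "0 \<le> decay_const k"
  "1 \<le> r \<Longrightarrow> pp r \<le> p \<Longrightarrow> p \<le> 1 \<Longrightarrow> 1 \<le> m \<Longrightarrow> 1 - pr M (\<lambda>_. p) (HX m a b) \<le> decay_const k * (r / real m) ^ k"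
  "1 \<le> r \<Longrightarrow> pp r \<le> p \<Longrightarrow> p \<le> 1 \<Longrightarrow> 1 \<le> m \<Longrightarrow> 1 - pr M (\<lambda>_. p) (VX m a b) \<le> decay_const k * (r / real m) ^ k"
proof -
  have "0 \<le> decay_const k \<and> (\<forall>r p m a b. 1 \<le> r \<longrightarrow> pp r \<le> p \<longrightarrow> p \<le> 1 \<longrightarrow> 1 \<le> m \<longrightarrow>
     1 - pr M (\<lambda>_. p) (HX m a b) \<le> decay_const k * (r / real m) ^ k \<and> 1 - pr M (\<lambda>_. p) (VX m a b) \<le> decay_const k * (r / real m) ^ k)"
    using someI_ex[OF crossing_decay[of k]] unfolding decay_const_def .
  then show "0 \<le> decay_const k"
    "1 \<le> r \<Longrightarrow> pp r \<le> p \<Longrightarrow> p \<le> 1 \<Longrightarrow> 1 \<le> m \<Longrightarrow> 1 - pr M (\<lambda>_. p) (HX m a b) \<le> decay_const k * (r / real m) ^ k"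
    "1 \<le> r \<Longrightarrow> pp r \<le> p \<Longrightarrow> p \<le> 1 \<Longrightarrow> 1 \<le> m \<Longrightarrow> 1 - pr M (\<lambda>_. p) (VX m a b) \<le> decay_const k * (r / real m) ^ k"
    by blast+
qed

lemma grid_fails_decay:
  assumes q: "field q" and r: "1 \<le> r" and n: "1 \<le> n"
    and le: "\<And>e. e \<in> elems (cell_region n i0 i1 j0 j1) \<Longrightarrow> pp r \<le> q e"
  shows "1 - pr M q (grid n i0 i1 j0 j1) \<le> 2 * real (card ({i0..i1} \<times> {j0..j1})) * (decay_const k * (r / real n) ^ k)"
proof (rule grid_fails_le)
  fix a b assume ab: "a \<in> {i0..i1}" "b \<in> {j0..j1}"
  have p: "p_c M \<le> pp r" "pp r \<le> 1" using pp[of r] r by auto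
  have fp: "field (\<lambda>_. pp r)" using p by (rule field_const)
  have sub: "elems (cell_region n a a b b) \<subseteq> elems (cell_region n i0 i1 j0 j1)"
    using ab by (intro elems_mono cell_region_mono) auto
  have fin: "finite (elems (cell_region n a a b b))" by (intro finite_elems finite_cell_region)
  have "pr M (\<lambda>_. pp r) (HX n a b) \<le> pr M q (HX n a b)" "pr M (\<lambda>_. pp r) (VX n a b) \<le> pr M q (VX n a b)"
    by (rule pr_mono_field[OF fin elems_subset HX_VX_event(5,3) field_prob_field[OF fp] field_prob_field[OF q]]
        pr_mono_field[OF fin elems_subset HX_VX_event(6,4) field_prob_field[OF fp] field_prob_field[OF q]]; use sub le in blast)+
  then show "1 - pr M q (HX n a b) \<le> decay_const k * (r / real n) ^ k \<and> 1 - pr M q (VX n a b) \<le> decay_const k * (r / real n) ^ k"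
    using decay_const(2,3)[OF r order_refl p(2) n, of a b k] by linarith
qed

text \<open>The radius 6n comes from two layers of cells and the margin of four in each region; the
  factor 50 counts the crossings.\<close>

lemma net_fails_decay:
  assumes q: "field q" and r: "1 \<le> r" and n: "1 \<le> n"
    and le: "\<And>e. e \<in> elems (rbox M x (6 * real n)) \<Longrightarrow> pp r \<le> q e"
  shows "1 - pr M q (net n x) \<le> 50 * decay_const k * (r / real n) ^ k"
proof -
  obtain i j where c: "cell_of n x = (i, j)" by fastforce
  have "cell_region n (i - 2) (i + 2) (j - 2) (j + 2) \<subseteq> rbox M x (6 * real n)"
    using cell_region_rbox[OF cell_of_bounds[OF n c], of 2] by simp
  then have "1 - pr M q (grid n (i - 2) (i + 2) (j - 2) (j + 2)) \<le> 2 * real (card ({i-2..i+2} \<times> {j-2..j+2})) * (decay_const k * (r / real n) ^ k)"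
    using elems_mono le by (intro grid_fails_decay q r n) blast
  then show ?thesis using c by (simp add: net_def card_cartesian_product)
qed

section \<open>Near-critical one-arm estimates\<close>

definition reg_const :: real where
  "reg_const = (SOME C. 1 \<le> C \<and> (\<forall>s t. 1 \<le> s \<longrightarrow> s \<le> t \<longrightarrow> arm s \<le> C * (t / s) * arm t))"

lemma reg_const: "1 \<le> reg_const" "1 \<le> s \<Longrightarrow> s \<le> t \<Longrightarrow> arm s \<le> reg_const * (t / s) * arm t"
  using someI_ex[OF arm_regular] unfolding reg_const_def by blast+

lemma arm_ratio:
  assumes "1 \<le> s" "1 \<le> t" "t \<le> A * s" "1 \<le> A"
  shows "arm s \<le> reg_const * A * arm t"
proof (cases "s \<le> t")
  case True
  have "t / s \<le> A" using assms by (simp add: field_simps)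
  then have "reg_const * (t / s) * arm t \<le> reg_const * A * arm t"
    using reg_const(1) arm_le_1(2)[of t] by (intro mult_right_mono mult_left_mono) auto
  then show ?thesis using reg_const(2)[OF assms(1) True] by linarith
next
  case False
  have "1 * 1 \<le> reg_const * A" using reg_const(1) assms(4) by (intro mult_mono) auto
  then have "1 * arm t \<le> reg_const * A * arm t" using arm_le_1(2)[of t] by (intro mult_right_mono) auto
  then show ?thesis using arm_antimono[of t s] False assms by simp
qed

lemma P_inf_mono: "p_c M \<le> p \<Longrightarrow> p \<le> p' \<Longrightarrow> p' \<le> 1 \<Longrightarrow> P_inf M p \<le> P_inf M p'"
  unfolding P_inf_pr by (rule LIMSEQ_le[OF pr_reach_lim pr_reach_lim]) (auto intro!: pr_mono_p reach_event)

text \<open>For large r the near-critical relation at scale L is transferred to r by comparability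
  of the lengths, regularity of the arm and the comparison with the exact sphere. For r below
  \<open>r0\<close> all quantities are bounded away from zero.\<close>

lemma P_inf_arm: "\<exists>ca Cb. 0 < ca \<and> 0 < Cb \<and> (\<forall>r\<ge>1. ca * arm r \<le> P_inf M (pp r) \<and> P_inf M (pp r) \<le> Cb * arm r)"
proof -
  obtain Ca Cb where C: "0 < Ca" "\<And>p. p_c M < p \<Longrightarrow> p \<le> 1 \<Longrightarrow> Ca * one_arm M (real (L p)) \<le> P_inf M p \<and> P_inf M p \<le> Cb * one_arm M (real (L p))"
    using near_critical by blast
  obtain La Lb r0 where L: "0 < La" "0 < Lb" "1 \<le> r0" "\<And>r. r0 \<le> r \<Longrightarrow> La * r \<le> real (L (pp r)) \<and> real (L (pp r)) \<le> Lb * r"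
    using fs_length_pp by blast
  obtain k where k: "0 < k" "\<And>n. k * arm (real n) \<le> sphere_arm n" using sphere_arm_ge by blast
  have oa: "one_arm M (real n) = sphere_arm n" for n by (simp add: one_arm_eq)
  define A where "A = max 1 (max Lb (1 / La))"
  have A: "1 \<le> A" "Lb \<le> A" "1 / La \<le> A" by (auto simp: A_def)
  have P0: "0 < P_inf M (pp r0)" using threshold[of "pp r0"] pp[of r0] p_c_bounds L(3) by simp
  define ca where "ca = min (Ca * k / (reg_const * A)) (P_inf M (pp r0))"
  define cb where "cb = max (\<bar>Cb\<bar> * (reg_const * A)) (1 / arm r0)"
  have rA: "0 < reg_const * A" using reg_const(1) A(1) by simp
  have "0 < ca" using C(1) k(1) rA P0 by (simp add: ca_def)
  moreover have "0 < cb" using arm_pos[of r0] by (simp add: cb_def less_max_iff_disj)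
  moreover have "ca * arm r \<le> P_inf M (pp r) \<and> P_inf M (pp r) \<le> cb * arm r" if r: "1 \<le> r" for r
  proof (cases "r0 \<le> r")
    case True
    let ?l = "real (L (pp r))"
    have p: "p_c M < pp r" "pp r \<le> 1" using pp[of r] r by auto
    have l1: "1 \<le> ?l" using fs_length(1)[OF p] by simp
    have le: "?l \<le> A * r" using L(4)[OF True] A(2) r mult_right_mono[of Lb A r] by linarith
    have ge: "r \<le> A * ?l"
    proof -
      have "r = 1 / La * (La * r)" using L(1) by simp
      also have "\<dots> \<le> A * ?l" using A L(1) r L(4)[OF True] by (intro mult_mono) auto
      finally show ?thesis .
    qed
    have lo: "arm r \<le> reg_const * A * arm ?l" using arm_ratio[OF r l1 le A(1)] .
    have hi: "arm ?l \<le> reg_const * A * arm r" using arm_ratio[OF l1 r ge A(1)] .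
    have "ca * arm r \<le> Ca * k / (reg_const * A) * arm r"
      using arm_le_1(2)[of r] by (intro mult_right_mono) (auto simp: ca_def)
    also have "\<dots> \<le> Ca * k / (reg_const * A) * (reg_const * A * arm ?l)"
      using lo C(1) k(1) rA by (intro mult_left_mono) auto
    also have "\<dots> = Ca * (k * arm ?l)" using reg_const(1) A(1) by simp
    also have "\<dots> \<le> Ca * sphere_arm (L (pp r))" using k(2) C(1) by (intro mult_left_mono) auto
    also have "\<dots> \<le> P_inf M (pp r)" using C(2)[OF p] unfolding oa by simp
    finally have 1: "ca * arm r \<le> P_inf M (pp r)" .
    have "P_inf M (pp r) \<le> Cb * sphere_arm (L (pp r))" using C(2)[OF p] unfolding oa by simp
    also have "\<dots> \<le> \<bar>Cb\<bar> * arm ?l" using sphere_arm_le by (intro mult_mono) (auto simp: sphere_arm_def)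
    also have "\<dots> \<le> \<bar>Cb\<bar> * (reg_const * A * arm r)" using hi by (intro mult_left_mono) auto
    also have "\<dots> \<le> cb * arm r" using arm_le_1(2)[of r] by (auto simp: cb_def mult.assoc[symmetric] intro!: mult_right_mono)
    finally show ?thesis using 1 by simp
  next
    case False
    have p: "p_c M \<le> pp r0" "pp r0 \<le> pp r" "pp r \<le> 1" using pp[of r] pp[of r0] pp_antimono[of r r0] r False by auto
    have "ca * arm r \<le> P_inf M (pp r0) * 1" using arm_le_1[of r] P0 by (intro mult_mono) (auto simp: ca_def)
    also have "\<dots> \<le> P_inf M (pp r)" using P_inf_mono[OF p] by simp
    finally have 1: "ca * arm r \<le> P_inf M (pp r)" .
    have "P_inf M (pp r) \<le> 1" by (simp add: P_inf_pr)
    also have "1 \<le> 1 / arm r0 * arm r" using arm_pos[of r0] arm_antimono[of r r0] r False by (simp add: field_simps)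
    also have "\<dots> \<le> cb * arm r" using arm_le_1(2)[of r] by (intro mult_right_mono) (auto simp: cb_def)
    finally show ?thesis using 1 by simp
  qed
  ultimately show ?thesis by blast
qed

text \<open>From a scale n \<ge> r on, the failure of the net at scale 3^k n is at most of order
  3^(-k), so percolation costs a constant factor beyond reaching 2n. The factor \<open>C0\<close>
  leaves room for n to exceed \<open>m0\<close> as well.\<close>

lemma near_critical_reach:
  "\<exists>C C0. 0 < C \<and> 1 \<le> C0 \<and> (\<forall>r\<ge>1. \<forall>x\<in>sites M. pr M (\<lambda>_. pp r) (reach x (C0 * r)) \<le> C * arm r)"
proof -
  obtain ca Cb where P: "0 < Cb" "\<And>r. 1 \<le> r \<Longrightarrow> P_inf M (pp r) \<le> Cb * arm r" using P_inf_arm by blast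
  have "0 \<le> 50 * decay_const 1" using decay_const(1) by simp
  from nets_occur[OF this, of "1/3"] obtain c where c: "0 < c"
    "\<And>q n x m. field q \<Longrightarrow> m0 \<le> n \<Longrightarrow> (\<And>k. 1 - pr M q (net (3 ^ k * n) x) \<le> 50 * decay_const 1 * (1/3) ^ k) \<Longrightarrow>
       c \<le> pr M q (\<lambda>\<omega>. \<forall>k\<in>{..m}. net (3 ^ k * n) x \<omega>)" by (auto 4 3)
  define C0 where "C0 = 2 * (real m0 + 2)"
  have "pr M (\<lambda>_. pp r) (reach x (C0 * r)) \<le> (Cb / (c * \<kappa>)) * arm r" if r: "1 \<le> r" and x: "x \<in> sites M" for r x
  proof -
    define n where "n = m0 + nat \<lceil>r\<rceil>"
    have n: "m0 \<le> n" "1 \<le> n" "r \<le> real n" "2 * real n \<le> C0 * r"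
    proof -
      show "m0 \<le> n" "1 \<le> n" using m0(1) by (auto simp: n_def)
      show "r \<le> real n" unfolding n_def by linarith
      have "real (nat \<lceil>r\<rceil>) \<le> r + 1" using r by linarith
      then have "real n \<le> real m0 * 1 + r + 1" unfolding n_def by simp
      also have "\<dots> \<le> real m0 * r + r + r" using r by (intro add_mono mult_left_mono) auto
      finally show "2 * real n \<le> C0 * r" by (simp add: C0_def algebra_simps)
    qed
    have p: "p_c M \<le> pp r" "pp r \<le> 1" using pp[of r] r by auto
    have q: "field (\<lambda>_. pp r)" using p by (rule field_const)
    have "1 - pr M (\<lambda>_. pp r) (net (3 ^ k * n) x) \<le> 50 * decay_const 1 * (1/3) ^ k" for k
    proof -
      have n1: "1 \<le> 3 ^ k * n" using n(2) by simp
      have "1 - pr M (\<lambda>_. pp r) (net (3 ^ k * n) x) \<le> 50 * decay_const 1 * (r / real (3 ^ k * n)) ^ 1"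
        by (rule net_fails_decay[OF q r n1]) simp
      also have "\<dots> \<le> 50 * decay_const 1 * (1/3) ^ k"
        using n(2,3) decay_const(1)[of 1] by (intro mult_left_mono) (auto simp: field_simps)
      finally show ?thesis .
    qed
    then have "c * pr M (\<lambda>_. pp r) (reach x (2 * real n)) \<le> pr M (\<lambda>_. pp r) (\<lambda>\<omega>. connected_to_infinity M \<omega> x)"
      using c(1) by (intro infinite_ge_reach[OF q n(2)] c(2)[OF q n(1)]) auto
    moreover have "pr M (\<lambda>_. pp r) (reach x (C0 * r)) \<le> pr M (\<lambda>_. pp r) (reach x (2 * real n))"
      using n(4) by (intro pr_reach_antimono) auto
    ultimately have "c * pr M (\<lambda>_. pp r) (reach x (C0 * r)) \<le> pr M (\<lambda>_. pp r) (\<lambda>\<omega>. connected_to_infinity M \<omega> x)"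
      using c(1) mult_left_mono[of _ _ c] by (meson less_imp_le order_trans)
    then have "\<kappa> * (c * pr M (\<lambda>_. pp r) (reach x (C0 * r))) \<le> \<kappa> * pr M (\<lambda>_. pp r) (\<lambda>\<omega>. connected_to_infinity M \<omega> x)"
      using \<kappa>(1) by (intro mult_left_mono) auto
    also have "\<dots> \<le> P_inf M (pp r)" by (rule infinite_site_vs_origin(2)[OF x p])
    also have "\<dots> \<le> Cb * arm r" by (rule P(2)[OF r])
    finally show ?thesis using c(1) \<kappa>(1) by (simp add: field_simps)
  qed
  moreover have "0 < Cb / (c * \<kappa>)" using P c \<kappa> by simp
  moreover have "1 \<le> C0" by (simp add: C0_def)
  ultimately show ?thesis by blast
qed

end

section \<open>The inhomogeneous model\<close>

lemma inverse_square_min_le: "0 < a \<Longrightarrow> 0 < b \<Longrightarrow> 1 / (min a b)\<^sup>2 \<le> 1 / a\<^sup>2 + 1 / (b::real)\<^sup>2"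
  by (auto simp: min_def)

lemma inverse_product_le:
  fixes a b :: real assumes "0 < a" "0 < b" shows "1 / (a * b) \<le> 1 / a\<^sup>2 + 1 / b\<^sup>2"
proof -
  have "0 \<le> (1 / a - 1 / b)\<^sup>2" by simp
  then have "2 * (1 / (a * b)) \<le> 1 / a\<^sup>2 + 1 / b\<^sup>2" by (simp add: power2_diff power_one_over field_simps)
  moreover have "0 \<le> 1 / (a * b)" using assms by simp
  ultimately show ?thesis by linarith
qed

context planar_percolation
begin

lemma box_mono: "s \<le> t \<Longrightarrow> rbox M x s \<subseteq> rbox M x t"
  by (auto simp: rbox_def)

lemma card_rbox: "\<exists>K\<ge>1. \<forall>x t. 1 \<le> t \<longrightarrow> real (card (sites M \<inter> rbox M x t)) \<le> K * t\<^sup>2"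
proof -
  obtain K where K: "1 \<le> K" "\<And>a b s t. 0 \<le> s \<Longrightarrow> 0 \<le> t \<Longrightarrow>
     real (card {v \<in> sites M. a \<le> coord1 M v \<and> coord1 M v \<le> a + s \<and> b \<le> coord2 M v \<and> coord2 M v \<le> b + t}) \<le> K * (s + 2) * (t + 2)"
    using card_sites_rectangle by blast
  have "real (card (sites M \<inter> rbox M x t)) \<le> (16 * K) * t\<^sup>2" if "1 \<le> t" for x t
  proof -
    have eq: "sites M \<inter> rbox M x t = {v \<in> sites M. coord1 M x - t \<le> coord1 M v \<and> coord1 M v \<le> (coord1 M x - t) + 2 * t \<and>
        coord2 M x - t \<le> coord2 M v \<and> coord2 M v \<le> (coord2 M x - t) + 2 * t}"
      by (auto simp: rbox_def rnorm_le_iff coord_linear abs_le_iff)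
    have "real (card (sites M \<inter> rbox M x t)) \<le> K * (2 * t + 2) * (2 * t + 2)" unfolding eq using that by (intro K) auto
    also have "\<dots> \<le> K * (4 * t) * (4 * t)" using K(1) that by (intro mult_mono) auto
    finally show ?thesis by (simp add: power2_eq_square)
  qed
  then show ?thesis using K(1) by (intro exI[of _ "16 * K"]) auto
qed

text \<open>Dyadic shells: the shell of radius 2^k contributes at most 4 K a^k with a = 2^(2 - s) >
  1, so the outermost one dominates. The constant is chosen to satisfy C + 4 K \<le> C a, which
  closes the induction.\<close>

lemma sum_inverse_powers:
  assumes s: "0 < s" "s < 2"
  shows "\<exists>C>0. \<forall>x t. 1 \<le> t \<longrightarrow> (\<Sum>y\<in>sites M \<inter> rbox M x t. max 1 (rnorm M (y - x)) powr (- s)) \<le> C * t powr (2 - s)"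
proof -
  obtain K where K: "1 \<le> K" "\<And>x t. 1 \<le> t \<Longrightarrow> real (card (sites M \<inter> rbox M x t)) \<le> K * t\<^sup>2" using card_rbox by blast
  define a where "a = 2 powr (2 - s)"
  have a: "1 < a" using s powr_less_mono[of 0 "2 - s" 2] unfolding a_def by simp
  define C where "C = K + 4 * K / (a - 1)"
  have C: "K \<le> C" "C + 4 * K \<le> C * a"
  proof -
    show "K \<le> C" using K(1) a by (simp add: C_def)
    have "4 * K = (4 * K / (a - 1)) * (a - 1)" using a by simp
    also have "\<dots> \<le> C * (a - 1)" using a K(1) by (intro mult_right_mono) (auto simp: C_def)
    finally show "C + 4 * K \<le> C * a" by (simp add: algebra_simps)
  qed
  let ?f = "\<lambda>x y. max 1 (rnorm M (y - x)) powr (- s)"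
  have dyadic: "(\<Sum>y\<in>sites M \<inter> rbox M x (2 ^ k). ?f x y) \<le> C * a ^ k" for x k
  proof (induction k)
    case 0
    have "?f x y \<le> 1" for y using powr_mono[of "- s" 0 "max 1 (rnorm M (y - x))"] s by (simp split: if_splits)
    then have "(\<Sum>y\<in>sites M \<inter> rbox M x (2 ^ 0). ?f x y) \<le> (\<Sum>y\<in>sites M \<inter> rbox M x 1. 1)"
      unfolding power_0 by (rule sum_mono)
    also have "\<dots> \<le> K * 1\<^sup>2" using K(2)[of 1 x] by simp
    finally show ?case using C by simp
  next
    case (Suc k)
    let ?A = "sites M \<inter> rbox M x (2 ^ k)" and ?B = "sites M \<inter> rbox M x (2 ^ Suc k)"
    have fin: "finite ?B" by (rule finite_sites_rbox)
    have "rbox M x (2 ^ k) \<subseteq> rbox M x (2 ^ Suc k)" by (rule box_mono) simp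
    then have "?A \<subseteq> ?B" by blast
    then have "(\<Sum>y\<in>?B. ?f x y) = (\<Sum>y\<in>?B - ?A. ?f x y) + (\<Sum>y\<in>?A. ?f x y)"
      using fin by (rule sum.subset_diff)
    also have "(\<Sum>y\<in>?B - ?A. ?f x y) \<le> (\<Sum>y\<in>?B - ?A. (2 ^ k) powr (- s))"
    proof (rule sum_mono)
      fix y assume "y \<in> ?B - ?A"
      then have "2 ^ k \<le> rnorm M (y - x)" by (auto simp: rbox_def)
      then show "?f x y \<le> (2 ^ k) powr (- s)" using s by (intro powr_mono2') auto
    qed
    also have "\<dots> \<le> real (card ?B) * (2 ^ k) powr (- s)" using fin by (auto intro!: mult_right_mono card_mono)
    also have "\<dots> \<le> (K * (2 ^ Suc k)\<^sup>2) * (2 ^ k) powr (- s)" by (intro mult_right_mono K one_le_power) auto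
    also have "\<dots> = 4 * K * ((2 ^ k) powr 2 * (2 ^ k) powr (- s))"
      by (simp add: power_mult_distrib)
    also have "(2 ^ k) powr 2 * (2 ^ k) powr (- s) = a ^ k"
      unfolding a_def by (simp add: powr_add[symmetric] powr_realpow[symmetric] powr_powr algebra_simps)
    finally have "(\<Sum>y\<in>?B. ?f x y) \<le> 4 * K * a ^ k + C * a ^ k" using Suc by linarith
    also have "\<dots> = (C + 4 * K) * a ^ k" by (simp add: algebra_simps)
    also have "\<dots> \<le> (C * a) * a ^ k" using C a by (intro mult_right_mono) auto
    finally show ?case by simp
  qed
  have "(\<Sum>y\<in>sites M \<inter> rbox M x t. ?f x y) \<le> (C * a) * t powr (2 - s)" if t: "1 \<le> t" for x t
  proof -
    define k where "k = nat \<lceil>log 2 t\<rceil>"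
    have lt: "0 \<le> log 2 t" using t by simp
    have k: "log 2 t \<le> real k" "real k \<le> log 2 t + 1" using lt unfolding k_def by linarith+
    have tk: "t \<le> 2 ^ k" using k(1) t by (simp add: log_le_iff powr_realpow)
    have "(\<Sum>y\<in>sites M \<inter> rbox M x t. ?f x y) \<le> (\<Sum>y\<in>sites M \<inter> rbox M x (2 ^ k). ?f x y)"
      using tk by (intro sum_mono2 finite_sites_rbox) (auto simp: rbox_def)
    also have "\<dots> \<le> C * a ^ k" by (rule dyadic)
    also have "a ^ k \<le> a * t powr (2 - s)"
    proof -
      have "a ^ k = a powr real k" using a by (simp add: powr_realpow)
      also have "\<dots> \<le> a powr (log 2 t + 1)" using k a by (intro powr_mono) auto
      also have "\<dots> = a * a powr (log 2 t)" using a by (simp add: powr_add)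
      also have "a powr (log 2 t) = t powr (2 - s)"
      proof -
        have "a powr (log 2 t) = (2 powr log 2 t) powr (2 - s)" unfolding a_def powr_powr by (simp only: mult.commute)
        then show ?thesis using t by simp
      qed
      finally show ?thesis .
    qed
    finally show ?thesis using C(1) K(1) by (simp add: mult.assoc mult_left_mono)
  qed
  moreover have "0 < C * a" using C(1) K(1) a by simp
  ultimately show ?thesis by blast
qed

end

section \<open>One-site and two-site probabilities in the inhomogeneous field\<close>

locale inhomogeneous_percolation = kesten_percolation +
  fixes w :: real
  assumes w: "0 < w" "w < 1"
begin

definition qd :: "complex set \<Rightarrow> real" where "qd e = density M w (location e)"

abbreviation Pw :: "((complex set \<Rightarrow> bool) \<Rightarrow> bool) \<Rightarrow> real" where "Pw \<equiv> pr M qd"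

abbreviation inf_at :: "complex \<Rightarrow> (complex set \<Rightarrow> bool) \<Rightarrow> bool" where
  "inf_at x \<omega> \<equiv> connected_to_infinity M \<omega> x"

text \<open>Truncated at 1 so that the regularity of the arm applies to its powers.\<close>

definition r1 :: "complex \<Rightarrow> real" where "r1 x = max 1 (rnorm M x)"

lemma density_pp: "density M w x = pp (rnorm M x powr w)"
  by (simp add: density_def pp_def)

lemma field_qd: "field qd"
  unfolding field_def qd_def density_pp using pp by (simp add: less_imp_le)

lemma qd_le:
  assumes "e \<in> elems (rbox M x s)" "0 \<le> t" "t + s \<le> rnorm M x"
  shows "qd e \<le> pp (t powr w)"
proof -
  have "rnorm M (location e - x) \<le> s" using assms(1) by (intro location_rbox) (auto simp: elems_def)
  then have "t \<le> rnorm M (location e)"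
    using assms(3) rnorm_triangle_sub[of M x 0 "location e"] rnorm_commute[of M x "location e"] by simp
  then have "t powr w \<le> rnorm M (location e) powr w" using assms(2) w by (intro powr_mono2) auto
  then show ?thesis unfolding qd_def density_pp by (intro pp_antimono) auto
qed

lemma qd_ge:
  assumes "e \<in> elems (rbox M x s)" "rnorm M x + s \<le> t"
  shows "pp (t powr w) \<le> qd e"
proof -
  have "rnorm M (location e - x) \<le> s" using assms(1) by (intro location_rbox) (auto simp: elems_def)
  then have "rnorm M (location e) \<le> t"
    using assms(2) rnorm_triangle_sub[of M "location e" 0 x] by simp
  then have "rnorm M (location e) powr w \<le> t powr w" using w by (intro powr_mono2) auto
  then show ?thesis unfolding qd_def density_pp by (intro pp_antimono) auto
qed

lemma r1: "1 \<le> r1 x" "rnorm M x \<le> r1 x" "1 \<le> r1 x powr w" "r1 x powr w \<le> r1 x"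
proof -
  show 1: "1 \<le> r1 x" "rnorm M x \<le> r1 x" by (auto simp: r1_def)
  show "1 \<le> r1 x powr w" using 1 w by (intro ge_one_powr_ge_zero) auto
  show "r1 x powr w \<le> r1 x" using powr_mono[of w 1 "r1 x"] 1 w by simp
qed

text \<open>Let t be the minimum on the right and \<rho> = t / (4 C0). The box of radius C0 \<rho> +
  R around x keeps distance at least half the norm of x from the origin once t \<ge> 4 R, and there
  the density is at most \<open>pp \<rho>\<close>. Then \<open>near_critical_reach\<close> applies;
  bounded t is trivial.\<close>

lemma reach_upper:
  "\<exists>C>0. \<forall>x\<in>sites M. \<forall>d\<ge>1. Pw (reach x d) \<le> C * arm (min d (r1 x powr w))"
proof -
  obtain C C0 where C: "0 < C" "1 \<le> C0" "\<And>r x. 1 \<le> r \<Longrightarrow> x \<in> sites M \<Longrightarrow> pr M (\<lambda>_. pp r) (reach x (C0 * r)) \<le> C * arm r"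
    using near_critical_reach by blast
  define C1 where "C1 = 4 * C0"
  define T0 where "T0 = max C1 (4 * R)"
  define D where "D = max (1 / arm T0) (C * (reg_const * C1))"
  have C1: "1 \<le> C1" using C(2) by (simp add: C1_def)
  have D: "0 < D" using arm_pos[of T0] by (simp add: D_def less_max_iff_disj)
  have "Pw (reach x d) \<le> D * arm (min d (r1 x powr w))" if x: "x \<in> sites M" and d: "1 \<le> d" for x d
  proof -
    let ?t = "min d (r1 x powr w)"
    have t1: "1 \<le> ?t" using d r1(3) by simp
    show ?thesis
    proof (cases "?t \<le> T0")
      case True
      have "Pw (reach x d) \<le> 1" by simp
      also have "1 \<le> 1 / arm T0 * arm ?t" using arm_pos[of T0] arm_antimono[of ?t T0] True t1 by (simp add: field_simps)
      also have "\<dots> \<le> D * arm ?t" using arm_le_1(2)[of ?t] by (intro mult_right_mono) (auto simp: D_def)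
      finally show ?thesis .
    next
      case False
      define \<rho> where "\<rho> = ?t / C1"
      have T: "C1 \<le> ?t" "4 * R \<le> ?t" using False by (auto simp: T0_def)
      have \<rho>1: "1 \<le> \<rho>" using T(1) C1 by (simp add: \<rho>_def field_simps)
      have C0\<rho>: "C0 * \<rho> = ?t / 4" using C(2) by (simp add: \<rho>_def C1_def field_simps)
      have "?t \<le> r1 x" using r1(4)[of x] by linarith
      moreover have r1x: "r1 x = rnorm M x"
        using calculation T R(1) unfolding r1_def by (simp add: max_def split: if_splits)
      ultimately have t_le: "?t \<le> rnorm M x" by simp
      have rad: "rnorm M x / 2 + (C0 * \<rho> + R) \<le> rnorm M x" using t_le T(2) unfolding C0\<rho> by linarith
      have "\<rho> \<le> (rnorm M x / 2) powr w"
      proof -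
        have "2 powr w \<le> 2 powr 1" using w by (intro powr_mono) auto
        then have "2 powr w \<le> C1" using C(2) by (simp add: C1_def)
        then have "rnorm M x powr w / C1 \<le> rnorm M x powr w / 2 powr w" using C1 by (intro divide_left_mono mult_pos_pos) auto
        also have "\<dots> = (rnorm M x / 2) powr w" by (simp add: powr_divide)
        finally have "rnorm M x powr w / C1 \<le> (rnorm M x / 2) powr w" .
        moreover have "\<rho> \<le> rnorm M x powr w / C1" unfolding \<rho>_def r1x using C1 by (intro divide_right_mono) auto
        ultimately show ?thesis by linarith
      qed
      then have pp_le: "pp ((rnorm M x / 2) powr w) \<le> pp \<rho>" using \<rho>1 by (intro pp_antimono) auto
      have p: "p_c M \<le> pp \<rho>" "pp \<rho> \<le> 1" using pp[of \<rho>] \<rho>1 by auto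
      have C0\<rho>_nonneg: "0 \<le> C0 * \<rho>" using C(2) \<rho>1 by simp
      have "Pw (reach x d) \<le> Pw (reach x (C0 * \<rho>))"
        using C0\<rho>_nonneg C0\<rho> t1 by (intro pr_reach_antimono) auto
      also have "\<dots> \<le> pr M (\<lambda>_. pp \<rho>) (reach x (C0 * \<rho>))"
      proof (rule pr_mono_field[OF finite_elems[OF finite_sites_rbox] elems_subset reach_event(3,2)[OF C0\<rho>_nonneg]])
        show "qd e \<le> pp \<rho>" if "e \<in> elems (rbox M x (C0 * \<rho> + R))" for e
          using qd_le[OF that _ rad] pp_le by simp
      qed (auto intro: field_prob_field field_qd field_const[OF p])
      also have "\<dots> \<le> C * arm \<rho>" by (rule C(3)[OF \<rho>1 x])
      also have "\<dots> \<le> C * (reg_const * C1 * arm ?t)"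
        using C(1) C1 \<rho>1 t1 by (intro mult_left_mono arm_ratio) (auto simp: \<rho>_def)
      also have "\<dots> = C * (reg_const * C1) * arm ?t" by simp
      also have "\<dots> \<le> D * arm ?t" using arm_le_1(2)[of ?t] by (intro mult_right_mono) (auto simp: D_def)
      finally show ?thesis .
    qed
  qed
  then show ?thesis using D by blast
qed

lemma infinite_upper: "\<exists>C>0. \<forall>x\<in>sites M. Pw (inf_at x) \<le> C * arm (r1 x powr w)"
proof -
  obtain C where C: "0 < C" "\<And>x d. x \<in> sites M \<Longrightarrow> 1 \<le> d \<Longrightarrow> Pw (reach x d) \<le> C * arm (min d (r1 x powr w))"
    using reach_upper by blast
  have "Pw (inf_at x) \<le> C * arm (r1 x powr w)" if "x \<in> sites M" for x
  proof -
    have "Pw (inf_at x) \<le> Pw (reach x (r1 x))" using r1(1)[of x] by (intro pr_infinite_le_reach) simp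
    then show ?thesis using C(2)[OF that r1(1)[of x]] r1(4)[of x] by (simp add: min_absorb2)
  qed
  then show ?thesis using C(1) by blast
qed

text \<open>Nets start at a scale n of order \<open>r1 x\<close>. The box of the net at scale m lies
  within distance 7 m of the origin, where correlation lengths are at most (7 m)^w, so the failure
  is of order m^(w - 1); as w < 1 this is geometric along m = 3^j n. The arm up to 2n is bounded
  below by the percolation probability at correlation length (7 n)^w, which is comparable to
  \<open>r1 x powr w\<close>.\<close>

lemma infinite_lower: "\<exists>c>0. \<forall>x\<in>sites M. c * arm (r1 x powr w) \<le> Pw (inf_at x)"
proof -
  define \<beta> where "\<beta> = (1/3) powr (1 - w)"
  have \<beta>: "0 \<le> \<beta>" "\<beta> < 1"
  proof -
    show "0 \<le> \<beta>" by (simp add: \<beta>_def)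
    have "(1/3) powr (1 - w) < 1 powr (1 - w)" using w by (intro powr_less_mono2) auto
    then show "\<beta> < 1" by (simp add: \<beta>_def)
  qed
  \<comment> \<open>The factor 350 is 50 from \<open>net_fails_decay\<close> times the bound 7^w
    \<le> 7.\<close>
  have A0: "0 \<le> 350 * decay_const 1" using decay_const(1) by simp
  obtain k where k: "0 < k" "\<And>q n x m. field q \<Longrightarrow> m0 \<le> n \<Longrightarrow> (\<And>k. 1 - pr M q (net (3 ^ k * n) x) \<le> 350 * decay_const 1 * \<beta> ^ k) \<Longrightarrow>
       k \<le> pr M q (\<lambda>\<omega>. \<forall>k\<in>{..m}. net (3 ^ k * n) x \<omega>)"
    using nets_occur[OF A0 \<beta>] by (auto 4 3)
  obtain ca where ca: "0 < ca" "\<And>r. 1 \<le> r \<Longrightarrow> ca * arm r \<le> P_inf M (pp r)" using P_inf_arm by blast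
  define A where "A = (7 * (real m0 + 2)) powr w"
  have A: "1 \<le> A" using w unfolding A_def by (intro ge_one_powr_ge_zero) auto
  have RA: "0 < reg_const * A" using reg_const(1) A by simp
  define c' where "c' = k * (\<kappa> * (ca / (reg_const * A)))"
  have "c' * arm (r1 x powr w) \<le> Pw (inf_at x)" if x: "x \<in> sites M" for x
  proof -
    define n where "n = m0 + nat \<lceil>r1 x\<rceil>"
    have n: "m0 \<le> n" "1 \<le> n" "r1 x \<le> real n" "real n \<le> (real m0 + 2) * r1 x"
    proof -
      show "m0 \<le> n" "1 \<le> n" using m0(1) by (auto simp: n_def)
      show "r1 x \<le> real n" unfolding n_def by linarith
      have "real (nat \<lceil>r1 x\<rceil>) \<le> r1 x + 1" using r1(1)[of x] by linarith
      then have "real n \<le> real m0 * 1 + r1 x + 1" unfolding n_def by simp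
      also have "\<dots> \<le> real m0 * r1 x + r1 x + r1 x" using r1(1)[of x] by (intro add_mono mult_left_mono) auto
      finally show "real n \<le> (real m0 + 2) * r1 x" by (simp add: algebra_simps)
    qed
    have rn: "rnorm M x \<le> real n" using n(3) r1(2)[of x] by linarith
    have fails: "1 - Pw (net (3 ^ j * n) x) \<le> 350 * decay_const 1 * \<beta> ^ j" for j
    proof -
      let ?n = "3 ^ j * n"
      have n1: "1 \<le> ?n" using n(2) by simp
      have "1 * real n \<le> 3 ^ j * real n" by (intro mult_right_mono) simp_all
      then have nn: "real n \<le> real ?n" by simp
      have n1r: "1 \<le> real ?n" using nn n(2) by linarith
      let ?\<rho> = "(7 * real ?n) powr w"
      have "1 \<le> 7 * real ?n" using n1r by linarith
      then have \<rho>: "1 \<le> ?\<rho>" using w by (intro ge_one_powr_ge_zero) auto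
      have "1 - Pw (net ?n x) \<le> 50 * decay_const 1 * (?\<rho> / real ?n) ^ 1"
      proof (rule net_fails_decay[OF field_qd \<rho> n1])
        fix e assume "e \<in> elems (rbox M x (6 * real ?n))"
        then show "pp ?\<rho> \<le> qd e" by (rule qd_ge) (use rn nn in linarith)
      qed
      also have "(?\<rho> / real ?n) ^ 1 \<le> 7 * \<beta> ^ j"
      proof -
        have n0: "0 < real n" using n(2) by simp
        have "(7::real) powr w \<le> 7" using w powr_mono[of w 1 "7::real"] by simp
        then have "?\<rho> \<le> 7 * real ?n powr w" unfolding powr_mult by (rule mult_right_mono) simp
        then have "?\<rho> / real ?n \<le> 7 * real ?n powr w / real ?n" by (rule divide_right_mono) simp
        then have "?\<rho> / real ?n \<le> 7 * (real ?n powr w / real ?n powr 1)" by simp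
        also have "real ?n powr w / real ?n powr 1 = real ?n powr (w - 1)" using n1 by (simp add: powr_diff)
        also have "\<dots> = (3 ^ j) powr (w - 1) * real n powr (w - 1)" by (simp add: powr_mult)
        also have "\<dots> \<le> (3 ^ j) powr (w - 1) * 1"
          using w n(2) powr_mono2'[of "w - 1" 1 "real n"] by (intro mult_left_mono) auto
        also have "(3 ^ j) powr (w - 1) = \<beta> ^ j"
          unfolding \<beta>_def by (simp add: powr_realpow[symmetric] powr_powr powr_divide powr_minus_divide[symmetric] algebra_simps)
        finally show ?thesis by simp
      qed
      finally show ?thesis using decay_const(1)[of 1] by (simp add: mult_left_mono mult.assoc)
    qed
    have 1: "k * Pw (reach x (2 * real n)) \<le> Pw (inf_at x)"
      using k(1) by (intro infinite_ge_reach[OF field_qd n(2)] k(2)[OF field_qd n(1) fails]) auto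
    let ?\<rho> = "(7 * real n) powr w"
    have \<rho>: "1 \<le> ?\<rho>" using n(2) w by (intro ge_one_powr_ge_zero) auto
    have p: "p_c M \<le> pp ?\<rho>" "pp ?\<rho> \<le> 1" using pp[of ?\<rho>] by auto
    have "arm (r1 x powr w) \<le> reg_const * A * arm ?\<rho>"
    proof (rule arm_ratio[OF r1(3) \<rho> _ A])
      have "7 * real n \<le> (7 * (real m0 + 2)) * r1 x" using mult_left_mono[OF n(4), of 7] by (simp only: mult.assoc)
      then have "?\<rho> \<le> ((7 * (real m0 + 2)) * r1 x) powr w" using w by (intro powr_mono2) auto
      then show "?\<rho> \<le> A * r1 x powr w" using r1(1)[of x] unfolding A_def by (simp add: powr_mult)
    qed
    then have "ca / (reg_const * A) * arm (r1 x powr w) \<le> ca * arm ?\<rho>" using RA ca(1) by (simp add: field_simps)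
    also have "\<dots> \<le> P_inf M (pp ?\<rho>)" by (rule ca(2)[OF \<rho>])
    finally have "\<kappa> * (ca / (reg_const * A) * arm (r1 x powr w)) \<le> \<kappa> * P_inf M (pp ?\<rho>)" by (rule mult_left_mono[OF _ less_imp_le[OF \<kappa>(1)]])
    also have "\<dots> \<le> pr M (\<lambda>_. pp ?\<rho>) (inf_at x)" by (rule infinite_site_vs_origin(1)[OF x p])
    also have "\<dots> \<le> pr M (\<lambda>_. pp ?\<rho>) (reach x (2 * real n))" by (rule pr_infinite_le_reach) simp
    also have "\<dots> \<le> Pw (reach x (2 * real n))"
    proof (rule pr_mono_field[OF finite_elems[OF finite_sites_rbox] elems_subset reach_event(3,2)])
      have "R \<le> real n" using m0(2) n(1) by linarith
      then show "pp ?\<rho> \<le> qd e" if "e \<in> elems (rbox M x (2 * real n + R))" for e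
        using rn by (intro qd_ge[OF that]) linarith
    qed (auto intro: field_prob_field field_qd field_const[OF p])
    finally have "k * (\<kappa> * (ca / (reg_const * A) * arm (r1 x powr w))) \<le> k * Pw (reach x (2 * real n))" by (rule mult_left_mono[OF _ less_imp_le[OF k(1)]])
    then show ?thesis using 1 by (simp add: c'_def mult.assoc)
  qed
  moreover have "0 < c'" using k \<kappa> ca RA by (simp add: c'_def)
  ultimately show ?thesis by blast
qed

lemma P_inf_density: "\<exists>ca Cb. 0 < ca \<and> 0 < Cb \<and> (\<forall>x. ca * arm (r1 x powr w) \<le> P_inf M (density M w x) \<and> P_inf M (density M w x) \<le> Cb * arm (r1 x powr w))"
proof -
  obtain ca Cb where P: "0 < ca" "0 < Cb" "\<And>r. 1 \<le> r \<Longrightarrow> ca * arm r \<le> P_inf M (pp r) \<and> P_inf M (pp r) \<le> Cb * arm r"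
    using P_inf_arm by blast
  have "ca * arm (r1 x powr w) \<le> P_inf M (density M w x) \<and> P_inf M (density M w x) \<le> max Cb (1 / arm 1) * arm (r1 x powr w)" for x
  proof (cases "1 \<le> rnorm M x")
    case True
    then have e: "r1 x = rnorm M x" by (simp add: r1_def)
    have "Cb * arm (r1 x powr w) \<le> max Cb (1 / arm 1) * arm (r1 x powr w)" using arm_le_1(2) by (intro mult_right_mono) auto
    then show ?thesis using P(3)[OF r1(3), of x] unfolding density_pp e by linarith
  next
    case False
    then have e: "r1 x powr w = 1" by (simp add: r1_def)
    have "rnorm M x powr w \<le> 1" using False w powr_mono2[of w "rnorm M x" 1] by simp
    then have "pp 1 \<le> pp (rnorm M x powr w)" by (intro pp_antimono) auto
    then have "P_inf M (pp 1) \<le> P_inf M (density M w x)" unfolding density_pp using pp[of 1] pp[of "rnorm M x powr w"] by (intro P_inf_mono) auto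
    moreover have "P_inf M (density M w x) \<le> 1" by (simp add: P_inf_pr)
    moreover have "1 \<le> max Cb (1 / arm 1) * arm 1"
    proof -
      have "1 = 1 / arm 1 * arm 1" using arm_pos[of 1] by simp
      also have "\<dots> \<le> max Cb (1 / arm 1) * arm 1" using arm_le_1(2) by (intro mult_right_mono) auto
      finally show ?thesis .
    qed
    ultimately show ?thesis using P(3)[of 1] unfolding e by linarith
  qed
  moreover have "0 < max Cb (1 / arm 1)" using P(2) by simp
  ultimately show ?thesis using P(1) by blast
qed

text \<open>The constant in the linear bound arm(t) \<le> \<open>reg_const\<close> U / t for t up to
  N^w. The variance bound takes the form N^(2 + 2 \<epsilon>) U^2.\<close>

definition U :: "nat \<Rightarrow> real" where "U N = real N powr w * arm (real N powr w)"

lemma N_powr: "1 \<le> N \<Longrightarrow> 1 \<le> real N powr w"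
  using w by (intro ge_one_powr_ge_zero) auto

text \<open>Lets bounded error terms be absorbed into multiples of U^2.\<close>

lemma U_lower: "\<exists>u>0. \<forall>N\<ge>1. u \<le> U N"
proof (intro exI[of _ "arm 1 / reg_const"] conjI allI impI)
  show "0 < arm 1 / reg_const" using arm_pos[of 1] reg_const(1) by simp
  fix N :: nat assume "1 \<le> N"
  from reg_const(2)[of 1, OF _ N_powr[OF this]] show "arm 1 / reg_const \<le> U N"
    using reg_const(1) by (simp add: U_def field_simps)
qed

lemma arm_le_U: "1 \<le> t \<Longrightarrow> t \<le> real N powr w \<Longrightarrow> arm t \<le> reg_const * U N / t"
  using reg_const(2)[of t "real N powr w"] by (simp add: U_def mult.assoc)

lemma reach_pair_independent:
  assumes "0 \<le> s" "2 * (s + R) < rnorm M (x - y)"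
  shows "Pw (\<lambda>\<omega>. reach x s \<omega> \<and> reach y s \<omega>) = Pw (reach x s) * Pw (reach y s)"
proof (rule pr_indep[OF finite_elems[OF finite_sites_rbox] elems_subset reach_event(3)[OF assms(1)]
    reach_event(1)[OF assms(1)] reach_event(3)[OF assms(1)] _ field_prob_field[OF field_qd]])
  have "False" if e: "e \<in> elems (rbox M x (s + R))" "e \<in> elems (rbox M y (s + R))" for e
  proof -
    obtain z where "z \<in> e" using e(1) element_sites(2) by (auto simp: elems_def)
    then have "rnorm M (z - x) \<le> s + R" "rnorm M (z - y) \<le> s + R" using e by (auto simp: elems_def rbox_def)
    then have "rnorm M (x - y) \<le> 2 * (s + R)" using rnorm_triangle_sub[of M x y z] rnorm_commute[of M x z] by simp
    then show False using assms(2) by simp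
  qed
  then show "elems (rbox M x (s + R)) \<inter> elems (rbox M y (s + R)) = {}" by blast
qed

lemma event_inf_pair: "event M (\<lambda>\<omega>. inf_at x \<omega> \<and> inf_at y \<omega>)"
  by (intro event_conj event_infinite)

lemma inf_imp_reach: "inf_at x \<omega> \<Longrightarrow> reach x d \<omega>"
  unfolding connected_to_infinity_iff using reach_antimono real_nat_ceiling_ge by blast

text \<open>Two arms of a quarter of the distance are independent. Each is at most a multiple of U /
  a with a the smaller of s and the local correlation length, and 1 / (a b) \<le> 1 / a^2 + 1 / b^2
  separates the contributions. Sites closer than 8 R are covered by U being bounded below.\<close>

lemma two_point:
  "\<exists>C>0. \<forall>N\<ge>1. \<forall>x\<in>rball M N 0. \<forall>y\<in>rball M N 0. Pw (\<lambda>\<omega>. inf_at x \<omega> \<and> inf_at y \<omega>) \<le>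
     C * (U N)\<^sup>2 * (2 * max 1 (rnorm M (y - x)) powr (-2) + r1 x powr (-2 * w) + r1 y powr (-2 * w))"
proof -
  obtain C where C: "0 < C" "\<And>x d. x \<in> sites M \<Longrightarrow> 1 \<le> d \<Longrightarrow> Pw (reach x d) \<le> C * arm (min d (r1 x powr w))"
    using reach_upper by blast
  obtain u where u: "0 < u" "\<And>N. 1 \<le> N \<Longrightarrow> u \<le> U N" using U_lower by blast
  define D where "D = max ((8 * R)\<^sup>2 / u\<^sup>2) ((4 * C * reg_const)\<^sup>2)"
  have D: "0 < D" using u R(1) by (simp add: D_def less_max_iff_disj)
  have "Pw (\<lambda>\<omega>. inf_at x \<omega> \<and> inf_at y \<omega>) \<le> D * (U N)\<^sup>2 * (2 * max 1 (rnorm M (y - x)) powr (-2) + r1 x powr (-2 * w) + r1 y powr (-2 * w))"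
    if N: "1 \<le> N" and x: "x \<in> rball M N 0" and y: "y \<in> rball M N 0" for N x y
  proof -
    let ?d = "rnorm M (y - x)" and ?S = "2 * max 1 (rnorm M (y - x)) powr (-2) + r1 x powr (-2 * w) + r1 y powr (-2 * w)"
    have UN: "u \<le> U N" by (rule u(2)[OF N])
    have sites: "x \<in> sites M" "y \<in> sites M" and rN: "r1 x \<le> real N" "r1 y \<le> real N"
      using x y N by (auto simp: rball_def r1_def)
    show ?thesis
    proof (cases "?d < 8 * R")
      case True
      have "max 1 ?d \<le> 8 * R" using True R(1) by simp
      then have "1 / (8 * R)\<^sup>2 \<le> 1 / (max 1 ?d)\<^sup>2" using R(1) by (intro divide_left_mono power_mono) auto
      also have "\<dots> = max 1 ?d powr (-2)" by (simp add: powr_minus_divide powr_numeral)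
      also have "\<dots> \<le> ?S" by (simp add: add_increasing2)
      finally have S: "1 / (8 * R)\<^sup>2 \<le> ?S" .
      have "1 = ((8 * R)\<^sup>2 / u\<^sup>2) * u\<^sup>2 * (1 / (8 * R)\<^sup>2)" using u(1) R(1) by simp
      also have "\<dots> \<le> D * (U N)\<^sup>2 * ?S"
        using S UN u(1) D by (intro mult_mono power_mono) (auto simp: D_def)
      finally show ?thesis using pr_le_1[of M qd] order_trans by blast
    next
      case False
      define s where "s = ?d / 4"
      have s: "1 \<le> s" "2 * (s + R) < rnorm M (x - y)"
        using False R(1) rnorm_commute[of M x y] by (auto simp: s_def)
      have dmax: "max 1 ?d = ?d" using False R(1) by simp
      let ?a = "min s (r1 x powr w)" and ?b = "min s (r1 y powr w)"
      have rw: "r1 x powr w \<le> real N powr w" "r1 y powr w \<le> real N powr w"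
        using rN r1(1) w by (auto intro!: powr_mono2 intro: order_trans[OF zero_le_one])
      have ab: "1 \<le> ?a" "1 \<le> ?b" "?a \<le> real N powr w" "?b \<le> real N powr w" using s(1) r1(3) rw by (auto simp: min_le_iff_disj)
      have "Pw (\<lambda>\<omega>. inf_at x \<omega> \<and> inf_at y \<omega>) \<le> Pw (\<lambda>\<omega>. reach x s \<omega> \<and> reach y s \<omega>)"
        using s(1) inf_imp_reach by (intro pr_mono cylinder_event cylinder_conj reach_event) auto
      also have "\<dots> = Pw (reach x s) * Pw (reach y s)" using s by (intro reach_pair_independent) auto
      also have "\<dots> \<le> (C * arm ?a) * (C * arm ?b)"
        using C s(1) sites arm_le_1 by (intro mult_mono) auto
      also have "\<dots> \<le> (C * (reg_const * U N / ?a)) * (C * (reg_const * U N / ?b))"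
      proof -
        have a: "C * arm ?a \<le> C * (reg_const * U N / ?a)" using C(1) ab by (intro mult_left_mono arm_le_U) auto
        have b: "C * arm ?b \<le> C * (reg_const * U N / ?b)" using C(1) ab by (intro mult_left_mono arm_le_U) auto
        have nn: "0 \<le> C * arm ?a" "0 \<le> C * arm ?b" using C(1) arm_le_1 by auto
        show ?thesis by (rule mult_mono[OF a b order_trans[OF nn(1) a] nn(2)])
      qed
      also have "\<dots> = (C * reg_const)\<^sup>2 * (U N)\<^sup>2 * (1 / (?a * ?b))" by (simp add: power2_eq_square)
      also have "\<dots> \<le> (C * reg_const)\<^sup>2 * (U N)\<^sup>2 * (16 * ?S)"
      proof (rule mult_left_mono)
        have "1 / (?a * ?b) \<le> 1 / ?a\<^sup>2 + 1 / ?b\<^sup>2" using ab by (intro inverse_product_le) auto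
        also have "\<dots> \<le> (1 / s\<^sup>2 + 1 / (r1 x powr w)\<^sup>2) + (1 / s\<^sup>2 + 1 / (r1 y powr w)\<^sup>2)"
          using s(1) r1(3)[of x] r1(3)[of y] by (intro add_mono inverse_square_min_le) auto
        finally have le: "1 / (?a * ?b) \<le> (1 / s\<^sup>2 + 1 / (r1 x powr w)\<^sup>2) + (1 / s\<^sup>2 + 1 / (r1 y powr w)\<^sup>2)" .
        have e1: "1 / s\<^sup>2 = 16 * max 1 ?d powr (-2)" unfolding dmax s_def using False R(1) by (simp add: powr_minus_divide powr_numeral power_divide)
        have e2: "1 / (r1 x powr w)\<^sup>2 = r1 x powr (-2 * w)" for x
          using r1(1)[of x] by (simp add: powr_minus_divide powr_powr powr_numeral[symmetric] mult.commute)
        have "1 / (?a * ?b) \<le> 2 * (16 * max 1 ?d powr (-2)) + r1 x powr (-2 * w) + r1 y powr (-2 * w)"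
          using le unfolding e1 e2 by linarith
        also have "\<dots> \<le> 16 * ?S" by simp
        finally show "1 / (?a * ?b) \<le> 16 * ?S" .
      qed simp
      also have "\<dots> = (4 * C * reg_const)\<^sup>2 * (U N)\<^sup>2 * ?S" by (simp add: power2_eq_square)
      also have "\<dots> \<le> D * (U N)\<^sup>2 * ?S" by (intro mult_right_mono) (auto simp: D_def)
      finally show ?thesis .
    qed
  qed
  then show ?thesis using D by blast
qed

section \<open>Mesoscopic scales\<close>

text \<open>Correlation lengths in the rhombus are at most N^w, so at this scale crossings fail with
  probability bounded by any power of N^(- \<epsilon>). Adding \<open>m0\<close> makes the critical
  crossing bounds available.\<close>

definition meso :: "real \<Rightarrow> nat \<Rightarrow> nat" where
  "meso \<epsilon> N = m0 + nat \<lceil>real N powr (w + \<epsilon>)\<rceil>"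

lemma meso:
  assumes "1 \<le> N" "0 < \<epsilon>" "\<epsilon> \<le> 1 - w"
  shows "m0 \<le> meso \<epsilon> N" "1 \<le> meso \<epsilon> N" "real N powr (w + \<epsilon>) \<le> real (meso \<epsilon> N)"
    "real (meso \<epsilon> N) \<le> (real m0 + 2) * real N powr (w + \<epsilon>)" "real (meso \<epsilon> N) \<le> (real m0 + 2) * real N"
    "R \<le> real (meso \<epsilon> N)"
proof -
  let ?x = "real N powr (w + \<epsilon>)"
  have x: "1 \<le> ?x" "?x \<le> real N"
  proof -
    show "1 \<le> ?x" using assms w by (intro ge_one_powr_ge_zero) auto
    show "?x \<le> real N" using powr_mono[of "w + \<epsilon>" 1 "real N"] assms by simp
  qed
  show "m0 \<le> meso \<epsilon> N" "1 \<le> meso \<epsilon> N" using m0(1) by (auto simp: meso_def)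
  then show "R \<le> real (meso \<epsilon> N)" using m0(2) by linarith
  show "?x \<le> real (meso \<epsilon> N)" unfolding meso_def by linarith
  have "real (nat \<lceil>?x\<rceil>) \<le> ?x + 1" using x by linarith
  then have "real (meso \<epsilon> N) \<le> real m0 * 1 + ?x + 1" unfolding meso_def by simp
  also have "\<dots> \<le> real m0 * ?x + ?x + ?x" using x by (intro add_mono mult_left_mono) auto
  finally show 1: "real (meso \<epsilon> N) \<le> (real m0 + 2) * ?x" by (simp add: algebra_simps)
  also have "\<dots> \<le> (real m0 + 2) * real N" using x by (intro mult_left_mono) auto
  finally show "real (meso \<epsilon> N) \<le> (real m0 + 2) * real N" .
qed

lemma rball_rbox: "rball M N 0 = sites M \<inter> rbox M 0 (real N)"
  by (auto simp: rball_def rbox_def)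

lemma finite_rball [simp]: "finite (rball M N 0)"
  unfolding rball_rbox by (rule finite_sites_rbox)

text \<open>Any large exponent would do; N^(-10) outweighs the order N^4 of pairs of sites.\<close>

lemma N_powr_neg_power:
  assumes "1 \<le> N" "0 < \<epsilon>" "10 / \<epsilon> \<le> real k" shows "(real N powr (- \<epsilon>)) ^ k \<le> 1 / real N ^ 10"
proof -
  have N: "1 \<le> real N" using assms(1) by simp
  have "10 \<le> \<epsilon> * real k" using assms(2,3) by (simp add: field_simps)
  then have "real N powr (- \<epsilon> * real k) \<le> real N powr (- 10)" using N by (intro powr_mono) auto
  moreover have "(real N powr (- \<epsilon>)) ^ k = real N powr (- \<epsilon> * real k)"
    using N by (simp add: powr_realpow[symmetric] powr_powr)
  ultimately show ?thesis using N by (simp add: powr_minus_divide powr_numeral)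
qed

text \<open>The failures of all nets from the mesoscopic scale on are summed. Growing boxes contain
  growing correlation lengths, but these increase only like 3^(j w) against the scale 3^j, which
  leaves a convergent geometric series.\<close>

lemma reach_meso:
  assumes \<epsilon>: "0 < \<epsilon>" "\<epsilon> \<le> 1 - w"
  shows "\<exists>C>0. \<forall>N\<ge>1. \<forall>x\<in>rball M N 0. Pw (reach x (2 * real (meso \<epsilon> N))) \<le> Pw (inf_at x) + C / real N ^ 10"
proof -
  define k where "k = nat \<lceil>10 / \<epsilon>\<rceil> + 1"
  have k: "1 \<le> k" "10 / \<epsilon> \<le> real k" unfolding k_def by linarith+
  define \<beta> where "\<beta> = (1/3) powr (1 - w)"
  have \<beta>: "0 \<le> \<beta>" "\<beta> < 1"
  proof -
    show "0 \<le> \<beta>" by (simp add: \<beta>_def)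
    have "(1/3) powr (1 - w) < 1 powr (1 - w)" using w by (intro powr_less_mono2) auto
    then show "\<beta> < 1" by (simp add: \<beta>_def)
  qed
  define A where "A = (13 + 6 * real m0) powr w"
  define C where "C = 50 * decay_const k * A ^ k * (1 / (1 - \<beta>)) + 1"
  have Cpos: "0 < C" using decay_const(1)[of k] \<beta> by (simp add: C_def add_nonneg_pos A_def)
  have "Pw (reach x (2 * real (meso \<epsilon> N))) \<le> Pw (inf_at x) + C / real N ^ 10" if N: "1 \<le> N" and x: "x \<in> rball M N 0" for N x
  proof (rule reach_le_infinite_plus)
    let ?n = "meso \<epsilon> N"
    note n = meso[OF N \<epsilon>]
    show "1 \<le> ?n" by (rule n(2))
    have N1: "1 \<le> real N" using N by simp
    have xN: "rnorm M x \<le> real N" using x by (simp add: rball_def)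
    have scale: "1 - Pw (net (3 ^ j * ?n) x) \<le> 50 * decay_const k * A ^ k * (1 / real N ^ 10) * \<beta> ^ j" for j
    proof -
      let ?m = "3 ^ j * ?n"
      \<comment> \<open>With n at most (m0 + 2) N, the radius N + 6 * 3^j n is at most 3^j N (1 + 6
        (m0 + 2)).\<close>
      let ?t = "3 ^ j * (real N * (13 + 6 * real m0))"
      let ?\<rho> = "?t powr w"
      have j1: "(1::real) \<le> 3 ^ j" by (rule one_le_power) simp
      have m1: "1 \<le> ?m" using n(2) by simp
      have t: "rnorm M x + 6 * real ?m \<le> ?t"
      proof -
        have "rnorm M x \<le> 3 ^ j * real N" using xN mult_right_mono[OF j1, of "real N"] by simp
        moreover have "6 * real ?m \<le> 6 * (3 ^ j * ((real m0 + 2) * real N))" using n(5) by simp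
        ultimately show ?thesis by (simp add: algebra_simps)
      qed
      have "1 * (1 * 1) \<le> ?t" using j1 N1 by (intro mult_mono) auto
      then have \<rho>: "1 \<le> ?\<rho>" using w by (intro ge_one_powr_ge_zero) auto
      have "1 - Pw (net ?m x) \<le> 50 * decay_const k * (?\<rho> / real ?m) ^ k"
        by (rule net_fails_decay[OF field_qd \<rho> m1]) (rule qd_ge[OF _ t])
      also have "?\<rho> / real ?m \<le> A * real N powr (- \<epsilon>) * \<beta> ^ j"
      proof -
        have "?\<rho> / real ?m = A * (real N powr w * ((3 ^ j) powr w / (3 ^ j) powr 1)) / real ?n"
          by (simp add: powr_mult A_def)
        also have "\<dots> \<le> A * (real N powr w * ((3 ^ j) powr w / (3 ^ j) powr 1)) / real N powr (w + \<epsilon>)"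
          using n(3) N1 n(2) by (intro divide_left_mono mult_nonneg_nonneg mult_pos_pos) (auto simp: A_def)
        also have "\<dots> = A * (real N powr w / real N powr (w + \<epsilon>)) * (3 ^ j) powr (w - 1)" by (simp add: powr_diff mult_ac)
        also have "real N powr w / real N powr (w + \<epsilon>) = real N powr (- \<epsilon>)" by (simp add: powr_diff[symmetric])
        also have "(3 ^ j) powr (w - 1) = \<beta> ^ j"
          unfolding \<beta>_def by (simp add: powr_realpow[symmetric] powr_powr powr_divide powr_minus_divide[symmetric] algebra_simps)
        finally show ?thesis .
      qed
      then have "(?\<rho> / real ?m) ^ k \<le> (A * real N powr (- \<epsilon>) * \<beta> ^ j) ^ k" by (intro power_mono) auto
      also have "\<dots> = A ^ k * (real N powr (- \<epsilon>)) ^ k * (\<beta> ^ j) ^ k" by (simp add: power_mult_distrib)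
      also have "\<dots> \<le> A ^ k * (1 / real N ^ 10) * \<beta> ^ j"
      proof (intro mult_mono N_powr_neg_power N \<epsilon>(1) k(2))
        have "\<beta> ^ j \<le> 1" using \<beta> by (intro power_le_one) auto
        then show "(\<beta> ^ j) ^ k \<le> \<beta> ^ j" using power_decreasing[of 1 k "\<beta> ^ j"] k(1) \<beta> by simp
      qed (use \<beta> in \<open>auto simp: A_def\<close>)
      finally show ?thesis using decay_const(1)[of k] by (simp add: mult_left_mono mult.assoc)
    qed
    show "(\<Sum>j\<in>{..m}. 1 - Pw (net (3 ^ j * ?n) x)) \<le> C / real N ^ 10" for m
    proof -
      have "(\<Sum>j\<in>{..m}. 1 - Pw (net (3 ^ j * ?n) x)) \<le> (\<Sum>j\<in>{..m}. 50 * decay_const k * A ^ k * (1 / real N ^ 10) * \<beta> ^ j)"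
        by (intro sum_mono scale)
      also have "\<dots> = 50 * decay_const k * A ^ k * (1 / real N ^ 10) * (\<Sum>j\<in>{0..m}. \<beta> ^ j)" by (simp add: sum_distrib_left atMost_atLeast0)
      also have "\<dots> \<le> 50 * decay_const k * A ^ k * (1 / real N ^ 10) * (\<beta> ^ 0 / (1 - \<beta>))"
        using decay_const(1)[of k] by (intro mult_left_mono geometric_tail_le \<beta>) (auto simp: A_def)
      also have "\<dots> = (50 * decay_const k * A ^ k * (1 / (1 - \<beta>))) / real N ^ 10" by simp
      also have "\<dots> \<le> C / real N ^ 10" by (intro divide_right_mono) (auto simp: C_def)
      finally show ?thesis .
    qed
  qed
  then show ?thesis using Cpos by blast
qed

text \<open>The condition on I keeps all regions inside the rhombus, where the density is at least
  that of correlation length N^w. Up to (3 N)^2 cells turn N^(-10) into N^(-8).\<close>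

lemma grid_meso:
  assumes \<epsilon>: "0 < \<epsilon>" "\<epsilon> \<le> 1 - w"
  shows "\<exists>C>0. \<forall>N\<ge>1. \<forall>I. 0 \<le> I \<longrightarrow> of_int (I + 5) * real (meso \<epsilon> N) \<le> real N \<longrightarrow>
    1 - Pw (grid (meso \<epsilon> N) (- I) I (- I) I) \<le> C / real N ^ 8"
proof -
  define k where "k = nat \<lceil>10 / \<epsilon>\<rceil> + 1"
  have k: "10 / \<epsilon> \<le> real k" unfolding k_def by linarith
  have "1 - Pw (grid (meso \<epsilon> N) (- I) I (- I) I) \<le> (18 * decay_const k + 1) / real N ^ 8"
    if N: "1 \<le> N" and I: "0 \<le> I" "of_int (I + 5) * real (meso \<epsilon> N) \<le> real N" for N I
  proof -
    let ?n = "meso \<epsilon> N" and ?\<rho> = "real N powr w"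
    note n = meso[OF N \<epsilon>]
    have N1: "1 \<le> real N" using N by simp
    have \<rho>: "1 \<le> ?\<rho>" by (rule N_powr[OF N])
    have sub: "cell_region ?n (- I) I (- I) I \<subseteq> rbox M 0 (real N)"
    proof
      fix v assume v: "v \<in> cell_region ?n (- I) I (- I) I"
      have e: "of_int (- I - 1) * real ?n = - (of_int (I + 1) * real ?n)" by (simp add: algebra_simps)
      have "of_int (I + 4) * real ?n \<le> real N" "of_int (I + 1) * real ?n \<le> real N"
        by (rule order_trans[OF _ I(2)], rule int_mult_le; simp)+
      then show "v \<in> rbox M 0 (real N)" using v unfolding cell_region_def rbox_def mem_Collect_eq rnorm_le_iff e diff_zero abs_le_iff
        by linarith
    qed
    have "1 - Pw (grid ?n (- I) I (- I) I) \<le> 2 * real (card ({- I..I} \<times> {- I..I})) * (decay_const k * (?\<rho> / real ?n) ^ k)"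
    proof (rule grid_fails_decay[OF field_qd \<rho> n(2)])
      fix e assume "e \<in> elems (cell_region ?n (- I) I (- I) I)"
      then have "e \<in> elems (rbox M 0 (real N))" using elems_mono[OF sub] by blast
      then show "pp ?\<rho> \<le> qd e" by (rule qd_ge) simp
    qed
    also have "\<dots> \<le> 2 * (3 * real N)\<^sup>2 * (decay_const k * (1 / real N ^ 10))"
    proof (intro mult_mono)
      have "of_int (I + 5) * 1 \<le> of_int (I + 5) * real ?n" using n(2) I(1) by (intro mult_left_mono) auto
      then have IN: "of_int I + 5 \<le> real N" using I(2) by simp
      have "real (card ({- I..I} \<times> {- I..I})) = (2 * of_int I + 1)\<^sup>2" using I(1) by (simp add: card_cartesian_product power2_eq_square)
      also have "\<dots> \<le> (3 * real N)\<^sup>2" using IN I(1) by (intro power_mono) auto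
      finally show "real (card ({- I..I} \<times> {- I..I})) \<le> (3 * real N)\<^sup>2" .
      have "?\<rho> / real ?n \<le> ?\<rho> / real N powr (w + \<epsilon>)" using n(3) N1 n(2) by (intro divide_left_mono mult_pos_pos) auto
      also have "\<dots> = real N powr (- \<epsilon>)" by (simp add: powr_diff[symmetric])
      finally have "(?\<rho> / real ?n) ^ k \<le> (real N powr (- \<epsilon>)) ^ k" by (intro power_mono) auto
      also have "\<dots> \<le> 1 / real N ^ 10" by (rule N_powr_neg_power[OF N \<epsilon>(1) k])
      finally show "(?\<rho> / real ?n) ^ k \<le> 1 / real N ^ 10" .
    qed (use decay_const(1)[of k] in auto)
    also have "\<dots> = 18 * decay_const k / real N ^ 8"
      using N1 by (simp add: power2_eq_square field_simps power_numeral_reduce)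
    also have "\<dots> \<le> (18 * decay_const k + 1) / real N ^ 8" by (intro divide_right_mono) auto
    finally show ?thesis .
  qed
  moreover have "0 < 18 * decay_const k + 1" using decay_const(1)[of k] by simp
  ultimately show ?thesis by blast
qed

text \<open>Arms of length 2n around sites 7n apart depend on disjoint sets of elements, since R
  \<le> n; passing between 2n and infinity costs N^(-10) at each of the two sites.\<close>

lemma covariance_far:
  assumes \<epsilon>: "0 < \<epsilon>" "\<epsilon> \<le> 1 - w"
  shows "\<exists>C>0. \<forall>N\<ge>1. \<forall>x\<in>rball M N 0. \<forall>y\<in>rball M N 0. 7 * real (meso \<epsilon> N) \<le> rnorm M (y - x) \<longrightarrow>
     Pw (\<lambda>\<omega>. inf_at x \<omega> \<and> inf_at y \<omega>) - Pw (inf_at x) * Pw (inf_at y) \<le> C / real N ^ 10"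
proof -
  obtain C where C: "0 < C" "\<And>N x. 1 \<le> N \<Longrightarrow> x \<in> rball M N 0 \<Longrightarrow> Pw (reach x (2 * real (meso \<epsilon> N))) \<le> Pw (inf_at x) + C / real N ^ 10"
    using reach_meso[OF \<epsilon>] by blast
  have "Pw (\<lambda>\<omega>. inf_at x \<omega> \<and> inf_at y \<omega>) - Pw (inf_at x) * Pw (inf_at y) \<le> (2 * C) / real N ^ 10"
    if N: "1 \<le> N" and xy: "x \<in> rball M N 0" "y \<in> rball M N 0" "7 * real (meso \<epsilon> N) \<le> rnorm M (y - x)" for N x y
  proof -
    let ?n = "real (meso \<epsilon> N)" and ?s = "C / real N ^ 10"
    note n = meso[OF N \<epsilon>]
    have far: "2 * (2 * ?n + R) < rnorm M (x - y)" using xy(3) n(2,6) rnorm_commute[of M x y] by simp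
    let ?a = "Pw (reach x (2 * ?n))" and ?b = "Pw (reach y (2 * ?n))" and ?p = "Pw (inf_at x)" and ?q = "Pw (inf_at y)"
    have "Pw (\<lambda>\<omega>. inf_at x \<omega> \<and> inf_at y \<omega>) \<le> Pw (\<lambda>\<omega>. reach x (2 * ?n) \<omega> \<and> reach y (2 * ?n) \<omega>)"
      using inf_imp_reach by (intro pr_mono cylinder_event cylinder_conj reach_event) auto
    also have "\<dots> = ?a * ?b" using far by (intro reach_pair_independent) auto
    finally have "Pw (\<lambda>\<omega>. inf_at x \<omega> \<and> inf_at y \<omega>) - ?p * ?q \<le> (?a - ?p) * ?b + ?p * (?b - ?q)" by (simp add: algebra_simps)
    also have "\<dots> \<le> ?s * 1 + 1 * ?s"
    proof (intro add_mono)
      have s0: "0 \<le> ?s" using C(1) by simp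
      have "(?a - ?p) * ?b \<le> ?s * ?b" using C(2)[OF N xy(1)] by (intro mult_right_mono) auto
      also have "\<dots> \<le> ?s * 1" using s0 by (intro mult_left_mono) auto
      finally show "(?a - ?p) * ?b \<le> ?s * 1" .
      have "?p * (?b - ?q) \<le> ?p * ?s" using C(2)[OF N xy(2)] by (intro mult_left_mono) auto
      also have "\<dots> \<le> 1 * ?s" using s0 by (intro mult_right_mono) auto
      finally show "?p * (?b - ?q) \<le> 1 * ?s" .
    qed
    finally show ?thesis by simp
  qed
  then show ?thesis using C(1) by (intro exI[of _ "2 * C"]) auto
qed

lemma card_rball: "\<exists>K\<ge>1. \<forall>N\<ge>1. real (card (rball M N 0)) \<le> K * (real N)\<^sup>2"
  using card_rbox unfolding rball_rbox by (metis of_nat_1 of_nat_le_iff)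

text \<open>The kernel of exponent -2 is borderline in dimension two; it is weakened to exponent -(2
  - \<epsilon>), at a cost below N^(2 \<epsilon>). In the other terms the number of near sites, of
  order N^(2 w + 2 \<epsilon>), is balanced by the sum of \<open>r1 x powr (-2 * w)\<close>, of
  order N^(2 - 2 w).\<close>

lemma pair_sum_near:
  assumes \<epsilon>: "0 < \<epsilon>" "\<epsilon> \<le> 1 - w"
  shows "\<exists>C>0. \<forall>N\<ge>1. (\<Sum>x\<in>rball M N 0. \<Sum>y\<in>rball M N 0 \<inter> rbox M x (7 * real (meso \<epsilon> N)).
     (2 * max 1 (rnorm M (y - x)) powr (-2) + r1 x powr (-2 * w) + r1 y powr (-2 * w))) \<le> C * real N powr (2 + 2 * \<epsilon>)"
proof -
  have e2: "0 < 2 - \<epsilon>" "2 - \<epsilon> < 2" using \<epsilon> w by auto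
  obtain C1 where C1: "0 < C1" "\<And>x t. 1 \<le> t \<Longrightarrow> (\<Sum>y\<in>sites M \<inter> rbox M x t. max 1 (rnorm M (y - x)) powr (- (2 - \<epsilon>))) \<le> C1 * t powr (2 - (2 - \<epsilon>))"
    using sum_inverse_powers[OF e2] by blast
  have w2: "0 < 2 * w" "2 * w < 2" using w by auto
  obtain C2 where C2: "0 < C2" "\<And>x t. 1 \<le> t \<Longrightarrow> (\<Sum>y\<in>sites M \<inter> rbox M x t. max 1 (rnorm M (y - x)) powr (- (2 * w))) \<le> C2 * t powr (2 - 2 * w)"
    using sum_inverse_powers[OF w2] by blast
  obtain K where K: "1 \<le> K" "\<And>x t. 1 \<le> t \<Longrightarrow> real (card (sites M \<inter> rbox M x t)) \<le> K * t\<^sup>2" using card_rbox by blast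
  define A where "A = 7 * (real m0 + 2)"
  have A: "1 \<le> A" by (simp add: A_def)
  define C where "C = 2 * K * C1 * A powr \<epsilon> + 2 * (K * A\<^sup>2 * C2)"
  have "0 < C" using K(1) C1(1) C2(1) A by (simp add: C_def add_pos_pos)
  moreover have "(\<Sum>x\<in>rball M N 0. \<Sum>y\<in>rball M N 0 \<inter> rbox M x (7 * real (meso \<epsilon> N)).
     (2 * max 1 (rnorm M (y - x)) powr (-2) + r1 x powr (-2 * w) + r1 y powr (-2 * w))) \<le> C * real N powr (2 + 2 * \<epsilon>)" if N: "1 \<le> N" for N
  proof -
    let ?n = "real (meso \<epsilon> N)" and ?B = "rball M N 0"
    let ?l = "7 * ?n"
    let ?S = "\<lambda>x. ?B \<inter> rbox M x ?l"
    note n = meso[OF N \<epsilon>]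
    have N1: "1 \<le> real N" using N by simp
    have l1: "1 \<le> ?l" using n(2) by simp
    have l_le: "?l \<le> A * real N powr (w + \<epsilon>)" "?l \<le> A * real N" using mult_left_mono[OF n(4), of 7] mult_left_mono[OF n(5), of 7] by (simp_all only: A_def mult.assoc)
    have sub: "?S x \<subseteq> sites M \<inter> rbox M x ?l" for x by (auto simp: rball_def)
    have cardS: "real (card (?S x)) \<le> K * ?l\<^sup>2" for x
      using K(2)[OF l1, of x] card_mono[OF finite_sites_rbox sub[of x]] by linarith
    have cardB: "real (card ?B) \<le> K * (real N)\<^sup>2" unfolding rball_rbox by (rule K(2)[OF N1])
    have Npow: "(real N)\<^sup>2 * real N powr (2 * \<epsilon>) = real N powr (2 + 2 * \<epsilon>)" using N1 by (simp add: powr_add powr_numeral)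
    have first: "(\<Sum>x\<in>?B. \<Sum>y\<in>?S x. max 1 (rnorm M (y - x)) powr (-2)) \<le> K * C1 * A powr \<epsilon> * real N powr (2 + 2 * \<epsilon>)"
    proof -
      have "(\<Sum>y\<in>?S x. max 1 (rnorm M (y - x)) powr (-2)) \<le> C1 * (A powr \<epsilon> * real N powr (2 * \<epsilon>))" for x
      proof -
        have "(\<Sum>y\<in>?S x. max 1 (rnorm M (y - x)) powr (-2)) \<le> (\<Sum>y\<in>sites M \<inter> rbox M x ?l. max 1 (rnorm M (y - x)) powr (-2))"
          by (intro sum_mono2 finite_sites_rbox sub) auto
        also have "\<dots> \<le> (\<Sum>y\<in>sites M \<inter> rbox M x ?l. max 1 (rnorm M (y - x)) powr (- (2 - \<epsilon>)))"
          using \<epsilon> by (intro sum_mono powr_mono) auto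
        also have "\<dots> \<le> C1 * ?l powr \<epsilon>" using C1(2)[OF l1, of x] by simp
        also have "\<dots> \<le> C1 * (A powr \<epsilon> * real N powr (2 * \<epsilon>))"
        proof (rule mult_left_mono)
          have "?l powr \<epsilon> \<le> (A * real N) powr \<epsilon>" using l_le l1 \<epsilon> by (intro powr_mono2) auto
          also have "\<dots> = A powr \<epsilon> * real N powr \<epsilon>" by (rule powr_mult)
          also have "\<dots> \<le> A powr \<epsilon> * real N powr (2 * \<epsilon>)" using N1 \<epsilon> by (intro mult_left_mono powr_mono) auto
          finally show "?l powr \<epsilon> \<le> A powr \<epsilon> * real N powr (2 * \<epsilon>)" .
        qed (use C1 in simp)
        finally show ?thesis .
      qed
      then have "(\<Sum>x\<in>?B. \<Sum>y\<in>?S x. max 1 (rnorm M (y - x)) powr (-2)) \<le> (\<Sum>x\<in>?B. C1 * (A powr \<epsilon> * real N powr (2 * \<epsilon>)))"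
        by (rule sum_mono)
      also have "\<dots> = real (card ?B) * (C1 * (A powr \<epsilon> * real N powr (2 * \<epsilon>)))" by simp
      also have "\<dots> \<le> (K * (real N)\<^sup>2) * (C1 * (A powr \<epsilon> * real N powr (2 * \<epsilon>)))"
        using cardB C1(1) by (intro mult_right_mono) auto
      also have "\<dots> = K * C1 * A powr \<epsilon> * ((real N)\<^sup>2 * real N powr (2 * \<epsilon>))" by simp
      finally show ?thesis unfolding Npow .
    qed
    have second: "(\<Sum>x\<in>?B. \<Sum>y\<in>?S x. r1 x powr (-2 * w)) \<le> K * A\<^sup>2 * C2 * real N powr (2 + 2 * \<epsilon>)"
    proof -
      have "(\<Sum>x\<in>?B. \<Sum>y\<in>?S x. r1 x powr (-2 * w)) = (\<Sum>x\<in>?B. real (card (?S x)) * r1 x powr (-2 * w))" by simp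
      also have "\<dots> \<le> (\<Sum>x\<in>?B. (K * ?l\<^sup>2) * r1 x powr (-2 * w))" by (intro sum_mono mult_right_mono cardS) simp
      also have "\<dots> = (K * ?l\<^sup>2) * (\<Sum>x\<in>?B. r1 x powr (-2 * w))" by (simp add: sum_distrib_left)
      also have "\<dots> \<le> (K * ?l\<^sup>2) * (C2 * real N powr (2 - 2 * w))"
        using C2(2)[OF N1, of 0] K(1) unfolding rball_rbox r1_def by (intro mult_left_mono) auto
      also have "\<dots> \<le> (K * (A * real N powr (w + \<epsilon>))\<^sup>2) * (C2 * real N powr (2 - 2 * w))"
        using l_le l1 K(1) C2(1) by (intro mult_right_mono mult_left_mono power_mono) auto
      also have "\<dots> = K * A\<^sup>2 * C2 * ((real N powr (w + \<epsilon>))\<^sup>2 * real N powr (2 - 2 * w))" by (simp add: power_mult_distrib)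
      also have "(real N powr (w + \<epsilon>))\<^sup>2 * real N powr (2 - 2 * w) = real N powr (2 + 2 * \<epsilon>)"
        by (simp add: power2_eq_square powr_add[symmetric] algebra_simps)
      finally show ?thesis .
    qed
    \<comment> \<open>Being near is symmetric, so exchanging the sums identifies the two remaining
      terms.\<close>
    have third: "(\<Sum>x\<in>?B. \<Sum>y\<in>?S x. r1 y powr (-2 * w)) = (\<Sum>x\<in>?B. \<Sum>y\<in>?S x. r1 x powr (-2 * w))"
    proof -
      have "(\<Sum>x\<in>?B. \<Sum>y\<in>?S x. r1 y powr (-2 * w)) = (\<Sum>x\<in>?B. \<Sum>y\<in>?B. if y \<in> rbox M x ?l then r1 y powr (-2 * w) else 0)"
        by (simp only: sum.inter_restrict[OF finite_rball])
      also have "\<dots> = (\<Sum>y\<in>?B. \<Sum>x\<in>?B. if y \<in> rbox M x ?l then r1 y powr (-2 * w) else 0)" by (rule sum.swap)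
      also have "\<dots> = (\<Sum>y\<in>?B. \<Sum>x\<in>?B. if x \<in> rbox M y ?l then r1 y powr (-2 * w) else 0)"
        by (intro sum.cong refl) (simp add: rbox_def rnorm_commute)
      also have "\<dots> = (\<Sum>y\<in>?B. \<Sum>x\<in>?S y. r1 y powr (-2 * w))"
        by (simp only: sum.inter_restrict[OF finite_rball])
      finally show ?thesis .
    qed
    have "(\<Sum>x\<in>?B. \<Sum>y\<in>?S x. (2 * max 1 (rnorm M (y - x)) powr (-2) + r1 x powr (-2 * w) + r1 y powr (-2 * w)))
      = 2 * (\<Sum>x\<in>?B. \<Sum>y\<in>?S x. max 1 (rnorm M (y - x)) powr (-2)) + (\<Sum>x\<in>?B. \<Sum>y\<in>?S x. r1 x powr (-2 * w)) + (\<Sum>x\<in>?B. \<Sum>y\<in>?S x. r1 y powr (-2 * w))"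
      by (simp add: sum.distrib sum_distrib_left)
    also have "\<dots> \<le> 2 * (K * C1 * A powr \<epsilon> * real N powr (2 + 2 * \<epsilon>)) + K * A\<^sup>2 * C2 * real N powr (2 + 2 * \<epsilon>) + K * A\<^sup>2 * C2 * real N powr (2 + 2 * \<epsilon>)"
      using first second unfolding third by linarith
    also have "\<dots> = C * real N powr (2 + 2 * \<epsilon>)" by (simp add: C_def algebra_simps)
    finally show ?thesis .
  qed
  ultimately show ?thesis by blast
qed

text \<open>Stated for all subsets T because it is applied to the whole rhombus and to its rim. The
  covariances are first replaced by the nonnegative majorant \<open>?h\<close>, whose sum may then
  be extended from T to the rhombus.\<close>

lemma covariance_sum:
  assumes \<epsilon>: "0 < \<epsilon>" "\<epsilon> \<le> 1 - w"
  shows "\<exists>C>0. \<forall>N\<ge>1. \<forall>T\<subseteq>rball M N 0. (\<Sum>x\<in>T. \<Sum>y\<in>T. Pw (\<lambda>\<omega>. inf_at x \<omega> \<and> inf_at y \<omega>) - Pw (inf_at x) * Pw (inf_at y))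
     \<le> C * real N powr (2 + 2 * \<epsilon>) * (U N)\<^sup>2"
proof -
  obtain C1 where C1: "0 < C1" "\<And>N x y. 1 \<le> N \<Longrightarrow> x \<in> rball M N 0 \<Longrightarrow> y \<in> rball M N 0 \<Longrightarrow> Pw (\<lambda>\<omega>. inf_at x \<omega> \<and> inf_at y \<omega>) \<le>
     C1 * (U N)\<^sup>2 * (2 * max 1 (rnorm M (y - x)) powr (-2) + r1 x powr (-2 * w) + r1 y powr (-2 * w))" using two_point by blast
  obtain C2 where C2: "0 < C2" "\<And>N x y. 1 \<le> N \<Longrightarrow> x \<in> rball M N 0 \<Longrightarrow> y \<in> rball M N 0 \<Longrightarrow> 7 * real (meso \<epsilon> N) \<le> rnorm M (y - x) \<Longrightarrow>
     Pw (\<lambda>\<omega>. inf_at x \<omega> \<and> inf_at y \<omega>) - Pw (inf_at x) * Pw (inf_at y) \<le> C2 / real N ^ 10" using covariance_far[OF \<epsilon>] by blast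
  obtain C3 where C3: "0 < C3" "\<And>N. 1 \<le> N \<Longrightarrow> (\<Sum>x\<in>rball M N 0. \<Sum>y\<in>rball M N 0 \<inter> rbox M x (7 * real (meso \<epsilon> N)).
     (2 * max 1 (rnorm M (y - x)) powr (-2) + r1 x powr (-2 * w) + r1 y powr (-2 * w))) \<le> C3 * real N powr (2 + 2 * \<epsilon>)" using pair_sum_near[OF \<epsilon>] by blast
  obtain K where K: "1 \<le> K" "\<And>N. 1 \<le> N \<Longrightarrow> real (card (rball M N 0)) \<le> K * (real N)\<^sup>2" using card_rball by blast
  obtain u where u: "0 < u" "\<And>N. 1 \<le> N \<Longrightarrow> u \<le> U N" using U_lower by blast
  define C where "C = K\<^sup>2 * C2 / u\<^sup>2 + C1 * C3"
  have "0 < C" using K C1 C2 C3 u by (simp add: C_def add_pos_pos)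
  moreover have "(\<Sum>x\<in>T. \<Sum>y\<in>T. Pw (\<lambda>\<omega>. inf_at x \<omega> \<and> inf_at y \<omega>) - Pw (inf_at x) * Pw (inf_at y))
     \<le> C * real N powr (2 + 2 * \<epsilon>) * (U N)\<^sup>2" if N: "1 \<le> N" and T: "T \<subseteq> rball M N 0" for N T
  proof -
    let ?B = "rball M N 0" and ?l = "7 * real (meso \<epsilon> N)"
    let ?g = "\<lambda>x y. 2 * max 1 (rnorm M (y - x)) powr (-2) + r1 x powr (-2 * w) + r1 y powr (-2 * w)"
    let ?h = "\<lambda>x y. C2 / real N ^ 10 + (if y \<in> rbox M x ?l then C1 * (U N)\<^sup>2 * ?g x y else 0)"
    have N1: "1 \<le> real N" using N by simp
    have g0: "0 \<le> ?g x y" for x y by simp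
    have h0: "0 \<le> ?h x y" for x y using g0[of x y] C1(1) C2(1) by simp
    have le: "Pw (\<lambda>\<omega>. inf_at x \<omega> \<and> inf_at y \<omega>) - Pw (inf_at x) * Pw (inf_at y) \<le> ?h x y" if xy: "x \<in> ?B" "y \<in> ?B" for x y
    proof (cases "y \<in> rbox M x ?l")
      case True
      have "0 \<le> Pw (inf_at x) * Pw (inf_at y)" "0 \<le> C2 / real N ^ 10" using C2(1) by auto
      moreover have "?h x y = C2 / real N ^ 10 + C1 * (U N)\<^sup>2 * ?g x y" using True by simp
      ultimately show ?thesis using C1(2)[OF N xy] by linarith
    next
      case False
      then have "?l \<le> rnorm M (y - x)" by (simp add: rbox_def)
      then show ?thesis using C2(2)[OF N xy] False by simp
    qed
    have "(\<Sum>x\<in>T. \<Sum>y\<in>T. Pw (\<lambda>\<omega>. inf_at x \<omega> \<and> inf_at y \<omega>) - Pw (inf_at x) * Pw (inf_at y)) \<le> (\<Sum>x\<in>T. \<Sum>y\<in>T. ?h x y)"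
      using T by (intro sum_mono le) auto
    also have "\<dots> \<le> (\<Sum>x\<in>T. \<Sum>y\<in>?B. ?h x y)" by (intro sum_mono sum_mono2 T h0) auto
    also have "\<dots> \<le> (\<Sum>x\<in>?B. \<Sum>y\<in>?B. ?h x y)" by (intro sum_mono2 T sum_nonneg h0) auto
    also have "\<dots> = (\<Sum>x\<in>?B. \<Sum>y\<in>?B. C2 / real N ^ 10) + (\<Sum>x\<in>?B. \<Sum>y\<in>?B \<inter> rbox M x ?l. C1 * (U N)\<^sup>2 * ?g x y)"
      by (simp only: sum.distrib sum.inter_restrict[OF finite_rball])
    also have "(\<Sum>x\<in>?B. \<Sum>y\<in>?B \<inter> rbox M x ?l. C1 * (U N)\<^sup>2 * ?g x y) = C1 * (U N)\<^sup>2 * (\<Sum>x\<in>?B. \<Sum>y\<in>?B \<inter> rbox M x ?l. ?g x y)"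
      by (simp only: sum_distrib_left)
    also have "\<dots> \<le> C1 * (U N)\<^sup>2 * (C3 * real N powr (2 + 2 * \<epsilon>))" using C3(2)[OF N] C1(1) by (intro mult_left_mono) auto
    also have "(\<Sum>x\<in>?B. \<Sum>y\<in>?B. C2 / real N ^ 10) \<le> K\<^sup>2 * C2 / u\<^sup>2 * real N powr (2 + 2 * \<epsilon>) * (U N)\<^sup>2"
    proof -
      have "(\<Sum>x\<in>?B. \<Sum>y\<in>?B. C2 / real N ^ 10) = (real (card ?B))\<^sup>2 * (C2 / real N ^ 10)" by (simp add: power2_eq_square)
      also have "\<dots> \<le> (K * (real N)\<^sup>2)\<^sup>2 * (C2 / real N ^ 10)" using K(2)[OF N] C2(1) by (intro mult_right_mono power_mono) auto
      also have "\<dots> = K\<^sup>2 * C2 * (real N ^ 4 / real N ^ 10)" by (simp add: power2_eq_square power4_eq_xxxx)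
      also have "\<dots> \<le> K\<^sup>2 * C2 * 1"
        using N1 K(1) C2(1) by (intro mult_left_mono) (auto simp: divide_le_eq_1 power_increasing)
      also have "\<dots> \<le> K\<^sup>2 * C2 * ((U N)\<^sup>2 / u\<^sup>2 * real N powr (2 + 2 * \<epsilon>))"
      proof (rule mult_left_mono)
        have "1 \<le> (U N)\<^sup>2 / u\<^sup>2" using u(1) u(2)[OF N] by (simp add: power_mono)
        moreover have "1 \<le> real N powr (2 + 2 * \<epsilon>)" using N1 \<epsilon> by (intro ge_one_powr_ge_zero) auto
        ultimately have "1 * 1 \<le> (U N)\<^sup>2 / u\<^sup>2 * real N powr (2 + 2 * \<epsilon>)" by (intro mult_mono) auto
        then show "1 \<le> (U N)\<^sup>2 / u\<^sup>2 * real N powr (2 + 2 * \<epsilon>)" by simp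
      qed (use K C2 in simp)
      also have "\<dots> = K\<^sup>2 * C2 / u\<^sup>2 * real N powr (2 + 2 * \<epsilon>) * (U N)\<^sup>2" by simp
      finally show ?thesis .
    qed
    finally show ?thesis by (simp add: C_def algebra_simps)
  qed
  ultimately show ?thesis by blast
qed

section \<open>The cluster of the origin inside a rhombus\<close>

lemma con_inter_sites: "con M \<omega> S x y \<Longrightarrow> con M \<omega> (sites M \<inter> S) x y"
  unfolding con_iff occupied_path_def by blast

text \<open>The bound (I - 1) n puts the cell of z and its neighbours into the grid, so both the
  origin and z are caught by it. The paths leading to the grid and the regions of its cells stay
  within (I + 5) n, hence the connection stays in the rhombus.\<close>

lemma grid_absorbs:
  assumes n: "1 \<le> n" "R \<le> real n" and I: "1 \<le> I" "of_int (I + 5) * real n \<le> real N"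
    and g: "grid n (- I) I (- I) I \<omega>"
    and z: "z \<in> sites M" "rnorm M z \<le> of_int (I - 1) * real n" "reach z (2 * real n) \<omega>" and o: "reach 0 (2 * real n) \<omega>"
  shows "con M \<omega> (rball M N 0) 0 z"
proof -
  have n0: "0 < real n" using n by simp
  have to_grid: "\<exists>a\<in>{-I..I}. \<exists>b\<in>{-I..I}. \<exists>y\<in>cell_net \<omega> n a b. con M \<omega> (rbox M 0 (real N)) x y"
    if x: "rnorm M x \<le> of_int (I - 1) * real n" "reach x (2 * real n) \<omega>" for x
  proof -
    obtain i j where c: "cell_of n x = (i, j)" by fastforce
    have cs: "\<bar>coord1 M x\<bar> \<le> of_int (I - 1) * real n" "\<bar>coord2 M x\<bar> \<le> of_int (I - 1) * real n"
      using x(1) by (auto simp: rnorm_le_iff)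
    have fl: "- (I - 1) \<le> \<lfloor>t / real n\<rfloor>" "\<lfloor>t / real n\<rfloor> \<le> I - 1" if "\<bar>t\<bar> \<le> of_int (I - 1) * real n" for t :: real
    proof -
      have "- of_int (I - 1) \<le> t / real n" "t / real n \<le> of_int (I - 1)" using that n0 by (auto simp: field_simps abs_le_iff)
      then show "- (I - 1) \<le> \<lfloor>t / real n\<rfloor>" "\<lfloor>t / real n\<rfloor> \<le> I - 1" by linarith+
    qed
    have ij: "- (I - 1) \<le> i" "i \<le> I - 1" "- (I - 1) \<le> j" "j \<le> I - 1" using fl[OF cs(1)] fl[OF cs(2)] c by (auto simp: cell_of_def)
    have "grid n (i - 1) (i + 1) (j - 1) (j + 1) \<omega>" by (rule grid_mono[OF g]) (use ij in auto)
    from reach_meets_grid[OF n(1) x(2) c this]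
    obtain a b y where y: "a \<in> {i-1..i+1}" "b \<in> {j-1..j+1}" "y \<in> cell_net \<omega> n a b" "con M \<omega> (rbox M x (2 * real n + R)) x y" by blast
    have "rbox M x (2 * real n + R) \<subseteq> rbox M 0 (real N)"
    proof
      fix v assume "v \<in> rbox M x (2 * real n + R)"
      then have "rnorm M v \<le> of_int (I - 1) * real n + 3 * real n"
        using x(1) n(2) rnorm_triangle_sub[of M v 0 x] by (simp add: rbox_def)
      also have "\<dots> \<le> of_int (I + 5) * real n" using n0 by (simp add: algebra_simps)
      finally show "v \<in> rbox M 0 (real N)" using I(2) by (simp add: rbox_def)
    qed
    then have "con M \<omega> (rbox M 0 (real N)) x y" using y(4) con_mono by blast
    moreover have "a \<in> {-I..I}" "b \<in> {-I..I}" using y(1,2) ij by auto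
    ultimately show ?thesis using y(3) by blast
  qed
  have "rnorm M 0 \<le> of_int (I - 1) * real n" using I(1) by simp
  from to_grid[OF this o] obtain a b y where y: "a \<in> {-I..I}" "b \<in> {-I..I}" "y \<in> cell_net \<omega> n a b" "con M \<omega> (rbox M 0 (real N)) 0 y" by blast
  from to_grid[OF z(2,3)] obtain a' b' y' where y': "a' \<in> {-I..I}" "b' \<in> {-I..I}" "y' \<in> cell_net \<omega> n a' b'" "con M \<omega> (rbox M 0 (real N)) z y'" by blast
  have sub: "cell_region n (- I) I (- I) I \<subseteq> rbox M 0 (real N)"
  proof
    fix v assume v: "v \<in> cell_region n (- I) I (- I) I"
    have e: "of_int (- I - 1) * real n = - (of_int (I + 1) * real n)" by (simp add: algebra_simps)
    have "of_int (I + 4) * real n \<le> real N" "of_int (I + 1) * real n \<le> real N"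
      by (rule order_trans[OF _ I(2)], rule int_mult_le; simp)+
    then show "v \<in> rbox M 0 (real N)" using v unfolding cell_region_def rbox_def mem_Collect_eq rnorm_le_iff e diff_zero abs_le_iff
      by linarith
  qed
  have "con M \<omega> (rbox M 0 (real N)) y y'" by (rule con_mono[OF grid_connected[OF g y(1-3) y'(1-3)] sub])
  from con_trans[OF con_trans[OF y(4) this] con_sym[OF y'(4)]]
  show ?thesis unfolding rball_rbox by (rule con_inter_sites)
qed

text \<open>Percolation is not a cylinder event; the inequality for \<open>reach\<close> passes to
  the limit.\<close>

lemma FKG_infinite:
  assumes "cylinder M A" "up_event A"
  shows "Pw A * Pw (inf_at 0) \<le> Pw (\<lambda>\<omega>. A \<omega> \<and> inf_at 0 \<omega>)"
proof -
  have "(\<lambda>n. Pw (\<lambda>\<omega>. A \<omega> \<and> reach 0 (real n) \<omega>)) \<longlonglongrightarrow> Pw (\<lambda>\<omega>. \<forall>n. A \<omega> \<and> reach 0 (real n) \<omega>)"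
  proof (rule pr_lim_decreasing)
    show "event M (\<lambda>\<omega>. A \<omega> \<and> reach 0 (real n) \<omega>)" for n by (intro cylinder_event cylinder_conj assms reach_event) simp
    show "A \<omega> \<and> reach 0 (real n) \<omega>" if "A \<omega> \<and> reach 0 (real (Suc n)) \<omega>" for n \<omega>
      using that reach_antimono[of 0 "real (Suc n)" \<omega> "real n"] by simp
  qed
  moreover have "(\<lambda>\<omega>. \<forall>n::nat. A \<omega> \<and> reach 0 (real n) \<omega>) = (\<lambda>\<omega>. A \<omega> \<and> inf_at 0 \<omega>)" by (auto simp: connected_to_infinity_iff)
  ultimately have lim: "(\<lambda>n. Pw (\<lambda>\<omega>. A \<omega> \<and> reach 0 (real n) \<omega>)) \<longlonglongrightarrow> Pw (\<lambda>\<omega>. A \<omega> \<and> inf_at 0 \<omega>)" by simp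
  show ?thesis
  proof (rule LIMSEQ_le_const[OF lim], rule exI[of _ 0], intro allI impI)
    fix n :: nat
    have "Pw A * Pw (inf_at 0) \<le> Pw A * Pw (reach 0 (real n))" by (intro mult_left_mono pr_infinite_le_reach) auto
    also have "\<dots> \<le> Pw (\<lambda>\<omega>. A \<omega> \<and> reach 0 (real n) \<omega>)"
      by (intro Harris_FKG assms reach_event field_prob_field field_qd) auto
    finally show "Pw A * Pw (inf_at 0) \<le> Pw (\<lambda>\<omega>. A \<omega> \<and> reach 0 (real n) \<omega>)" .
  qed
qed

lemma infinite_pos: "x \<in> sites M \<Longrightarrow> 0 < Pw (inf_at x)"
  using infinite_lower arm_pos by (metis mult_pos_pos order_less_le_trans)

lemma con_rball_event: "event M (\<lambda>\<omega>. con M \<omega> (rball M N 0) x y)"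
proof -
  have "(\<lambda>\<omega>. con M \<omega> (rball M N 0) x y) = path_event (rball M N 0) (\<lambda>vs. hd vs = x \<and> last vs = y)"
    by (auto simp: con_iff path_event_def fun_eq_iff)
  then show ?thesis by (simp add: cylinder_event cylinder_path_event)
qed

text \<open>A grid at a scale proportional to N has a fixed number of cells, so FKG gives it a
  probability bounded below uniformly in N. The numbers are those of \<open>grid_absorbs\<close> for
  I = 15: 20 = I + 5 and 14 = I - 1.\<close>

lemma con_origin_lower:
  "\<exists>k>0. \<exists>N0\<ge>1. \<forall>N\<ge>N0. \<forall>z\<in>sites M. rnorm M z \<le> 14 * real (N div 20) \<longrightarrow>
     k * arm (real N powr w) \<le> Pw (\<lambda>\<omega>. con M \<omega> (rball M N 0) 0 z \<and> inf_at 0 \<omega>)"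
proof -
  obtain a where a: "0 < a" "\<And>x. x \<in> sites M \<Longrightarrow> a * arm (r1 x powr w) \<le> Pw (inf_at x)" using infinite_lower by blast
  define Q where "Q = (q0\<^sup>2) ^ card ({-15..15::int} \<times> {-15..15::int})"
  have Q: "0 < Q" using q0 by (simp add: Q_def)
  have th: "0 < Pw (inf_at 0)" by (rule infinite_pos[OF origin])
  define k where "k = a * Q * Pw (inf_at 0)"
  have "k * arm (real N powr w) \<le> Pw (\<lambda>\<omega>. con M \<omega> (rball M N 0) 0 z \<and> inf_at 0 \<omega>)"
    if N: "20 * m0 + 20 \<le> N" and z: "z \<in> sites M" "rnorm M z \<le> 14 * real (N div 20)" for N z
  proof -
    let ?n = "N div 20"
    have n: "m0 \<le> ?n" "1 \<le> ?n" "20 * ?n \<le> N" using N by auto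
    have nR: "R \<le> real ?n" using m0(2) n(1) by linarith
    have nN: "20 * real ?n \<le> real N" using n(3) by linarith
    let ?A = "\<lambda>\<omega>. grid ?n (-15) 15 (-15) 15 \<omega> \<and> reach z (2 * real ?n) \<omega>"
    have A: "cylinder M ?A" "up_event ?A" by (intro cylinder_conj up_event_conj grid_event reach_event; simp)+
    have zN: "r1 z \<le> real N" using z(2) nN N by (simp add: r1_def)
    have armz: "arm (real N powr w) \<le> arm (r1 z powr w)"
      using zN r1(1)[of z] w by (intro arm_antimono powr_mono2) auto
    have "k * arm (real N powr w) = Q * (a * arm (real N powr w)) * Pw (inf_at 0)" by (simp add: k_def)
    also have "\<dots> \<le> Q * Pw (reach z (2 * real ?n)) * Pw (inf_at 0)"
    proof (intro mult_right_mono mult_left_mono)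
      have "a * arm (real N powr w) \<le> a * arm (r1 z powr w)" using armz a(1) by simp
      also have "\<dots> \<le> Pw (inf_at z)" by (rule a(2)[OF z(1)])
      also have "\<dots> \<le> Pw (reach z (2 * real ?n))" by (rule pr_infinite_le_reach) simp
      finally show "a * arm (real N powr w) \<le> Pw (reach z (2 * real ?n))" .
    qed (use Q in auto)
    also have "\<dots> \<le> Pw (grid ?n (-15) 15 (-15) 15) * Pw (reach z (2 * real ?n)) * Pw (inf_at 0)"
      unfolding Q_def using q0 crossing_ge_q0[OF field_qd n(1)] by (intro mult_right_mono grid_ge_power field_qd) auto
    also have "\<dots> \<le> Pw ?A * Pw (inf_at 0)"
      by (intro mult_right_mono Harris_FKG grid_event reach_event field_prob_field field_qd) auto
    also have "\<dots> \<le> Pw (\<lambda>\<omega>. ?A \<omega> \<and> inf_at 0 \<omega>)" by (rule FKG_infinite[OF A])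
    also have "\<dots> \<le> Pw (\<lambda>\<omega>. con M \<omega> (rball M N 0) 0 z \<and> inf_at 0 \<omega>)"
    proof (rule pr_mono)
      show "event M (\<lambda>\<omega>. con M \<omega> (rball M N 0) 0 z \<and> inf_at 0 \<omega>)" by (intro event_conj con_rball_event event_infinite)
      fix \<omega> assume *: "?A \<omega> \<and> inf_at 0 \<omega>"
      have "con M \<omega> (rball M N 0) 0 z"
        by (rule grid_absorbs[OF n(2) nR, of 15]) (use * z nN inf_imp_reach in auto)
      then show "con M \<omega> (rball M N 0) 0 z \<and> inf_at 0 \<omega>" using * by simp
    qed
    finally show ?thesis .
  qed
  moreover have "0 < k" using a Q th by (simp add: k_def)
  ultimately show ?thesis by (intro exI[of _ k] conjI exI[of _ "20 * m0 + 20"]) auto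
qed

text \<open>A connection to the origin is an arm of z of length r(z), which for r(z) \<ge> 1 exceeds
  the local correlation scale r(z)^w; sites with r(z) < 1 are covered by the constant.\<close>

lemma con_origin_upper:
  "\<exists>C>0. \<forall>N. \<forall>z\<in>rball M N 0. Pw (\<lambda>\<omega>. con M \<omega> (rball M N 0) 0 z) \<le> C * arm (r1 z powr w)"
proof -
  obtain C where C: "0 < C" "\<And>x d. x \<in> sites M \<Longrightarrow> 1 \<le> d \<Longrightarrow> Pw (reach x d) \<le> C * arm (min d (r1 x powr w))"
    using reach_upper by blast
  have "Pw (\<lambda>\<omega>. con M \<omega> (rball M N 0) 0 z) \<le> max C (1 / arm 1) * arm (r1 z powr w)" if z: "z \<in> rball M N 0" for N z
  proof (cases "1 \<le> rnorm M z")
    case True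
    then have r: "r1 z = rnorm M z" by (simp add: r1_def)
    have zs: "z \<in> sites M" using z by (simp add: rball_def)
    have "Pw (\<lambda>\<omega>. con M \<omega> (rball M N 0) 0 z) \<le> Pw (reach z (rnorm M z))"
    proof (rule pr_mono)
      fix \<omega> assume "con M \<omega> (rball M N 0) 0 z"
      then show "reach z (rnorm M z) \<omega>" using reach_con[OF con_sym] by simp
    qed (intro cylinder_event reach_event; simp)
    also have "\<dots> \<le> C * arm (r1 z powr w)" using C(2)[OF zs True] r1(4)[of z] r by (simp add: min_absorb2)
    also have "\<dots> \<le> max C (1 / arm 1) * arm (r1 z powr w)" using arm_le_1(2) by (intro mult_right_mono) auto
    finally show ?thesis .
  next
    case False
    then have r: "r1 z powr w = 1" by (simp add: r1_def)
    have "Pw (\<lambda>\<omega>. con M \<omega> (rball M N 0) 0 z) \<le> 1" by simp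
    also have "1 = 1 / arm 1 * arm 1" using arm_pos[of 1] by simp
    also have "\<dots> \<le> max C (1 / arm 1) * arm 1" using arm_le_1(2) by (intro mult_right_mono) auto
    finally show ?thesis using r by simp
  qed
  then show ?thesis using C(1) by (intro exI[of _ "max C (1 / arm 1)"]) auto
qed

end

section \<open>Counting sites of the infinite cluster\<close>

lemma eventually_le_imp_le:
  fixes f g :: "nat \<Rightarrow> real"
  assumes "\<And>N. N1 \<le> N \<Longrightarrow> f N \<le> C * g N" "\<And>N. 1 \<le> N \<Longrightarrow> 0 < g N"
  shows "\<exists>C. \<forall>N\<ge>1. f N \<le> C * g N"
proof (intro exI allI impI)
  fix N :: nat assume N: "1 \<le> N"
  let ?D = "Max (insert C ((\<lambda>N. f N / g N) ` {1..N1}))"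
  show "f N \<le> ?D * g N"
  proof (cases "N1 \<le> N")
    case True
    have "C \<le> ?D" by simp
    then have "C * g N \<le> ?D * g N" using assms(2)[OF N] by (intro mult_right_mono) auto
    then show ?thesis using assms(1)[OF True] by linarith
  next
    case False
    then have "f N / g N \<le> ?D" using N by (intro Max_ge) auto
    then show ?thesis using assms(2)[OF N] by (simp add: pos_divide_le_eq)
  qed
qed

context inhomogeneous_percolation
begin

abbreviation Mw :: "(complex set \<Rightarrow> bool) measure" where "Mw \<equiv> inhom_measure M w"

lemma Mw_eq: "Mw = perc_measure M qd"
  by (simp add: inhom_measure_def qd_def[abs_def])

lemma prob_space_Mw: "prob_space Mw"
  unfolding Mw_eq by (rule prob_space_perc_measure)

sublocale Mw: prob_space Mw by (rule prob_space_Mw)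

lemma space_Mw: "space Mw = elements M \<rightarrow>\<^sub>E UNIV"
  by (simp add: Mw_eq)

lemma event_sets_Mw: "event M A \<Longrightarrow> {\<omega> \<in> space Mw. A \<omega>} \<in> sets Mw"
  unfolding space_Mw unfolding Mw_eq by (rule event_sets)

lemma of_bool_measurable: "event M A \<Longrightarrow> (\<lambda>\<omega>. of_bool (A \<omega>) :: real) \<in> borel_measurable Mw"
  using event_sets_Mw[of A] unfolding of_bool_def by (intro measurable_If) (auto simp: pred_def)

lemma bounded_integrable: "f \<in> borel_measurable Mw \<Longrightarrow> (\<And>\<omega>. \<bar>f \<omega>\<bar> \<le> (B::real)) \<Longrightarrow> integrable Mw f"
  by (rule Mw.integrable_const_bound[of _ B]) auto

lemma of_bool_integrable: "event M A \<Longrightarrow> integrable Mw (\<lambda>\<omega>. of_bool (A \<omega>) :: real)"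
  by (rule bounded_integrable[OF of_bool_measurable, of _ 1]) auto

lemma integral_of_bool: "event M A \<Longrightarrow> (\<integral>\<omega>. of_bool (A \<omega>) \<partial>Mw) = Pw A"
proof -
  assume A: "event M A"
  have "(\<integral>\<omega>. (of_bool (A \<omega>) :: real) \<partial>Mw) = (\<integral>\<omega>. indicator {\<omega> \<in> space Mw. A \<omega>} \<omega> \<partial>Mw)"
    by (rule Bochner_Integration.integral_cong) (auto simp: indicator_def)
  also have "\<dots> = measure Mw {\<omega> \<in> space Mw. A \<omega>}" using event_sets_Mw[OF A] by simp
  finally show ?thesis by (simp add: pr_def Mw_eq)
qed

text \<open>For T the rhombus this is \<open>Psi\<close>; for T the rim it bounds the difference of
  \<open>Psi\<close> and \<open>Phi\<close>.\<close>

definition inf_count :: "complex set \<Rightarrow> (complex set \<Rightarrow> bool) \<Rightarrow> real" where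
  "inf_count T \<omega> = (\<Sum>v\<in>T. of_bool (inf_at v \<omega>))"

lemma count_measurable: "inf_count T \<in> borel_measurable Mw"
  unfolding inf_count_def[abs_def] by (intro borel_measurable_sum of_bool_measurable event_infinite)

lemma count_bounds: "0 \<le> inf_count T \<omega>" "inf_count T \<omega> \<le> real (card T)"
proof -
  show "0 \<le> inf_count T \<omega>" unfolding inf_count_def by (intro sum_nonneg) simp
  show "inf_count T \<omega> \<le> real (card T)" unfolding inf_count_def using sum_bounded_above[of T "\<lambda>v. of_bool (inf_at v \<omega>) :: real" 1] by simp
qed

lemma count_integrable: "integrable Mw (inf_count T)" "integrable Mw (\<lambda>\<omega>. (inf_count T \<omega>)\<^sup>2)"
proof -
  show "integrable Mw (inf_count T)"
    using count_bounds by (intro bounded_integrable[OF count_measurable, of _ "real (card T)"]) (simp add: abs_le_iff order_trans[OF _ count_bounds(2)])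
  have "\<bar>(inf_count T \<omega>)\<^sup>2\<bar> \<le> (real (card T))\<^sup>2" for \<omega> using count_bounds[of T \<omega>] by (simp add: power_mono)
  then show "integrable Mw (\<lambda>\<omega>. (inf_count T \<omega>)\<^sup>2)" by (intro bounded_integrable borel_measurable_power count_measurable)
qed

lemma expectation_count: "(\<integral>\<omega>. inf_count T \<omega> \<partial>Mw) = (\<Sum>v\<in>T. Pw (inf_at v))"
  unfolding inf_count_def by (subst Bochner_Integration.integral_sum) (simp_all add: of_bool_integrable integral_of_bool event_infinite)

lemma second_moment_count: "(\<integral>\<omega>. (inf_count T \<omega>)\<^sup>2 \<partial>Mw) = (\<Sum>x\<in>T. \<Sum>y\<in>T. Pw (\<lambda>\<omega>. inf_at x \<omega> \<and> inf_at y \<omega>))"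
proof -
  have "(inf_count T \<omega>)\<^sup>2 = (\<Sum>x\<in>T. \<Sum>y\<in>T. of_bool (inf_at x \<omega> \<and> inf_at y \<omega>))" for \<omega>
    unfolding inf_count_def power2_eq_square sum_product of_bool_conj ..
  then show ?thesis
    by (simp add: Bochner_Integration.integral_sum of_bool_integrable integral_of_bool event_inf_pair del: of_bool_conj)
qed

lemma variance_count: "(\<integral>\<omega>. (inf_count T \<omega> - (\<integral>\<omega>. inf_count T \<omega> \<partial>Mw))\<^sup>2 \<partial>Mw)
   = (\<Sum>x\<in>T. \<Sum>y\<in>T. Pw (\<lambda>\<omega>. inf_at x \<omega> \<and> inf_at y \<omega>) - Pw (inf_at x) * Pw (inf_at y))"
  unfolding Mw.variance_eq[OF count_integrable] unfolding second_moment_count expectation_count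
  by (simp add: power2_eq_square sum_product sum_subtractf)

lemma card_filter: "finite T \<Longrightarrow> real (card {v \<in> T. P v}) = (\<Sum>v\<in>T. of_bool (P v))"
  by (simp add: of_bool_def sum.If_cases Int_def)

lemma Psi_count: "Psi M N = inf_count (rball M N 0)"
  by (rule ext) (simp add: Psi_def inf_count_def card_filter)

definition con0 :: "nat \<Rightarrow> complex \<Rightarrow> (complex set \<Rightarrow> bool) \<Rightarrow> bool" where
  "con0 N z \<omega> = con M \<omega> (rball M N 0) 0 z"

lemma event_con0: "event M (con0 N z)"
  unfolding con0_def[abs_def] by (rule con_rball_event)

lemma Phi_sum: "Phi M N \<omega> = (\<Sum>v\<in>rball M N 0. of_bool (con0 N v \<omega>))"
  unfolding Phi_def con0_def by (rule card_filter) simp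

lemma Phi_measurable: "Phi M N \<in> borel_measurable Mw"
  unfolding Phi_sum[abs_def] by (intro borel_measurable_sum of_bool_measurable event_con0)

lemma Phi_bounds: "0 \<le> Phi M N \<omega>" "Phi M N \<omega> \<le> real (card (rball M N 0))"
  unfolding Phi_def by (auto intro!: card_mono)

lemma expectation_Phi: "(\<integral>\<omega>. Phi M N \<omega> \<partial>Mw) = (\<Sum>v\<in>rball M N 0. Pw (con0 N v))"
  unfolding Phi_sum by (subst Bochner_Integration.integral_sum) (simp_all add: of_bool_integrable integral_of_bool event_con0)

abbreviation one_inf :: "(complex set \<Rightarrow> bool) \<Rightarrow> real" where "one_inf \<omega> \<equiv> of_bool (inf_at 0 \<omega>)"

lemma expectation_Phi_inf: "(\<integral>\<omega>. one_inf \<omega> * Phi M N \<omega> \<partial>Mw) = (\<Sum>v\<in>rball M N 0. Pw (\<lambda>\<omega>. con0 N v \<omega> \<and> inf_at 0 \<omega>))"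
proof -
  have eq: "one_inf \<omega> * Phi M N \<omega> = (\<Sum>v\<in>rball M N 0. of_bool (con0 N v \<omega> \<and> inf_at 0 \<omega>))" for \<omega>
    unfolding Phi_sum of_bool_conj sum_distrib_left by (simp add: mult.commute)
  have ev: "event M (\<lambda>\<omega>. con0 N v \<omega> \<and> inf_at 0 \<omega>)" for v by (intro event_conj event_con0 event_infinite)
  show ?thesis
    unfolding eq by (subst Bochner_Integration.integral_sum) (simp_all only: of_bool_integrable[OF ev] integral_of_bool[OF ev])
qed

definition \<theta> :: real where "\<theta> = Pw (inf_at 0)"

lemma \<theta>: "0 < \<theta>"
  unfolding \<theta>_def by (rule infinite_pos[OF origin])

abbreviation Cw :: "(complex set \<Rightarrow> bool) measure" where "Cw \<equiv> cond_measure M w"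

text \<open>As a density with respect to \<open>Mw\<close>, so that conditional integrals become
  integrals weighted by \<open>one_inf\<close>.\<close>

lemma Cw_density: "Cw = Nonnegative_Lebesgue_Integration.density Mw (\<lambda>\<omega>. ennreal (one_inf \<omega> / \<theta>))"
proof -
  let ?A = "{\<omega> \<in> space Mw. inf_at 0 \<omega>}"
  have "emeasure Mw ?A = ennreal \<theta>" by (simp add: \<theta>_def pr_def Mw_eq Mw.emeasure_eq_measure[unfolded Mw_eq])
  then have "Cw = Nonnegative_Lebesgue_Integration.density Mw (\<lambda>\<omega>. indicator ?A \<omega> / ennreal \<theta>)" by (simp add: cond_measure_def uniform_measure_def)
  also have "\<dots> = Nonnegative_Lebesgue_Integration.density Mw (\<lambda>\<omega>. ennreal (one_inf \<omega> / \<theta>))"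
  proof (rule density_cong)
    have ev: "?A \<in> sets Mw" by (rule event_sets_Mw[OF event_infinite])
    then show "(\<lambda>\<omega>. indicator ?A \<omega> / ennreal \<theta>) \<in> borel_measurable Mw" by measurable
    show "(\<lambda>\<omega>. ennreal (one_inf \<omega> / \<theta>)) \<in> borel_measurable Mw"
      using of_bool_measurable[OF event_infinite, of 0] by measurable
    show "AE \<omega> in Mw. indicator ?A \<omega> / ennreal \<theta> = ennreal (one_inf \<omega> / \<theta>)"
    proof (rule AE_I2)
      fix \<omega> assume "\<omega> \<in> space Mw"
      then show "indicator ?A \<omega> / ennreal \<theta> = ennreal (one_inf \<omega> / \<theta>)"
        using \<theta> divide_ennreal[of 1 \<theta>] by (cases "inf_at 0 \<omega>") (auto simp: indicator_def)
    qed
  qed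
  finally show ?thesis .
qed

lemma sets_Cw [measurable_cong]: "sets Cw = sets Mw"
  by (simp add: cond_measure_def)

lemma prob_space_Cw: "prob_space Cw"
  unfolding cond_measure_def
proof (rule prob_space_uniform_measure)
  have "emeasure Mw {\<omega> \<in> space Mw. inf_at 0 \<omega>} = ennreal \<theta>" by (simp add: \<theta>_def pr_def Mw_eq Mw.emeasure_eq_measure[unfolded Mw_eq])
  then show "emeasure Mw {\<omega> \<in> space Mw. inf_at 0 \<omega>} \<noteq> 0" "emeasure Mw {\<omega> \<in> space Mw. inf_at 0 \<omega>} \<noteq> \<infinity>" using \<theta> by auto
qed

sublocale Cw: prob_space Cw by (rule prob_space_Cw)

lemma integral_Cw: "f \<in> borel_measurable Mw \<Longrightarrow> (\<integral>\<omega>. f \<omega> \<partial>Cw) = (\<integral>\<omega>. one_inf \<omega> * f \<omega> \<partial>Mw) / \<theta>" for f :: "_ \<Rightarrow> real"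
proof -
  assume f: "f \<in> borel_measurable Mw"
  have "(\<integral>\<omega>. f \<omega> \<partial>Cw) = (\<integral>\<omega>. (one_inf \<omega> / \<theta>) *\<^sub>R f \<omega> \<partial>Mw)"
    unfolding Cw_density using \<theta> of_bool_measurable[OF event_infinite, of 0] f
    by (intro integral_density) auto
  then show ?thesis by simp
qed

lemma bounded_integrable_Cw: "f \<in> borel_measurable Mw \<Longrightarrow> (\<And>\<omega>. \<bar>f \<omega>\<bar> \<le> (B::real)) \<Longrightarrow> integrable Cw f"
  by (rule Cw.integrable_const_bound[of _ B]) (auto simp: measurable_cong_sets[OF sets_Cw refl])

section \<open>Orders of magnitude\<close>

text \<open>The common yardstick: each first moment is shown to be of this order, and the
  comparisons in the theorem follow by transitivity.\<close>

definition F :: "nat \<Rightarrow> real" where "F N = (real N)\<^sup>2 * arm (real N powr w)"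

lemma F_pos: "1 \<le> N \<Longrightarrow> 0 < F N"
  using arm_pos by (simp add: F_def)

definition of_order_F :: "(nat \<Rightarrow> real) \<Rightarrow> bool" where
  "of_order_F f \<longleftrightarrow> (\<exists>a b. 0 < a \<and> 0 < b \<and> (\<forall>N\<ge>1. a * F N \<le> f N \<and> f N \<le> b * F N))"

lemma of_order_F_comparable:
  assumes "of_order_F f" "of_order_F g" shows "comparable f g"
proof -
  obtain a b where ab: "0 < a" "0 < b" "\<And>N. 1 \<le> N \<Longrightarrow> a * F N \<le> f N \<and> f N \<le> b * F N" using assms(1) by (auto simp: of_order_F_def)
  obtain a' b' where ab': "0 < a'" "0 < b'" "\<And>N. 1 \<le> N \<Longrightarrow> a' * F N \<le> g N \<and> g N \<le> b' * F N" using assms(2) by (auto simp: of_order_F_def)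
  have "a / b' * g N \<le> f N \<and> f N \<le> max (a / b') (b / a') * g N" if N: "1 \<le> N" for N
  proof
    have FN: "0 < F N" by (rule F_pos[OF N])
    have "a / b' * g N \<le> a / b' * (b' * F N)" using ab(1) ab'(2) ab'(3)[OF N] by (intro mult_left_mono) auto
    then show "a / b' * g N \<le> f N" using ab(3)[OF N] ab'(2) by simp
    have g0: "0 \<le> g N" using ab'(1) ab'(3)[OF N] FN by (meson less_imp_le mult_nonneg_nonneg order_trans)
    have "f N \<le> b / a' * (a' * F N)" using ab(3)[OF N] ab'(1) by simp
    also have "\<dots> \<le> b / a' * g N" using ab(2) ab'(1) ab'(3)[OF N] by (intro mult_left_mono) auto
    also have "\<dots> \<le> max (a / b') (b / a') * g N" using g0 by (intro mult_right_mono) auto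
    finally show "f N \<le> max (a / b') (b / a') * g N" .
  qed
  moreover have "0 < a / b'" using ab(1) ab'(2) by simp
  ultimately show ?thesis unfolding comparable_def by (intro exI[of _ "a / b'"] exI[of _ "max (a / b') (b / a')"]) auto
qed

lemma one_arm_order: "\<exists>a b. 0 < a \<and> 0 < b \<and> (\<forall>N\<ge>1. a * arm (real N powr w) \<le> one_arm M (real N powr w) \<and> one_arm M (real N powr w) \<le> b * arm (real N powr w))"
proof -
  obtain k where k: "0 < k" "\<And>n. k * arm (real n) \<le> sphere_arm n" using sphere_arm_ge by blast
  have rc: "0 < reg_const * 2" using reg_const(1) by simp
  have "k / (reg_const * 2) * arm x \<le> one_arm M x \<and> one_arm M x \<le> reg_const * 2 * arm x" if x: "1 \<le> x" for x
  proof -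
    let ?n = "nat (round x)"
    have r: "of_int (round x) \<le> x + 1/2" "x - 1/2 \<le> of_int (round x)" by (rule of_int_round_le of_int_round_ge)+
    then have "0 < round x" using x by linarith
    then have n: "real ?n = of_int (round x)" "1 \<le> real ?n" by auto
    have 1: "arm x \<le> reg_const * 2 * arm (real ?n)" using r x n by (intro arm_ratio) auto
    have 2: "arm (real ?n) \<le> reg_const * 2 * arm x" using r x n by (intro arm_ratio) auto
    have "k / (reg_const * 2) * arm x \<le> k / (reg_const * 2) * (reg_const * 2 * arm (real ?n))"
      using 1 k(1) rc by (intro mult_left_mono) auto
    also have "\<dots> = k * arm (real ?n)" using rc by simp
    also have "\<dots> \<le> sphere_arm ?n" by (rule k(2))
    finally show ?thesis using sphere_arm_le[of ?n] 2 unfolding one_arm_eq by linarith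
  qed
  moreover have "0 < k / (reg_const * 2)" using k rc by simp
  ultimately show ?thesis using rc N_powr by blast
qed

lemma one_arm_of_order: "of_order_F (\<lambda>N. (real N)\<^sup>2 * one_arm M (real N powr w))"
proof -
  obtain a b where ab: "0 < a" "0 < b" "\<And>N. 1 \<le> N \<Longrightarrow> a * arm (real N powr w) \<le> one_arm M (real N powr w) \<and> one_arm M (real N powr w) \<le> b * arm (real N powr w)"
    using one_arm_order by blast
  have "a * F N \<le> (real N)\<^sup>2 * one_arm M (real N powr w) \<and> (real N)\<^sup>2 * one_arm M (real N powr w) \<le> b * F N" if "1 \<le> N" for N
  proof
    have e: "r * F N = (real N)\<^sup>2 * (r * arm (real N powr w))" for r by (simp add: F_def)
    show "a * F N \<le> (real N)\<^sup>2 * one_arm M (real N powr w)" "(real N)\<^sup>2 * one_arm M (real N powr w) \<le> b * F N"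
      unfolding e using ab(3)[OF that] by (auto intro: mult_left_mono)
  qed
  then show ?thesis using ab unfolding of_order_F_def by blast
qed

lemma lattice_box_card: "(real k)\<^sup>2 \<le> real (card (sites M \<inter> rbox M 0 (real k)))"
proof -
  let ?f = "\<lambda>(i, j). lat M (of_int i) (of_int j)"
  have inj: "inj_on ?f ({0..<int k} \<times> {0..<int k})"
  proof (rule inj_onI, clarify)
    fix a b c d :: int assume "lat M (of_int a) (of_int b) = lat M (of_int c) (of_int d)"
    then have "coord1 M (lat M (of_int a) (of_int b)) = coord1 M (lat M (of_int c) (of_int d))"
      "coord2 M (lat M (of_int a) (of_int b)) = coord2 M (lat M (of_int c) (of_int d))" by simp_all
    then show "a = c \<and> b = d" by simp
  qed
  have sub: "?f ` ({0..<int k} \<times> {0..<int k}) \<subseteq> sites M \<inter> rbox M 0 (real k)"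
    using lat_in_sites by (auto simp: rbox_def rnorm_le_iff)
  have "k * k = card ({0..<int k} \<times> {0..<int k})" by (simp add: card_cartesian_product)
  also have "\<dots> = card (?f ` ({0..<int k} \<times> {0..<int k}))" by (rule card_image[OF inj, symmetric])
  also have "\<dots> \<le> card (sites M \<inter> rbox M 0 (real k))" by (rule card_mono[OF finite_sites_rbox sub])
  finally have "real (k * k) \<le> real (card (sites M \<inter> rbox M 0 (real k)))" by (rule of_nat_mono)
  then show ?thesis by (simp add: power2_eq_square)
qed

text \<open>Below, every summand is at least the outermost one. Above, the linear bound turns the
  sum into U times the sum of \<open>r1 z powr (- w)\<close>, of order N^w arm(N^w) N^(2 -
  w).\<close>

lemma arm_sum_of_order: "of_order_F (\<lambda>N. \<Sum>z\<in>rball M N 0. arm (r1 z powr w))"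
proof -
  have w': "0 < w" "w < 2" using w by auto
  obtain C where C: "0 < C" "\<And>x t. 1 \<le> t \<Longrightarrow> (\<Sum>y\<in>sites M \<inter> rbox M x t. max 1 (rnorm M (y - x)) powr (- w)) \<le> C * t powr (2 - w)"
    using sum_inverse_powers[OF w'] by blast
  have "1 * F N \<le> (\<Sum>z\<in>rball M N 0. arm (r1 z powr w)) \<and> (\<Sum>z\<in>rball M N 0. arm (r1 z powr w)) \<le> reg_const * C * F N" if N: "1 \<le> N" for N
  proof
    have N1: "1 \<le> real N" using N by simp
    have r: "r1 z powr w \<le> real N powr w" if "z \<in> rball M N 0" for z
      using that N1 w r1(1)[of z] by (intro powr_mono2) (auto simp: rball_def r1_def)
    have "1 * F N \<le> real (card (rball M N 0)) * arm (real N powr w)"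
      using lattice_box_card[of N] arm_le_1(2) unfolding F_def rball_rbox by (simp add: mult_right_mono)
    also have "\<dots> = (\<Sum>z\<in>rball M N 0. arm (real N powr w))" by simp
    also have "\<dots> \<le> (\<Sum>z\<in>rball M N 0. arm (r1 z powr w))"
      using r r1(3) by (intro sum_mono arm_antimono) (auto intro: order_trans[OF zero_le_one])
    finally show "1 * F N \<le> (\<Sum>z\<in>rball M N 0. arm (r1 z powr w))" .
    have "(\<Sum>z\<in>rball M N 0. arm (r1 z powr w)) \<le> (\<Sum>z\<in>rball M N 0. reg_const * U N * r1 z powr (- w))"
    proof (rule sum_mono)
      fix z assume "z \<in> rball M N 0"
      from arm_le_U[OF r1(3) r[OF this]] show "arm (r1 z powr w) \<le> reg_const * U N * r1 z powr (- w)"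
        by (simp add: powr_minus_divide)
    qed
    also have "\<dots> = reg_const * U N * (\<Sum>z\<in>sites M \<inter> rbox M 0 (real N). max 1 (rnorm M (z - 0)) powr (- w))"
      by (simp add: sum_distrib_left rball_rbox r1_def)
    also have "\<dots> \<le> reg_const * U N * (C * real N powr (2 - w))"
      using C(2)[OF N1, of 0] reg_const(1) arm_le_1(2) by (intro mult_left_mono) (auto simp: U_def)
    also have "\<dots> = reg_const * C * ((real N powr w * real N powr (2 - w)) * arm (real N powr w))" by (simp add: U_def)
    also have "real N powr w * real N powr (2 - w) = (real N)\<^sup>2" using N1 by (simp add: powr_add[symmetric] powr_numeral)
    finally show "(\<Sum>z\<in>rball M N 0. arm (r1 z powr w)) \<le> reg_const * C * F N" by (simp add: F_def)
  qed
  moreover have "0 < reg_const * C" using reg_const(1) C(1) by simp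
  ultimately show ?thesis unfolding of_order_F_def by (intro exI[of _ 1] exI[of _ "reg_const * C"]) auto
qed

lemma of_order_F_sum:
  assumes "0 < a" "0 < b" "\<And>N z. 1 \<le> N \<Longrightarrow> z \<in> rball M N 0 \<Longrightarrow> a * arm (r1 z powr w) \<le> f N z \<and> f N z \<le> b * arm (r1 z powr w)"
  shows "of_order_F (\<lambda>N. \<Sum>z\<in>rball M N 0. f N z)"
proof -
  obtain A B where AB: "0 < A" "0 < B" "\<And>N. 1 \<le> N \<Longrightarrow> A * F N \<le> (\<Sum>z\<in>rball M N 0. arm (r1 z powr w)) \<and> (\<Sum>z\<in>rball M N 0. arm (r1 z powr w)) \<le> B * F N"
    using arm_sum_of_order unfolding of_order_F_def by blast
  have "(a * A) * F N \<le> (\<Sum>z\<in>rball M N 0. f N z) \<and> (\<Sum>z\<in>rball M N 0. f N z) \<le> (b * B) * F N" if N: "1 \<le> N" for N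
  proof
    let ?s = "\<Sum>z\<in>rball M N 0. arm (r1 z powr w)"
    have "(a * A) * F N \<le> a * ?s" using AB(3)[OF N] assms(1) by (simp add: mult.assoc)
    also have "\<dots> \<le> (\<Sum>z\<in>rball M N 0. f N z)" unfolding sum_distrib_left using assms(3)[OF N] by (intro sum_mono) auto
    finally show "(a * A) * F N \<le> (\<Sum>z\<in>rball M N 0. f N z)" .
    have "(\<Sum>z\<in>rball M N 0. f N z) \<le> b * ?s" unfolding sum_distrib_left using assms(3)[OF N] by (intro sum_mono) auto
    also have "\<dots> \<le> (b * B) * F N" using AB(3)[OF N] assms(2) by (simp add: mult.assoc)
    finally show "(\<Sum>z\<in>rball M N 0. f N z) \<le> (b * B) * F N" .
  qed
  then show ?thesis using assms(1,2) AB(1,2) unfolding of_order_F_def by (intro exI[of _ "a * A"] exI[of _ "b * B"]) auto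
qed

lemma I_sum_of_order: "of_order_F (I_sum M w)"
proof -
  obtain a b where ab: "0 < a" "0 < b" "\<And>x. a * arm (r1 x powr w) \<le> P_inf M (density M w x) \<and> P_inf M (density M w x) \<le> b * arm (r1 x powr w)"
    using P_inf_density by blast
  show ?thesis unfolding I_sum_def[abs_def] by (rule of_order_F_sum[OF ab(1,2)]) (rule ab(3))
qed

lemma E_Psi_of_order: "of_order_F (\<lambda>N. \<integral>\<omega>. Psi M N \<omega> \<partial>Mw)"
proof -
  obtain a b where ab: "0 < a" "0 < b" "\<And>x. x \<in> sites M \<Longrightarrow> a * arm (r1 x powr w) \<le> Pw (inf_at x)" "\<And>x. x \<in> sites M \<Longrightarrow> Pw (inf_at x) \<le> b * arm (r1 x powr w)"
    using infinite_lower infinite_upper by blast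
  show ?thesis unfolding Psi_count expectation_count by (rule of_order_F_sum[OF ab(1,2)]) (use ab(3,4) in \<open>auto simp: rball_def\<close>)
qed

text \<open>The lower bound is proved on the event that the origin percolates, so that it serves the
  conditional and the unconditional expectation.\<close>

lemma E_Phi_bounds:
  "\<exists>a b. 0 < a \<and> 0 < b \<and> (\<forall>N\<ge>1. a * F N \<le> (\<integral>\<omega>. one_inf \<omega> * Phi M N \<omega> \<partial>Mw) \<and> (\<integral>\<omega>. Phi M N \<omega> \<partial>Mw) \<le> b * F N)"
proof -
  obtain k N0 where k: "0 < k" "1 \<le> N0" "\<And>N z. N0 \<le> N \<Longrightarrow> z \<in> sites M \<Longrightarrow> rnorm M z \<le> 14 * real (N div 20) \<Longrightarrow>
     k * arm (real N powr w) \<le> Pw (\<lambda>\<omega>. con M \<omega> (rball M N 0) 0 z \<and> inf_at 0 \<omega>)" using con_origin_lower by blast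
  define N1 where "N1 = max N0 20"
  \<comment> \<open>The number 1600 is 40^2, because N is at most 40 (N div 20) for N \<ge> 20. The
    second term is for small N, where the site 0 alone suffices.\<close>
  define a where "a = min (k / 1600) (\<theta> / (real N1)\<^sup>2)"
  have a: "0 < a" using k(1) \<theta> by (simp add: a_def N1_def)
  have lo: "a * F N \<le> (\<integral>\<omega>. one_inf \<omega> * Phi M N \<omega> \<partial>Mw)" if N: "1 \<le> N" for N
  proof (cases "N1 \<le> N")
    case True
    let ?n = "N div 20"
    have n: "real N \<le> 40 * real ?n" "20 * real ?n \<le> real N"
    proof -
      have "20 \<le> N" using True by (simp add: N1_def)
      then have "N \<le> 40 * ?n" "20 * ?n \<le> N" by presburger+
      then show "real N \<le> 40 * real ?n" "20 * real ?n \<le> real N" by linarith+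
    qed
    let ?S = "sites M \<inter> rbox M 0 (real ?n)"
    have sub: "?S \<subseteq> rball M N 0" using n(2) by (auto simp: rball_rbox rbox_def)
    have "a \<le> k / 1600" unfolding a_def by (rule min.cobounded1)
    then have "a * F N \<le> k / 1600 * F N" using F_pos[OF N] by (intro mult_right_mono) auto
    also have "\<dots> = (real N)\<^sup>2 / 1600 * (k * arm (real N powr w))" by (simp add: F_def)
    also have "\<dots> \<le> real (card ?S) * (k * arm (real N powr w))"
    proof (rule mult_right_mono)
      have "(real N)\<^sup>2 \<le> (40 * real ?n)\<^sup>2" using n(1) by (intro power_mono) auto
      then have "(real N)\<^sup>2 / 1600 \<le> (real ?n)\<^sup>2" by (simp add: power_mult_distrib)
      then show "(real N)\<^sup>2 / 1600 \<le> real (card ?S)" using lattice_box_card[of ?n] by linarith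
    qed (use k(1) arm_le_1 in auto)
    also have "\<dots> = (\<Sum>z\<in>?S. k * arm (real N powr w))" by simp
    also have "\<dots> \<le> (\<Sum>z\<in>?S. Pw (\<lambda>\<omega>. con0 N z \<omega> \<and> inf_at 0 \<omega>))"
      unfolding con0_def using True by (intro sum_mono k(3)) (auto simp: N1_def rbox_def)
    also have "\<dots> \<le> (\<Sum>z\<in>rball M N 0. Pw (\<lambda>\<omega>. con0 N z \<omega> \<and> inf_at 0 \<omega>))" by (intro sum_mono2 sub) auto
    finally show ?thesis unfolding expectation_Phi_inf .
  next
    case False
    have "F N \<le> (real N)\<^sup>2 * 1" unfolding F_def by (intro mult_left_mono arm_le_1) simp
    also have "\<dots> \<le> (real N1)\<^sup>2" using False by (simp add: power_mono)
    finally have "a * F N \<le> \<theta> / (real N1)\<^sup>2 * (real N1)\<^sup>2" using a F_pos[OF N] \<theta> by (intro mult_mono) (auto simp: a_def)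
    also have "\<dots> = \<theta>" by (simp add: N1_def)
    also have "\<dots> \<le> Pw (\<lambda>\<omega>. con0 N 0 \<omega> \<and> inf_at 0 \<omega>)"
      unfolding \<theta>_def
    proof (rule pr_mono)
      show "event M (\<lambda>\<omega>. con0 N 0 \<omega> \<and> inf_at 0 \<omega>)" by (intro event_conj event_con0 event_infinite)
      fix \<omega> assume i: "inf_at 0 \<omega>"
      obtain vs where vs: "occupied_path M \<omega> vs" "hd vs = 0" using inf_imp_reach[OF i, of 0] by (auto simp: reach_def)
      have "occupied_path M \<omega> (take 1 vs)" by (rule occupied_path_take[OF vs(1)]) simp
      moreover have "take 1 vs = [0]" using vs by (cases vs) (auto simp: occupied_path_def)
      ultimately have "occupied_path M \<omega> [0]" by simp
      then have "con0 N 0 \<omega>" unfolding con0_def con_iff using origin by (intro exI[of _ "[0]"]) (auto simp: rball_def)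
      then show "con0 N 0 \<omega> \<and> inf_at 0 \<omega>" using i by simp
    qed
    also have "\<dots> \<le> (\<Sum>z\<in>rball M N 0. Pw (\<lambda>\<omega>. con0 N z \<omega> \<and> inf_at 0 \<omega>))"
    proof (rule member_le_sum)
      show "0 \<in> rball M N 0" using origin by (simp add: rball_def)
    qed simp_all
    finally show ?thesis unfolding expectation_Phi_inf .
  qed
  obtain C where C: "0 < C" "\<And>N z. z \<in> rball M N 0 \<Longrightarrow> Pw (\<lambda>\<omega>. con M \<omega> (rball M N 0) 0 z) \<le> C * arm (r1 z powr w)" using con_origin_upper by blast
  obtain B where B: "0 < B" "\<And>N. 1 \<le> N \<Longrightarrow> (\<Sum>z\<in>rball M N 0. arm (r1 z powr w)) \<le> B * F N"
    using arm_sum_of_order unfolding of_order_F_def by blast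
  have hi: "(\<integral>\<omega>. Phi M N \<omega> \<partial>Mw) \<le> (C * B) * F N" if N: "1 \<le> N" for N
  proof -
    have "(\<integral>\<omega>. Phi M N \<omega> \<partial>Mw) \<le> (\<Sum>z\<in>rball M N 0. C * arm (r1 z powr w))"
      unfolding expectation_Phi con0_def[abs_def] by (intro sum_mono C(2))
    also have "\<dots> = C * (\<Sum>z\<in>rball M N 0. arm (r1 z powr w))" by (simp add: sum_distrib_left)
    also have "\<dots> \<le> C * (B * F N)" using B(2)[OF N] C(1) by (intro mult_left_mono) auto
    finally show ?thesis by (simp add: mult.assoc)
  qed
  have "0 < C * B" using C(1) B(1) by simp
  then show ?thesis using a lo hi by blast
qed

lemma E_Phi_inf_le: "(\<integral>\<omega>. one_inf \<omega> * Phi M N \<omega> \<partial>Mw) \<le> (\<integral>\<omega>. Phi M N \<omega> \<partial>Mw)"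
  unfolding expectation_Phi_inf expectation_Phi by (intro sum_mono pr_mono event_con0) auto

lemma E_Phi_of_order: "of_order_F (\<lambda>N. \<integral>\<omega>. Phi M N \<omega> \<partial>Mw)"
  using E_Phi_bounds E_Phi_inf_le unfolding of_order_F_def by (meson order_trans)

lemma E_Phi_cond_of_order: "of_order_F (\<lambda>N. \<integral>\<omega>. Phi M N \<omega> \<partial>Cw)"
proof -
  obtain a b where ab: "0 < a" "0 < b" "\<And>N. 1 \<le> N \<Longrightarrow> a * F N \<le> (\<integral>\<omega>. one_inf \<omega> * Phi M N \<omega> \<partial>Mw) \<and> (\<integral>\<omega>. Phi M N \<omega> \<partial>Mw) \<le> b * F N"
    using E_Phi_bounds by blast
  have "a / \<theta> * F N \<le> (\<integral>\<omega>. Phi M N \<omega> \<partial>Cw) \<and> (\<integral>\<omega>. Phi M N \<omega> \<partial>Cw) \<le> b / \<theta> * F N" if "1 \<le> N" for N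
    using ab(3)[OF that] E_Phi_inf_le[of N] \<theta> unfolding integral_Cw[OF Phi_measurable] by (auto simp: divide_right_mono)
  then show ?thesis using ab(1,2) \<theta> unfolding of_order_F_def by (intro exI[of _ "a / \<theta>"] exI[of _ "b / \<theta>"]) auto
qed

section \<open>Variance bounds\<close>

abbreviation EPsi :: "nat \<Rightarrow> real" where "EPsi N \<equiv> \<integral>\<omega>. Psi M N \<omega> \<partial>Mw"

lemma variance_inf_count:
  assumes \<epsilon>: "0 < \<epsilon>" "\<epsilon> \<le> 1 - w"
  shows "\<exists>C>0. \<forall>N\<ge>1. \<forall>T\<subseteq>rball M N 0. (\<integral>\<omega>. (inf_count T \<omega> - (\<integral>\<omega>. inf_count T \<omega> \<partial>Mw))\<^sup>2 \<partial>Mw) \<le> C * real N powr (2 + 2 * \<epsilon>) * (U N)\<^sup>2"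
  using covariance_sum[OF \<epsilon>] unfolding variance_count .

text \<open>Contains the part of the rhombus that the largest admissible grid of mesoscopic scale
  may fail to serve.\<close>

definition rim :: "real \<Rightarrow> nat \<Rightarrow> complex set" where
  "rim \<epsilon> N = {z \<in> rball M N 0. real N - 7 * real (meso \<epsilon> N) \<le> rnorm M z}"

text \<open>Four rectangles of sides 7n and 2N cover the rim; each has at most K * 9n * 4N
  sites.\<close>

lemma card_rim: "\<exists>K>0. \<forall>N \<epsilon>. 1 \<le> N \<longrightarrow> 0 < \<epsilon> \<longrightarrow> \<epsilon> \<le> 1 - w \<longrightarrow> real (card (rim \<epsilon> N)) \<le> K * real (meso \<epsilon> N) * real N"
proof -
  define rect where "rect a s b t = {v \<in> sites M. a \<le> coord1 M v \<and> coord1 M v \<le> a + s \<and> b \<le> coord2 M v \<and> coord2 M v \<le> b + t}" for a s b t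
  obtain K where K: "1 \<le> K" "\<And>a b s t. 0 \<le> s \<Longrightarrow> 0 \<le> t \<Longrightarrow> finite (rect a s b t) \<and> real (card (rect a s b t)) \<le> K * (s + 2) * (t + 2)"
    using card_sites_rectangle unfolding rect_def by blast
  have "real (card (rim \<epsilon> N)) \<le> (144 * K) * real (meso \<epsilon> N) * real N" if N: "1 \<le> N" and \<epsilon>: "0 < \<epsilon>" "\<epsilon> \<le> 1 - w" for N \<epsilon>
  proof -
    let ?n = "7 * real (meso \<epsilon> N)" and ?N = "real N"
    let ?R = "{rect (?N - ?n) ?n (- ?N) (2 * ?N), rect (- ?N) ?n (- ?N) (2 * ?N), rect (- ?N) (2 * ?N) (?N - ?n) ?n, rect (- ?N) (2 * ?N) (- ?N) ?n}"
    have n1: "7 \<le> ?n" "1 \<le> ?N" using meso(2)[OF N \<epsilon>] N by auto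
    have b: "(?n + 2) * (2 * ?N + 2) \<le> 36 * real (meso \<epsilon> N) * ?N"
    proof -
      have "(?n + 2) * (2 * ?N + 2) \<le> (9 * real (meso \<epsilon> N)) * (4 * ?N)" using n1 by (intro mult_mono) auto
      then show ?thesis by simp
    qed
    have each: "finite A \<and> real (card A) \<le> K * (36 * real (meso \<epsilon> N) * ?N)" if "A \<in> ?R" for A
    proof -
      have "finite A \<and> real (card A) \<le> K * ((?n + 2) * (2 * ?N + 2))"
        using that
      proof (elim insertE emptyE)
        have 1: "finite (rect a ?n b (2 * ?N)) \<and> real (card (rect a ?n b (2 * ?N))) \<le> K * ((?n + 2) * (2 * ?N + 2))" for a b
          using K(2)[of ?n "2 * ?N" a b] n1 by (simp add: mult.assoc)
        have 2: "finite (rect a (2 * ?N) b ?n) \<and> real (card (rect a (2 * ?N) b ?n)) \<le> K * ((?n + 2) * (2 * ?N + 2))" for a b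
          using K(2)[of "2 * ?N" ?n a b] n1 by (simp add: mult.assoc mult.commute[of "2 * ?N + 2"])
        show ?thesis if "A = rect (?N - ?n) ?n (- ?N) (2 * ?N)" using 1 that by simp
        show ?thesis if "A = rect (- ?N) ?n (- ?N) (2 * ?N)" using 1 that by simp
        show ?thesis if "A = rect (- ?N) (2 * ?N) (?N - ?n) ?n" using 2 that by simp
        show ?thesis if "A = rect (- ?N) (2 * ?N) (- ?N) ?n" using 2 that by simp
      qed
      moreover have "K * ((?n + 2) * (2 * ?N + 2)) \<le> K * (36 * real (meso \<epsilon> N) * ?N)" using b K(1) by (intro mult_left_mono) auto
      ultimately show ?thesis by (blast intro: order_trans)
    qed
    have "rim \<epsilon> N \<subseteq> \<Union>?R"
    proof
      fix v assume "v \<in> rim \<epsilon> N"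
      then have v: "v \<in> sites M" "\<bar>coord1 M v\<bar> \<le> ?N" "\<bar>coord2 M v\<bar> \<le> ?N" "?N - ?n \<le> \<bar>coord1 M v\<bar> \<or> ?N - ?n \<le> \<bar>coord2 M v\<bar>"
        by (auto simp: rim_def rball_def rnorm_le_iff) (auto simp: rnorm_def le_max_iff_disj)
      then consider "?N - ?n \<le> coord1 M v" | "coord1 M v \<le> - (?N - ?n)" | "?N - ?n \<le> coord2 M v" | "coord2 M v \<le> - (?N - ?n)"
        by (auto simp: abs_real_def split: if_splits)
      then show "v \<in> \<Union>?R"
      proof cases
        case 1
        then have "v \<in> rect (?N - ?n) ?n (- ?N) (2 * ?N)" using v by (auto simp: rect_def)
        then show ?thesis by blast
      next
        case 2
        then have "v \<in> rect (- ?N) ?n (- ?N) (2 * ?N)" using v by (auto simp: rect_def)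
        then show ?thesis by blast
      next
        case 3
        then have "v \<in> rect (- ?N) (2 * ?N) (?N - ?n) ?n" using v by (auto simp: rect_def)
        then show ?thesis by blast
      next
        case 4
        then have "v \<in> rect (- ?N) (2 * ?N) (- ?N) ?n" using v by (auto simp: rect_def)
        then show ?thesis by blast
      qed
    qed
    moreover have "finite (\<Union>?R)" using each by blast
    ultimately have "card (rim \<epsilon> N) \<le> card (\<Union>?R)" by (intro card_mono) auto
    also have "\<dots> \<le> (\<Sum>A\<in>?R. card A)" by (rule card_Union_le_sum_card)
    finally have "real (card (rim \<epsilon> N)) \<le> (\<Sum>A\<in>?R. real (card A))" unfolding of_nat_sum[symmetric] of_nat_le_iff .
    also have "\<dots> \<le> real (card ?R) * (K * (36 * real (meso \<epsilon> N) * ?N))" using each by (intro sum_bounded_above) auto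
    also have "\<dots> \<le> 4 * (K * (36 * real (meso \<epsilon> N) * ?N))"
    proof (rule mult_right_mono)
      have "card ?R \<le> 4" by (simp add: card_insert_if)
      then show "real (card ?R) \<le> 4" by simp
    qed (use K(1) in simp)
    finally show ?thesis by simp
  qed
  then show ?thesis using K(1) by (intro exI[of _ "144 * K"]) auto
qed

text \<open>If the origin percolates, every site joined to it percolates too, so \<open>Phi\<close>
  counts a subset of what \<open>Psi\<close> counts.\<close>

lemma Psi_minus_Phi:
  assumes i: "inf_at 0 \<omega>"
  shows "0 \<le> Psi M N \<omega> - Phi M N \<omega>" "Psi M N \<omega> - Phi M N \<omega> \<le> real (card (rball M N 0))"
    and "(\<And>z. z \<in> rball M N 0 \<Longrightarrow> z \<notin> T \<Longrightarrow> inf_at z \<omega> \<Longrightarrow> con0 N z \<omega>) \<Longrightarrow> T \<subseteq> rball M N 0 \<Longrightarrow> Psi M N \<omega> - Phi M N \<omega> \<le> inf_count T \<omega>"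
proof -
  have eq: "Psi M N \<omega> - Phi M N \<omega> = (\<Sum>z\<in>rball M N 0. of_bool (inf_at z \<omega>) - of_bool (con0 N z \<omega>))"
    unfolding Psi_count inf_count_def Phi_sum by (simp only: sum_subtractf)
  have imp: "inf_at z \<omega>" if "con0 N z \<omega>" for z
  proof -
    have "con M \<omega> UNIV 0 z" using that con_mono unfolding con0_def by blast
    then have "{v. con M \<omega> UNIV 0 v} \<subseteq> {v. con M \<omega> UNIV z v}" using con_trans con_sym by blast
    then show ?thesis using i finite_subset unfolding connected_to_infinity_def by blast
  qed
  show "0 \<le> Psi M N \<omega> - Phi M N \<omega>" unfolding eq using imp by (intro sum_nonneg) auto
  show "Psi M N \<omega> - Phi M N \<omega> \<le> real (card (rball M N 0))"
    using count_bounds(2)[of "rball M N 0" \<omega>] Phi_bounds(1)[of N \<omega>] unfolding Psi_count by linarith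
  assume *: "\<And>z. z \<in> rball M N 0 \<Longrightarrow> z \<notin> T \<Longrightarrow> inf_at z \<omega> \<Longrightarrow> con0 N z \<omega>" and T: "T \<subseteq> rball M N 0"
  have "(\<Sum>z\<in>rball M N 0. of_bool (inf_at z \<omega>) - of_bool (con0 N z \<omega>)) \<le> (\<Sum>z\<in>rball M N 0. if z \<in> T then of_bool (inf_at z \<omega>) else (0::real))"
    using * imp by (intro sum_mono) auto
  also have "\<dots> = inf_count T \<omega>"
    unfolding inf_count_def using T by (simp add: sum.inter_restrict[symmetric] Int_absorb1)
  finally show "Psi M N \<omega> - Phi M N \<omega> \<le> inf_count T \<omega>" unfolding eq .
qed

text \<open>On the grid event only rim sites are missed, and off it the crude bound by the number of
  sites meets a probability of order N^(-8). The second moment over the rim is variance plus squared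
  mean; the mean is of order n N arm(N^w), that is N^(1 + \<epsilon>) U, just within the
  bound.\<close>

lemma Psi_Phi_distance:
  assumes \<epsilon>: "0 < \<epsilon>" "\<epsilon> < 1 - w"
  shows "\<exists>C N1. 1 \<le> N1 \<and> (\<forall>N\<ge>N1. (\<integral>\<omega>. one_inf \<omega> * (Psi M N \<omega> - Phi M N \<omega>)\<^sup>2 \<partial>Mw) \<le> C * real N powr (2 + 2 * \<epsilon>) * (U N)\<^sup>2)"
proof -
  have \<epsilon>': "\<epsilon> \<le> 1 - w" using \<epsilon> by simp
  obtain C1 where C1: "0 < C1" "\<And>N T. 1 \<le> N \<Longrightarrow> T \<subseteq> rball M N 0 \<Longrightarrow>
      (\<integral>\<omega>. (inf_count T \<omega> - (\<integral>\<omega>. inf_count T \<omega> \<partial>Mw))\<^sup>2 \<partial>Mw) \<le> C1 * real N powr (2 + 2 * \<epsilon>) * (U N)\<^sup>2"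
    using variance_inf_count[OF \<epsilon>(1) \<epsilon>'] by blast
  obtain C2 where C2: "0 < C2" "\<And>N I. 1 \<le> N \<Longrightarrow> 0 \<le> I \<Longrightarrow> of_int (I + 5) * real (meso \<epsilon> N) \<le> real N \<Longrightarrow>
      1 - Pw (grid (meso \<epsilon> N) (- I) I (- I) I) \<le> C2 / real N ^ 8" using grid_meso[OF \<epsilon>(1) \<epsilon>'] by blast
  obtain C3 where C3: "0 < C3" "\<And>x. x \<in> sites M \<Longrightarrow> Pw (inf_at x) \<le> C3 * arm (r1 x powr w)" using infinite_upper by blast
  obtain K where K: "0 < K" "\<And>N. 1 \<le> N \<Longrightarrow> real (card (rim \<epsilon> N)) \<le> K * real (meso \<epsilon> N) * real N" using card_rim \<epsilon>(1) \<epsilon>' by blast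
  obtain K' where K': "1 \<le> K'" "\<And>N. 1 \<le> N \<Longrightarrow> real (card (rball M N 0)) \<le> K' * (real N)\<^sup>2" using card_rball by blast
  obtain u where u: "0 < u" "\<And>N. 1 \<le> N \<Longrightarrow> u \<le> U N" using U_lower by blast
  define A where "A = 14 * (real m0 + 2)"
  define a where "a = 1 - w - \<epsilon>"
  have a: "0 < a" using \<epsilon> by (simp add: a_def)
  \<comment> \<open>From here on 14 n \<le> N, because A N^(w + \<epsilon>) \<le> N amounts to A
    \<le> N^a. It makes I positive and keeps the rim outside radius N / 2, where arms are comparable
    to those at N.\<close>
  define N1 where "N1 = nat \<lceil>A powr (1 / a)\<rceil> + 1"
  define D where "D = K * (real m0 + 2) * (C3 * (reg_const * 2))"
  have D: "0 \<le> D" using K C3 reg_const(1) by (simp add: D_def)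
  define C where "C = C1 + D\<^sup>2 + K'\<^sup>2 * C2 / u\<^sup>2"
  have "(\<integral>\<omega>. one_inf \<omega> * (Psi M N \<omega> - Phi M N \<omega>)\<^sup>2 \<partial>Mw) \<le> C * real N powr (2 + 2 * \<epsilon>) * (U N)\<^sup>2" if NN: "N1 \<le> N" for N
  proof -
    have N: "1 \<le> N" using NN by (simp add: N1_def)
    have N1: "1 \<le> real N" using N by simp
    let ?n = "meso \<epsilon> N"
    note n = meso[OF N \<epsilon>(1) \<epsilon>']
    have n0: "0 < real ?n" using n(2) by simp
    have big: "14 * real ?n \<le> real N"
    proof -
      have "A powr (1 / a) \<le> real N" using NN unfolding N1_def by linarith
      then have "(A powr (1 / a)) powr a \<le> real N powr a" using a by (intro powr_mono2) auto
      then have "A \<le> real N powr a" using a by (simp add: powr_powr A_def)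
      then have "A * real N powr (w + \<epsilon>) \<le> real N powr a * real N powr (w + \<epsilon>)" by (intro mult_right_mono) auto
      also have "\<dots> = real N"
      proof -
        have "a + (w + \<epsilon>) = 1" by (simp add: a_def)
        then show ?thesis using N1 by (simp only: powr_add[symmetric]) simp
      qed
      finally have "14 * ((real m0 + 2) * real N powr (w + \<epsilon>)) \<le> real N" unfolding A_def by (simp only: mult.assoc)
      then show ?thesis using n(4) by linarith
    qed
    \<comment> \<open>The largest value allowed by \<open>grid_absorbs\<close>; then I - 1 exceeds N
      / n - 7 up to equality, which is where the width 7n of the rim comes from.\<close>
    define I where "I = \<lfloor>real N / real ?n\<rfloor> - 5"
    have "14 \<le> real N / real ?n" using big n0 by (simp add: field_simps)
    then have "14 \<le> \<lfloor>real N / real ?n\<rfloor>" by (simp add: le_floor_iff)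
    then have I1: "1 \<le> I" by (simp add: I_def)
    have fl: "of_int \<lfloor>real N / real ?n\<rfloor> \<le> real N / real ?n" "real N / real ?n \<le> of_int \<lfloor>real N / real ?n\<rfloor> + 1"
      by (rule of_int_floor_le, rule real_of_int_floor_add_one_ge)
    have fl': "of_int \<lfloor>real N / real ?n\<rfloor> * real ?n \<le> real N" "real N \<le> (of_int \<lfloor>real N / real ?n\<rfloor> + 1) * real ?n"
      using fl n0 by (simp_all only: pos_le_divide_eq pos_divide_le_eq)
    have I2: "of_int (I + 5) * real ?n \<le> real N" using fl'(1) by (simp add: I_def)
    have I3: "real N - 7 * real ?n \<le> of_int (I - 1) * real ?n" using fl'(2) by (simp add: I_def distrib_right left_diff_distrib)
    let ?G = "grid ?n (- I) I (- I) I" and ?T = "rim \<epsilon> N" and ?c = "real (card (rball M N 0))"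
    have T: "?T \<subseteq> rball M N 0" by (auto simp: rim_def)
    have G0: "event M ?G" by (rule cylinder_event[OF grid_event(1)])
    have G: "event M (\<lambda>\<omega>. \<not> ?G \<omega>)" by (rule event_not[OF G0])
    have pointwise: "one_inf \<omega> * (Psi M N \<omega> - Phi M N \<omega>)\<^sup>2 \<le> (inf_count ?T \<omega>)\<^sup>2 + ?c\<^sup>2 * of_bool (\<not> ?G \<omega>)" for \<omega>
    proof (cases "inf_at 0 \<omega>")
      case i: True
      show ?thesis
      proof (cases "?G \<omega>")
        case True
        have "con0 N z \<omega>" if z: "z \<in> rball M N 0" "z \<notin> ?T" "inf_at z \<omega>" for z
          unfolding con0_def
        proof (rule grid_absorbs[OF n(2,6) I1 I2 True])
          show "z \<in> sites M" using z(1) by (simp add: rball_def)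
          show "rnorm M z \<le> of_int (I - 1) * real ?n" using z(1,2) I3 by (simp add: rim_def)
        qed (use z(3) i inf_imp_reach in auto)
        from Psi_minus_Phi(3)[OF i this T] have "Psi M N \<omega> - Phi M N \<omega> \<le> inf_count ?T \<omega>" by simp
        then have "(Psi M N \<omega> - Phi M N \<omega>)\<^sup>2 \<le> (inf_count ?T \<omega>)\<^sup>2" using Psi_minus_Phi(1)[OF i] by (rule power_mono)
        then show ?thesis using i True by simp
      next
        case False
        have "(Psi M N \<omega> - Phi M N \<omega>)\<^sup>2 \<le> ?c\<^sup>2" using Psi_minus_Phi(1,2)[OF i] by (intro power_mono)
        then show ?thesis using i False by (simp add: add_increasing)
      qed
    qed simp
    have "(\<integral>\<omega>. one_inf \<omega> * (Psi M N \<omega> - Phi M N \<omega>)\<^sup>2 \<partial>Mw) \<le> (\<integral>\<omega>. (inf_count ?T \<omega>)\<^sup>2 + ?c\<^sup>2 * of_bool (\<not> ?G \<omega>) \<partial>Mw)"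
    proof (rule Bochner_Integration.integral_mono[OF _ _ pointwise])
      show "integrable Mw (\<lambda>\<omega>. (inf_count ?T \<omega>)\<^sup>2 + ?c\<^sup>2 * of_bool (\<not> ?G \<omega>))"
        using count_integrable(2) of_bool_integrable[OF G] by (intro Bochner_Integration.integrable_add integrable_mult_right)
      show "integrable Mw (\<lambda>\<omega>. one_inf \<omega> * (Psi M N \<omega> - Phi M N \<omega>)\<^sup>2)"
      proof (rule bounded_integrable[where B = "?c\<^sup>2"])
        show "(\<lambda>\<omega>. one_inf \<omega> * (Psi M N \<omega> - Phi M N \<omega>)\<^sup>2) \<in> borel_measurable Mw"
          unfolding Psi_count by (intro borel_measurable_times borel_measurable_power borel_measurable_diff of_bool_measurable event_infinite count_measurable Phi_measurable)
        fix \<omega>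
        show "\<bar>one_inf \<omega> * (Psi M N \<omega> - Phi M N \<omega>)\<^sup>2\<bar> \<le> ?c\<^sup>2"
          using Psi_minus_Phi(1,2)[of \<omega> N] by (cases "inf_at 0 \<omega>") (auto intro: power_mono)
      qed
    qed
    also have "\<dots> = (\<integral>\<omega>. (inf_count ?T \<omega>)\<^sup>2 \<partial>Mw) + ?c\<^sup>2 * Pw (\<lambda>\<omega>. \<not> ?G \<omega>)"
      using count_integrable(2) of_bool_integrable[OF G]
      by (subst Bochner_Integration.integral_add) (auto simp: integral_of_bool[OF G])
    also have "(\<integral>\<omega>. (inf_count ?T \<omega>)\<^sup>2 \<partial>Mw) \<le> (C1 + D\<^sup>2) * real N powr (2 + 2 * \<epsilon>) * (U N)\<^sup>2"
    proof -
      let ?e = "\<integral>\<omega>. inf_count ?T \<omega> \<partial>Mw"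
      have "(\<integral>\<omega>. (inf_count ?T \<omega>)\<^sup>2 \<partial>Mw) = (\<integral>\<omega>. (inf_count ?T \<omega> - ?e)\<^sup>2 \<partial>Mw) + ?e\<^sup>2"
        using Mw.variance_eq[OF count_integrable, of ?T] by simp
      moreover have "?e\<^sup>2 \<le> D\<^sup>2 * real N powr (2 + 2 * \<epsilon>) * (U N)\<^sup>2"
      proof -
        have each: "Pw (inf_at z) \<le> C3 * (reg_const * 2) * arm (real N powr w)" if z: "z \<in> ?T" for z
        proof -
          have zs: "z \<in> sites M" using z by (simp add: rim_def rball_def)
          have "real N \<le> 2 * rnorm M z" using z big by (simp add: rim_def)
          then have "real N \<le> 2 * r1 z" using r1(2)[of z] by linarith
          then have "real N powr w \<le> (2 * r1 z) powr w" using w N1 by (intro powr_mono2) auto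
          also have "\<dots> = 2 powr w * r1 z powr w" by (rule powr_mult)
          also have "\<dots> \<le> 2 * r1 z powr w" using w powr_mono[of w 1 "2::real"] by (intro mult_right_mono) auto
          finally have "arm (r1 z powr w) \<le> reg_const * 2 * arm (real N powr w)" by (intro arm_ratio r1(3) N_powr N) auto
          then have "C3 * arm (r1 z powr w) \<le> C3 * (reg_const * 2 * arm (real N powr w))" using C3(1) by (intro mult_left_mono) auto
          then show ?thesis using C3(2)[OF zs] by (simp add: mult.assoc)
        qed
        have "?e \<le> (\<Sum>z\<in>?T. C3 * (reg_const * 2) * arm (real N powr w))" unfolding expectation_count by (intro sum_mono each)
        also have "\<dots> = real (card ?T) * (C3 * (reg_const * 2) * arm (real N powr w))" by simp
        also have "\<dots> \<le> (K * ((real m0 + 2) * real N powr (w + \<epsilon>)) * real N) * (C3 * (reg_const * 2) * arm (real N powr w))"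
        proof (rule mult_right_mono)
          have "K * real ?n * real N \<le> K * ((real m0 + 2) * real N powr (w + \<epsilon>)) * real N" using n(4) K(1) by (intro mult_right_mono mult_left_mono) auto
          then show "real (card ?T) \<le> K * ((real m0 + 2) * real N powr (w + \<epsilon>)) * real N" using K(2)[OF N] by linarith
        qed (use C3(1) reg_const(1) arm_le_1 in simp)
        also have "\<dots> = D * ((real N powr (w + \<epsilon>) * real N powr 1) * arm (real N powr w))" by (simp add: D_def)
        also have "real N powr (w + \<epsilon>) * real N powr 1 = real N powr (1 + \<epsilon>) * real N powr w"
          by (simp only: powr_add[symmetric]) (simp add: add.commute add.left_commute)
        finally have e_le: "?e \<le> D * (real N powr (1 + \<epsilon>) * U N)" by (simp add: U_def mult.assoc)
        have "0 \<le> ?e" unfolding expectation_count by (intro sum_nonneg) simp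
        then have "?e\<^sup>2 \<le> (D * (real N powr (1 + \<epsilon>) * U N))\<^sup>2" using e_le by (intro power_mono)
        also have "\<dots> = D\<^sup>2 * (real N powr (1 + \<epsilon>) * real N powr (1 + \<epsilon>)) * (U N)\<^sup>2" by (simp add: power2_eq_square)
        also have "real N powr (1 + \<epsilon>) * real N powr (1 + \<epsilon>) = real N powr (2 + 2 * \<epsilon>)" by (simp only: powr_add[symmetric]) simp
        finally show ?thesis .
      qed
      ultimately show ?thesis using C1(2)[OF N T] by (simp add: algebra_simps)
    qed
    also have "?c\<^sup>2 * Pw (\<lambda>\<omega>. \<not> ?G \<omega>) \<le> K'\<^sup>2 * C2 / u\<^sup>2 * real N powr (2 + 2 * \<epsilon>) * (U N)\<^sup>2"
    proof -
      have "Pw (\<lambda>\<omega>. \<not> ?G \<omega>) = 1 - Pw ?G" by (rule pr_not[OF G0])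
      also have "\<dots> \<le> C2 / real N ^ 8" using C2(2)[OF N _ I2] I1 by simp
      finally have "?c\<^sup>2 * Pw (\<lambda>\<omega>. \<not> ?G \<omega>) \<le> (K' * (real N)\<^sup>2)\<^sup>2 * (C2 / real N ^ 8)"
        using K'(2)[OF N] by (intro mult_mono power_mono) auto
      also have "\<dots> = K'\<^sup>2 * C2 * (real N ^ 4 / real N ^ 8)" by (simp add: power2_eq_square power4_eq_xxxx)
      also have "\<dots> \<le> K'\<^sup>2 * C2 * 1"
        using N1 K'(1) C2(1) by (intro mult_left_mono) (auto simp: divide_le_eq_1 power_increasing)
      also have "\<dots> \<le> K'\<^sup>2 * C2 * ((U N)\<^sup>2 / u\<^sup>2 * real N powr (2 + 2 * \<epsilon>))"
      proof (rule mult_left_mono)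
        have "1 \<le> (U N)\<^sup>2 / u\<^sup>2" using u(1) u(2)[OF N] by (simp add: power_mono)
        moreover have "1 \<le> real N powr (2 + 2 * \<epsilon>)" using N1 \<epsilon> by (intro ge_one_powr_ge_zero) auto
        ultimately have "1 * 1 \<le> (U N)\<^sup>2 / u\<^sup>2 * real N powr (2 + 2 * \<epsilon>)" by (intro mult_mono) auto
        then show "1 \<le> (U N)\<^sup>2 / u\<^sup>2 * real N powr (2 + 2 * \<epsilon>)" by simp
      qed (use K' C2 in simp)
      also have "\<dots> = K'\<^sup>2 * C2 / u\<^sup>2 * real N powr (2 + 2 * \<epsilon>) * (U N)\<^sup>2" by simp
      finally show ?thesis .
    qed
    finally show ?thesis by (simp add: C_def algebra_simps)
  qed
  then show ?thesis by (intro exI[of _ C] exI[of _ N1]) (auto simp: N1_def)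
qed

text \<open>The mean square about any constant dominates the variance, so \<open>Phi\<close> may be
  centred at the unconditional mean of \<open>Psi\<close>. The deviation is split through
  \<open>Psi\<close>, and the density of the conditional measure is at most 1 / \<theta>.\<close>

lemma cond_variance_Phi_le:
  "(\<integral>\<omega>. (Phi M N \<omega> - (\<integral>\<omega>. Phi M N \<omega> \<partial>Cw))\<^sup>2 \<partial>Cw) \<le>
     (2 / \<theta>) * ((\<integral>\<omega>. one_inf \<omega> * (Psi M N \<omega> - Phi M N \<omega>)\<^sup>2 \<partial>Mw) + (\<integral>\<omega>. (Psi M N \<omega> - EPsi N)\<^sup>2 \<partial>Mw))"
proof -
  let ?a = "EPsi N" and ?c = "real (card (rball M N 0))" and ?m = "\<integral>\<omega>. Phi M N \<omega> \<partial>Cw"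
  have Psi_b: "\<bar>Psi M N \<omega>\<bar> \<le> ?c" for \<omega> using count_bounds[of "rball M N 0" \<omega>] unfolding Psi_count by simp
  have Phi_b: "\<bar>Phi M N \<omega>\<bar> \<le> ?c" for \<omega> using Phi_bounds[of N \<omega>] by (subst abs_of_nonneg) auto
  have Psi_m: "Psi M N \<in> borel_measurable Mw" unfolding Psi_count by (rule count_measurable)
  have I1: "integrable Cw (Phi M N)" by (rule bounded_integrable_Cw[OF Phi_measurable Phi_b])
  have I2: "integrable Cw (\<lambda>\<omega>. (Phi M N \<omega>)\<^sup>2)"
    using Phi_bounds[of N] by (intro bounded_integrable_Cw[where B = "?c\<^sup>2"] borel_measurable_power Phi_measurable) (auto intro: power_mono)
  have "(\<integral>\<omega>. (Phi M N \<omega> - ?a)\<^sup>2 \<partial>Cw) = (\<integral>\<omega>. (Phi M N \<omega>)\<^sup>2 \<partial>Cw) - 2 * ?a * ?m + ?a\<^sup>2"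
  proof -
    have "(\<integral>\<omega>. (Phi M N \<omega> - ?a)\<^sup>2 \<partial>Cw) = (\<integral>\<omega>. (Phi M N \<omega>)\<^sup>2 - 2 * ?a * Phi M N \<omega> + ?a\<^sup>2 \<partial>Cw)"
      by (simp add: power2_diff algebra_simps)
    also have "\<dots> = (\<integral>\<omega>. (Phi M N \<omega>)\<^sup>2 \<partial>Cw) - 2 * ?a * ?m + ?a\<^sup>2"
      using I1 I2 Cw.prob_space by simp
    finally show ?thesis .
  qed
  then have "(\<integral>\<omega>. (Phi M N \<omega> - ?m)\<^sup>2 \<partial>Cw) = (\<integral>\<omega>. (Phi M N \<omega> - ?a)\<^sup>2 \<partial>Cw) - (?m - ?a)\<^sup>2"
    using Cw.variance_eq[OF I1 I2] by (simp add: power2_diff)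
  also have "\<dots> \<le> (\<integral>\<omega>. (Phi M N \<omega> - ?a)\<^sup>2 \<partial>Cw)" by simp
  also have "\<dots> = (\<integral>\<omega>. one_inf \<omega> * (Phi M N \<omega> - ?a)\<^sup>2 \<partial>Mw) / \<theta>"
    by (intro integral_Cw borel_measurable_power borel_measurable_diff Phi_measurable borel_measurable_const)
  also have "(\<integral>\<omega>. one_inf \<omega> * (Phi M N \<omega> - ?a)\<^sup>2 \<partial>Mw) \<le> (\<integral>\<omega>. 2 * (one_inf \<omega> * (Psi M N \<omega> - Phi M N \<omega>)\<^sup>2) + 2 * (Psi M N \<omega> - ?a)\<^sup>2 \<partial>Mw)"
  proof (rule Bochner_Integration.integral_mono)
    have sq: "x\<^sup>2 \<le> B\<^sup>2" if "\<bar>x\<bar> \<le> B" for x B :: real using that by (metis abs_ge_zero power2_abs power_mono)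
    have b: "\<bar>Phi M N \<omega> - ?a\<bar> \<le> ?c + \<bar>?a\<bar>" "\<bar>Psi M N \<omega> - ?a\<bar> \<le> ?c + \<bar>?a\<bar>" "\<bar>Psi M N \<omega> - Phi M N \<omega>\<bar> \<le> 2 * ?c" for \<omega>
      using Phi_b[of \<omega>] Psi_b[of \<omega>] by linarith+
    show "integrable Mw (\<lambda>\<omega>. one_inf \<omega> * (Phi M N \<omega> - ?a)\<^sup>2)"
      by (rule bounded_integrable[where B = "(?c + \<bar>?a\<bar>)\<^sup>2"])
        (use sq[OF b(1)] in \<open>auto intro!: borel_measurable_times borel_measurable_power borel_measurable_diff Phi_measurable of_bool_measurable event_infinite\<close>)
    have i1: "integrable Mw (\<lambda>\<omega>. one_inf \<omega> * (Psi M N \<omega> - Phi M N \<omega>)\<^sup>2)"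
      by (rule bounded_integrable[where B = "(2 * ?c)\<^sup>2"])
        (use sq[OF b(3)] in \<open>auto intro!: borel_measurable_times borel_measurable_power borel_measurable_diff Phi_measurable Psi_m of_bool_measurable event_infinite\<close>)
    have i2: "integrable Mw (\<lambda>\<omega>. (Psi M N \<omega> - ?a)\<^sup>2)"
      by (rule bounded_integrable[where B = "(?c + \<bar>?a\<bar>)\<^sup>2"])
        (use sq[OF b(2)] in \<open>auto intro!: borel_measurable_power borel_measurable_diff Psi_m\<close>)
    show "integrable Mw (\<lambda>\<omega>. 2 * (one_inf \<omega> * (Psi M N \<omega> - Phi M N \<omega>)\<^sup>2) + 2 * (Psi M N \<omega> - ?a)\<^sup>2)"
      using i1 i2 by (intro Bochner_Integration.integrable_add integrable_mult_right)
    fix \<omega>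
    have "(Phi M N \<omega> - ?a)\<^sup>2 \<le> 2 * (Psi M N \<omega> - Phi M N \<omega>)\<^sup>2 + 2 * (Psi M N \<omega> - ?a)\<^sup>2"
    proof -
      have "0 \<le> ((Psi M N \<omega> - Phi M N \<omega>) + (Psi M N \<omega> - ?a))\<^sup>2" by simp
      then show ?thesis by (simp add: power2_eq_square algebra_simps)
    qed
    then show "one_inf \<omega> * (Phi M N \<omega> - ?a)\<^sup>2 \<le> 2 * (one_inf \<omega> * (Psi M N \<omega> - Phi M N \<omega>)\<^sup>2) + 2 * (Psi M N \<omega> - ?a)\<^sup>2"
      by (cases "inf_at 0 \<omega>") auto
  qed
  also have "(\<integral>\<omega>. 2 * (one_inf \<omega> * (Psi M N \<omega> - Phi M N \<omega>)\<^sup>2) + 2 * (Psi M N \<omega> - ?a)\<^sup>2 \<partial>Mw)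
      = 2 * (\<integral>\<omega>. one_inf \<omega> * (Psi M N \<omega> - Phi M N \<omega>)\<^sup>2 \<partial>Mw) + 2 * (\<integral>\<omega>. (Psi M N \<omega> - ?a)\<^sup>2 \<partial>Mw)"
  proof -
    have sq: "x\<^sup>2 \<le> B\<^sup>2" if "\<bar>x\<bar> \<le> B" for x B :: real using that by (metis abs_ge_zero power2_abs power_mono)
    have b: "\<bar>Psi M N \<omega> - ?a\<bar> \<le> ?c + \<bar>?a\<bar>" "\<bar>Psi M N \<omega> - Phi M N \<omega>\<bar> \<le> 2 * ?c" for \<omega>
      using Phi_b[of \<omega>] Psi_b[of \<omega>] by linarith+
    have i1: "integrable Mw (\<lambda>\<omega>. one_inf \<omega> * (Psi M N \<omega> - Phi M N \<omega>)\<^sup>2)"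
      by (rule bounded_integrable[where B = "(2 * ?c)\<^sup>2"])
        (use sq[OF b(2)] in \<open>auto intro!: borel_measurable_times borel_measurable_power borel_measurable_diff Phi_measurable Psi_m of_bool_measurable event_infinite\<close>)
    have i2: "integrable Mw (\<lambda>\<omega>. (Psi M N \<omega> - ?a)\<^sup>2)"
      by (rule bounded_integrable[where B = "(?c + \<bar>?a\<bar>)\<^sup>2"])
        (use sq[OF b(1)] in \<open>auto intro!: borel_measurable_power borel_measurable_diff Psi_m\<close>)
    show ?thesis using i1 i2 by (subst Bochner_Integration.integral_add) auto
  qed
  finally show ?thesis using \<theta> by (simp add: divide_right_mono field_simps)
qed

text \<open>The form shared by both variance bounds. The restriction on \<epsilon> keeps the
  mesoscopic scale below N; larger \<epsilon> are recovered by monotonicity.\<close>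

definition small_variance :: "(nat \<Rightarrow> real) \<Rightarrow> bool" where
  "small_variance v \<longleftrightarrow> (\<forall>N. 0 \<le> v N) \<and>
     (\<forall>\<epsilon>. 0 < \<epsilon> \<longrightarrow> \<epsilon> < 1 - w \<longrightarrow> (\<exists>C. \<forall>N\<ge>1. v N \<le> C * (real N powr (2 + 2 * \<epsilon>) * (U N)\<^sup>2)))"

lemma U_pos: "1 \<le> N \<Longrightarrow> 0 < U N"
  using arm_pos N_powr[of N] by (simp add: U_def)

lemma small_variance_Psi: "small_variance (\<lambda>N. \<integral>\<omega>. (Psi M N \<omega> - EPsi N)\<^sup>2 \<partial>Mw)"
  unfolding small_variance_def
proof (intro conjI allI impI)
  show "0 \<le> (\<integral>\<omega>. (Psi M N \<omega> - EPsi N)\<^sup>2 \<partial>Mw)" for N by simp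
  fix \<epsilon> :: real assume "0 < \<epsilon>" "\<epsilon> < 1 - w"
  then obtain C where "\<And>N T. 1 \<le> N \<Longrightarrow> T \<subseteq> rball M N 0 \<Longrightarrow>
      (\<integral>\<omega>. (inf_count T \<omega> - (\<integral>\<omega>. inf_count T \<omega> \<partial>Mw))\<^sup>2 \<partial>Mw) \<le> C * real N powr (2 + 2 * \<epsilon>) * (U N)\<^sup>2"
    using variance_inf_count[of \<epsilon>] by auto
  from this[OF _ subset_refl] show "\<exists>C. \<forall>N\<ge>1. (\<integral>\<omega>. (Psi M N \<omega> - EPsi N)\<^sup>2 \<partial>Mw) \<le> C * (real N powr (2 + 2 * \<epsilon>) * (U N)\<^sup>2)"
    unfolding Psi_count by (intro exI[of _ C]) (simp add: mult.assoc)
qed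

lemma small_variance_Phi: "small_variance (\<lambda>N. \<integral>\<omega>. (Phi M N \<omega> - (\<integral>\<omega>. Phi M N \<omega> \<partial>Cw))\<^sup>2 \<partial>Cw)"
  unfolding small_variance_def
proof (intro conjI allI impI)
  let ?v = "\<lambda>N. \<integral>\<omega>. (Phi M N \<omega> - (\<integral>\<omega>. Phi M N \<omega> \<partial>Cw))\<^sup>2 \<partial>Cw"
  show "0 \<le> ?v N" for N by simp
  fix \<epsilon> :: real assume \<epsilon>: "0 < \<epsilon>" "\<epsilon> < 1 - w"
  let ?g = "\<lambda>N. real N powr (2 + 2 * \<epsilon>) * (U N)\<^sup>2"
  obtain C1 N1 where C1: "1 \<le> N1" "\<And>N. N1 \<le> N \<Longrightarrow> (\<integral>\<omega>. one_inf \<omega> * (Psi M N \<omega> - Phi M N \<omega>)\<^sup>2 \<partial>Mw) \<le> C1 * real N powr (2 + 2 * \<epsilon>) * (U N)\<^sup>2"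
    using Psi_Phi_distance[OF \<epsilon>] by blast
  obtain C2 where C2: "\<And>N. 1 \<le> N \<Longrightarrow> (\<integral>\<omega>. (Psi M N \<omega> - EPsi N)\<^sup>2 \<partial>Mw) \<le> C2 * ?g N"
    using small_variance_Psi \<epsilon> unfolding small_variance_def by blast
  have "?v N \<le> (2 / \<theta> * (C1 + C2)) * ?g N" if N: "N1 \<le> N" for N
  proof -
    have "?v N \<le> (2 / \<theta>) * ((\<integral>\<omega>. one_inf \<omega> * (Psi M N \<omega> - Phi M N \<omega>)\<^sup>2 \<partial>Mw) + (\<integral>\<omega>. (Psi M N \<omega> - EPsi N)\<^sup>2 \<partial>Mw))"
      by (rule cond_variance_Phi_le)
    also have "\<dots> \<le> (2 / \<theta>) * (C1 * ?g N + C2 * ?g N)"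
    proof (rule mult_left_mono[OF add_mono])
      show "(\<integral>\<omega>. one_inf \<omega> * (Psi M N \<omega> - Phi M N \<omega>)\<^sup>2 \<partial>Mw) \<le> C1 * ?g N" using C1(2)[OF N] by (simp only: mult.assoc)
      show "(\<integral>\<omega>. (Psi M N \<omega> - EPsi N)\<^sup>2 \<partial>Mw) \<le> C2 * ?g N" using C2[of N] C1(1) N by simp
    qed (use \<theta> in simp)
    also have "\<dots> = (2 / \<theta> * (C1 + C2)) * ?g N" by (simp only: distrib_right mult.assoc)
    finally show ?thesis .
  qed
  from eventually_le_imp_le[where f = ?v and g = ?g and C = "2 / \<theta> * (C1 + C2)", OF this]
  show "\<exists>C. \<forall>N\<ge>1. ?v N \<le> C * ?g N" using U_pos by force
qed

lemma small_variance_bound: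
  assumes "small_variance v" "0 < \<epsilon>"
  shows "\<exists>C. \<forall>N\<ge>1. v N \<le> C * real N powr (2 * \<epsilon>) * real N powr (2 + 2 * w) * (one_arm M (real N powr w))\<^sup>2"
proof -
  \<comment> \<open>An admissible exponent not above \<epsilon>; shrinking the exponent only
    strengthens the bound.\<close>
  define e where "e = min \<epsilon> ((1 - w) / 2)"
  have e: "0 < e" "e < 1 - w" "e \<le> \<epsilon>" using assms(2) w by (auto simp: e_def min_def)
  obtain C where C: "\<And>N. 1 \<le> N \<Longrightarrow> v N \<le> C * (real N powr (2 + 2 * e) * (U N)\<^sup>2)"
    using assms(1) e unfolding small_variance_def by blast
  obtain a where a: "0 < a" "\<And>N. 1 \<le> N \<Longrightarrow> a * arm (real N powr w) \<le> one_arm M (real N powr w)" using one_arm_order by blast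
  have "v N \<le> (\<bar>C\<bar> / a\<^sup>2) * real N powr (2 * \<epsilon>) * real N powr (2 + 2 * w) * (one_arm M (real N powr w))\<^sup>2" if N: "1 \<le> N" for N
  proof -
    have N1: "1 \<le> real N" using N by simp
    let ?x = "arm (real N powr w)" and ?o = "one_arm M (real N powr w)"
    have "real N powr (2 + 2 * e) * (U N)\<^sup>2 = real N powr (2 * e) * (real N powr 2 * (real N powr w * real N powr w)) * ?x\<^sup>2"
      unfolding U_def by (simp add: power_mult_distrib power2_eq_square powr_add)
    also have "real N powr 2 * (real N powr w * real N powr w) = real N powr (2 + 2 * w)" by (simp only: powr_add[symmetric]) simp
    finally have eq: "real N powr (2 + 2 * e) * (U N)\<^sup>2 = real N powr (2 * e) * real N powr (2 + 2 * w) * ?x\<^sup>2" .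
    have "v N \<le> \<bar>C\<bar> * (real N powr (2 + 2 * e) * (U N)\<^sup>2)"
      using C[OF N] by (rule order_trans) (intro mult_right_mono; simp)
    also have "\<dots> \<le> \<bar>C\<bar> * (real N powr (2 * \<epsilon>) * real N powr (2 + 2 * w) * (?o / a)\<^sup>2)"
      unfolding eq
    proof (intro mult_left_mono mult_mono power_mono)
      show "real N powr (2 * e) \<le> real N powr (2 * \<epsilon>)" using e N1 by (intro powr_mono) auto
      show "?x \<le> ?o / a" using a(2)[OF N] a(1) by (simp add: field_simps)
    qed (use arm_le_1 in auto)
    finally show ?thesis by (simp add: power_divide)
  qed
  then show ?thesis by blast
qed

text \<open>With e = (1 - w) / 2 the exponent is 2 + 2 e + 2 w = 4 - (1 - w), so the variance is
  smaller than F^2, of order N^4 arm(N^w)^2, by the factor N^(w - 1).\<close>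

lemma small_variance_ratio:
  assumes "small_variance v" "of_order_F g"
  shows "(\<lambda>N. v N / (g N)\<^sup>2) \<longlonglongrightarrow> 0" "v \<in> o(\<lambda>N. (g N)\<^sup>2)"
proof -
  define e where "e = (1 - w) / 2"
  have e: "0 < e" "e < 1 - w" using w by (auto simp: e_def)
  obtain C where C: "\<And>N. 1 \<le> N \<Longrightarrow> v N \<le> C * (real N powr (2 + 2 * e) * (U N)\<^sup>2)"
    using assms(1) e unfolding small_variance_def by blast
  have v0: "0 \<le> v N" for N using assms(1) by (simp add: small_variance_def)
  obtain a where a: "0 < a" "\<And>N. 1 \<le> N \<Longrightarrow> a * F N \<le> g N" using assms(2) unfolding of_order_F_def by blast
  have g: "0 < g N" if "1 \<le> N" for N using a(1) a(2)[OF that] F_pos[OF that] by (meson mult_pos_pos order_less_le_trans)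
  have le: "v N / (g N)\<^sup>2 \<le> (\<bar>C\<bar> / a\<^sup>2) * real N powr (w - 1)" if N: "1 \<le> N" for N
  proof -
    have N1: "1 \<le> real N" using N by simp
    have "real N powr (2 + 2 * e) * (U N)\<^sup>2 = (real N powr (2 + 2 * e) * (real N powr w * real N powr w)) * (arm (real N powr w))\<^sup>2"
      unfolding U_def by (simp only: power_mult_distrib power2_eq_square mult_ac)
    also have "real N powr (2 + 2 * e) * (real N powr w * real N powr w) = real N powr (w - 1) * real N powr 4"
    proof -
      have "2 + 2 * e + (w + w) = w - 1 + 4" unfolding e_def by argo
      then show ?thesis by (simp only: powr_add[symmetric])
    qed
    also have "real N powr 4 = ((real N)\<^sup>2)\<^sup>2" using N1 powr_realpow[of "real N" 4] by simp
    finally have eq: "real N powr (2 + 2 * e) * (U N)\<^sup>2 = real N powr (w - 1) * (F N)\<^sup>2"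
      unfolding F_def by (simp only: power_mult_distrib mult.assoc)
    have "v N \<le> \<bar>C\<bar> * (real N powr (w - 1) * (F N)\<^sup>2)"
      using C[OF N] unfolding eq by (rule order_trans) (intro mult_right_mono; simp)
    also have "\<dots> \<le> \<bar>C\<bar> * (real N powr (w - 1) * (g N / a)\<^sup>2)"
    proof (intro mult_left_mono power_mono)
      show "F N \<le> g N / a" using a(1) a(2)[OF N] by (simp add: field_simps)
    qed (use F_pos[OF N] in auto)
    also have "\<dots> = (\<bar>C\<bar> / a\<^sup>2) * real N powr (w - 1) * (g N)\<^sup>2" by (simp add: power_divide)
    finally show ?thesis using g[OF N] by (simp add: pos_divide_le_eq)
  qed
  have "filterlim real at_top sequentially" by (rule filterlim_real_sequentially)
  then have "(\<lambda>N. real N powr (w - 1)) \<longlonglongrightarrow> 0" using w by (intro tendsto_neg_powr) auto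
  then have lim: "(\<lambda>N. (\<bar>C\<bar> / a\<^sup>2) * real N powr (w - 1)) \<longlonglongrightarrow> 0" by (rule tendsto_mult_right_zero)
  show ratio: "(\<lambda>N. v N / (g N)\<^sup>2) \<longlonglongrightarrow> 0"
  proof (rule tendsto_sandwich[OF _ _ tendsto_const lim])
    show "\<forall>\<^sub>F N in sequentially. 0 \<le> v N / (g N)\<^sup>2" using v0 by simp
    show "\<forall>\<^sub>F N in sequentially. v N / (g N)\<^sup>2 \<le> (\<bar>C\<bar> / a\<^sup>2) * real N powr (w - 1)"
      using le by (intro eventually_sequentiallyI[of 1])
  qed
  show "v \<in> o(\<lambda>N. (g N)\<^sup>2)"
  proof (rule smalloI_tendsto[OF ratio])
    show "\<forall>\<^sub>F N in sequentially. (g N)\<^sup>2 \<noteq> 0"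
    proof (rule eventually_sequentiallyI[of 1])
      fix N :: nat assume "1 \<le> N"
      then show "(g N)\<^sup>2 \<noteq> 0" using g[of N] by simp
    qed
  qed
qed

lemma normalised_tendsto_L2:
  fixes \<mu> :: "(complex set \<Rightarrow> bool) measure"
  assumes \<mu>: "prob_space \<mu>" and X: "\<And>N. X N \<in> borel_measurable \<mu>" "\<And>N \<omega>. \<bar>X N \<omega>\<bar> \<le> B N"
    and v: "small_variance (\<lambda>N. \<integral>\<omega>. (X N \<omega> - (\<integral>\<omega>. X N \<omega> \<partial>\<mu>))\<^sup>2 \<partial>\<mu>)" and e: "of_order_F (\<lambda>N. \<integral>\<omega>. X N \<omega> \<partial>\<mu>)"
  shows "tendsto_L2 \<mu> (\<lambda>N \<omega>. X N \<omega> / (\<integral>\<omega>. X N \<omega> \<partial>\<mu>)) 1"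
proof -
  interpret prob_space \<mu> by (rule \<mu>)
  let ?e = "\<lambda>N. \<integral>\<omega>. X N \<omega> \<partial>\<mu>"
  obtain a where a: "0 < a" "\<And>N. 1 \<le> N \<Longrightarrow> a * F N \<le> ?e N" using e unfolding of_order_F_def by blast
  have e0: "0 < ?e N" if "1 \<le> N" for N using a(1) a(2)[OF that] F_pos[OF that] by (meson mult_pos_pos order_less_le_trans)
  have m: "(\<lambda>\<omega>. X N \<omega> / ?e N) \<in> borel_measurable \<mu>" for N by (intro borel_measurable_divide X(1) borel_measurable_const)
  \<comment> \<open>Boundedness suffices whatever the value of the mean; this covers N = 0, about
    which \<open>of_order_F\<close> says nothing.\<close>
  have int: "integrable \<mu> (\<lambda>\<omega>. (X N \<omega> / ?e N - 1)\<^sup>2)" for N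
  proof (rule integrable_const_bound[where B = "(\<bar>B N / ?e N\<bar> + 1)\<^sup>2"])
    have "norm ((X N \<omega> / ?e N - 1)\<^sup>2) \<le> (\<bar>B N / ?e N\<bar> + 1)\<^sup>2" for \<omega>
    proof -
      have "\<bar>X N \<omega>\<bar> \<le> \<bar>B N\<bar>" using X(2)[of N \<omega>] by linarith
      then have "\<bar>X N \<omega> / ?e N\<bar> \<le> \<bar>B N / ?e N\<bar>" unfolding abs_divide by (rule divide_right_mono) simp
      then have "\<bar>X N \<omega> / ?e N - 1\<bar> \<le> \<bar>B N / ?e N\<bar> + 1" by linarith
      then have "\<bar>X N \<omega> / ?e N - 1\<bar>\<^sup>2 \<le> (\<bar>B N / ?e N\<bar> + 1)\<^sup>2" by (rule power_mono) simp
      then show ?thesis by simp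
    qed
    then show "AE \<omega> in \<mu>. norm ((X N \<omega> / ?e N - 1)\<^sup>2) \<le> (\<bar>B N / ?e N\<bar> + 1)\<^sup>2" by simp
    show "(\<lambda>\<omega>. (X N \<omega> / ?e N - 1)\<^sup>2) \<in> borel_measurable \<mu>" by (intro borel_measurable_power borel_measurable_diff m borel_measurable_const)
  qed
  have "(\<lambda>N. (\<integral>\<omega>. (X N \<omega> - ?e N)\<^sup>2 \<partial>\<mu>) / (?e N)\<^sup>2) \<longlonglongrightarrow> 0" by (rule small_variance_ratio(1)[OF v e])
  moreover have "\<forall>\<^sub>F N in sequentially. (\<integral>\<omega>. (X N \<omega> - ?e N)\<^sup>2 \<partial>\<mu>) / (?e N)\<^sup>2 = (\<integral>\<omega>. (X N \<omega> / ?e N - 1)\<^sup>2 \<partial>\<mu>)"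
  proof (rule eventually_sequentiallyI[of 1])
    fix N :: nat assume "1 \<le> N"
    then have ne: "?e N \<noteq> 0" using e0[of N] by simp
    have "(X N \<omega> / ?e N - 1)\<^sup>2 = (X N \<omega> - ?e N)\<^sup>2 / (?e N)\<^sup>2" for \<omega>
      using ne by (simp add: power_divide[symmetric] diff_divide_distrib)
    then show "(\<integral>\<omega>. (X N \<omega> - ?e N)\<^sup>2 \<partial>\<mu>) / (?e N)\<^sup>2 = (\<integral>\<omega>. (X N \<omega> / ?e N - 1)\<^sup>2 \<partial>\<mu>)" by simp
  qed
  ultimately have "(\<lambda>N. \<integral>\<omega>. (X N \<omega> / ?e N - 1)\<^sup>2 \<partial>\<mu>) \<longlonglongrightarrow> 0" by (rule Lim_transform_eventually)
  then show ?thesis unfolding tendsto_L2_def using m int by blast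
qed

lemma Psi_tendsto_L2: "tendsto_L2 Mw (\<lambda>N \<omega>. Psi M N \<omega> / (\<integral>\<omega>. Psi M N \<omega> \<partial>Mw)) 1"
proof (rule normalised_tendsto_L2[OF prob_space_Mw _ _ small_variance_Psi E_Psi_of_order])
  show "Psi M N \<in> borel_measurable Mw" for N unfolding Psi_count by (rule count_measurable)
  show "\<bar>Psi M N \<omega>\<bar> \<le> real (card (rball M N 0))" for N \<omega>
    using count_bounds[of "rball M N 0" \<omega>] unfolding Psi_count by simp
qed

lemma Phi_tendsto_L2: "tendsto_L2 Cw (\<lambda>N \<omega>. Phi M N \<omega> / (\<integral>\<omega>. Phi M N \<omega> \<partial>Cw)) 1"
proof (rule normalised_tendsto_L2[OF prob_space_Cw _ _ small_variance_Phi E_Phi_cond_of_order])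
  show "Phi M N \<in> borel_measurable Cw" for N using Phi_measurable by (simp add: measurable_cong_sets[OF sets_Cw refl])
  show "\<bar>Phi M N \<omega>\<bar> \<le> real (card (rball M N 0))" for N \<omega> using Phi_bounds[of N \<omega>] by (subst abs_of_nonneg) auto
qed

end

theorem theorem2p1:
  fixes M :: percolation_model and c \<delta> w :: real
  assumes "kesten_percolation M c \<delta>"
    and "0 < w" and "w < 1"
  shows
    "comparable (I_sum M w) (\<lambda>N. (real N)\<^sup>2 * one_arm M (real N powr w)) \<and>
     comparable (\<lambda>N. prob_space.expectation (inhom_measure M w) (Psi M N)) (I_sum M w) \<and>
     comparable (\<lambda>N. prob_space.expectation (inhom_measure M w) (Phi M N)) (I_sum M w) \<and>
     (\<forall>\<epsilon>>0. \<exists>C. \<forall>N\<ge>1. prob_space.variance (inhom_measure M w) (Psi M N)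
       \<le> C * real N powr (2 * \<epsilon>) * real N powr (2 + 2 * w) * (one_arm M (real N powr w))\<^sup>2) \<and>
     ((\<lambda>N. prob_space.variance (inhom_measure M w) (Psi M N)) \<in> o(\<lambda>N. (I_sum M w N)\<^sup>2)) \<and>
     tendsto_L2 (inhom_measure M w)
       (\<lambda>N \<omega>. Psi M N \<omega> / prob_space.expectation (inhom_measure M w) (Psi M N)) 1 \<and>
     comparable (\<lambda>N. prob_space.expectation (cond_measure M w) (Phi M N)) (I_sum M w) \<and>
     (\<forall>\<epsilon>>0. \<exists>C. \<forall>N\<ge>1. prob_space.variance (cond_measure M w) (Phi M N)
       \<le> C * real N powr (2 * \<epsilon>) * real N powr (2 + 2 * w) * (one_arm M (real N powr w))\<^sup>2) \<and>
     ((\<lambda>N. prob_space.variance (cond_measure M w) (Phi M N)) \<in> o(\<lambda>N. (I_sum M w N)\<^sup>2)) \<and>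
     tendsto_L2 (cond_measure M w)
       (\<lambda>N \<omega>. Phi M N \<omega> / prob_space.expectation (cond_measure M w) (Phi M N)) 1"
proof -
  interpret kesten_percolation M c \<delta> by (rule assms(1))
  interpret inhomogeneous_percolation M c \<delta> w by unfold_locales (rule assms(2,3))+
  show ?thesis
    by (intro conjI allI impI of_order_F_comparable I_sum_of_order one_arm_of_order E_Psi_of_order E_Phi_of_order
        E_Phi_cond_of_order small_variance_bound small_variance_ratio(2) small_variance_Psi small_variance_Phi
        Psi_tendsto_L2 Phi_tendsto_L2)
qed

end
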